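(* Let $N$ be a separable II$_1$ factor that embeds into $\mathcal R^\mathcal U$ and has the generalized Jung property. Then $N\cong \mathcal R$.
   Context: Standing assumptions: the Continuum Hypothesis holds; $\mathcal U$ is a fixed nonprincipal ultrafilter on $\mathbb N$. $\mathcal R$ denotes the separable hyperfinite II$_1$ factor. For a tracial von Neumann algebra $(M,\tau)$, $M^\mathcal U$ is the tracial ultrapower $\ell^\infty(M)/\{(x_k):\lim_{k\to\mathcal U}\|x_k\|_2=0\}$, where $\|x\|_2=\tau(x^*x)^{1/2}$, with trace $\tau_\mathcal U((x_k)_\mathcal U)=\lim_{k\to\mathcal U}\tau(x_k)$. An embedding is an injective unital trace-preserving $*$-homomorphism. Two embeddings $\pi_1,\pi_2:N\hookrightarrow P$ are automorphically equivalent if $\pi_1=\alpha\circ\pi_2$ for some $\alpha\in\mathrm{Aut}(P)$. A II$_1$ factor $N$ has the generalized Jung property if any two embeddings $N\hookrightarrow N^\mathcal U$ are automorphically equivalent. *)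

theory Defs
  imports "HOL-Analysis.Analysis" "HOL-Library.Equipollence"
begin

record 'a tvna =
  vcarrier :: "'a set"
  vadd :: "'a \<Rightarrow> 'a \<Rightarrow> 'a"
  vmult :: "'a \<Rightarrow> 'a \<Rightarrow> 'a"
  vsmult :: "complex \<Rightarrow> 'a \<Rightarrow> 'a"
  vstar :: "'a \<Rightarrow> 'a"
  vone :: "'a"
  vtr :: "'a \<Rightarrow> complex"

definition vzero :: "'a tvna \<Rightarrow> 'a" where
  "vzero M = vsmult M 0 (vone M)"

definition vsub :: "'a tvna \<Rightarrow> 'a \<Rightarrow> 'a \<Rightarrow> 'a" where
  "vsub M x y = vadd M x (vsmult M (-1) y)"

definition nrm2 :: "'a tvna \<Rightarrow> 'a \<Rightarrow> real" where
  "nrm2 M x = sqrt (Re (vtr M (vmult M (vstar M x) x)))"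

text \<open>Operator norm of the left multiplication action on (M, 2-norm), i.e. on L^2(M).\<close>
definition opnorm :: "'a tvna \<Rightarrow> 'a \<Rightarrow> real" where
  "opnorm M x = Sup {nrm2 M (vmult M x y) | y. y \<in> vcarrier M \<and> nrm2 M y \<le> 1}"

text \<open>Tracial von Neumann algebra: a unital complex *-algebra with a faithful positive
  tracial state tau acting boundedly on L^2 by left multiplication and whose operator-norm
  unit ball is complete for the 2-norm (the standard abstract characterisation of a
  tracial von Neumann algebra).\<close>

definition tracial_vna :: "'a tvna \<Rightarrow> bool" where
  "tracial_vna M \<longleftrightarrow>
    (let C = vcarrier M; ad = vadd M; mu = vmult M; sm = vsmult M; st = vstar M;
         e = vone M; z = vzero M; tau = vtr M in
     e \<in> C \<and>
     (\<forall>x\<in>C. \<forall>y\<in>C. ad x y \<in> C \<and> mu x y \<in> C) \<and>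
     (\<forall>x\<in>C. \<forall>c. sm c x \<in> C) \<and> (\<forall>x\<in>C. st x \<in> C) \<and>
     (\<forall>x\<in>C. \<forall>y\<in>C. \<forall>w\<in>C. ad (ad x y) w = ad x (ad y w)) \<and>
     (\<forall>x\<in>C. \<forall>y\<in>C. ad x y = ad y x) \<and>
     (\<forall>x\<in>C. ad x z = x) \<and>
     (\<forall>x\<in>C. ad x (sm (-1) x) = z) \<and>
     (\<forall>x\<in>C. \<forall>y\<in>C. \<forall>c. sm c (ad x y) = ad (sm c x) (sm c y)) \<and>
     (\<forall>x\<in>C. \<forall>c d. sm (c + d) x = ad (sm c x) (sm d x)) \<and>
     (\<forall>x\<in>C. \<forall>c d. sm c (sm d x) = sm (c * d) x) \<and>
     (\<forall>x\<in>C. sm 1 x = x) \<and>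
     (\<forall>x\<in>C. \<forall>y\<in>C. \<forall>w\<in>C. mu (mu x y) w = mu x (mu y w)) \<and>
     (\<forall>x\<in>C. mu e x = x \<and> mu x e = x) \<and>
     (\<forall>x\<in>C. \<forall>y\<in>C. \<forall>w\<in>C. mu x (ad y w) = ad (mu x y) (mu x w)
                        \<and> mu (ad x y) w = ad (mu x w) (mu y w)) \<and>
     (\<forall>x\<in>C. \<forall>y\<in>C. \<forall>c. sm c (mu x y) = mu (sm c x) y \<and> sm c (mu x y) = mu x (sm c y)) \<and>
     (\<forall>x\<in>C. st (st x) = x) \<and>
     (\<forall>x\<in>C. \<forall>y\<in>C. st (ad x y) = ad (st x) (st y) \<and> st (mu x y) = mu (st y) (st x)) \<and>
     (\<forall>x\<in>C. \<forall>c. st (sm c x) = sm (cnj c) (st x)) \<and>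
     (\<forall>x\<in>C. \<forall>y\<in>C. tau (ad x y) = tau x + tau y \<and> tau (mu x y) = tau (mu y x)) \<and>
     (\<forall>x\<in>C. \<forall>c. tau (sm c x) = c * tau x) \<and>
     tau e = 1 \<and>
     (\<forall>x\<in>C. Im (tau (mu (st x) x)) = 0 \<and> Re (tau (mu (st x) x)) \<ge> 0) \<and>
     (\<forall>x\<in>C. tau (mu (st x) x) = 0 \<longrightarrow> x = z) \<and>
     (\<forall>x\<in>C. \<exists>K. \<forall>y\<in>C. nrm2 M (mu x y) \<le> K * nrm2 M y) \<and>
     (\<forall>s. (\<forall>n. s n \<in> C \<and> opnorm M (s n) \<le> 1) \<and>
          (\<forall>\<epsilon>>0. \<exists>N. \<forall>m\<ge>N. \<forall>n\<ge>N. nrm2 M (vsub M (s m) (s n)) < \<epsilon>) \<longrightarrow>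
          (\<exists>x\<in>C. opnorm M x \<le> 1 \<and> (\<lambda>n. nrm2 M (vsub M (s n) x)) \<longlonglongrightarrow> 0)))"

definition factor :: "'a tvna \<Rightarrow> bool" where
  "factor M \<longleftrightarrow> (\<forall>w\<in>vcarrier M. (\<forall>x\<in>vcarrier M. vmult M w x = vmult M x w)
                     \<longrightarrow> (\<exists>c. w = vsmult M c (vone M)))"

definition lincomb :: "'a tvna \<Rightarrow> complex list \<Rightarrow> 'a list \<Rightarrow> 'a" where
  "lincomb M cs fs = foldr (\<lambda>(c, f) acc. vadd M (vsmult M c f) acc) (zip cs fs) (vzero M)"

definition fin_dim :: "'a tvna \<Rightarrow> 'a set \<Rightarrow> bool" where
  "fin_dim M B \<longleftrightarrow> (\<exists>fs. set fs \<subseteq> B \<and>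
      (\<forall>x\<in>B. \<exists>cs. length cs = length fs \<and> x = lincomb M cs fs))"

definition star_subalg :: "'a tvna \<Rightarrow> 'a set \<Rightarrow> bool" where
  "star_subalg M B \<longleftrightarrow> B \<subseteq> vcarrier M \<and> vone M \<in> B \<and>
     (\<forall>x\<in>B. \<forall>y\<in>B. vadd M x y \<in> B \<and> vmult M x y \<in> B) \<and>
     (\<forall>x\<in>B. \<forall>c. vsmult M c x \<in> B) \<and> (\<forall>x\<in>B. vstar M x \<in> B)"

text \<open>A tracial factor is of type II_1 iff it is infinite dimensional.\<close>
definition II1_factor :: "'a tvna \<Rightarrow> bool" where
  "II1_factor M \<longleftrightarrow> tracial_vna M \<and> factor M \<and> \<not> fin_dim M (vcarrier M)"

definition separable :: "'a tvna \<Rightarrow> bool" where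
  "separable M \<longleftrightarrow> (\<exists>D. countable D \<and> D \<subseteq> vcarrier M \<and>
     (\<forall>x\<in>vcarrier M. \<forall>\<epsilon>>0. \<exists>d\<in>D. nrm2 M (vsub M x d) < \<epsilon>))"

definition AFD :: "'a tvna \<Rightarrow> bool" where
  "AFD M \<longleftrightarrow> (\<forall>F \<epsilon>. finite F \<and> F \<subseteq> vcarrier M \<and> \<epsilon> > 0 \<longrightarrow>
     (\<exists>B. star_subalg M B \<and> fin_dim M B \<and> (\<forall>x\<in>F. \<exists>b\<in>B. nrm2 M (vsub M x b) < \<epsilon>)))"

text \<open>R: the separable hyperfinite II_1 factor (unique up to isomorphism).\<close>
definition hyperfinite_II1 :: "'a tvna \<Rightarrow> bool" where
  "hyperfinite_II1 M \<longleftrightarrow> II1_factor M \<and> separable M \<and> AFD M"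

definition nonprincipal_ultrafilter :: "nat filter \<Rightarrow> bool" where
  "nonprincipal_ultrafilter U \<longleftrightarrow> U \<noteq> bot \<and>
     (\<forall>P. eventually P U \<or> eventually (\<lambda>n. \<not> P n) U) \<and> U \<le> cofinite"

definition useqs :: "'a tvna \<Rightarrow> (nat \<Rightarrow> 'a) set" where
  "useqs M = {x. (\<forall>k. x k \<in> vcarrier M) \<and> (\<exists>K. \<forall>k. opnorm M (x k) \<le> K)}"

definition ucls :: "nat filter \<Rightarrow> 'a tvna \<Rightarrow> (nat \<Rightarrow> 'a) \<Rightarrow> (nat \<Rightarrow> 'a) set" where
  "ucls U M x = {y \<in> useqs M. ((\<lambda>k. nrm2 M (vsub M (x k) (y k))) \<longlongrightarrow> 0) U}"

definition urep :: "(nat \<Rightarrow> 'a) set \<Rightarrow> nat \<Rightarrow> 'a" where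
  "urep X = (SOME x. x \<in> X)"

definition ultrapower :: "nat filter \<Rightarrow> 'a tvna \<Rightarrow> (nat \<Rightarrow> 'a) set tvna" where
  "ultrapower U M = \<lparr>
     vcarrier = ucls U M ` useqs M,
     vadd = (\<lambda>X Y. ucls U M (\<lambda>k. vadd M (urep X k) (urep Y k))),
     vmult = (\<lambda>X Y. ucls U M (\<lambda>k. vmult M (urep X k) (urep Y k))),
     vsmult = (\<lambda>c X. ucls U M (\<lambda>k. vsmult M c (urep X k))),
     vstar = (\<lambda>X. ucls U M (\<lambda>k. vstar M (urep X k))),
     vone = ucls U M (\<lambda>k. vone M),
     vtr = (\<lambda>X. Lim U (\<lambda>k. vtr M (urep X k))) \<rparr>"

definition star_hom :: "'a tvna \<Rightarrow> 'b tvna \<Rightarrow> ('a \<Rightarrow> 'b) \<Rightarrow> bool" where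
  "star_hom M P f \<longleftrightarrow> f ` vcarrier M \<subseteq> vcarrier P \<and> f (vone M) = vone P \<and>
     (\<forall>x\<in>vcarrier M. \<forall>y\<in>vcarrier M. f (vadd M x y) = vadd P (f x) (f y) \<and>
                                    f (vmult M x y) = vmult P (f x) (f y)) \<and>
     (\<forall>x\<in>vcarrier M. \<forall>c. f (vsmult M c x) = vsmult P c (f x)) \<and>
     (\<forall>x\<in>vcarrier M. f (vstar M x) = vstar P (f x))"

definition embedding :: "'a tvna \<Rightarrow> 'b tvna \<Rightarrow> ('a \<Rightarrow> 'b) \<Rightarrow> bool" where
  "embedding M P f \<longleftrightarrow> star_hom M P f \<and> inj_on f (vcarrier M) \<and>
     (\<forall>x\<in>vcarrier M. vtr P (f x) = vtr M x)"

definition automorphism :: "'a tvna \<Rightarrow> ('a \<Rightarrow> 'a) \<Rightarrow> bool" where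
  "automorphism P \<alpha> \<longleftrightarrow> star_hom P P \<alpha> \<and> bij_betw \<alpha> (vcarrier P) (vcarrier P)"

definition aut_equiv :: "'a tvna \<Rightarrow> 'b tvna \<Rightarrow> ('a \<Rightarrow> 'b) \<Rightarrow> ('a \<Rightarrow> 'b) \<Rightarrow> bool" where
  "aut_equiv N P \<pi>1 \<pi>2 \<longleftrightarrow> (\<exists>\<alpha>. automorphism P \<alpha> \<and> (\<forall>x\<in>vcarrier N. \<pi>1 x = \<alpha> (\<pi>2 x)))"

definition gen_Jung :: "nat filter \<Rightarrow> 'a tvna \<Rightarrow> bool" where
  "gen_Jung U N \<longleftrightarrow> (\<forall>\<pi>1 \<pi>2. embedding N (ultrapower U N) \<pi>1 \<and> embedding N (ultrapower U N) \<pi>2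
       \<longrightarrow> aut_equiv N (ultrapower U N) \<pi>1 \<pi>2)"

definition tvna_iso :: "'a tvna \<Rightarrow> 'b tvna \<Rightarrow> bool" where
  "tvna_iso M P \<longleftrightarrow> (\<exists>f. embedding M P f \<and> f ` vcarrier M = vcarrier P)"

definition CH :: bool where
  "CH \<longleftrightarrow> (\<forall>S :: real set. countable S \<or> S \<approx> (UNIV :: real set))"

end

(* Write P = N^U and let dg be the diagonal embedding of N.  Since N embeds into R^U and R is approximately finite
   dimensional, N has approximately multiplicative maps into matrix algebras inside N, in which three unitaries with a
   spectral gap that does not depend on the size determine the relative commutant.  In the limit this gives one embedding
   of N into P that has, in its commutant, the commutant of finitely many elements, and this smaller algebra is a factor.
   The generalized Jung property carries this over to dg; a reindexing argument then shows that dg(N)' has trivial centre,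
   and so has the commutant of every embedding of N into P.

   Hence two embeddings of N that commute with the same 2 x 2 matrix units are unitarily conjugate: compare the two
   diagonal projections in the commutant of their direct sum.  Applied to dg and its image under the automorphism given
   by the Jung property, this makes every embedding of N into (S)^U, where S is the commutant of 2 x 2 matrix units in N,
   unitarily conjugate to dg.  For R the corresponding statement is the uniqueness of embeddings of finite dimensional
   algebras.  Since N maps approximately to R, and R approximately to S, a two-sided approximate intertwining yields
   an isomorphism. *)

theory Submission
 imports Defs
begin

no_notation matrix_matrix_mult (infixl "**" 70)
no_notation map_add (infixl "++" 100)
notation vadd (infixl "++\<index>" 65)
notation vsub (infixl "--\<index>" 65)
notation vmult (infixl "**\<index>" 70)
notation vsmult (infixr ".*\<index>" 75)
notation vstar ("~*\<index>_" [90] 90)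
notation vone ("\<one>\<index>")
notation vzero ("\<zero>\<index>")

syntax "_index1" :: "id => index" ("\<^sub>_")
translations "_index1 x" => "_index x"

section \<open>Tracial *-algebras\<close>

text \<open>The hypothesis on N supplies automorphisms of P, which need not act coordinatewise,
  whereas approximate statements inside N require unitaries, since these lift to sequences of
  unitaries. What an automorphism does carry along are commutants. Once the relevant commutants are
  known to be factors, comparison of projections trades the automorphism for a unitary. The direct
  sum of two embeddings is formed inside P with the help of 2 x 2 matrix units commuting with both,
  which is the reason for mapping into S. In a sequence of matrix algebras of growing size, finitely
  many elements cut out the relative commutant because of a commutator estimate whose constant is
  free of the size. It comes from the action of a shear and a rotation on (Z/n)^2, with residues
  taken in a symmetric box, so that n is odd there. All of this rests on the trace, the 2-norm and
  completeness alone: operator bounds are read off from moments, extreme points replace polar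
  decomposition and spectral projections, and elements of minimal 2-norm replace weak
  compactness.\<close>

locale talg =
 fixes M :: "'a tvna" (structure)
 assumes one_c [simp]: "\<one> : vcarrier M"
  and add_c [simp]: "[|x : vcarrier M; y : vcarrier M|] ==> x ++ y : vcarrier M"
  and mult_c [simp]: "[|x : vcarrier M; y : vcarrier M|] ==> x ** y : vcarrier M"
  and smult_c [simp]: "x : vcarrier M ==> c .* x : vcarrier M"
  and star_c [simp]: "x : vcarrier M ==> ~*x : vcarrier M"
  and add_assoc: "[|x : vcarrier M; y : vcarrier M; w : vcarrier M|] ==> x ++ y ++ w = x ++ (y ++ w)"
  and add_comm: "[|x : vcarrier M; y : vcarrier M|] ==> x ++ y = y ++ x"
  and add_zero [simp]: "x : vcarrier M ==> x ++ \<zero> = x"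
  and add_neg: "x : vcarrier M ==> x ++ (-1) .* x = \<zero>"
  and smult_add: "[|x : vcarrier M; y : vcarrier M|] ==> c .* (x ++ y) = c .* x ++ c .* y"
  and add_smult: "x : vcarrier M ==> (c + d) .* x = c .* x ++ d .* x"
  and smult_smult: "x : vcarrier M ==> c .* d .* x = (c * d) .* x"
  and smult_one [simp]: "x : vcarrier M ==> 1 .* x = x"
  and mult_assoc: "[|x : vcarrier M; y : vcarrier M; w : vcarrier M|] ==> x ** y ** w = x ** (y ** w)"
  and one_mult [simp]: "x : vcarrier M ==> \<one> ** x = x"
  and mult_one [simp]: "x : vcarrier M ==> x ** \<one> = x"
  and distrib_l: "[|x : vcarrier M; y : vcarrier M; w : vcarrier M|] ==> x ** (y ++ w) = x ** y ++ x ** w"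
  and distrib_r: "[|x : vcarrier M; y : vcarrier M; w : vcarrier M|] ==> (x ++ y) ** w = x ** w ++ y ** w"
  and smult_mult: "[|x : vcarrier M; y : vcarrier M|] ==> (c .* x) ** y = c .* (x ** y)"
  and mult_smult: "[|x : vcarrier M; y : vcarrier M|] ==> x ** (c .* y) = c .* (x ** y)"
  and star_star [simp]: "x : vcarrier M ==> ~*~*x = x"
  and star_add: "[|x : vcarrier M; y : vcarrier M|] ==> ~*(x ++ y) = ~*x ++ ~*y"
  and star_mult: "[|x : vcarrier M; y : vcarrier M|] ==> ~*(x ** y) = ~*y ** ~*x"
  and star_smult: "x : vcarrier M ==> ~*(c .* x) = cnj c .* ~*x"
  and tr_add: "[|x : vcarrier M; y : vcarrier M|] ==> vtr M (x ++ y) = vtr M x + vtr M y"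
  and tr_comm: "[|x : vcarrier M; y : vcarrier M|] ==> vtr M (x ** y) = vtr M (y ** x)"
  and tr_smult: "x : vcarrier M ==> vtr M (c .* x) = c * vtr M x"
  and tr_one [simp]: "vtr M \<one> = 1"
  and tr_im: "x : vcarrier M ==> Im (vtr M (~*x ** x)) = 0"
  and tr_re: "x : vcarrier M ==> Re (vtr M (~*x ** x)) >= 0"
  and tr_faithful: "[|x : vcarrier M; vtr M (~*x ** x) = 0|] ==> x = \<zero>"
  and mult_bdd: "x : vcarrier M ==> EX K. ALL y:vcarrier M. nrm2 M (x ** y) <= K * nrm2 M y"

text \<open>Completeness is split off so that the \<open>talg\<close> facts are available for the
  ultrapower while its completeness is still being proved.\<close>

locale tvna = talg +
 assumes complete0: "[|!!n. s n : vcarrier M; !!n::nat. opnorm M (s n) <= 1;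
   !!\<epsilon>. \<epsilon> > 0 ==> EX K. ALL m>=K. ALL n>=K. nrm2 M (s m -- s n) < \<epsilon>|]
   ==> EX x:vcarrier M. opnorm M x <= 1 & (%n. nrm2 M (s n -- x)) \<longlonglongrightarrow> 0"

lemma tvna_if_tracial_vna: assumes "tracial_vna M" shows "tvna M"
proof -
 note r = assms[unfolded tracial_vna_def Let_def]
 note c1 = r[THEN conjunct1] note r = r[THEN conjunct2]
 note c2 = r[THEN conjunct1] note r = r[THEN conjunct2]
 note c3 = r[THEN conjunct1] note r = r[THEN conjunct2]
 note c4 = r[THEN conjunct1] note r = r[THEN conjunct2]
 note c5 = r[THEN conjunct1] note r = r[THEN conjunct2]
 note c6 = r[THEN conjunct1] note r = r[THEN conjunct2]
 note c7 = r[THEN conjunct1] note r = r[THEN conjunct2]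
 note c8 = r[THEN conjunct1] note r = r[THEN conjunct2]
 note c9 = r[THEN conjunct1] note r = r[THEN conjunct2]
 note c10 = r[THEN conjunct1] note r = r[THEN conjunct2]
 note c11 = r[THEN conjunct1] note r = r[THEN conjunct2]
 note c12 = r[THEN conjunct1] note r = r[THEN conjunct2]
 note c13 = r[THEN conjunct1] note r = r[THEN conjunct2]
 note c14 = r[THEN conjunct1] note r = r[THEN conjunct2]
 note c15 = r[THEN conjunct1] note r = r[THEN conjunct2]
 note c16 = r[THEN conjunct1] note r = r[THEN conjunct2]
 note c17 = r[THEN conjunct1] note r = r[THEN conjunct2]
 note c18 = r[THEN conjunct1] note r = r[THEN conjunct2]
 note c19 = r[THEN conjunct1] note r = r[THEN conjunct2]
 note c20 = r[THEN conjunct1] note r = r[THEN conjunct2]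
 note c21 = r[THEN conjunct1] note r = r[THEN conjunct2]
 note c22 = r[THEN conjunct1] note r = r[THEN conjunct2]
 note c23 = r[THEN conjunct1] note r = r[THEN conjunct2]
 note c24 = r[THEN conjunct1] note r = r[THEN conjunct2]
 note c25 = r[THEN conjunct1] note r = r[THEN conjunct2]
 show ?thesis
  apply unfold_locales
  subgoal by (rule c1)
  subgoal using c2 by blast
  subgoal using c2 by blast
  subgoal using c3 by blast
  subgoal using c4 by blast
  subgoal using c5 by blast
  subgoal using c6 by blast
  subgoal using c7 by blast
  subgoal using c8 by blast
  subgoal using c9 by blast
  subgoal using c10 by blast
  subgoal using c11 by blast
  subgoal using c12 by blast
  subgoal using c13 by blast
  subgoal using c14 by blast
  subgoal using c14 by blast
  subgoal using c15 by blast
  subgoal using c15 by blast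
  subgoal by (metis c16)
  subgoal by (metis c16)
  subgoal using c17 by blast
  subgoal using c18 by blast
  subgoal using c18 by blast
  subgoal using c19 by blast
  subgoal using c20 by blast
  subgoal using c20 by blast
  subgoal using c21 by blast
  subgoal by (rule c22)
  subgoal using c23 by blast
  subgoal using c23 by blast
  subgoal using c24 by blast
  subgoal using c25 by blast
  subgoal using r by blast
  done
qed

section \<open>The trace inner product and the 2-norm\<close>

context talg
begin

abbreviation C where "C \<equiv> vcarrier M"
abbreviation nn where "nn \<equiv> nrm2 M"
abbreviation tr where "tr \<equiv> vtr M"

lemma zero_c [simp]: "\<zero> : C" and sub_c [simp]: "[|x : C; y : C|] ==> x -- y : C"
 by (simp_all add: vzero_def vsub_def)

lemma tr_sub: "[|x : C; y : C|] ==> tr (x -- y) = tr x - tr y"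
 by (simp add: vsub_def tr_add tr_smult)

lemma tr_zero [simp]: "tr \<zero> = 0" by (simp add: vzero_def tr_smult)

lemma smult_zero_left [simp]: "x : C ==> 0 .* x = \<zero>"
proof -
 assume x: "x : C"
 have "0 .* x = (1 + (-1)) .* x" by simp
 also have "... = x ++ (-1) .* x" using x by (subst add_smult) auto
 finally show ?thesis using x by (simp add: add_neg)
qed

lemma mult_zero [simp]: "x : C ==> x ** \<zero> = \<zero>" and zero_mult [simp]: "x : C ==> \<zero> ** x = \<zero>"
 and smult_zero [simp]: "c .* \<zero> = \<zero>"
 using mult_smult[of x \<one> 0] smult_mult[of \<one> x 0] smult_smult[of \<one> c 0] by simp_all

lemma sub_eq_zero: "[|x : C; y : C; x -- y = \<zero>|] ==> x = y"
proof -
 assume a: "x : C" "y : C" "x -- y = \<zero>"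
 have "y = (x ++ (-1) .* y) ++ y" using a add_comm[of \<zero> y] by (simp add: vsub_def)
 also have "... = x ++ (y ++ (-1) .* y)" using a add_comm[of y "(-1) .* y"] by (simp add: add_assoc)
 finally show ?thesis using a by (simp add: add_neg)
qed

lemma sub_self [simp]: "x : C ==> x -- x = \<zero>" by (simp add: vsub_def add_neg)

lemmas alg0 = vsub_def distrib_l distrib_r smult_mult mult_smult mult_assoc smult_add smult_smult
 star_add star_mult star_smult

text \<open>Faithfulness lets the functionals x \<mapsto> tr (w ** x) separate points. Used as an
  extensionality rule, it turns an identity in the algebra into arithmetic with complex
  numbers.\<close>

lemma tau_ext: "[|x : C; y : C; !!w. w : C ==> tr (w ** x) = tr (w ** y)|] ==> x = y"
proof -
 assume a: "x : C" "y : C" and w: "!!w. w : C ==> tr (w ** x) = tr (w ** y)"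
 have "tr (~*(x -- y) ** (x -- y)) = 0"
  using a w[of "~*(x -- y)"] by (simp add: vsub_def distrib_l mult_smult tr_add tr_smult)
 then show ?thesis using a tr_faithful sub_eq_zero by (meson sub_c)
qed

lemma tr_star: assumes x: "x : C" shows "tr (~*x) = cnj (tr x)"
proof -
 have st1: "~*\<one> = \<one>" by (metis mult_one one_c one_mult star_c star_mult star_star)
 \<comment> \<open>The trace of ~*y ** y is real. Taking y = 1 + x gives the imaginary part of the
   claim, y = 1 + i x the real part.\<close>
 have "Im (tr (~*(\<one> ++ x) ** (\<one> ++ x))) = 0" "Im (tr (~*(\<one> ++ \<i> .* x) ** (\<one> ++ \<i> .* x))) = 0"
  using x by (auto intro!: tr_im)
 then show ?thesis using x tr_im[OF x]
  by (simp add: alg0 st1 tr_add tr_smult complex_eq_iff)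
qed

lemma star_one [simp]: "~*\<one> = \<one>" by (metis mult_one one_c one_mult star_c star_mult star_star)
lemma star_zero [simp]: "~*\<zero> = \<zero>" using star_smult[of \<one> 0] by simp

lemma zero_add [simp]: "x : C ==> \<zero> ++ x = x" using add_comm[of \<zero> x] by simp

lemmas alg = alg0 tr_add tr_smult

lemma nn_sq: "x : C ==> (nn x)\<^sup>2 = Re (tr (~*x ** x))"
 unfolding nrm2_def by (simp add: tr_re)

lemma tr_nn: "x : C ==> tr (~*x ** x) = of_real ((nn x)\<^sup>2)"
 by (simp add: nn_sq complex_eq_iff tr_im)

lemma nn_ge0 [simp]: "x : C ==> 0 <= nn x" unfolding nrm2_def by (simp add: tr_re)

lemma nn_zero [simp]: "nn \<zero> = 0" by (simp add: nrm2_def)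

lemma nn_zero_iff: "x : C ==> nn x = 0 \<longleftrightarrow> x = \<zero>"
 using tr_faithful[of x] tr_nn[of x] by auto

lemma nn_one [simp]: "nn \<one> = 1" by (simp add: nrm2_def)

lemma eq_if_nn: "[|x : C; y : C; nn (x -- y) <= 0|] ==> x = y"
 by (metis nn_ge0 nn_zero_iff order_antisym sub_c sub_eq_zero)

lemma nn_smult: "x : C ==> nn (c .* x) = cmod c * nn x"
proof -
 assume x: "x : C"
 have "tr (~*(c .* x) ** (c .* x)) = of_real ((cmod c)\<^sup>2) * tr (~*x ** x)"
  using x unfolding complex_norm_square by (simp add: alg0 tr_smult mult_ac)
 then have "(nn (c .* x))\<^sup>2 = (cmod c * nn x)\<^sup>2"
  using x by (simp add: nn_sq power_mult_distrib)
 then show ?thesis using x by (simp add: power2_eq_iff_nonneg)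
qed

lemma tr_swap: "[|x : C; y : C|] ==> tr (~*x ** y) = cnj (tr (~*y ** x))"
 using tr_star[of "~*y ** x"] by (simp add: star_mult)

lemma nn_add_sq: "[|x : C; y : C|] ==> (nn (x ++ y))\<^sup>2 = (nn x)\<^sup>2 + 2 * Re (tr (~*y ** x)) + (nn y)\<^sup>2"
 using tr_swap[of x y] by (simp add: nn_sq alg)

lemma nn_sub_sq: "[|x : C; y : C|] ==> (nn (x -- y))\<^sup>2 = (nn x)\<^sup>2 - 2 * Re (tr (~*y ** x)) + (nn y)\<^sup>2"
 using tr_swap[of x y] by (simp add: nn_sq alg)

lemma cauchy_schwarz: assumes x: "x : C" and y: "y : C" shows "cmod (tr (~*y ** x)) <= nn y * nn x"
proof (cases "nn y = 0")
 case True then show ?thesis using x y nn_zero_iff[of y] by simp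
next
 case False
 then have p: "nn y > 0" using y by (metis nn_ge0 less_eq_real_def)
 define t where "t = tr (~*y ** x)"
 define c where "c = t / of_real ((nn y)\<^sup>2)"
 have "0 <= (nn (x -- c .* y))\<^sup>2" by simp
 also have "... = (nn x)\<^sup>2 - 2 * Re (cnj c * t) + (cmod c)\<^sup>2 * (nn y)\<^sup>2"
  using x y by (simp add: nn_sub_sq nn_smult star_smult smult_mult tr_smult t_def power_mult_distrib)
 also have "cnj c * t = of_real ((cmod t)\<^sup>2 / (nn y)\<^sup>2)"
  unfolding c_def by (simp add: complex_norm_square[symmetric] mult.commute)
 also have "(cmod c)\<^sup>2 * (nn y)\<^sup>2 = (cmod t)\<^sup>2 / (nn y)\<^sup>2"
  unfolding c_def using p by (simp add: norm_divide power_divide power2_eq_square norm_mult field_simps)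
 finally have "(cmod t)\<^sup>2 / (nn y)\<^sup>2 <= (nn x)\<^sup>2" by simp
 then have "(cmod t)\<^sup>2 <= (nn y * nn x)\<^sup>2" using p by (simp add: field_simps power_mult_distrib)
 then show ?thesis unfolding t_def using x y by (simp add: power2_le_iff_abs_le)
qed

lemma cs_re: "[|x : C; y : C|] ==> \<bar>Re (tr (~*y ** x))\<bar> <= nn y * nn x"
 using cauchy_schwarz[of x y] abs_Re_le_cmod[of "tr (~*y ** x)"] by simp

lemma tr_le_nn: "x : C ==> cmod (tr x) <= nn x"
 using cauchy_schwarz[of x \<one>] by simp

lemma triangle: assumes x: "x : C" and y: "y : C" shows "nn (x ++ y) <= nn x + nn y"
proof -
 have "(nn (x ++ y))\<^sup>2 <= (nn x + nn y)\<^sup>2"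
  using nn_add_sq[OF x y] cs_re[OF x y] by (simp add: power2_sum algebra_simps)
 then show ?thesis using x y by (simp add: power2_le_iff_abs_le)
qed

lemma nn_neg [simp]: "x : C ==> nn ((-1) .* x) = nn x" by (simp add: nn_smult)

lemma sub_swap: "[|x : C; y : C|] ==> nn (x -- y) = nn (y -- x)"
proof -
 assume a: "x : C" "y : C"
 have "y -- x = (-1) .* (x -- y)" using a by (intro tau_ext) (simp_all add: alg)
 then show ?thesis using a by simp
qed

lemma sub_tri: "[|x : C; y : C; z : C|] ==> nn (x -- z) <= nn (x -- y) + nn (y -- z)"
proof -
 assume a: "x : C" "y : C" "z : C"
 have "x -- z = (x -- y) ++ (y -- z)" using a by (intro tau_ext) (simp_all add: alg)
 then show ?thesis using a triangle[of "x -- y" "y -- z"] by simp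
qed

lemma nn_diff: "[|x : C; y : C|] ==> \<bar>nn x - nn y\<bar> <= nn (x -- y)"
proof -
 assume a: "x : C" "y : C"
 have "x -- \<zero> = x" "y -- \<zero> = y" using a by (simp_all add: vsub_def)
 then show ?thesis using a sub_tri[of x y \<zero>] sub_tri[of y x \<zero>] sub_swap[of x y] by simp
qed

lemma nn_star [simp]: "x : C ==> nn (~*x) = nn x"
 unfolding nrm2_def using tr_comm[of "~*x" x] by simp

lemma parallelogram: "[|x : C; y : C|] ==> (nn (x ++ y))\<^sup>2 + (nn (x -- y))\<^sup>2 = 2 * (nn x)\<^sup>2 + 2 * (nn y)\<^sup>2"
 by (simp add: nn_add_sq nn_sub_sq)

subsection \<open>Operator bounds\<close>

text \<open>The operator norm bound \<open>opnorm M x <= K\<close>, phrased as a predicate that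
  composes without suprema; \<open>opnorm_le_iff\<close> translates between the two.\<close>

definition bnd :: "real => 'a => bool" where
 "bnd K x \<longleftrightarrow> x : C & 0 <= K & (ALL y:C. nn (x ** y) <= K * nn y)"

lemma bnd_c: "bnd K x ==> x : C" and bnd_ge0: "bnd K x ==> 0 <= K"
 and bndD: "[|bnd K x; y : C|] ==> nn (x ** y) <= K * nn y"
 by (auto simp: bnd_def)

lemma ex_bnd: "x : C ==> EX K. bnd K x"
proof -
 assume x: "x : C"
 obtain K where K: "ALL y:C. nn (x ** y) <= K * nn y" using mult_bdd[OF x] by auto
 have "0 <= nn (x ** \<one>)" using x by simp
 also have "... <= K * nn \<one>" by (rule bspec[OF K one_c])
 finally have "0 <= K" by simp
 then have "bnd K x" using K x unfolding bnd_def by blast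
 then show ?thesis by auto
qed

lemma opnorm_le_iff: assumes x: "x : C" and K: "0 <= K" shows "opnorm M x <= K \<longleftrightarrow> bnd K x"
proof -
 let ?A = "{nn (x ** y) | y. y : C & nn y <= 1}"
 obtain L where L: "bnd L x" using ex_bnd[OF x] by auto
 have ne: "?A ~= {}" using nn_one one_c by fastforce
 have "ALL a:?A. a <= L"
 proof clarify
  fix y assume y: "y : C" "nn y <= 1"
  show "nn (x ** y) <= L" using bndD[OF L y(1)] mult_left_le[of "nn y" L] y bnd_ge0[OF L] by (simp add: mult.commute)
 qed
 then have bdd: "bdd_above ?A" by (meson bdd_aboveI)
 have ub: "nn (x ** y) <= opnorm M x * nn y" if y: "y : C" for y
 proof (cases "nn y = 0")
  case True then show ?thesis using y x nn_zero_iff[of y] by simp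
 next
  case False
  then have p: "nn y > 0" using y by (metis nn_ge0 less_eq_real_def)
  have "nn (x ** (of_real (1 / nn y) .* y)) <= opnorm M x"
   unfolding opnorm_def using p y by (intro cSup_upper[OF _ bdd]) (auto simp: nn_smult norm_divide intro!: exI[of _ "of_real (1 / nn y) .* y"])
  then have "nn (x ** y) / nn y <= opnorm M x" using p x y by (simp add: mult_smult nn_smult norm_divide)
  then show ?thesis using p by (simp add: field_simps)
 qed
 show ?thesis
 proof
  assume o: "opnorm M x <= K"
  show "bnd K x" unfolding bnd_def
  proof (intro conjI ballI)
   fix y assume y: "y : C"
   show "nn (x ** y) <= K * nn y" using ub[OF y] mult_right_mono[OF o nn_ge0[OF y]] by linarith
  qed (use x K in auto)
 next
  assume b: "bnd K x"
  show "opnorm M x <= K" unfolding opnorm_def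
  proof (rule cSup_least[OF ne], clarify)
   fix y assume y: "y : C" "nn y <= 1"
   show "nn (x ** y) <= K" using bndD[OF b y(1)] mult_left_le[of "nn y" K] y K by (simp add: mult.commute)
  qed
 qed
qed

lemma opnorm_ge0: "x : C ==> 0 <= opnorm M x"
proof (rule ccontr)
 assume x: "x : C" and n: "~ 0 <= opnorm M x"
 then have b: "bnd 0 x" using opnorm_le_iff[of x 0] by simp
 have "nn (x ** \<one>) <= 0 * nn \<one>" using bndD[OF b one_c] .
 then have z: "x = \<zero>" using x by (metis eq_iff mult_one mult_zero_left nn_ge0 nn_zero_iff)
 have "opnorm M x = Sup {0}" unfolding opnorm_def z by (rule arg_cong[of _ _ Sup]) (auto intro: exI[of _ \<zero>])
 then show False using n by simp
qed

lemma bnd_opnorm: "x : C ==> bnd (opnorm M x) x" using opnorm_le_iff opnorm_ge0 by blast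

lemma bndI: "[|x : C; 0 <= K; !!y. y : C ==> nn (x ** y) <= K * nn y|] ==> bnd K x"
 unfolding bnd_def by blast

lemma bnd_mono: assumes "bnd K x" "K <= L" shows "bnd L x"
proof (rule bndI)
 show "x : C" using assms bnd_c by blast
 show "0 <= L" using assms bnd_ge0 order_trans by blast
 fix y assume y: "y : C"
 show "nn (x ** y) <= L * nn y"
  using bndD[OF assms(1) y] mult_right_mono[OF assms(2) nn_ge0[OF y]] by linarith
qed

lemma bnd_one [simp]: "bnd 1 \<one>" by (rule bndI) auto
lemma bnd_zero [simp]: "0 <= K ==> bnd K \<zero>" by (rule bndI) auto

lemma bnd_smult: assumes b: "bnd K x" shows "bnd (cmod c * K) (c .* x)"
proof (rule bndI)
 fix y assume y: "y : C"
 show "nn (c .* x ** y) <= cmod c * K * nn y"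
  using bndD[OF b y] bnd_c[OF b] y by (simp add: smult_mult nn_smult mult.assoc mult_left_mono)
qed (use bnd_c[OF b] bnd_ge0[OF b] in auto)

lemma bnd_add: assumes a: "bnd K x" and b: "bnd L y" shows "bnd (K + L) (x ++ y)"
proof (rule bndI)
 note c = bnd_c[OF a] bnd_c[OF b]
 fix z assume z: "z : C"
 have "nn ((x ++ y) ** z) <= nn (x ** z) + nn (y ** z)" using c z by (simp add: distrib_r triangle)
 also have "... <= K * nn z + L * nn z" by (intro add_mono bndD a b z)
 finally show "nn ((x ++ y) ** z) <= (K + L) * nn z" by (simp add: distrib_right)
qed (use bnd_ge0[OF a] bnd_ge0[OF b] bnd_c[OF a] bnd_c[OF b] in auto)

lemma bnd_mult: assumes a: "bnd K x" and b: "bnd L y" shows "bnd (K * L) (x ** y)"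
proof (rule bndI)
 note c = bnd_c[OF a] bnd_c[OF b]
 fix z assume z: "z : C"
 have "nn (x ** y ** z) <= K * nn (y ** z)" using c z bndD[OF a, of "y ** z"] by (simp add: mult_assoc)
 also have "... <= K * (L * nn z)" by (intro mult_left_mono bndD a b z bnd_ge0[OF a])
 finally show "nn (x ** y ** z) <= K * L * nn z" by simp
qed (use bnd_ge0[OF a] bnd_ge0[OF b] bnd_c[OF a] bnd_c[OF b] in auto)

text \<open>The square of \<open>nn (~*x ** y)\<close> is the inner product of y with x ** ~*x ** y,
  hence at most nn y times K times \<open>nn (~*x ** y)\<close>, and one factor cancels.\<close>

lemma bnd_star: assumes b: "bnd K x" shows "bnd K (~*x)"
proof (rule bndI)
 have x: "x : C" and K: "0 <= K" using bnd_c[OF b] bnd_ge0[OF b] by auto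
 show "~*x : C" "0 <= K" using x K by auto
 fix y assume y: "y : C"
 let ?n = "nn (~*x ** y)"
 have "?n\<^sup>2 = Re (tr (~*y ** (x ** (~*x ** y))))" using x y by (simp add: nn_sq star_mult mult_assoc)
 also have "... <= nn y * nn (x ** (~*x ** y))" using cs_re[of "x ** (~*x ** y)" y] x y by simp
 also have "... <= nn y * (K * ?n)" using bndD[OF b, of "~*x ** y"] x y by (intro mult_left_mono) auto
 finally have i: "?n * ?n <= (K * nn y) * ?n" by (simp add: power2_eq_square mult_ac)
 have p: "0 <= ?n" "0 <= K * nn y" using x y K by auto
 show "?n <= K * nn y"
 proof (cases "?n = 0")
  case False
  then have "0 < ?n" using p by simp
  then show ?thesis using i by (rule mult_right_le_imp_le[rotated])
 qed (use p in simp)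
qed

lemma bndR: "[|bnd K x; y : C|] ==> nn (y ** x) <= K * nn y"
 using bndD[OF bnd_star, of K x "~*y"] nn_star[of "y ** x"] bnd_c[of K x] by (simp add: star_mult)

lemma bnd_nn: "bnd K x ==> nn x <= K" using bndD[of K x \<one>] bnd_c[of K x] by simp

end

section \<open>Convergence in the 2-norm\<close>

context talg
begin

definition cv :: "'i filter => ('i => 'a) => 'a => bool" where
 "cv F s x \<longleftrightarrow> (ALL n. s n : C) & x : C & ((%n. nn (s n -- x)) \<longlongrightarrow> 0) F"

lemma cv_c: "cv F s x ==> s n : C" "cv F s x ==> x : C"
 and cvD: "cv F s x ==> ((%n. nn (s n -- x)) \<longlongrightarrow> 0) F"
 by (auto simp: cv_def)

lemma cvI: assumes "!!n. s n : C" "x : C" "eventually (%n. nn (s n -- x) <= g n) F" "(g \<longlongrightarrow> 0) F"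
 shows "cv F s x"
proof -
 have "((%n. nn (s n -- x)) \<longlongrightarrow> 0) F"
  by (rule Lim_null_comparison[OF _ assms(4)]) (use assms in simp)
 then show ?thesis using assms by (simp add: cv_def)
qed

lemma cv_const [simp]: "x : C ==> cv F (%_. x) x" by (simp add: cv_def)

lemma cv_add: assumes "cv F s x" "cv F t y" shows "cv F (%n. s n ++ t n) (x ++ y)"
proof (rule cvI[where g = "%n. nn (s n -- x) + nn (t n -- y)"])
 note c = cv_c[OF assms(1)] cv_c[OF assms(2)]
 have "nn ((s n ++ t n) -- (x ++ y)) <= nn (s n -- x) + nn (t n -- y)" for n
 proof -
  have "(s n ++ t n) -- (x ++ y) = (s n -- x) ++ (t n -- y)"
   using c by (intro tau_ext) (simp_all add: alg)
  then show ?thesis using c by (simp add: triangle)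
 qed
 then show "eventually (%n. nn ((s n ++ t n) -- (x ++ y)) <= nn (s n -- x) + nn (t n -- y)) F" by simp
 show "((%n. nn (s n -- x) + nn (t n -- y)) \<longlongrightarrow> 0) F"
  using tendsto_add[OF cvD[OF assms(1)] cvD[OF assms(2)]] by simp
qed (use cv_c[OF assms(1)] cv_c[OF assms(2)] in auto)

lemma cv_smult: assumes "cv F s x" shows "cv F (%n. c .* s n) (c .* x)"
proof (rule cvI[where g = "%n. cmod c * nn (s n -- x)"])
 note c = cv_c[OF assms]
 have "nn (c .* s n -- c .* x) = cmod c * nn (s n -- x)" for n
  using c by (subst nn_smult[symmetric]) (simp_all add: vsub_def smult_add smult_smult mult.commute)
 then show "eventually (%n. nn (c .* s n -- c .* x) <= cmod c * nn (s n -- x)) F" by simp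
 show "((%n. cmod c * nn (s n -- x)) \<longlongrightarrow> 0) F"
  using tendsto_mult_left[OF cvD[OF assms], of "cmod c"] by simp
qed (use cv_c[OF assms] in auto)

lemma cv_sub: "[|cv F s x; cv F t y|] ==> cv F (%n. s n -- t n) (x -- y)"
 unfolding vsub_def by (intro cv_add cv_smult)

lemma star_sub: "[|x : C; y : C|] ==> ~*(x -- y) = ~*x -- ~*y"
 by (simp add: vsub_def star_add star_smult)

lemma cv_star: assumes "cv F s x" shows "cv F (%n. ~*s n) (~*x)"
proof -
 note c = cv_c[OF assms]
 have "nn (~*s n -- ~*x) = nn (s n -- x)" for n using c by (simp flip: star_sub)
 then show ?thesis using assms by (simp add: cv_def)
qed

lemma mult_diff_le: assumes "bnd K s" "bnd L y" "t : C" "x : C"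
 shows "nn (s ** t -- x ** y) <= K * nn (t -- y) + L * nn (s -- x)"
proof -
 have c: "s : C" "y : C" using assms bnd_c by auto
 have "s ** t -- x ** y = s ** (t -- y) ++ (s -- x) ** y"
  using c assms by (intro tau_ext) (simp_all add: alg)
 then have "nn (s ** t -- x ** y) <= nn (s ** (t -- y)) + nn ((s -- x) ** y)"
  using c assms by (simp add: triangle)
 then show ?thesis using bndD[OF assms(1), of "t -- y"] bndR[OF assms(2), of "s -- x"] c assms by simp
qed

text \<open>Multiplication is jointly continuous for the 2-norm on operator-norm bounded sets,
  whence the common bound on the first factors; the limit y brings its own bound.\<close>

lemma cv_mult: assumes "!!n. bnd K (s n)" "cv F s x" "cv F t y" shows "cv F (%n. s n ** t n) (x ** y)"
proof -
 note c = cv_c[OF assms(2)] cv_c[OF assms(3)]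
 obtain L where L: "bnd L y" using ex_bnd[OF c(4)] by auto
 show ?thesis
 proof (rule cvI[where g = "%n. K * nn (t n -- y) + L * nn (s n -- x)"])
  show "eventually (%n. nn (s n ** t n -- x ** y) <= K * nn (t n -- y) + L * nn (s n -- x)) F"
   by (rule always_eventually, rule allI, rule mult_diff_le) (use assms L c in auto)
  show "((%n. K * nn (t n -- y) + L * nn (s n -- x)) \<longlongrightarrow> 0) F"
   using tendsto_add[OF tendsto_mult_left[OF cvD[OF assms(3)], of K] tendsto_mult_left[OF cvD[OF assms(2)], of L]] by simp
 qed (use c in auto)
qed

lemma cv_mult': assumes "!!n. bnd K (t n)" "cv F s x" "cv F t y" shows "cv F (%n. s n ** t n) (x ** y)"
proof -
 note c = cv_c[OF assms(2)] cv_c[OF assms(3)]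
 have "cv F (%n. ~*t n ** ~*s n) (~*y ** ~*x)"
  by (rule cv_mult[where K = K]) (use assms bnd_star cv_star in auto)
 from cv_star[OF this] show ?thesis using c by (simp add: star_mult)
qed

lemma cv_cmult: "[|x : C; cv F t y|] ==> cv F (%n. x ** t n) (x ** y)"
 using ex_bnd[of x] cv_mult[of _ "%_. x" F x t y] by auto

lemma cv_multc: "[|x : C; cv F t y|] ==> cv F (%n. t n ** x) (y ** x)"
 using ex_bnd[of x] cv_mult'[of _ "%_. x" F t y x] by auto

lemma cv_tr: assumes "cv F s x" shows "((%n. tr (s n)) \<longlongrightarrow> tr x) F"
proof -
 note c = cv_c[OF assms]
 have "((%n. tr (s n) - tr x) \<longlongrightarrow> 0) F"
  by (rule Lim_null_comparison[OF _ cvD[OF assms]]) (use c tr_le_nn in \<open>simp flip: tr_sub\<close>)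
 then show ?thesis by (simp add: LIM_zero_iff)
qed

lemma cv_nn: assumes "cv F s x" shows "((%n. nn (s n)) \<longlongrightarrow> nn x) F"
proof -
 note c = cv_c[OF assms]
 have "((%n. nn (s n) - nn x) \<longlongrightarrow> 0) F"
  by (rule Lim_null_comparison[OF _ cvD[OF assms]]) (use c nn_diff in simp)
 then show ?thesis by (simp add: LIM_zero_iff)
qed

lemma cv_unique: assumes "cv F s x" "cv F s y" "F ~= bot" shows "x = y"
proof (rule eq_if_nn)
 note c = cv_c[OF assms(1)] cv_c[OF assms(2)]
 show "x : C" "y : C" using c by auto
 have t: "((%n. nn (s n -- x) + nn (s n -- y)) \<longlongrightarrow> 0) F"
  using tendsto_add[OF cvD[OF assms(1)] cvD[OF assms(2)]] by simp
 show "nn (x -- y) <= 0"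
  by (rule tendsto_lowerbound[OF t _ assms(3)]) (use c sub_tri[of x "s _" y] sub_swap[of x "s _"] in simp)
qed

lemma cv_bnd: assumes "!!n. bnd K (s n)" "cv F s x" "F ~= bot" shows "bnd K x"
proof (rule bndI)
 note c = cv_c[OF assms(2)]
 show "x : C" "0 <= K" using c bnd_ge0[OF assms(1)] by auto
 fix y assume y: "y : C"
 show "nn (x ** y) <= K * nn y"
  by (rule tendsto_upperbound[OF cv_nn[OF cv_multc[OF y assms(2)]] _ assms(3)])
   (use bndD[OF assms(1) y] in simp)
qed

subsection \<open>Operator bounds from moments\<close>

text \<open>The power x^(2^j). Only these exponents occur, because Cauchy-Schwarz doubles the
  exponent at each use.\<close>

primrec sqr :: "nat => 'a => 'a" where
 "sqr 0 x = x"
| "sqr (Suc j) x = sqr j x ** sqr j x"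

lemma sqr_c [simp]: "x : C ==> sqr j x : C" by (induction j) auto
lemma sqr_star: "[|x : C; ~*x = x|] ==> ~*(sqr j x) = sqr j x" by (induction j) (auto simp: star_mult)

lemma quad_sq: "[|z : C; y : C|] ==> Re (tr (~*y ** (~*z ** z ** y))) = (nn (z ** y))\<^sup>2"
 by (simp add: nn_sq star_mult mult_assoc)

lemma quad_cs: assumes h: "h : C" "~*h = h" and y: "y : C"
 shows "(Re (tr (~*y ** (h ** y))))\<^sup>2 <= Re (tr (~*y ** (h ** h ** y))) * (nn y)\<^sup>2"
proof -
 have "\<bar>Re (tr (~*y ** (h ** y)))\<bar> <= nn y * nn (h ** y)" using cs_re[of "h ** y" y] h y by simp
 then have "(Re (tr (~*y ** (h ** y))))\<^sup>2 <= (nn y * nn (h ** y))\<^sup>2" using abs_le_square_iff h y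
  by (metis abs_ge_zero abs_of_nonneg order_trans)
 also have "... = (nn y)\<^sup>2 * Re (tr (~*y ** (h ** h ** y)))"
  using quad_sq[of h y] h y by (simp add: power_mult_distrib)
 finally show ?thesis by (simp add: mult.commute)
qed

text \<open>Iterated Cauchy-Schwarz: for self-adjoint h the square of the inner product of h ** y
  with y is at most that of h ** h ** y with y, times the square of \<open>nn y\<close>.\<close>

lemma moment_ineq: assumes z: "z : C" and y: "y : C"
 shows "((nn (z ** y))\<^sup>2) ^ (2 ^ j) <= Re (tr (~*y ** (sqr j (~*z ** z) ** y))) * ((nn y)\<^sup>2) ^ (2 ^ j - 1)"
proof (induction j)
 case 0
 then show ?case using quad_sq[OF z y] by simp
next
 case (Suc j)
 define f where "f j = Re (tr (~*y ** (sqr j (~*z ** z) ** y)))" for j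
 define a where "a = (nn y)\<^sup>2"
 define b where "b = (nn (z ** y))\<^sup>2"
 have e: "(2::nat) ^ Suc j - 1 = 2 * (2 ^ j - 1) + 1" by (cases "(2::nat) ^ j") simp_all
 have cs: "(f j)\<^sup>2 <= f (Suc j) * a" unfolding f_def a_def sqr.simps
  by (rule quad_cs) (use z y sqr_star[of "~*z ** z"] in \<open>simp_all add: star_mult\<close>)
 have "b ^ (2 ^ Suc j) = (b ^ (2 ^ j))\<^sup>2" by (simp add: power_mult[symmetric] mult.commute)
 also have "... <= (f j * a ^ (2 ^ j - 1))\<^sup>2" using Suc by (intro power_mono) (auto simp: f_def a_def b_def)
 also have "... = (f j)\<^sup>2 * a ^ (2 * (2 ^ j - 1))" by (simp add: power_mult_distrib power_mult[symmetric] mult.commute)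
 also have "... <= f (Suc j) * a * a ^ (2 * (2 ^ j - 1))" using cs by (intro mult_right_mono) (auto simp: a_def)
 also have "... = f (Suc j) * a ^ (2 ^ Suc j - 1)" unfolding e by simp
 finally show ?case unfolding f_def a_def b_def .
qed

text \<open>With b the left side, \<open>moment_ineq\<close> reads b^(N+1) <= f a^N, which is
  impossible if b exceeds both a and f. This is what makes the truncation in
  \<open>contractive_lift\<close> contractive.\<close>

lemma moment_max: assumes z: "z : C" and y: "y : C"
 shows "(nn (z ** y))\<^sup>2 <= (nn y)\<^sup>2 + Re (tr (~*y ** (sqr (Suc j) (~*z ** z) ** y)))"
proof -
 define N where "N = (2::nat) ^ Suc j - 1"
 define f where "f = Re (tr (~*y ** (sqr (Suc j) (~*z ** z) ** y)))"
 define a where "a = (nn y)\<^sup>2"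
 define b where "b = (nn (z ** y))\<^sup>2"
 have N: "(2::nat) ^ Suc j = Suc N" unfolding N_def by simp
 have h: "b ^ Suc N <= f * a ^ N"
  using moment_ineq[OF z y, of "Suc j"] N unfolding f_def a_def b_def N_def by simp
 have "f = (nn (sqr j (~*z ** z) ** y))\<^sup>2"
  unfolding f_def using quad_sq[of "sqr j (~*z ** z)" y] z y sqr_star[of "~*z ** z" j] by (simp add: star_mult)
 then have f0: "0 <= f" by simp
 have a0: "0 <= a" by (simp add: a_def)
 have "b <= a + f"
 proof (rule ccontr)
  assume "~ b <= a + f"
  then have ab: "a < b" "f < b" using f0 a0 by linarith+
  have "f * a ^ N <= f * b ^ N" using ab a0 f0 by (intro mult_left_mono power_mono) auto
  also have "... < b * b ^ N" using ab a0 by (intro mult_strict_right_mono) auto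
  finally show False using h by simp
 qed
 then show ?thesis unfolding a_def b_def f_def .
qed

lemma le_one_if_pow_bdd: fixes x :: real assumes "!!j. x ^ (2 ^ j) <= B" shows "x <= 1"
proof (rule ccontr)
 assume "~ x <= 1"
 then have x: "1 < x" by simp
 obtain n where n: "B < x ^ n" using real_arch_pow[OF x] by blast
 have "n <= 2 ^ n" by (rule less_imp_le[OF less_exp])
 then have "x ^ n <= x ^ (2 ^ n)" using x by (intro power_increasing) auto
 then show False using assms[of n] n by simp
qed

text \<open>The operator norm is recovered from the growth of the 2-norms of the powers of ~*z ** z,
  and a constant factor K disappears under the roots. As moments are traces, every trace-preserving
  homomorphism respects operator bounds.\<close>

lemma bnd_if_moments: assumes z: "z : C" and c: "0 <= c" and m: "!!j. nn (sqr j (~*z ** z)) <= K * (c\<^sup>2) ^ (2 ^ j)"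
 shows "bnd c z"
proof (rule bndI[OF z c])
 fix y assume y: "y : C"
 show "nn (z ** y) <= c * nn y"
 proof (cases "nn y = 0")
  case True then show ?thesis using y z nn_zero_iff[of y] by simp
 next
  case False
  then have p: "nn y > 0" using y by (metis nn_ge0 less_eq_real_def)
  define a where "a = (nn y)\<^sup>2"
  define b where "b = (nn (z ** y))\<^sup>2"
  have a: "a > 0" using p by (simp add: a_def)
  have K: "0 <= K * (c\<^sup>2) ^ (2 ^ j)" for j using m[of j] nn_ge0[of "sqr j (~*z ** z)"] z by (meson mult_c order_trans sqr_c star_c)
  have est: "b ^ (2 ^ j) <= (K * nn (y ** ~*y) / a) * (c\<^sup>2 * a) ^ (2 ^ j)" for j
  proof -
   have s: "~*(sqr j (~*z ** z)) = sqr j (~*z ** z)" using z by (intro sqr_star) (simp_all add: star_mult)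
   \<comment> \<open>Cyclicity of the trace puts y on one side; what remains of it is a factor
     independent of j.\<close>
   have "Re (tr (~*y ** (sqr j (~*z ** z) ** y))) = Re (tr (~*(sqr j (~*z ** z)) ** (y ** ~*y)))"
    unfolding s using z y tr_comm[of "~*y" "sqr j (~*z ** z) ** y"] by (simp add: mult_assoc)
   also have "... <= nn (sqr j (~*z ** z)) * nn (y ** ~*y)" using cs_re[of "y ** ~*y" "sqr j (~*z ** z)"] z y by simp
   also have "... <= K * (c\<^sup>2) ^ (2 ^ j) * nn (y ** ~*y)" using m[of j] y by (intro mult_right_mono) auto
   finally have f: "Re (tr (~*y ** (sqr j (~*z ** z) ** y))) <= K * (c\<^sup>2) ^ (2 ^ j) * nn (y ** ~*y)" .
   have "b ^ (2 ^ j) <= K * (c\<^sup>2) ^ (2 ^ j) * nn (y ** ~*y) * a ^ (2 ^ j - 1)"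
    using order_trans[OF moment_ineq[OF z y, of j] mult_right_mono[OF f]] by (simp add: a_def b_def)
   also have "a ^ (2 ^ j - 1) = a ^ (2 ^ j) / a" using a by (simp add: power_diff)
   finally show ?thesis by (simp add: power_mult_distrib mult_ac)
  qed
  have "b <= c\<^sup>2 * a"
  proof (cases "c = 0")
   case True then show ?thesis using est[of 0] by simp
  next
   case False
   then have ca: "c\<^sup>2 * a > 0" using a by simp
   have "b / (c\<^sup>2 * a) <= 1"
   proof (rule le_one_if_pow_bdd)
    fix j
    have "0 < (c\<^sup>2 * a) ^ (2 ^ j)" using ca by simp
    then show "(b / (c\<^sup>2 * a)) ^ (2 ^ j) <= K * nn (y ** ~*y) / a"
     using est[of j] by (simp add: power_divide pos_divide_le_eq)
   qed
   then show ?thesis using ca by (simp add: pos_divide_le_eq)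
  qed
  then have "(nn (z ** y))\<^sup>2 <= (c * nn y)\<^sup>2" by (simp add: a_def b_def power_mult_distrib)
  then show ?thesis by (rule power2_le_imp_le) (use c p in simp)
 qed
qed

lemma bnd_sqr: "bnd c h ==> bnd (c ^ (2 ^ j)) (sqr j h)"
proof (induction j)
 case (Suc j)
 from bnd_mult[OF Suc(1)[OF Suc(2)] Suc(1)[OF Suc(2)]] show ?case by (simp add: power_add[symmetric] mult_2)
qed simp

lemma bnd_star_mult: "bnd K z ==> bnd (K\<^sup>2) (~*z ** z)"
 using bnd_mult[OF bnd_star] by (simp add: power2_eq_square)

text \<open>Spectrally, h = ~*z ** z lies between 0 and K^2, hence so does K^2 - h. In the expansion
  of the norm, the square of \<open>nn (h ** y)\<close> is at most K^2 times that of
  \<open>nn (z ** y)\<close>, and the cross term removes twice this amount.\<close>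

lemma bnd_complement: assumes b: "bnd K z" shows "bnd (K\<^sup>2) (of_real (K\<^sup>2) .* \<one> -- ~*z ** z)"
proof (rule bndI)
 have z: "z : C" and K: "0 <= K" using b bnd_c bnd_ge0 by auto
 show "of_real (K\<^sup>2) .* \<one> -- ~*z ** z : C" "0 <= K\<^sup>2" using z by auto
 fix y assume y: "y : C"
 let ?h = "~*z ** z ** y"
 have e: "(of_real (K\<^sup>2) .* \<one> -- ~*z ** z) ** y = of_real (K\<^sup>2) .* y -- ?h"
  using z y by (simp add: vsub_def distrib_r smult_mult)
 have h: "nn ?h <= K * nn (z ** y)" using bndD[OF bnd_star[OF b], of "z ** y"] z y by (simp add: mult_assoc)
 have "(nn ?h)\<^sup>2 <= K\<^sup>2 * (nn (z ** y))\<^sup>2" using power_mono[OF h, of 2] z y by (simp add: power_mult_distrib)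
 moreover have "Re (tr (~*?h ** (of_real (K\<^sup>2) .* y))) = K\<^sup>2 * (nn (z ** y))\<^sup>2"
  using z y by (simp add: star_mult mult_smult tr_smult nn_sq mult_assoc)
 moreover have "(nn (of_real (K\<^sup>2) .* y -- ?h))\<^sup>2 = (nn (of_real (K\<^sup>2) .* y))\<^sup>2
   - 2 * Re (tr (~*?h ** (of_real (K\<^sup>2) .* y))) + (nn ?h)\<^sup>2"
  by (rule nn_sub_sq) (use z y in auto)
 moreover have "0 <= K\<^sup>2 * (nn (z ** y))\<^sup>2" by simp
 ultimately have "(nn (of_real (K\<^sup>2) .* y -- ?h))\<^sup>2 <= (nn (of_real (K\<^sup>2) .* y))\<^sup>2"
  by linarith
 then have "nn (of_real (K\<^sup>2) .* y -- ?h) <= nn (of_real (K\<^sup>2) .* y)"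
  by (rule power2_le_imp_le) (use y in simp)
 then show "nn ((of_real (K\<^sup>2) .* \<one> -- ~*z ** z) ** y) <= K\<^sup>2 * nn y"
  unfolding e using y by (simp add: nn_smult norm_power)
qed

lemma inv_comm: assumes "v : C" "g : C" "c : C" "v ** g = \<one>" "g ** v = \<one>" "c ** g = g ** c"
 shows "c ** v = v ** c"
proof -
 have "c ** v = v ** g ** c ** v" using assms(1-4) by simp
 also have "... = v ** (g ** c) ** v" using assms(1-3) by (simp only: mult_assoc mult_c)
 also have "... = v ** (c ** g) ** v" using assms by simp
 also have "... = v ** c ** (g ** v)" using assms(1-3) by (simp add: mult_assoc)
 finally show ?thesis using assms by simp
qed

subsection \<open>Von Neumann subalgebras and commutants\<close>

text \<open>Strong closedness of a von Neumann subalgebra, expressed as closedness under 2-norm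
  limits of operator-norm bounded sequences.\<close>

definition vnsub :: "'a set => bool" where
 "vnsub S \<longleftrightarrow> star_subalg M S &
  (ALL s x K. (ALL n::nat. s n : S & bnd K (s n)) & cv sequentially s x --> x : S)"

lemma vnsubD: assumes "vnsub S"
 shows "x : S ==> x : C" "\<one> : S" "[|x : S; y : S|] ==> x ++ y : S" "[|x : S; y : S|] ==> x ** y : S"
  "x : S ==> c .* x : S" "x : S ==> ~*x : S" "[|x : S; y : S|] ==> x -- y : S" "\<zero> : S"
 using assms smult_zero_left[OF one_c] unfolding vnsub_def star_subalg_def vsub_def by (blast, blast, blast, blast, blast, blast, blast, metis)

lemma vnsub_lim: "[|vnsub S; !!n::nat. s n : S; !!n. bnd K (s n); cv sequentially s x|] ==> x : S"
 unfolding vnsub_def by blast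

definition comm :: "'a set => 'a set" where
 "comm X = {x : C. ALL y:X. x ** y = y ** x}"

lemma commD: "x : comm X ==> x : C" "[|x : comm X; y : X|] ==> x ** y = y ** x" by (auto simp: comm_def)

lemma vnsub_comm: assumes X: "X \<subseteq> C" and st: "!!y. y : X ==> ~*y : X" shows "vnsub (comm X)"
 unfolding vnsub_def star_subalg_def
proof (intro conjI ballI allI impI)
 show "comm X \<subseteq> C" "\<one> : comm X" using X by (auto simp: comm_def subset_eq)
 fix x y assume x: "x : comm X" and y: "y : comm X"
 note c = commD[OF x] commD[OF y]
 show "x ++ y : comm X" using X c by (auto simp: comm_def distrib_l distrib_r subset_eq)
 show "x ** y : comm X" unfolding comm_def
 proof (intro CollectI conjI ballI)
  show "x ** y : C" using c by simp
  fix z assume z: "z : X"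
  then have zc: "z : C" using X by auto
  have "x ** y ** z = x ** (z ** y)" using c zc z by (simp add: mult_assoc)
  also have "... = z ** x ** y" using c zc z by (simp flip: mult_assoc)
  finally show "x ** y ** z = z ** (x ** y)" using c zc by (simp add: mult_assoc)
 qed
next
 fix x c assume x: "x : comm X"
 show "c .* x : comm X" using X commD[OF x] by (auto simp: comm_def smult_mult mult_smult subset_eq)
next
 fix x assume x: "x : comm X"
 show "~*x : comm X" unfolding comm_def
 proof (intro CollectI conjI ballI)
  show "~*x : C" using commD[OF x] by simp
  fix z assume z: "z : X"
  then have zc: "z : C" using X by auto
  have "~*(x ** ~*z) = ~*(~*z ** x)" using commD(2)[OF x st[OF z]] by simp
  then show "~*x ** z = z ** ~*x" using commD(1)[OF x] zc by (simp add: star_mult)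
 qed
next
 fix s x K assume a: "(ALL n::nat. s n : comm X & bnd K (s n)) & cv sequentially s x"
 show "x : comm X" unfolding comm_def
 proof (intro CollectI conjI ballI)
  show "x : C" using a cv_c by blast
  fix z assume z: "z : X"
  then have zc: "z : C" using X by auto
  have e: "(%n. s n ** z) = (%n. z ** s n)" using a commD(2) z by blast
  have "cv sequentially s x" using a by simp
  from cv_multc[OF zc this] cv_cmult[OF zc this]
  show "x ** z = z ** x" unfolding e by (rule cv_unique) simp
 qed
qed

lemma vnsub_C: "vnsub C" unfolding vnsub_def star_subalg_def using cv_c by auto

definition tcen :: "'a set => bool" where
 "tcen S \<longleftrightarrow> (ALL z:S. (ALL y:S. z ** y = y ** z) --> (EX c. z = c .* \<one>))"

lemma tcen_C_iff: "tcen C \<longleftrightarrow> factor M" unfolding tcen_def factor_def ..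

definition unit :: "'a => bool" where
 "unit u \<longleftrightarrow> u : C & ~*u ** u = \<one> & u ** ~*u = \<one>"

lemma unitD: "unit u ==> u : C" "unit u ==> ~*u ** u = \<one>" "unit u ==> u ** ~*u = \<one>"
 by (auto simp: unit_def)

lemma unit_star: "unit u ==> unit (~*u)" by (simp add: unit_def)

lemma unit_mult: "[|unit u; unit v|] ==> unit (u ** v)"
 unfolding unit_def
proof (elim conjE, intro conjI)
 assume c: "u : C" "v : C" and u: "~*u ** u = \<one>" "u ** ~*u = \<one>" and v: "~*v ** v = \<one>" "v ** ~*v = \<one>"
 show "u ** v : C" using c by simp
 have "~*(u ** v) ** (u ** v) = ~*v ** (~*u ** u) ** v" using c by (simp add: star_mult mult_assoc)
 then show "~*(u ** v) ** (u ** v) = \<one>" using c u v by simp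
 have "(u ** v) ** ~*(u ** v) = u ** (v ** ~*v) ** ~*u" using c by (simp add: star_mult mult_assoc)
 then show "(u ** v) ** ~*(u ** v) = \<one>" using c u v by simp
qed

lemma unit_nn: assumes "unit u" "x : C" shows "nn (u ** x) = nn x" "nn (x ** u) = nn x"
proof -
 note u = unitD[OF assms(1)]
 have "~*(u ** x) ** (u ** x) = ~*x ** (~*u ** u) ** x" using u(1) assms(2) by (simp add: star_mult mult_assoc)
 then show a: "nn (u ** x) = nn x" using u assms(2) by (simp add: nrm2_def)
 have "(x ** u) ** ~*(x ** u) = x ** (u ** ~*u) ** ~*x" using u(1) assms(2) by (simp add: star_mult mult_assoc)
 then have "nn (~*(x ** u)) = nn (~*x)" using u assms(2) unfolding nrm2_def by simp
 then show "nn (x ** u) = nn x" using u assms(2) by simp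
qed

lemma unit_bnd: "unit u ==> bnd 1 u" by (rule bndI) (auto simp: unit_nn unitD)

lemma bnd_conj: assumes "unit u" "bnd K x" shows "bnd K (u ** x ** ~*u)"
 using bnd_mult[OF bnd_mult[OF unit_bnd[OF assms(1)] assms(2)] unit_bnd[OF unit_star[OF assms(1)]]] by simp

end

section \<open>Consequences of completeness\<close>

context tvna
begin

lemma complete:
 assumes b: "!!n. bnd K (s n)" and cau: "!!e. e > 0 ==> EX N. ALL m>=N. ALL n>=N. nn (s m -- s n) < e"
 shows "EX x. bnd K x & cv sequentially s x"
proof -
 \<comment> \<open>K may be 0; dividing by K + 1 still lands in the unit ball.\<close>
 define L where "L = K + 1"
 have L: "L >= 1" "K <= L" "L > 0" using bnd_ge0[OF b] by (auto simp: L_def)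
 have s: "s n : C" for n using b bnd_c by blast
 define t where "t n = of_real (1 / L) .* s n" for n
 have tc: "t n : C" for n using s by (simp add: t_def)
 have "bnd 1 (t n)" for n
 proof -
  have "bnd (cmod (of_real (1 / L)) * K) (t n)" unfolding t_def by (rule bnd_smult[OF b])
  then show ?thesis by (rule bnd_mono) (use L in \<open>simp add: norm_divide\<close>)
 qed
 then have o: "opnorm M (t n) <= 1" for n using opnorm_le_iff[of "t n" 1] tc by auto
 have d: "nn (t m -- t n) <= nn (s m -- s n)" for m n
 proof -
  have "t m -- t n = of_real (1 / L) .* (s m -- s n)"
   using s by (intro tau_ext) (simp_all add: t_def alg algebra_simps)
  then have "nn (t m -- t n) = (1 / L) * nn (s m -- s n)" using s L by (simp add: nn_smult norm_divide)
  also have "... <= 1 * nn (s m -- s n)" using L s by (intro mult_right_mono) auto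
  finally show ?thesis by simp
 qed
 have "EX x:C. opnorm M x <= 1 & (%n. nn (t n -- x)) \<longlonglongrightarrow> 0"
 proof (rule complete0[OF tc o])
  fix e :: real assume "e > 0"
  then obtain N where "ALL m>=N. ALL n>=N. nn (s m -- s n) < e" using cau by blast
  then show "EX N. ALL m>=N. ALL n>=N. nn (t m -- t n) < e" using d order_le_less_trans by blast
 qed
 then obtain x where x: "x : C" "(%n. nn (t n -- x)) \<longlonglongrightarrow> 0" by blast
 then have "cv sequentially t x" using tc by (simp add: cv_def)
 then have "cv sequentially (%n. of_real L .* t n) (of_real L .* x)" by (rule cv_smult)
 moreover have "(%n. of_real L .* t n) = s" using s L by (simp add: t_def smult_smult fun_eq_iff)
 ultimately have "cv sequentially s (of_real L .* x)" by simp
 moreover from this have "bnd K (of_real L .* x)" by (intro cv_bnd[OF b]) auto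
 ultimately show ?thesis by blast
qed

lemma geom_bound:
 assumes s: "!!n. s n : C" and d: "!!n. nn (s (Suc n) -- s n) <= c * q ^ n" and q: "0 <= q" "q < 1"
 shows "nn (s (n + k) -- s n) <= c * q ^ n * ((1 - q ^ k) / (1 - q))"
proof (induction k)
 case 0 then show ?case using s by simp
next
 case (Suc k)
 have "nn (s (n + Suc k) -- s n) <= c * q ^ (n + k) + c * q ^ n * ((1 - q ^ k) / (1 - q))"
  using sub_tri[of "s (n + Suc k)" "s (n + k)" "s n"] d[of "n + k"] Suc s by fastforce
 also have "... = c * q ^ n * (q ^ k + (1 - q ^ k) / (1 - q))" by (simp add: power_add algebra_simps)
 also have "q ^ k + (1 - q ^ k) / (1 - q) = (1 - q ^ Suc k) / (1 - q)" using q by (simp add: field_simps)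
 finally show ?case .
qed

lemma complete_geom:
 assumes b: "!!n. bnd K (s n)" and d: "!!n. nn (s (Suc n) -- s n) <= c * q ^ n" and q: "0 <= q" "q < 1"
 shows "EX x. bnd K x & cv sequentially s x"
proof (rule complete[OF b])
 fix e :: real assume e: "e > 0"
 have s: "s n : C" for n using b bnd_c by blast
 have c: "0 <= c" using order_trans[OF nn_ge0[OF sub_c[OF s s]] d[of 0]] by simp
 have "(%n. c * q ^ n * (1 / (1 - q))) \<longlonglongrightarrow> c * 0 * (1 / (1 - q))"
  by (intro tendsto_intros LIMSEQ_power_zero) (use q in auto)
 then have "eventually (%n. c * q ^ n * (1 / (1 - q)) < e / 2) sequentially"
  using e by (intro order_tendstoD(2)) auto
 then obtain N where N: "c * q ^ N * (1 / (1 - q)) < e / 2" by (auto simp: eventually_sequentially)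
 have m: "nn (s m -- s N) < e / 2" if "m >= N" for m
 proof -
  obtain k where k: "m = N + k" using \<open>m >= N\<close> nat_le_iff_add by blast
  have "nn (s m -- s N) <= c * q ^ N * ((1 - q ^ k) / (1 - q))"
   unfolding k by (rule geom_bound[OF s d q])
  also have "... <= c * q ^ N * (1 / (1 - q))"
   using c q by (intro mult_left_mono divide_right_mono) auto
  finally show ?thesis using N by (rule order.strict_trans1)
 qed
 show "EX N. ALL m>=N. ALL n>=N. nn (s m -- s n) < e"
 proof (intro exI allI impI)
  fix m n assume "m >= N" "n >= N"
  then show "nn (s m -- s n) < e"
   using sub_tri[of "s m" "s N" "s n"] sub_swap[of "s n" "s N"] m[of m] m[of n] s by simp
 qed
qed

text \<open>The partial sums of the geometric series are bounded by 1 / (1 - q) in operator norm and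
  converge geometrically in the 2-norm, so that completeness applies. They lie in every subalgebra
  containing y, hence so does the inverse.\<close>

lemma neumann:
 assumes y: "bnd q y" and q1: "q < 1"
 shows "EX r. r : C & (\<one> -- y) ** r = \<one> & r ** (\<one> -- y) = \<one> & (ALL S. vnsub S --> y : S --> r : S)"
proof -
 have yc: "y : C" and q0: "0 <= q" using y bnd_c bnd_ge0 by auto
 define p where "p = rec_nat \<one> (%_ v. \<one> ++ y ** v)"
 have p0: "p 0 = \<one>" and pS: "p (Suc n) = \<one> ++ y ** p n" for n by (simp_all add: p_def)
 have pc: "p n : C" for n by (induction n) (auto simp: p0 pS yc)
 have pb: "bnd (1 / (1 - q)) (p n)" for n
 proof (induction n)
  case 0
  show ?case unfolding p0 using q0 q1 by (intro bnd_mono[OF bnd_one]) (simp add: field_simps)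
 next
  case (Suc n)
  have "bnd (1 + q * (1 / (1 - q))) (p (Suc n))"
   unfolding pS by (intro bnd_add bnd_one bnd_mult[OF y Suc])
  moreover have "1 + q * (1 / (1 - q)) = 1 / (1 - q)" using q1 by (simp add: field_simps)
  ultimately show ?case by simp
 qed
 have d: "nn (p (Suc n) -- p n) <= q * q ^ n" for n
 proof (induction n)
  case 0
  have "p (Suc 0) -- p 0 = y" using yc by (intro tau_ext) (simp_all add: p0 pS alg)
  then show ?case using bnd_nn[OF y] by simp
 next
  case (Suc n)
  have "p (Suc (Suc n)) -- p (Suc n) = y ** (p (Suc n) -- p n)"
   unfolding pS[of "Suc n"] using yc pc by (subst (2) pS) (intro tau_ext, simp_all add: alg)
  then have "nn (p (Suc (Suc n)) -- p (Suc n)) <= q * nn (p (Suc n) -- p n)" using bndD[OF y] pc by simp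
  also have "... <= q * (q * q ^ n)" using Suc q0 by (rule mult_left_mono)
  finally show ?case by simp
 qed
 obtain r where r: "cv sequentially p r" using complete_geom[OF pb d q0 q1] by auto
 have rc: "r : C" using cv_c r by blast
 have com: "p n ** y = y ** p n" for n
  by (induction n) (auto simp: p0 pS yc pc distrib_l distrib_r mult_assoc)
 have "cv sequentially (%n. p (Suc n)) r" using r LIMSEQ_Suc[OF cvD[OF r]] by (simp add: cv_def)
 moreover have "cv sequentially (%n. p (Suc n)) (\<one> ++ y ** r)"
  unfolding pS by (intro cv_add cv_const one_c cv_cmult yc r)
 ultimately have e: "r = \<one> ++ y ** r" by (rule cv_unique) simp
 have "cv sequentially (%n. p n ** y) (r ** y)" "cv sequentially (%n. p n ** y) (y ** r)"
  using cv_multc[OF yc r] cv_cmult[OF yc r] by (simp_all add: com)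
 then have ry: "r ** y = y ** r" by (rule cv_unique) simp
 have "(\<one> -- y) ** r = r -- y ** r" using rc yc by (intro tau_ext) (simp_all add: alg)
 also have "... = \<one>" using rc yc by (subst (1) e) (intro tau_ext, simp_all add: alg)
 finally have 1: "(\<one> -- y) ** r = \<one>" .
 have "r ** (\<one> -- y) = (\<one> -- y) ** r" using rc yc ry by (simp add: vsub_def distrib_l distrib_r mult_smult smult_mult)
 then have 2: "r ** (\<one> -- y) = \<one>" using 1 by simp
 have "r : S" if S: "vnsub S" "y : S" for S
 proof (rule vnsub_lim[OF S(1) _ pb r])
  show "p n : S" for n by (induction n) (auto simp: p0 pS vnsubD[OF S(1)] S)
 qed
 then show ?thesis using 1 2 rc by blast
qed

lemma inverse_one_plus:
 assumes z: "z : C"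
 shows "EX r. r : C & ~*r = r & (\<one> ++ ~*z ** z) ** r = \<one> & r ** (\<one> ++ ~*z ** z) = \<one> & bnd 1 r
  & (ALL S. vnsub S --> z : S --> r : S)"
proof -
 obtain K where K: "bnd K z" using ex_bnd[OF z] by auto
 \<comment> \<open>Rescaling writes c (1 + ~*z ** z) as 1 - y, where y = c (K^2 - ~*z ** z) has
   operator norm at most K^2 / (1 + K^2) < 1.\<close>
 define c where "c = 1 / (1 + K\<^sup>2)"
 have c: "c > 0" "c * (1 + K\<^sup>2) = 1" "c * K\<^sup>2 < 1" by (auto simp: c_def add_pos_nonneg field_simps)
   (metis add.commute add_pos_nonneg less_numeral_extra(1) less_numeral_extra(3) zero_le_power2)
 define w where "w = \<one> ++ ~*z ** z"
 have wc: "w : C" using z by (simp add: w_def)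
 define y where "y = of_real c .* (of_real (K\<^sup>2) .* \<one> -- ~*z ** z)"
 have yc: "y : C" using z by (simp add: y_def)
 have "bnd (cmod (of_real c) * K\<^sup>2) y" unfolding y_def by (rule bnd_smult[OF bnd_complement[OF K]])
 then have yb: "bnd (c * K\<^sup>2) y" using c by simp
 obtain r' where r': "r' : C" "(\<one> -- y) ** r' = \<one>" "r' ** (\<one> -- y) = \<one>" "!!S. vnsub S ==> y : S ==> r' : S"
  using neumann[OF yb c(3)] by blast
 have cc: "complex_of_real c + complex_of_real c * (complex_of_real K)\<^sup>2 = 1"
  using arg_cong[OF c(2), of complex_of_real] by (simp add: algebra_simps)
 have e: "\<one> -- y = of_real c .* w"
 proof (rule tau_ext)
  fix u assume u: "u : C"
  have "tr u = (complex_of_real c + complex_of_real c * (complex_of_real K)\<^sup>2) * tr u" unfolding cc by simp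
  then show "tr (u ** (\<one> -- y)) = tr (u ** (of_real c .* w))"
   using u z unfolding y_def w_def by (simp add: alg algebra_simps)
 qed (use yc wc in auto)
 define r where "r = of_real c .* r'"
 have rc: "r : C" using r' by (simp add: r_def)
 have 1: "w ** r = \<one>" using r'(2) wc r'(1) unfolding e r_def by (simp add: mult_smult smult_mult)
 have 2: "r ** w = \<one>" using r'(3) wc r'(1) unfolding e r_def by (simp add: mult_smult smult_mult)
 have ws: "~*w = w" using z by (simp add: w_def star_add star_mult)
 have "~*r = (~*r ** w) ** r" using 1 rc wc by (simp add: mult_assoc)
 also have "~*r ** w = ~*(w ** r)" using rc wc ws by (simp add: star_mult)
 finally have rs: "~*r = r" using 1 rc by simp
 \<comment> \<open>For x = v + ~*z ** z ** v the cross term in the square of nn x is twice the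
   square of \<open>nn (z ** v)\<close>, so that nn v <= nn x.\<close>
 have "bnd 1 r"
 proof (rule bndI)
  fix x assume x: "x : C"
  define v where "v = r ** x"
  have v: "v : C" using rc x by (simp add: v_def)
  have xv: "x = w ** v" using 1 rc x wc by (simp add: v_def flip: mult_assoc)
  have "x = v ++ ~*z ** z ** v" unfolding xv w_def using z v by (simp add: distrib_r)
  then have "(nn x)\<^sup>2 = (nn v)\<^sup>2 + 2 * Re (tr (~*(~*z ** z ** v) ** v)) + (nn (~*z ** z ** v))\<^sup>2"
   using nn_add_sq[of v "~*z ** z ** v"] z v by simp
  moreover have "Re (tr (~*(~*z ** z ** v) ** v)) = (nn (z ** v))\<^sup>2"
   using z v by (simp add: star_mult nn_sq mult_assoc)
  ultimately have "(nn v)\<^sup>2 <= (nn x)\<^sup>2" by simp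
  then have "nn v <= nn x" by (rule power2_le_imp_le) (use x in simp)
  then show "nn (r ** x) <= 1 * nn x" by (simp add: v_def)
 qed (use rc in auto)
 moreover have "r : S" if S: "vnsub S" "z : S" for S
 proof -
  have "y : S" unfolding y_def using S by (intro vnsubD[OF S(1)])
  then show ?thesis unfolding r_def using r'(4)[OF S(1)] vnsubD(5)[OF S(1)] by blast
 qed
 ultimately show ?thesis using 1 2 rs rc unfolding w_def by blast
qed

text \<open>The Cayley transform: unitaries of the form \<open>2(1 - it)\<inverse> - 1\<close> already determine commutants,
  so that no functional calculus is needed.\<close>

lemma cayley:
 assumes S: "vnsub S" and t: "t : S" "~*t = t"
 shows "EX u:S. unit u & (ALL c:C. c ** u = u ** c --> c ** t = t ** c)"
proof -
 have tc: "t : C" using S t vnsubD by blast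
 obtain r where r: "r : C" "~*r = r" "(\<one> ++ t ** t) ** r = \<one>" "r ** (\<one> ++ t ** t) = \<one>" and rS: "r : S"
  using inverse_one_plus[OF tc] t S by metis
 define w where "w = \<one> ++ t ** t"
 have wc: "w : C" and wr: "w ** r = \<one>" and rw: "r ** w = \<one>" using tc r by (simp_all add: w_def)
 have tw: "t ** w = w ** t" using tc by (simp add: w_def distrib_l distrib_r mult_assoc)
 have tr': "t ** r = r ** t" by (rule sym, rule inv_comm[OF r(1) wc tc rw wr tw, symmetric])
 define v where "v = \<one> -- \<i> .* t"
 define v' where "v' = \<one> ++ \<i> .* t"
 have vc: "v : C" "v' : C" using tc by (simp_all add: v_def v'_def)
 have vv: "v ** v' = w" "v' ** v = w" using tc
  by (intro tau_ext; simp add: v_def v'_def w_def alg algebra_simps)+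
 have vs: "~*v' = v" "~*v = v'" using tc t(2) by (intro tau_ext; simp add: v_def v'_def alg algebra_simps)+
 have rv: "r ** v = v ** r" "r ** v' = v' ** r" using tc r(1) tr'
  by (simp_all add: v_def v'_def vsub_def distrib_l distrib_r mult_smult smult_mult smult_smult)
 \<comment> \<open>Since v ** v' = 1 + t^2, this is the inverse of v = 1 - i t.\<close>
 define g where "g = v' ** r"
 have gc: "g : C" using vc r by (simp add: g_def)
 have gs: "~*g = r ** v" using vc r vs by (simp add: g_def star_mult)
 have vg: "v ** g = \<one>" using vv wr vc r(1) by (simp add: g_def flip: mult_assoc)
 have "g ** v = r ** (v' ** v)" unfolding g_def using rv vc r(1) by (simp flip: rv) (simp add: mult_assoc)
 then have gv: "g ** v = \<one>" using vv rw by simp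
 have "~*g ** g = r ** (v ** g)" unfolding gs using vc r(1) gc by (simp add: mult_assoc)
 then have gg: "~*g ** g = r" using vg r(1) by simp
 have "g ** ~*g = g ** (v ** r)" using gs rv by simp
 also have "... = g ** v ** r" using gc vc r(1) by (simp add: mult_assoc)
 finally have gg': "g ** ~*g = r" using gv r(1) by simp
 have "g ++ ~*g = r ** (v' ++ v)" unfolding gs using vc r(1) rv by (simp add: g_def distrib_l)
 also have "v' ++ v = 2 .* \<one>" using tc by (intro tau_ext) (simp_all add: v_def v'_def alg algebra_simps)
 finally have sum: "g ++ ~*g = 2 .* r" using r(1) by (simp add: mult_smult)
 \<comment> \<open>Unitarity amounts to g + ~*g = 2 (~*g ** g), and both sides equal 2 r.\<close>
 define u where "u = 2 .* g -- \<one>"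
 have uc: "u : C" using gc by (simp add: u_def)
 have us: "~*u = 2 .* ~*g -- \<one>" using gc by (simp add: u_def star_sub star_smult)
 have tsum: "tr (x ** g) + tr (x ** ~*g) = 2 * tr (x ** r)" if "x : C" for x
  using arg_cong[OF sum, of "%y. tr (x ** y)"] that gc r(1) by (simp add: alg)
 have "~*u ** u = \<one>"
 proof (rule tau_ext)
  fix x assume x: "x : C"
  have "tr (x ** (~*u ** u)) = 4 * tr (x ** (~*g ** g)) - 2 * (tr (x ** g) + tr (x ** ~*g)) + tr x"
   unfolding us unfolding u_def using x gc by (simp add: alg algebra_simps)
  then show "tr (x ** (~*u ** u)) = tr (x ** \<one>)" using tsum[OF x] x by (simp add: gg)
 qed (use uc in auto)
 moreover have "u ** ~*u = \<one>"
 proof (rule tau_ext)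
  fix x assume x: "x : C"
  have "tr (x ** (u ** ~*u)) = 4 * tr (x ** (g ** ~*g)) - 2 * (tr (x ** g) + tr (x ** ~*g)) + tr x"
   unfolding us unfolding u_def using x gc by (simp add: alg algebra_simps)
  then show "tr (x ** (u ** ~*u)) = tr (x ** \<one>)" using tsum[OF x] x by (simp add: gg')
 qed (use uc in auto)
 ultimately have uu: "unit u" using uc by (simp add: unit_def)
 have vS: "v' : S" unfolding v'_def using S t by (intro vnsubD[OF S])
 have uS: "u : S" unfolding u_def g_def using vS rS by (intro vnsubD[OF S])
 have "c ** t = t ** c" if c: "c : C" "c ** u = u ** c" for c
 proof -
  have g: "g = (1/2) .* (u ++ \<one>)" using gc by (intro tau_ext) (simp_all add: u_def alg)
  have cg: "c ** g = g ** c" unfolding g using c uc by (simp add: distrib_l distrib_r mult_smult smult_mult)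
  have cv: "c ** v = v ** c" by (rule inv_comm[OF vc(1) gc c(1) vg gv cg])
  have t': "t = (-\<i>) .* (\<one> -- v)" using tc by (intro tau_ext) (simp_all add: v_def alg algebra_simps)
  show ?thesis using c vc cv by (subst (1 2) t') (simp add: vsub_def distrib_l distrib_r mult_smult smult_mult)
 qed
 then show ?thesis using uu uS by blast
qed

lemma commute_if_unit:
 assumes S: "vnsub S" and c: "c : C" and u: "!!u. [|u : S; unit u|] ==> c ** u = u ** c" and t: "t : S"
 shows "c ** t = t ** c"
proof -
 have sa: "c ** h = h ** c" if "h : S" "~*h = h" for h using cayley[OF S that] c u by blast
 have tc: "t : C" using t S vnsubD by blast
 define h where "h = (1/2) .* (t ++ ~*t)"
 define k where "k = (-\<i>/2) .* (t -- ~*t)"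
 have S': "h : S" "k : S" unfolding h_def k_def using t by (auto intro!: vnsubD[OF S])
 have sh: "~*h = h" unfolding h_def using tc by (intro tau_ext) (simp_all add: alg algebra_simps)
 have sk: "~*k = k" unfolding k_def using tc by (intro tau_ext) (simp_all add: alg algebra_simps)
 have e: "t = h ++ \<i> .* k" unfolding h_def k_def using tc by (intro tau_ext) (simp_all add: alg algebra_simps)
 have hk: "h : C" "k : C" using S' S vnsubD by blast+
 show ?thesis unfolding e using sa[OF S'(1) sh] sa[OF S'(2) sk] hk c
  by (simp add: distrib_l distrib_r mult_smult smult_mult)
qed

subsection \<open>Elements of minimal norm and Dixmier averaging\<close>

definition mid :: "'a => 'a => 'a" where "mid x y = (1/2) .* (x ++ y)"

lemma mid_c [simp]: "[|x : C; y : C|] ==> mid x y : C" by (simp add: mid_def)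

text \<open>Nonempty, convex, closed and bounded. Midpoints are the only convex combinations
  required below: they suffice for the parallelogram law, for averaging and for faces.\<close>

definition ccb :: "'a set => bool" where
 "ccb A \<longleftrightarrow> A ~= {} & (EX L. ALL x:A. bnd L x) & (ALL x:A. ALL y:A. mid x y : A) &
  (ALL s x. (ALL n::nat. s n : A) & cv sequentially s x --> x : A)"

lemma ccbD: assumes "ccb A" shows "A ~= {}" "EX L. ALL x:A. bnd L x" "[|x : A; y : A|] ==> mid x y : A"
  "[|!!n::nat. s n : A; cv sequentially s x|] ==> x : A" "x : A ==> x : C"
 using assms bnd_c unfolding ccb_def by blast+

lemma mid_nn: "[|x : C; y : C|] ==> (nn (x -- y))\<^sup>2 = 2 * (nn x)\<^sup>2 + 2 * (nn y)\<^sup>2 - 4 * (nn (mid x y))\<^sup>2"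
 using parallelogram[of x y] by (simp add: mid_def nn_smult norm_divide power_mult_distrib power_divide)

text \<open>By the parallelogram law a minimizing sequence is Cauchy. The inequality in the
  conclusion is a quantitative form of uniqueness: invariance of the minimizer and the comparison of
  nested sets are both read off from it.\<close>

lemma min_nn:
 assumes A: "ccb A" shows "EX m:A. ALL x:A. (nn (x -- m))\<^sup>2 <= 2 * (nn x)\<^sup>2 - 2 * (nn m)\<^sup>2"
proof -
 note Ac = ccbD(5)[OF A]
 obtain L where L: "ALL x:A. bnd L x" using ccbD(2)[OF A] by blast
 define D where "D = Inf ((%x. (nn x)\<^sup>2) ` A)"
 have bd: "bdd_below ((%x. (nn x)\<^sup>2) ` A)" by (rule bdd_belowI2[of _ 0]) simp
 have D: "D <= (nn x)\<^sup>2" if "x : A" for x unfolding D_def using that bd by (intro cInf_lower) auto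
 have "EX x:A. (nn x)\<^sup>2 < D + 1 / Suc n" for n
  using cInf_lessD[of "(%x. (nn x)\<^sup>2) ` A" "D + 1 / Suc n"] ccbD(1)[OF A] unfolding D_def by fastforce
 then obtain s where s: "!!n. s n : A" "!!n. (nn (s n))\<^sup>2 < D + 1 / Suc n" by metis
 have dist: "(nn (x -- y))\<^sup>2 <= 2 * (nn x)\<^sup>2 + 2 * (nn y)\<^sup>2 - 4 * D" if "x : A" "y : A" for x y
  using mid_nn[OF Ac Ac, OF that] D[OF ccbD(3)[OF A that]] by simp
 have "EX m. bnd L m & cv sequentially s m"
 proof (rule complete)
  show "bnd L (s n)" for n using L s by blast
  fix e :: real assume e: "e > 0"
  obtain N where N: "1 / real (Suc N) < e\<^sup>2 / 4" using reals_Archimedean[of "e\<^sup>2 / 4"] e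
   by (auto simp: inverse_eq_divide)
  show "EX N. ALL m>=N. ALL n>=N. nn (s m -- s n) < e"
  proof (intro exI allI impI)
   fix m n assume mn: "m >= N" "n >= N"
   have "1 / real (Suc m) <= 1 / real (Suc N)" "1 / real (Suc n) <= 1 / real (Suc N)" using mn by (auto simp: field_simps)
   then have "(nn (s m -- s n))\<^sup>2 < e\<^sup>2"
    using dist[OF s(1) s(1), of m n] s(2)[of m] s(2)[of n] N by linarith
   then show "nn (s m -- s n) < e" using e by (simp add: power_less_imp_less_base)
  qed
 qed
 then obtain m where m: "cv sequentially s m" by blast
 have mA: "m : A" using ccbD(4)[OF A s(1) m] .
 have "(%n. (nn (s n))\<^sup>2) \<longlonglongrightarrow> (nn m)\<^sup>2" by (intro tendsto_power cv_nn m)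
 moreover have "(%n. D + 1 / Suc n) \<longlonglongrightarrow> D + 0" by (intro tendsto_intros LIMSEQ_Suc[OF lim_const_over_n])
 ultimately have "(nn m)\<^sup>2 <= D + 0" by (rule LIMSEQ_le) (use s(2) less_imp_le in blast)
 then have "(nn m)\<^sup>2 = D" using D[OF mA] by simp
 then have "ALL x:A. (nn (x -- m))\<^sup>2 <= 2 * (nn x)\<^sup>2 - 2 * (nn m)\<^sup>2" using dist mA by fastforce
 then show ?thesis using mA by blast
qed

lemma conj_mid: "[|u : C; v : C; x : C; y : C|] ==> u ** mid x y ** v = mid (u ** x ** v) (u ** y ** v)"
 by (simp add: mid_def distrib_l distrib_r mult_smult smult_mult)

text \<open>Conjugation by a unitary of S preserves A and the 2-norm, so it fixes the element of
  minimal norm. That element is therefore central in S, thus a scalar, and the constant trace on A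
  identifies the scalar.\<close>

lemma dixmier:
 assumes S: "vnsub S" and tc: "tcen S" and A: "ccb A" "A \<subseteq> S"
  and inv: "!!u x. [|u : S; unit u; x : A|] ==> u ** x ** ~*u : A"
  and t: "!!x. x : A ==> tr x = t"
 shows "t .* \<one> : A"
proof -
 obtain m where m: "m : A" "!!x. x : A ==> (nn (x -- m))\<^sup>2 <= 2 * (nn x)\<^sup>2 - 2 * (nn m)\<^sup>2"
  using min_nn[OF A(1)] by blast
 have mc: "m : C" "m : S" using m A ccbD(5)[OF A(1)] by auto
 have com: "m ** u = u ** m" if u: "u : S" "unit u" for u
 proof -
  note uc = unitD[OF u(2)]
  have n: "nn (u ** m ** ~*u) = nn m" using unit_nn[OF u(2)] unit_nn[OF unit_star[OF u(2)]] mc uc by simp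
  have "(nn (u ** m ** ~*u -- m))\<^sup>2 <= 0" using m(2)[OF inv[OF u m(1)]] n by simp
  then have "nn (u ** m ** ~*u -- m) <= 0" by simp
  then have e: "u ** m ** ~*u = m" using uc mc by (intro eq_if_nn) auto
  have "m ** u = (u ** m ** ~*u) ** u" using e by simp
  also have "... = u ** m ** (~*u ** u)" using uc(1) mc by (simp add: mult_assoc)
  finally show ?thesis using uc mc by simp
 qed
 have "m ** y = y ** m" if "y : S" for y by (rule commute_if_unit[OF S mc(1) com that])
 then obtain c where c: "m = c .* \<one>" using tc mc unfolding tcen_def by blast
 then have "tr m = c" by (simp add: tr_smult)
 then show ?thesis using t[OF m(1)] m(1) c by simp
qed

lemma ccb_ballI:
 assumes S: "vnsub S" and x0: "x0 : S" "bnd L x0" "P x0"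
  and mid: "!!x y. [|x : S; y : S; P x; P y|] ==> P (mid x y)"
  and lim: "!!s x. [|!!n::nat. s n : S; !!n. P (s n); !!n. bnd L (s n); cv sequentially s x|] ==> P x"
 shows "ccb {x : S. bnd L x & P x}"
 unfolding ccb_def
proof (intro conjI ballI allI impI)
 show "{x : S. bnd L x & P x} ~= {}" using x0 by blast
 show "EX K. ALL x:{x : S. bnd L x & P x}. bnd K x" by blast
 fix x y assume a: "x : {x : S. bnd L x & P x}" "y : {x : S. bnd L x & P x}"
 have "bnd (cmod (1/2) * (L + L)) (mid x y)" unfolding mid_def using a by (intro bnd_smult bnd_add) auto
 then have "bnd L (mid x y)" by (simp add: norm_divide)
 moreover have "mid x y : S" unfolding mid_def using a by (intro vnsubD[OF S]) auto
 ultimately show "mid x y : {x : S. bnd L x & P x}" using mid a by simp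
next
 fix s x assume a: "(ALL n::nat. s n : {x : S. bnd L x & P x}) & cv sequentially s x"
 then have b: "!!n. bnd L (s n)" and c: "cv sequentially s x" by auto
 have "bnd L x" by (rule cv_bnd[OF b c]) simp
 moreover have "x : S" using vnsub_lim[OF S _ b c] a by blast
 moreover have "P x" by (rule lim[of s]) (use a in auto)
 ultimately show "x : {x : S. bnd L x & P x}" by simp
qed

text \<open>The elements x of S with tr x = tr (b ** ~*b) that a ** s annihilates for all s in S
  form an invariant convex set containing b ** ~*b. Averaging puts the scalar tr (b ** ~*b) into it,
  so this scalar times a is zero.\<close>

lemma prime_subfactor:
 assumes S: "vnsub S" and tc: "tcen S" and a: "a : C" and b: "b : S"
  and z: "!!s. s : S ==> a ** (s ** b) = \<zero>"
 shows "a = \<zero> | b = \<zero>"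
proof -
 have bc: "b : C" using b S vnsubD by blast
 define x0 where "x0 = b ** ~*b"
 have x0: "x0 : S" unfolding x0_def using b by (intro vnsubD[OF S])
 have x0c: "x0 : C" using x0 S vnsubD by blast
 obtain L where L: "bnd L x0" using ex_bnd[OF x0c] by blast
 define P where "P x \<longleftrightarrow> tr x = tr x0 & (ALL s:S. a ** (s ** x) = \<zero>)" for x
 let ?A = "{x : S. bnd L x & P x}"
 have A: "ccb ?A"
 proof (rule ccb_ballI[OF S x0 L])
  show "P x0" unfolding P_def
  proof (intro conjI ballI refl)
   fix s assume s: "s : S"
   have sc: "s : C" using s S vnsubD by blast
   have "a ** (s ** x0) = a ** (s ** b) ** ~*b" unfolding x0_def using a sc bc by (simp add: mult_assoc)
   then show "a ** (s ** x0) = \<zero>" using z[OF s] bc by simp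
  qed
  show "P (mid x y)" if "x : S" "y : S" "P x" "P y" for x y
  proof -
   have c: "x : C" "y : C" using that S vnsubD by blast+
   have "a ** (s ** mid x y) = \<zero>" if s: "s : S" for s
   proof -
    have "s : C" using s S vnsubD by blast
    then show ?thesis using s \<open>P x\<close> \<open>P y\<close> a c unfolding P_def mid_def by (simp add: distrib_l mult_smult)
   qed
   then show ?thesis using \<open>P x\<close> \<open>P y\<close> c unfolding P_def by (simp add: mid_def tr_add tr_smult)
  qed
  show "P x" if s: "!!n::nat. s n : S" "!!n. P (s n)" "cv sequentially s x" for s x
  proof -
   have "(%n. tr (s n)) \<longlonglongrightarrow> tr x" by (rule cv_tr[OF s(3)])
   moreover have "(%n. tr (s n)) = (%n. tr x0)" using s(2) by (simp add: P_def)
   ultimately have 1: "tr x = tr x0" by (simp add: LIMSEQ_const_iff)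
   have "a ** (r ** x) = \<zero>" if r: "r : S" for r
   proof -
    have rc: "r : C" using r S vnsubD by blast
    have "cv sequentially (%n. a ** (r ** s n)) (a ** (r ** x))" by (intro cv_cmult a rc s)
    moreover have "(%n. a ** (r ** s n)) = (%n. \<zero>)" using s(2) r by (simp add: P_def)
    ultimately show ?thesis using cv_unique[OF _ cv_const[OF zero_c]] by fastforce
   qed
   then show ?thesis using 1 by (simp add: P_def)
  qed
 qed
 have "tr x0 .* \<one> : ?A"
 proof (rule dixmier[OF S tc A])
  fix u x assume u: "u : S" "unit u" and x: "x : ?A"
  note uc = unitD[OF u(2)]
  have xc: "x : C" using x S vnsubD by blast
  have "u ** x ** ~*u : S" using x u by (intro vnsubD[OF S]) auto
  moreover have "bnd L (u ** x ** ~*u)" using bnd_conj[OF u(2)] x by simp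
  moreover have "tr (u ** x ** ~*u) = tr x"
   using tr_comm[of "u ** x" "~*u"] uc xc by (simp flip: mult_assoc)
  moreover have "a ** (s ** (u ** x ** ~*u)) = \<zero>" if s: "s : S" for s
  proof -
   have sc: "s : C" using s S vnsubD by blast
   have "a ** (s ** (u ** x ** ~*u)) = a ** ((s ** u) ** x) ** ~*u" using a sc uc(1) xc by (simp add: mult_assoc)
   also have "a ** ((s ** u) ** x) = \<zero>" using x vnsubD(4)[OF S s u(1)] by (simp add: P_def)
   finally show ?thesis using uc by simp
  qed
  ultimately show "u ** x ** ~*u : ?A" using x by (simp add: P_def)
 qed (auto simp: P_def)
 then have "a ** (\<one> ** (tr x0 .* \<one>)) = \<zero>" using vnsubD(2)[OF S] unfolding P_def by blast
 then have "tr x0 .* a = \<zero>" using a by (simp add: mult_smult)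
 then have "cmod (tr x0) * nn a = 0" using nn_smult[OF a, of "tr x0"] by simp
 then have "tr x0 = 0 | a = \<zero>" using nn_zero_iff[OF a] by simp
 moreover have "b = \<zero>" if "tr x0 = 0"
  using that tr_faithful[of "~*b"] bc unfolding x0_def by (metis star_c star_star star_zero)
 ultimately show ?thesis by blast
qed

text \<open>The elements all of whose unitary conjugates stay within \<delta> of z, with the trace
  of z, form an invariant convex set containing z; averaging produces the scalar tr z in it. The
  constant does not depend on S, which is what survives in ultrapowers.\<close>

lemma dist_scalar:
 assumes S: "vnsub S" and tc: "tcen S" and z: "z : S"
  and d: "!!u. [|u : S; unit u|] ==> nn (u ** z ** ~*u -- z) <= \<delta>"
 shows "nn (tr z .* \<one> -- z) <= \<delta>"
proof -
 have zc: "z : C" using z S vnsubD by blast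
 obtain L where L: "bnd L z" using ex_bnd[OF zc] by blast
 define P where "P x \<longleftrightarrow> tr x = tr z & (ALL u:S. unit u --> nn (u ** x ** ~*u -- z) <= \<delta>)" for x
 let ?A = "{x : S. bnd L x & P x}"
 have A: "ccb ?A"
 proof (rule ccb_ballI[OF S z L])
  show "P z" unfolding P_def using d by blast
  show "P (mid x y)" if xy: "x : S" "y : S" "P x" "P y" for x y
  proof -
   have c: "x : C" "y : C" using that S vnsubD by blast+
   have "nn (u ** mid x y ** ~*u -- z) <= \<delta>" if u: "u : S" "unit u" for u
   proof -
    let ?p = "u ** x ** ~*u" and ?q = "u ** y ** ~*u"
    have pc: "?p : C" "?q : C" using unitD[OF u(2)] c by auto
    have "u ** mid x y ** ~*u -- z = mid (?p -- z) (?q -- z)"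
     unfolding conj_mid[OF unitD(1)[OF u(2)] star_c[OF unitD(1)[OF u(2)]] c]
     using pc zc by (intro tau_ext) (simp_all add: mid_def vsub_def distrib_l mult_smult smult_smult tr_add tr_smult smult_add algebra_simps)
    then have "nn (u ** mid x y ** ~*u -- z) <= (1/2) * (nn (?p -- z) + nn (?q -- z))"
     using pc zc triangle[of "?p -- z" "?q -- z"] by (simp add: mid_def nn_smult norm_divide)
    also have "... <= (1/2) * (\<delta> + \<delta>)" using xy u unfolding P_def by (intro mult_left_mono add_mono) auto
    finally show ?thesis by simp
   qed
   then show ?thesis using \<open>P x\<close> \<open>P y\<close> c unfolding P_def by (simp add: mid_def tr_add tr_smult)
  qed
  show "P x" if s: "!!n::nat. s n : S" "!!n. P (s n)" "cv sequentially s x" for s x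
  proof -
   have "(%n. tr (s n)) \<longlonglongrightarrow> tr x" by (rule cv_tr[OF s(3)])
   moreover have "(%n. tr (s n)) = (%n. tr z)" using s(2) by (simp add: P_def)
   ultimately have 1: "tr x = tr z" by (simp add: LIMSEQ_const_iff)
   have "nn (u ** x ** ~*u -- z) <= \<delta>" if u: "u : S" "unit u" for u
   proof -
    have "cv sequentially (%n. u ** s n ** ~*u -- z) (u ** x ** ~*u -- z)"
     by (intro cv_sub cv_const cv_multc cv_cmult zc star_c unitD(1)[OF u(2)] s)
    from cv_nn[OF this] show ?thesis
     by (rule LIMSEQ_le_const2) (use s(2) u in \<open>auto simp: P_def\<close>)
   qed
   then show ?thesis using 1 by (simp add: P_def)
  qed
 qed
 have "tr z .* \<one> : ?A"
 proof (rule dixmier[OF S tc A])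
  fix u x assume u: "u : S" "unit u" and x: "x : ?A"
  note uc = unitD[OF u(2)]
  have xc: "x : C" using x S vnsubD by blast
  have "u ** x ** ~*u : S" using x u by (intro vnsubD[OF S]) auto
  moreover have "bnd L (u ** x ** ~*u)" using bnd_conj[OF u(2)] x by simp
  moreover have "tr (u ** x ** ~*u) = tr x"
   using tr_comm[of "u ** x" "~*u"] uc xc by (simp flip: mult_assoc)
  moreover have "nn (v ** (u ** x ** ~*u) ** ~*v -- z) <= \<delta>" if v: "v : S" "unit v" for v
  proof -
   have vc: "v : C" using unitD[OF v(2)] by simp
   have "v ** (u ** x ** ~*u) ** ~*v = (v ** u) ** x ** ~*(v ** u)"
    using vc uc(1) xc by (simp add: mult_assoc star_mult)
   then show ?thesis using x vnsubD(4)[OF S v(1) u(1)] unit_mult[OF v(2) u(2)] by (simp add: P_def)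
  qed
  ultimately show "u ** x ** ~*u : ?A" using x by (simp add: P_def)
 qed (auto simp: P_def)
 then have "nn (\<one> ** (tr z .* \<one>) ** ~*\<one> -- z) <= \<delta>"
  using vnsubD(2)[OF S] unfolding P_def unit_def by fastforce
 then show ?thesis by simp
qed

end

section \<open>Extreme points\<close>

context tvna
begin

definition extr :: "'a set => 'a => bool" where
 "extr A e \<longleftrightarrow> e : A & (ALL x:A. ALL y:A. mid x y = e --> x = e & y = e)"

definition face :: "'a set => 'a set => bool" where
 "face A F \<longleftrightarrow> ccb F & F \<subseteq> A & (ALL x:A. ALL y:A. mid x y : F --> x : F & y : F)"

text \<open>Takes the place of weak compactness. As the sets of the chain shrink, their minimal
  2-norms increase, and by \<open>min_nn\<close> sets with nearly equal minimal norms have nearly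
  equal minimizers. Along sets approaching the supremum the minimizers converge, and the limit
  belongs to every member of the chain.\<close>

lemma chain_inter:
 assumes ne: "\<C> ~= {}" and ccb: "!!A. A : \<C> ==> ccb A" and L: "!!A x. [|A : \<C>; x : A|] ==> bnd L x"
  and ch: "!!A B. [|A : \<C>; B : \<C>|] ==> A \<subseteq> B | B \<subseteq> A"
 shows "EX m. ALL A:\<C>. m : A"
proof -
 have "ALL A:\<C>. EX m. m : A & (ALL x:A. (nn (x -- m))\<^sup>2 <= 2 * (nn x)\<^sup>2 - 2 * (nn m)\<^sup>2)"
  using min_nn ccb by blast
 then obtain mm where mm: "!!A. A : \<C> ==> mm A : A"
  "!!A x. [|A : \<C>; x : A|] ==> (nn (x -- mm A))\<^sup>2 <= 2 * (nn x)\<^sup>2 - 2 * (nn (mm A))\<^sup>2"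
  by metis
 have mc: "mm A : C" "bnd L (mm A)" if "A : \<C>" for A using mm(1)[OF that] L[OF that] bnd_c by blast+
 define d where "d A = (nn (mm A))\<^sup>2" for A
 have dL: "d A <= L\<^sup>2" if "A : \<C>" for A
  unfolding d_def using bnd_nn[OF mc(2)[OF that]] mc(1)[OF that] by (intro power_mono) auto
 define D where "D = Sup (d ` \<C>)"
 have bd: "bdd_above (d ` \<C>)" using dL by (auto simp: bdd_above_def)
 have D: "d A <= D" if "A : \<C>" for A unfolding D_def using that bd by (intro cSup_upper) auto
 have sub: "(nn (mm A -- mm B))\<^sup>2 <= 2 * (d A - d B)" if "A : \<C>" "B : \<C>" "A \<subseteq> B" for A B
  using mm(2)[OF that(2), of "mm A"] mm(1)[OF that(1)] that(3) unfolding d_def by auto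
 have "EX A:\<C>. D - 1 / Suc n < d A" for n
  using less_cSupD[of "d ` \<C>" "D - 1 / Suc n"] ne unfolding D_def by auto
 then obtain An where An: "!!n. An n : \<C>" "!!n. D - 1 / Suc n < d (An n)" by metis
 have close: "(nn (mm (An m) -- mm (An n)))\<^sup>2 <= 2 * (1 / Suc N)" if "m >= N" "n >= N" for m n N
 proof -
  have i: "1 / real (Suc m) <= 1 / real (Suc N)" "1 / real (Suc n) <= 1 / real (Suc N)" using that by (auto simp: field_simps)
  have dd: "\<bar>d (An m) - d (An n)\<bar> <= 1 / Suc N" using i An(2)[of m] An(2)[of n] D[OF An(1)[of m]] D[OF An(1)[of n]] by linarith
  from ch[OF An(1) An(1), of m n] show ?thesis
  proof
   assume "An m \<subseteq> An n"
   have "2 * (d (An m) - d (An n)) <= 2 * (1 / Suc N)" using dd by (intro mult_left_mono) linarith+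
   with sub[OF An(1) An(1) \<open>An m \<subseteq> An n\<close>] show ?thesis by (rule order_trans)
  next
   assume "An n \<subseteq> An m"
   have "2 * (d (An n) - d (An m)) <= 2 * (1 / Suc N)" using dd by (intro mult_left_mono) linarith+
   with sub[OF An(1) An(1) \<open>An n \<subseteq> An m\<close>] show ?thesis
    unfolding sub_swap[OF mc(1)[OF An(1)] mc(1)[OF An(1)], of m n] by (rule order_trans)
  qed
 qed
 have "EX m. bnd L m & cv sequentially (%n. mm (An n)) m"
 proof (rule complete)
  show "bnd L (mm (An n))" for n using mc An by blast
  fix e :: real assume e: "e > 0"
  obtain N where N: "1 / real (Suc N) < e\<^sup>2 / 2" using reals_Archimedean[of "e\<^sup>2 / 2"] e
   by (auto simp: inverse_eq_divide)
  show "EX N. ALL m>=N. ALL n>=N. nn (mm (An m) -- mm (An n)) < e"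
  proof (intro exI allI impI)
   fix m n assume mn: "m >= N" "n >= N"
   have "(nn (mm (An m) -- mm (An n)))\<^sup>2 < e\<^sup>2" using close[OF mn] N by linarith
   then show "nn (mm (An m) -- mm (An n)) < e" using e by (simp add: power_less_imp_less_base)
  qed
 qed
 then obtain m where m: "cv sequentially (%n. mm (An n)) m" by blast
 have "m : A" if A: "A : \<C>" for A
 proof -
  \<comment> \<open>If An n is not inside A, then A is inside An n, and the minimizer of A is close
    to that of An n. The modified sequence stays in A and has the same limit.\<close>
  define t where "t n = (if An n \<subseteq> A then mm (An n) else mm A)" for n
  have tA: "t n : A" for n unfolding t_def using mm(1)[OF A] mm(1)[OF An(1)] by auto
  have tc: "t n : C" for n using tA ccbD(5)[OF ccb[OF A]] by blast
  have dist: "(nn (t n -- mm (An n)))\<^sup>2 <= 2 * (1 / Suc n)" for n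
  proof (cases "An n \<subseteq> A")
   case True then show ?thesis using mc An by (simp add: t_def)
  next
   case False
   then have "A \<subseteq> An n" using ch[OF An(1) A] by blast
   have "2 * (d A - d (An n)) <= 2 * (1 / Suc n)" using D[OF A] An(2)[of n] by (intro mult_left_mono) linarith+
   with sub[OF A An(1) \<open>A \<subseteq> An n\<close>] False show ?thesis by (auto simp: t_def intro: order_trans)
  qed
  have "nn (t n -- mm (An n)) <= sqrt (2 * (1 / Suc n))" for n using real_le_rsqrt[OF dist] .
  then have "nn (t n -- m) <= sqrt (2 * (1 / Suc n)) + nn (mm (An n) -- m)" for n
   using sub_tri[OF tc mc(1)[OF An(1)] cv_c(2)[OF m], of n n] by (smt (verit))
  moreover have "(%n. sqrt (2 * (1 / Suc n)) + nn (mm (An n) -- m)) \<longlonglongrightarrow> sqrt (2 * 0) + 0"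
   by (intro tendsto_add tendsto_real_sqrt tendsto_mult tendsto_const cvD[OF m] LIMSEQ_Suc[OF lim_const_over_n])
  ultimately have tm: "cv sequentially t m" by (intro cvI[OF tc cv_c(2)[OF m]]) auto
  show "m : A" by (rule ccbD(4)[OF ccb[OF A] _ tm]) (rule tA)
 qed
 then show ?thesis by blast
qed

definition fl :: "'a => 'a => real" where "fl v x = Re (tr (~*v ** x))"

lemma fl_mid: "[|v : C; x : C; y : C|] ==> fl v (mid x y) = (fl v x + fl v y) / 2"
 by (simp add: fl_def mid_def mult_smult distrib_l tr_smult tr_add)

lemma fl_cv: "[|v : C; cv F s x|] ==> ((%n. fl v (s n)) \<longlongrightarrow> fl v x) F"
 unfolding fl_def by (intro tendsto_Re cv_tr cv_cmult star_c)

text \<open>The functional attains its maximum because its superlevel sets form a chain; the points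
  where a linear functional is maximal form a face.\<close>

lemma max_face:
 assumes F: "face A F" and v: "v : C" and Ac: "A \<subseteq> C"
 shows "face A {x : F. ALL y:F. fl v y <= fl v x}"
proof -
 have cF: "ccb F" using F by (simp add: face_def)
 obtain L where L: "!!x. x : F ==> bnd L x" using ccbD(2)[OF cF] by blast
 let ?G = "%a. {x : F. a <= fl v x}"
 have cG: "ccb (?G (fl v y))" if y: "y : F" for y
  unfolding ccb_def
 proof (intro conjI ballI allI impI)
  show "?G (fl v y) ~= {}" using y by auto
  show "EX L. ALL x:?G (fl v y). bnd L x" using L by blast
  fix x z assume "x : ?G (fl v y)" "z : ?G (fl v y)"
  then show "mid x z : ?G (fl v y)" using ccbD(3,5)[OF cF] by (simp add: fl_mid[OF v])
 next
  fix s x assume a: "(ALL n::nat. s n : ?G (fl v y)) & cv sequentially s x"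
  then have xF: "x : F" using ccbD(4)[OF cF, of s x] by blast
  have "fl v y <= fl v x" by (rule LIMSEQ_le_const[OF fl_cv[OF v]]) (use a in auto)
  then show "x : ?G (fl v y)" using xF by simp
 qed
 have "EX m. ALL A:(%y. ?G (fl v y)) ` F. m : A"
 proof (rule chain_inter)
  show "(%y. ?G (fl v y)) ` F ~= {}" using ccbD(1)[OF cF] by simp
  show "!!A B. [|A : (%y. ?G (fl v y)) ` F; B : (%y. ?G (fl v y)) ` F|] ==> A \<subseteq> B | B \<subseteq> A" by force
 qed (use cG L in auto)
 then obtain m where m: "m : F" "!!y. y : F ==> fl v y <= fl v m" using ccbD(1)[OF cF] by auto
 have e: "{x : F. ALL y:F. fl v y <= fl v x} = ?G (fl v m)" using m by force
 show ?thesis unfolding e face_def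
 proof (intro conjI ballI impI)
  show "ccb (?G (fl v m))" by (rule cG[OF m(1)])
  show "?G (fl v m) \<subseteq> A" using F by (auto simp: face_def)
  fix x y assume xy: "x : A" "y : A" and q: "mid x y : ?G (fl v m)"
  then have F2: "x : F" "y : F" using F by (auto simp: face_def)
  have "fl v m <= (fl v x + fl v y) / 2" using q xy Ac v by (auto simp: fl_mid subset_eq)
  then have "fl v m <= fl v x" "fl v m <= fl v y" using m(2)[OF F2(1)] m(2)[OF F2(2)] by auto
  then show "x : ?G (fl v m)" "y : ?G (fl v m)" using F2 by auto
 qed
qed

text \<open>Zorn's lemma gives a minimal face inside the set of maximizers of fl v. A minimal face
  is a single point, which is extreme in A.\<close>

theorem krein_milman:
 assumes A: "ccb A" and v: "v : C"
 shows "EX e. extr A e & (ALL y:A. fl v y <= fl v e)"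
proof -
 have Ac: "A \<subseteq> C" using ccbD(5)[OF A] by blast
 obtain L where L: "!!x. x : A ==> bnd L x" using ccbD(2)[OF A] by blast
 define A' where "A' = {x : A. ALL y:A. fl v y <= fl v x}"
 have "face A A" using A by (simp add: face_def)
 then have A': "face A A'" unfolding A'_def by (rule max_face[OF _ v Ac])
 define \<F> where "\<F> = {F. face A F & F \<subseteq> A'}"
 define P where "P F G \<longleftrightarrow> G \<subseteq> F" for F G :: "'a set"
 have "EX m:\<F>. ALL a:\<F>. P m a --> a = m"
 proof (rule predicate_Zorn)
  show "partial_order_on \<F> (relation_of P \<F>)"
   by (rule partial_order_on_relation_ofI) (auto simp: P_def)
  fix \<C> assume ch: "\<C> : Chains (relation_of P \<F>)"
  then have CF: "\<C> \<subseteq> \<F>" unfolding Chains_def relation_of_def by blast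
  have tot: "F \<subseteq> G | G \<subseteq> F" if "F : \<C>" "G : \<C>" for F G
   using ch that unfolding Chains_def relation_of_def P_def by blast
  show "EX u:\<F>. ALL a:\<C>. P a u"
  proof (cases "\<C> = {}")
   case True then show ?thesis using A' by (auto simp: \<F>_def)
  next
   case False
   have fC: "face A F" "F \<subseteq> A'" if "F : \<C>" for F using that CF by (auto simp: \<F>_def)
   have "EX m. ALL F:\<C>. m : F"
   proof (rule chain_inter[OF False _ _ tot])
    show "ccb F" if "F : \<C>" for F using fC[OF that] by (simp add: face_def)
    show "bnd L x" if "F : \<C>" "x : F" for F x using fC(1)[OF that(1)] that L unfolding face_def by blast
   qed
   then have ne: "\<Inter>\<C> ~= {}" by blast
   have "face A (\<Inter>\<C>)" unfolding face_def
   proof (intro conjI ballI impI)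
    show "ccb (\<Inter>\<C>)" unfolding ccb_def
    proof (intro conjI ballI allI impI ne)
     show "EX L. ALL x:\<Inter>\<C>. bnd L x" using False fC(1) L unfolding face_def by blast
     fix x y assume "x : \<Inter>\<C>" "y : \<Inter>\<C>"
     then show "mid x y : \<Inter>\<C>" using fC(1) ccbD(3) unfolding face_def by blast
    next
     fix s x assume a: "(ALL n::nat. s n : \<Inter>\<C>) & cv sequentially s x"
     show "x : \<Inter>\<C>"
     proof
      fix F assume F: "F : \<C>"
      then have "ccb F" using fC(1) unfolding face_def by blast
      then show "x : F" by (rule ccbD(4)[of F s x]) (use a F in auto)
     qed
    qed
    show "\<Inter>\<C> \<subseteq> A" using False fC(1) unfolding face_def by blast
    fix x y assume xy: "x : A" "y : A" "mid x y : \<Inter>\<C>"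
    show "x : \<Inter>\<C>" "y : \<Inter>\<C>" using xy fC(1) unfolding face_def by blast+
   qed
   moreover have "\<Inter>\<C> \<subseteq> A'" using False fC(2) by blast
   ultimately have "\<Inter>\<C> \<in> \<F>" by (simp add: \<F>_def)
   then show ?thesis unfolding P_def by blast
  qed
 qed
 then obtain F where F: "F : \<F>" "!!G. [|G : \<F>; G \<subseteq> F|] ==> G = F" unfolding P_def by blast
 have fF: "face A F" "F \<subseteq> A'" using F by (auto simp: \<F>_def)
 then have cF: "ccb F" by (simp add: face_def)
 obtain e where e: "e : F" using ccbD(1)[OF cF] by blast
 have sing: "x = e" if x: "x : F" for x
 proof (rule ccontr)
  assume "x ~= e"
  have xc: "x : C" "e : C" using x e ccbD(5)[OF cF] by auto
  \<comment> \<open>The functional given by x - e takes different values at x and at e, so its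
    maximizers form a strictly smaller face.\<close>
  define w where "w = x -- e"
  have wc: "w : C" using xc by (simp add: w_def)
  define G where "G = {x : F. ALL y:F. fl w y <= fl w x}"
  have "face A G" unfolding G_def by (rule max_face[OF fF(1) wc Ac])
  then have "G : \<F>" using fF(2) unfolding G_def \<F>_def by auto
  then have "G = F" by (rule F(2)) (auto simp: G_def)
  then have "fl w x = fl w e" using x e unfolding G_def by (metis (mono_tags, lifting) mem_Collect_eq order_antisym)
  moreover have "fl w x - fl w e = (nn w)\<^sup>2"
   using xc by (simp add: fl_def nn_sq w_def vsub_def distrib_l mult_smult tr_add tr_smult)
  ultimately have "nn w = 0" by simp
  then show False using \<open>x ~= e\<close> xc nn_zero_iff[OF wc] sub_eq_zero unfolding w_def by blast
 qed
 have "extr A e" unfolding extr_def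
 proof (intro conjI ballI impI)
  show "e : A" using e fF by (auto simp: face_def)
  fix x y assume "x : A" "y : A" "mid x y = e"
  then have "x : F" "y : F" using fF(1) e unfolding face_def by blast+
  then show "x = e" "y = e" using sing by auto
 qed
 moreover have "ALL y:A. fl v y <= fl v e" using e fF(2) unfolding A'_def by blast
 ultimately show ?thesis by blast
qed

subsection \<open>Comparison of projections\<close>

definition proj :: "'a => bool" where "proj p \<longleftrightarrow> p : C & ~*p = p & p ** p = p"

lemma projD: "proj p ==> p : C" "proj p ==> ~*p = p" "proj p ==> p ** p = p" by (auto simp: proj_def)

lemma proj_one [simp]: "proj \<one>" by (simp add: proj_def)

lemma proj_tr: "proj p ==> tr p = of_real ((nn p)\<^sup>2)"
 using tr_nn[of p] projD[of p] by metis

lemma proj_nn: "[|proj p; y : C|] ==> (nn (p ** y))\<^sup>2 = Re (tr (~*y ** (p ** y)))"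
proof -
 assume p: "proj p" and y: "y : C"
 have "p ** (p ** y) = p ** y" using projD[OF p] y by (metis mult_assoc)
 then show ?thesis using projD[OF p] y by (simp add: nn_sq star_mult mult_assoc)
qed

lemma proj_bnd: assumes p: "proj p" shows "bnd 1 p"
proof (rule bndI)
 show "p : C" using projD[OF p] by simp
 fix y assume y: "y : C"
 have "(nn (p ** y))\<^sup>2 <= nn y * nn (p ** y)"
  unfolding proj_nn[OF p y] using cs_re[of "p ** y" y] y projD[OF p] by simp
 then have "nn (p ** y) * nn (p ** y) <= nn y * nn (p ** y)" by (simp add: power2_eq_square)
 then show "nn (p ** y) <= 1 * nn y"
  by (metis mult_1 mult_c mult_le_cancel_right_pos nn_ge0 order_le_less p projD(1) y)
qed simp

lemma proj_compl: "[|proj p; proj q; q ** p = p|] ==> proj (q -- p)"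
proof -
 assume p: "proj p" and q: "proj q" and e: "q ** p = p"
 note c = projD[OF p] projD[OF q]
 have "~*(q ** p) = ~*p" using e by simp
 then have e': "p ** q = p" using c by (simp add: star_mult)
 have "(q -- p) ** (q -- p) = q -- p" using c(1,4)
  by (intro tau_ext) (simp_all add: vsub_def distrib_l distrib_r mult_smult smult_mult smult_smult tr_add tr_smult c e e' smult_add)
 then show ?thesis using c by (simp add: proj_def star_sub)
qed

lemma proj_zero_if_tr: "[|proj p; tr p = 0|] ==> p = \<zero>"
 using proj_tr[of p] nn_zero_iff[of p] projD[of p] by simp

lemma proj_if_star_mult: assumes w: "w : C" and p: "proj p" and e: "~*w ** w = p" "w ** p = w" shows "proj (w ** ~*w)"
proof -
 have "w ** ~*w ** (w ** ~*w) = w ** (~*w ** w) ** ~*w" using w by (simp add: mult_assoc)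
 then have "w ** ~*w ** (w ** ~*w) = w ** ~*w" unfolding e .
 then show ?thesis using w by (simp add: proj_def star_mult)
qed

text \<open>The second-order perturbation of a contraction \<open>w\<close> by \<open>(q - w w*) y (p - w* w)\<close> stays
  in the unit ball; hence this defect vanishes at extreme points.\<close>

lemma perturb:
 assumes p: "proj p" and q: "proj q" and w: "bnd 1 w" "w ** p = w" "q ** w = w" and y: "bnd L y"
  and s: "2 * \<bar>s\<bar> * L + s\<^sup>2 * L\<^sup>2 <= 1"
 defines "D \<equiv> of_real s .* ((q -- w ** ~*w) ** (y ** (p -- ~*w ** w)))"
 shows "bnd 1 (w ++ D)"
proof (rule bndI)
 have wc: "w : C" and yc: "y : C" using w y bnd_c by auto
 note pc = projD[OF p] and qc = projD[OF q]
 define a where "a = q -- w ** ~*w"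
 define b where "b = p -- ~*w ** w"
 have c: "a : C" "b : C" "D : C" using wc yc pc qc by (auto simp: a_def b_def D_def)
 have wq: "~*w ** q = ~*w" using arg_cong[OF w(3), of "vstar M"] wc qc by (simp add: star_mult)
 have pw: "p ** ~*w = ~*w" using arg_cong[OF w(2), of "vstar M"] wc pc by (simp add: star_mult)
 \<comment> \<open>This relation turns the term of first order in s into one that is quadratic in h
   = b ** x.\<close>
 have aw: "~*a ** w = w ** b" unfolding a_def b_def using wc pc qc
  by (simp add: star_sub star_mult) (simp add: vsub_def distrib_l distrib_r mult_smult smult_mult mult_assoc w)
 show "w ++ D : C" using wc c by simp
 show "0 <= (1::real)" by simp
 have abnd: "nn (a ** x) <= nn x" if x: "x : C" for x
 proof -
  have qx: "q ** x : C" "~*w ** x : C" using qc x wc by auto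
  have 1: "a ** x = q ** x -- w ** (~*w ** x)" using qc x wc by (simp add: a_def vsub_def distrib_r smult_mult mult_assoc)
  have "Re (tr (~*(w ** (~*w ** x)) ** (q ** x))) = (nn (~*w ** x))\<^sup>2"
  proof -
   have "~*(w ** (~*w ** x)) ** (q ** x) = ~*(~*w ** x) ** (~*w ** q ** x)" using qc(1) x wc by (simp add: star_mult mult_assoc)
   then show ?thesis using wq qx by (simp add: nn_sq)
  qed
  then have 2: "(nn (a ** x))\<^sup>2 = (nn (q ** x))\<^sup>2 - 2 * (nn (~*w ** x))\<^sup>2 + (nn (w ** (~*w ** x)))\<^sup>2"
   unfolding 1 using nn_sub_sq[of "q ** x" "w ** (~*w ** x)"] qx wc by simp
  have "nn (w ** (~*w ** x)) <= nn (~*w ** x)" using bndD[OF w(1) qx(2)] by simp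
  then have 3: "(nn (w ** (~*w ** x)))\<^sup>2 <= (nn (~*w ** x))\<^sup>2" using qx wc by (intro power_mono) auto
  have "nn (q ** x) <= nn x" using bndD[OF proj_bnd[OF q] x] by simp
  then have "(nn (q ** x))\<^sup>2 <= (nn x)\<^sup>2" using qx by (intro power_mono) auto
  then have "(nn (a ** x))\<^sup>2 <= (nn x)\<^sup>2" using 2 3 zero_le_power2[of "nn (~*w ** x)"] by linarith
  then show ?thesis by (rule power2_le_imp_le) (use x in simp)
 qed
 fix x assume x: "x : C"
 define h where "h = b ** x"
 have hc: "h : C" using c x by (simp add: h_def)
 have cD: "D ** x = of_real s .* (a ** (y ** h))"
  unfolding D_def a_def[symmetric] b_def[symmetric] h_def using c yc x by (simp add: smult_mult mult_assoc)
 have nD: "nn (D ** x) <= \<bar>s\<bar> * L * nn h"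
 proof -
  have "nn (a ** (y ** h)) <= nn (y ** h)" using abnd yc hc by simp
  also have "... <= L * nn h" by (rule bndD[OF y hc])
  finally have "\<bar>s\<bar> * nn (a ** (y ** h)) <= \<bar>s\<bar> * (L * nn h)" by (intro mult_left_mono) auto
  then show ?thesis unfolding cD using c yc hc by (simp add: nn_smult mult.assoc)
 qed
 have L0: "0 <= L" using bnd_ge0[OF y] .
 have nD2: "(nn (D ** x))\<^sup>2 <= s\<^sup>2 * L\<^sup>2 * (nn h)\<^sup>2"
 proof -
  have "(nn (D ** x))\<^sup>2 <= (\<bar>s\<bar> * L * nn h)\<^sup>2" using nD c x by (intro power_mono) auto
  then show ?thesis by (simp add: power_mult_distrib)
 qed
 have cross: "Re (tr (~*(D ** x) ** (w ** x))) <= \<bar>s\<bar> * L * (nn h)\<^sup>2"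
 proof -
  have "~*(a ** (y ** h)) ** (w ** x) = ~*(y ** h) ** (~*a ** w ** x)" using c yc hc wc x by (simp add: star_mult mult_assoc)
  also have "~*a ** w ** x = w ** h" unfolding aw h_def using wc c x by (simp add: mult_assoc)
  finally have "Re (tr (~*(D ** x) ** (w ** x))) = s * Re (tr (~*(y ** h) ** (w ** h)))"
   unfolding cD using c yc hc wc x by (simp add: star_smult smult_mult tr_smult)
  also have "... <= \<bar>s\<bar> * \<bar>Re (tr (~*(y ** h) ** (w ** h)))\<bar>" by (simp add: abs_mult[symmetric])
  also have "... <= \<bar>s\<bar> * (nn (y ** h) * nn (w ** h))"
   using cs_re[of "w ** h" "y ** h"] yc wc hc by (intro mult_left_mono) auto
  also have "... <= \<bar>s\<bar> * ((L * nn h) * (1 * nn h))"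
   using L0 yc wc hc by (intro mult_left_mono mult_mono bndD[OF y hc] bndD[OF w(1) hc]) auto
  finally show ?thesis by (simp add: power2_eq_square mult_ac)
 qed
 \<comment> \<open>The room that w leaves below p, measured by the same h; it pays for the terms of
   both orders.\<close>
 have gap: "(nn h)\<^sup>2 <= (nn (p ** x))\<^sup>2 - (nn (w ** x))\<^sup>2"
 proof -
  let ?k = "~*w ** (w ** x)"
  have e: "h = p ** x -- ?k" unfolding h_def b_def using wc pc x by (simp add: vsub_def distrib_r smult_mult mult_assoc)
  have "~*?k ** (p ** x) = ~*(w ** x) ** (w ** p ** x)" using wc pc(1) x by (simp add: star_mult mult_assoc)
  then have "Re (tr (~*?k ** (p ** x))) = (nn (w ** x))\<^sup>2" using w wc x by (simp add: nn_sq)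
  then have "(nn h)\<^sup>2 = (nn (p ** x))\<^sup>2 - 2 * (nn (w ** x))\<^sup>2 + (nn ?k)\<^sup>2"
   unfolding e using nn_sub_sq[of "p ** x" ?k] wc pc x by simp
  moreover have "(nn ?k)\<^sup>2 <= (nn (w ** x))\<^sup>2"
   using bndD[OF bnd_star[OF w(1)], of "w ** x"] wc x by (intro power_mono) auto
  ultimately show ?thesis by simp
 qed
 have "(nn ((w ++ D) ** x))\<^sup>2 = (nn (w ** x))\<^sup>2 + 2 * Re (tr (~*(D ** x) ** (w ** x))) + (nn (D ** x))\<^sup>2"
  using nn_add_sq[of "w ** x" "D ** x"] wc c x by (simp add: distrib_r)
 also have "... <= (nn (w ** x))\<^sup>2 + (2 * \<bar>s\<bar> * L + s\<^sup>2 * L\<^sup>2) * (nn h)\<^sup>2"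
  using cross nD2 by (simp add: algebra_simps)
 also have "... <= (nn (w ** x))\<^sup>2 + 1 * (nn h)\<^sup>2" using s by (intro add_left_mono mult_right_mono) auto
 also have "... <= (nn (p ** x))\<^sup>2" using gap by simp
 also have "... <= (nn x)\<^sup>2" using bndD[OF proj_bnd[OF p] x] pc x by (intro power_mono) auto
 finally have "nn ((w ++ D) ** x) <= nn x" by (rule power2_le_imp_le) (use x in simp)
 then show "nn ((w ++ D) ** x) <= 1 * nn x" by simp
qed

text \<open>With s L <= 1/3 the left side is at most 2/3 + 1/9.\<close>

lemma small_pert: "0 <= L ==> EX s>0. 2 * \<bar>s\<bar> * L + s\<^sup>2 * L\<^sup>2 <= (1::real)"
proof (rule exI[of _ "1 / (3 * (L + 1))"], intro conjI)
 assume L: "0 <= L"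
 let ?s = "1 / (3 * (L + 1))"
 show "?s > 0" using L by simp
 have "?s * L <= 1/3" using L by (simp add: field_simps)
 moreover have "0 <= ?s * L" using L by simp
 ultimately have "(?s * L)\<^sup>2 <= (1/3)\<^sup>2" by (intro power_mono)
 then have "?s\<^sup>2 * L\<^sup>2 <= 1/9" by (simp add: power_mult_distrib power_divide)
 moreover have "\<bar>?s\<bar> = ?s" using L by simp
 ultimately show "2 * \<bar>?s\<bar> * L + ?s\<^sup>2 * L\<^sup>2 <= 1" using \<open>?s * L <= 1/3\<close> by simp
qed

lemma mid_pert: "[|w : C; D : C|] ==> mid (w ++ of_real s .* D) (w ++ of_real (-s) .* D) = w"
 by (intro tau_ext) (simp_all add: mid_def alg algebra_simps)

text \<open>w is the midpoint of its perturbations by s D and -s D, both in A for small s, so an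
  extreme w forces D = 0.\<close>

lemma extr_defect_zero:
 assumes p: "proj p" and q: "proj q" and e: "extr A w" and w: "bnd 1 w" "w ** p = w" "q ** w = w"
  and y: "y : C"
  and D: "!!s. bnd 1 (w ++ of_real s .* ((q -- w ** ~*w) ** (y ** (p -- ~*w ** w))))
    ==> w ++ of_real s .* ((q -- w ** ~*w) ** (y ** (p -- ~*w ** w))) : A"
 shows "(q -- w ** ~*w) ** (y ** (p -- ~*w ** w)) = \<zero>" (is "?D = \<zero>")
proof -
 obtain L where L: "bnd L y" using ex_bnd[OF y] by blast
 obtain s where s: "s > 0" "2 * \<bar>s\<bar> * L + s\<^sup>2 * L\<^sup>2 <= 1" using small_pert[OF bnd_ge0[OF L]] by blast
 have wc: "w : C" using w bnd_c by blast
 have c: "?D : C" using wc y projD[OF p] projD[OF q] by simp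
 have "w ++ of_real s .* ?D : A" "w ++ of_real (-s) .* ?D : A"
  by (rule D, rule perturb[OF p q w L], use s in simp)+
 then have i: "w ++ of_real s .* ?D = w" using e mid_pert[OF wc c, of s] unfolding extr_def by blast
 have "x = (w ++ x) -- w" if "x : C" for x using wc that by (intro tau_ext) (simp_all add: alg)
 from this[of "of_real s .* ?D"] have "of_real s .* ?D = \<zero>" unfolding i using c wc by simp
 then have "cmod (of_real s) * nn ?D = 0" using nn_smult[OF c, of "of_real s"] by simp
 then show ?thesis using s nn_zero_iff[OF c] by simp
qed

text \<open>An extreme point w of the contractions in S from p to q has (q - w ** ~*w) S (p - ~*w **
  w) = 0. By primeness one of the two defects vanishes, and the equality of traces makes the other
  vanish as well.\<close>

theorem comparison:
 assumes S: "vnsub S" and tc: "tcen S" and p: "proj p" "p : S" and q: "proj q" "q : S" and t: "tr p = tr q"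
 shows "EX w:S. ~*w ** w = p & w ** ~*w = q & w ** p = w & q ** w = w"
proof -
 define P where "P x \<longleftrightarrow> x ** p = x & q ** x = x" for x
 note pc = projD[OF p(1)] and qc = projD[OF q(1)]
 have A: "ccb {x : S. bnd 1 x & P x}" (is "ccb ?A")
 proof (rule ccb_ballI[OF S])
  show "\<zero> : S" "bnd 1 \<zero>" "P \<zero>" using vnsubD(8)[OF S] pc qc by (auto simp: P_def)
  show "P (mid x y)" if "x : S" "y : S" "P x" "P y" for x y
  proof -
   have "x : C" "y : C" using that S vnsubD by blast+
   then show ?thesis using that pc qc by (simp add: P_def mid_def distrib_l distrib_r mult_smult smult_mult)
  qed
  show "P x" if s: "!!n::nat. s n : S" "!!n. P (s n)" "cv sequentially s x" for s x
  proof -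
   have "cv sequentially s (x ** p)" using cv_multc[OF pc(1) s(3)] s(2) by (simp add: P_def)
   then have 1: "x ** p = x" by (rule cv_unique[OF _ s(3)]) simp
   have "cv sequentially s (q ** x)" using cv_cmult[OF qc(1) s(3)] s(2) by (simp add: P_def)
   then have 2: "q ** x = x" by (rule cv_unique[OF _ s(3)]) simp
   show ?thesis unfolding P_def using 1 2 by blast
  qed
 qed
 obtain w where w: "extr ?A w" using krein_milman[OF A one_c] by blast
 have wA: "w : S" "bnd 1 w" "w ** p = w" "q ** w = w" using w by (auto simp: extr_def P_def)
 have wc: "w : C" using wA bnd_c by blast
 define a where "a = q -- w ** ~*w"
 define b where "b = p -- ~*w ** w"
 have aS: "a : S" "b : S" unfolding a_def b_def using wA p q by (auto intro!: vnsubD[OF S])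
 have ac: "a : C" "b : C" using aS S vnsubD by blast+
 have "p ** ~*w = ~*w" using arg_cong[OF wA(3), of "vstar M"] wc pc by (simp add: star_mult)
 then have pw: "p ** (~*w ** w) = ~*w ** w" "~*w ** w ** p = ~*w ** w"
  using mult_assoc[of p "~*w" w] mult_assoc[of "~*w" w p] wc pc(1) wA(3) by simp_all
 have qw: "q ** (w ** ~*w) = w ** ~*w" using wA(4) wc qc mult_assoc[of q w "~*w"] by simp
 have z: "a ** (y ** b) = \<zero>" if y: "y : S" for y
  unfolding a_def b_def
 proof (rule extr_defect_zero[OF p(1) q(1) w wA(2-4)])
  show yc: "y : C" using y S vnsubD by blast
  fix s
  let ?D = "of_real s .* ((q -- w ** ~*w) ** (y ** (p -- ~*w ** w)))"
  assume b1: "bnd 1 (w ++ ?D)"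
  have "w ++ ?D : S" using wA y p q by (auto intro!: vnsubD[OF S])
  moreover have "(p -- ~*w ** w) ** p = p -- ~*w ** w"
   using pc wc pw by (simp add: vsub_def distrib_r smult_mult)
  then have "?D ** p = ?D" using pc(1) qc(1) wc yc by (simp add: smult_mult mult_assoc)
  then have "(w ++ ?D) ** p = w ++ ?D" using pc(1) qc(1) wc yc wA by (simp add: distrib_r)
  moreover have "q ** (q -- w ** ~*w) = q -- w ** ~*w"
   using qc wc qw by (simp add: vsub_def distrib_l mult_smult)
  then have "q ** ?D = ?D" using pc(1) qc(1) wc yc by (simp add: mult_smult flip: mult_assoc)
  then have "q ** (w ++ ?D) = w ++ ?D" using pc(1) qc(1) wc yc wA by (simp add: distrib_l)
  ultimately show "w ++ ?D : ?A" using b1 by (simp add: P_def)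
 qed
 from prime_subfactor[OF S tc ac(1) aS(2) z] have ab: "a = \<zero> | b = \<zero>" .
 have trs: "tr a = tr b" unfolding a_def b_def using t tr_comm[OF wc star_c[OF wc]] pc qc wc by (simp add: tr_sub)
 \<comment> \<open>If b = 0, then w is a partial isometry, so that a is a projection; its trace is
   that of b, namely 0. The other case is symmetric.\<close>
 have "a = \<zero> & b = \<zero>"
 proof (cases "b = \<zero>")
  case True
  then have e: "~*w ** w = p" using sub_eq_zero pc wc unfolding b_def by (metis mult_c star_c)
  have "proj (w ** ~*w)" by (rule proj_if_star_mult[OF wc p(1) e wA(3)])
  then have "proj a" unfolding a_def using q(1) qw by (rule proj_compl)
  then show ?thesis using True trs proj_zero_if_tr by simp
 next
  case False
  then have a0: "a = \<zero>" using ab by simp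
  then have e: "w ** ~*w = q" using sub_eq_zero qc wc unfolding a_def by (metis mult_c star_c)
  have "~*w ** q = ~*w" using arg_cong[OF wA(4), of "vstar M"] wc qc by (simp add: star_mult)
  then have "proj (~*w ** ~*~*w)" by (intro proj_if_star_mult[OF _ q(1)]) (use e wc in simp_all)
  then have "proj b" unfolding b_def using p(1) pw(1) wc proj_compl by simp
  then show ?thesis using a0 trs proj_zero_if_tr by simp
 qed
 then have "~*w ** w = p" "w ** ~*w = q" using sub_eq_zero pc qc wc unfolding a_def b_def by (metis mult_c star_c)+
 then show ?thesis using wA by blast
qed

text \<open>An extreme contraction maximizing the real inner product with v is unitary, by the
  argument of \<open>comparison\<close> with p = q = 1. Since v itself competes, this inner product
  is at least the square of nn v. The unitary plays the role of the polar part of v.\<close>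

lemma near_unit:
 assumes f: "tcen C" and v: "bnd 1 v"
 shows "EX u. unit u & (nn (u -- v))\<^sup>2 <= 1 - (nn v)\<^sup>2"
proof -
 have vc: "v : C" using v bnd_c by blast
 have A: "ccb {x : C. bnd 1 x & True}" (is "ccb ?A") by (rule ccb_ballI[OF vnsub_C, of \<one>]) auto
 obtain w where w: "extr ?A w" "!!y. y : ?A ==> fl v y <= fl v w" using krein_milman[OF A vc] by blast
 have wA: "w : C" "bnd 1 w" using w by (auto simp: extr_def)
 define a where "a = \<one> -- w ** ~*w"
 define b where "b = \<one> -- ~*w ** w"
 have ac: "a : C" "b : C" using wA by (auto simp: a_def b_def)
 have z: "a ** (y ** b) = \<zero>" if y: "y : C" for y
  unfolding a_def b_def by (rule extr_defect_zero[OF proj_one proj_one w(1)]) (use wA y bnd_c in auto)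
 from prime_subfactor[OF vnsub_C f ac z] have ab: "a = \<zero> | b = \<zero>" .
 have trs: "tr a = tr b" unfolding a_def b_def using tr_comm[of w "~*w"] wA by (simp add: tr_sub)
 have "a = \<zero> & b = \<zero>"
 proof (cases "b = \<zero>")
  case True
  then have e: "~*w ** w = \<one>" using sub_eq_zero wA unfolding b_def by (metis mult_c star_c one_c)
  have "proj (w ** ~*w)" by (rule proj_if_star_mult[OF wA(1) proj_one e]) (use wA in simp)
  then have "proj a" unfolding a_def using wA by (intro proj_compl) auto
  then show ?thesis using True trs proj_zero_if_tr by simp
 next
  case False
  then have a0: "a = \<zero>" using ab by simp
  then have e: "w ** ~*w = \<one>" using sub_eq_zero wA unfolding a_def by (metis mult_c star_c one_c)
  have "proj (~*w ** ~*~*w)" by (rule proj_if_star_mult[OF _ proj_one]) (use e wA in simp_all)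
  then have "proj b" unfolding b_def using wA by (intro proj_compl) auto
  then show ?thesis using a0 trs proj_zero_if_tr by simp
 qed
 then have u: "unit w" unfolding unit_def using sub_eq_zero wA unfolding a_def b_def by (metis mult_c star_c one_c)
 have "fl v v <= fl v w" using w(2) v vc by simp
 then have m: "(nn v)\<^sup>2 <= Re (tr (~*v ** w))" by (simp add: fl_def nn_sq vc)
 have "nn w = 1" using unit_nn(1)[OF u one_c] wA by simp
 then have "(nn (w -- v))\<^sup>2 <= 1 - (nn v)\<^sup>2" using nn_sub_sq[OF wA(1) vc] m by simp
 then show ?thesis using u by blast
qed

text \<open>Extreme points of \<open>{g = g* : -p \<le> g \<le> p, \<tau>(g) = s}\<close> are symmetries, unless
  the algebra has a minimal projection below \<open>p\<close>.\<close>

definition minproj :: "'a set => 'a => bool" where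
 "minproj S e \<longleftrightarrow> proj e & e : S & e ~= \<zero> & (ALL y:S. EX c. e ** y ** e = c .* e)"

theorem projection_of_trace:
 assumes S: "vnsub S" and p: "proj p" "p : S" and t: "0 <= t" "of_real t = c * tr p" "c = of_real c'" "c' <= 1" "0 <= c'"
 shows "(EX h:S. proj h & p ** h = h & tr h = of_real t) | (EX e. minproj S e & p ** e = e)"
proof (cases "EX e. minproj S e & p ** e = e")
 case False
 note pc = projD[OF p(1)]
 \<comment> \<open>g will be the symmetry 2 h - p attached to the projection h that is sought; this
   is its trace.\<close>
 define s where "s = 2 * of_real t - tr p"
 define P where "P x \<longleftrightarrow> ~*x = x & p ** x = x & tr x = s" for x
 have A: "ccb {x : S. bnd 1 x & P x}" (is "ccb ?A")
 proof (rule ccb_ballI[OF S])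
  let ?x = "of_real (2 * c' - 1) .* p"
  show "?x : S" using p by (intro vnsubD[OF S])
  show "bnd 1 ?x" by (rule bnd_mono[OF bnd_smult[OF proj_bnd[OF p(1)]]]) (unfold norm_of_real, use t in auto)
  show "P ?x" unfolding P_def s_def using pc t by (simp add: star_smult mult_smult tr_smult algebra_simps)
  show "P (mid x y)" if "x : S" "y : S" "P x" "P y" for x y
  proof -
   have "x : C" "y : C" using that S vnsubD by blast+
   then show ?thesis using that pc by (simp add: P_def mid_def distrib_l mult_smult star_smult star_add tr_add tr_smult)
  qed
  show "P x" if r: "!!n::nat. r n : S" "!!n. P (r n)" "cv sequentially r x" for r x
  proof -
   have "cv sequentially r (~*x)" using cv_star[OF r(3)] r(2) by (simp add: P_def)
   then have 1: "~*x = x" by (rule cv_unique[OF _ r(3)]) simp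
   have "cv sequentially r (p ** x)" using cv_cmult[OF pc(1) r(3)] r(2) by (simp add: P_def)
   then have 2: "p ** x = x" by (rule cv_unique[OF _ r(3)]) simp
   have "tr x = s" using cv_tr[OF r(3)] r(2) by (simp add: P_def LIMSEQ_const_iff)
   then show ?thesis unfolding P_def using 1 2 by blast
  qed
 qed
 obtain g where g: "extr ?A g" using krein_milman[OF A one_c] by blast
 have gA: "g : S" "bnd 1 g" "~*g = g" "p ** g = g" "tr g = s" using g by (auto simp: extr_def P_def)
 have gc: "g : C" using gA bnd_c by blast
 have gp: "g ** p = g" using arg_cong[OF gA(4), of "vstar M"] gc pc gA(3) by (simp add: star_mult)
 \<comment> \<open>Perturbing g by multiples of k ** y ** k respects every constraint if y is
   self-adjoint and the trace of k ** y ** k is 0, so such products vanish. If k is not 0, the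
   compression of S by k is thus spanned by k ** k, and a minimal projection appears.\<close>
 define k where "k = p -- g ** g"
 have kS: "k : S" unfolding k_def using gA p by (auto intro!: vnsubD[OF S])
 have kc: "k : C" using kS S vnsubD by blast
 have ks: "~*k = k" unfolding k_def using pc gc gA(3) by (simp add: star_sub star_mult)
 have pk: "p ** k = k" unfolding k_def using pc gc gA(4) by (simp add: vsub_def distrib_l mult_smult flip: mult_assoc)
 have kp: "k ** p = k" using arg_cong[OF pk, of "vstar M"] kc pc ks by (simp add: star_mult)
 have z: "k ** (y ** k) = \<zero>" if y: "y : S" "~*y = y" "tr (k ** (y ** k)) = 0" for y
 proof -
  have yc: "y : C" using y S vnsubD by blast
  have kk: "k = p -- g ** ~*g" "k = p -- ~*g ** g" by (simp_all add: gA(3) k_def)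
  have "(p -- g ** ~*g) ** (y ** (p -- ~*g ** g)) = \<zero>"
  proof (rule extr_defect_zero[OF p(1) p(1) g gA(2) gp gA(4) yc])
   fix r assume b: "bnd 1 (g ++ of_real r .* ((p -- g ** ~*g) ** (y ** (p -- ~*g ** g))))"
   let ?D = "of_real r .* (k ** (y ** k))"
   have Dc: "?D : C" using kc yc by simp
   have "g ++ ?D : S" using kS gA y by (auto intro!: vnsubD[OF S])
   moreover have "~*(g ++ ?D) = g ++ ?D" using gc gA(3) kc ks yc y by (simp add: star_add star_smult star_mult mult_assoc)
   moreover have "p ** ?D = ?D" using pk kc yc pc(1) by (simp add: mult_smult flip: mult_assoc)
   then have "p ** (g ++ ?D) = g ++ ?D" using gA(4) gc Dc pc by (simp add: distrib_l)
   moreover have "tr (g ++ ?D) = s" using gc kc yc y gA(5) by (simp add: tr_add tr_smult)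
   ultimately show "g ++ of_real r .* ((p -- g ** ~*g) ** (y ** (p -- ~*g ** g))) : ?A"
    using b unfolding kk[symmetric] by (simp add: P_def)
  qed
  then show ?thesis unfolding kk[symmetric] .
 qed
 have k0: "k = \<zero>"
 proof (rule ccontr)
  assume kn: "k ~= \<zero>"
  define n where "n = (nn k)\<^sup>2"
  have n: "n > 0" using kn nn_zero_iff[OF kc] by (simp add: n_def)
  have trkk: "tr (k ** k) = of_real n" using tr_nn[OF kc] ks by (simp add: n_def)
  have sa: "EX c. k ** (y ** k) = c .* (k ** k)" if y: "y : S" "~*y = y" for y
  proof -
   have yc: "y : C" using y S vnsubD by blast
   \<comment> \<open>Subtracting this scalar from y makes the trace of the compression by k equal to
     0.\<close>
   define c where "c = tr (k ** (y ** k)) / of_real n"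
   have "cnj (tr (k ** (y ** k))) = tr (k ** (y ** k))"
    using tr_star[of "k ** (y ** k)"] kc yc ks y by (simp add: star_mult mult_assoc)
   then have cr: "cnj c = c" by (simp add: c_def)
   define y' where "y' = y -- c .* \<one>"
   have y'c: "y' : C" using yc by (simp add: y'_def)
   have e: "k ** (y' ** k) = k ** (y ** k) -- c .* (k ** k)"
    unfolding y'_def using kc yc by (simp add: vsub_def distrib_l distrib_r mult_smult smult_mult smult_smult)
   have "k ** (y' ** k) = \<zero>"
   proof (rule z)
    show "y' : S" unfolding y'_def using y by (intro vnsubD[OF S])
    show "~*y' = y'" unfolding y'_def using yc y cr by (simp add: star_sub star_smult)
    show "tr (k ** (y' ** k)) = 0" unfolding e using kc yc trkk n by (simp add: tr_sub tr_smult c_def)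
   qed
   then have "k ** (y ** k) = c .* (k ** k)" unfolding e by (rule sub_eq_zero[rotated 2]) (use kc yc in auto)
   then show ?thesis by blast
  qed
  have all: "EX c. k ** (y ** k) = c .* (k ** k)" if y: "y : S" for y
  proof -
   have yc: "y : C" using y S vnsubD by blast
   define h1 where "h1 = (1/2) .* (y ++ ~*y)"
   define h2 where "h2 = (-\<i>/2) .* (y -- ~*y)"
   have S': "h1 : S" "h2 : S" unfolding h1_def h2_def using y by (auto intro!: vnsubD[OF S])
   have sh: "~*h1 = h1" "~*h2 = h2" unfolding h1_def h2_def using yc by (intro tau_ext; simp add: alg algebra_simps)+
   have e: "y = h1 ++ \<i> .* h2" unfolding h1_def h2_def using yc by (intro tau_ext) (simp_all add: alg algebra_simps)
   have hk: "h1 : C" "h2 : C" using S' S vnsubD by blast+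
   obtain c1 c2 where "k ** (h1 ** k) = c1 .* (k ** k)" "k ** (h2 ** k) = c2 .* (k ** k)" using sa S' sh by blast
   then have "k ** (y ** k) = (c1 + \<i> * c2) .* (k ** k)" unfolding e using hk kc
    by (simp add: distrib_l distrib_r mult_smult smult_mult add_smult smult_smult)
   then show ?thesis by blast
  qed
  have kkS: "k ** k : S" using kS by (intro vnsubD[OF S])
  obtain c where c: "k ** ((k ** k) ** k) = c .* (k ** k)" using all[OF kkS] by blast
  have c0: "c ~= 0"
  proof
   assume "c = 0"
   then have "tr (~*(k ** k) ** (k ** k)) = 0" using c kc ks by (simp add: star_mult mult_assoc)
   then have "k ** k = \<zero>" using tr_faithful kc by simp
   then show False using trkk n by simp
  qed
  have cr: "cnj c = c"
  proof -
   have "(cnj c) .* (k ** k) = c .* (k ** k)" using arg_cong[OF c, of "vstar M"] c kc ks by (simp add: star_mult star_smult mult_assoc)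
   then have "cnj c * tr (k ** k) = c * tr (k ** k)" using arg_cong[of _ _ tr] kc by (metis mult_c tr_smult)
   then show ?thesis using trkk n by simp
  qed
  \<comment> \<open>From k^4 = c k^2 this is a projection, and its corner in S is
    one-dimensional.\<close>
  define e where "e = (1 / c) .* (k ** k)"
  have ec: "e : C" using kc by (simp add: e_def)
  have eS: "e : S" unfolding e_def by (rule vnsubD(5)[OF S kkS])
  have ee: "e ** e = e" unfolding e_def using kc c c0 by (simp add: mult_smult smult_mult smult_smult mult_assoc)
  have es: "~*e = e" unfolding e_def using kc ks cr by (simp add: star_smult star_mult)
  have en: "e ~= \<zero>"
  proof
   assume "e = \<zero>"
   moreover have "tr e = (1 / c) * of_real n" unfolding e_def using kc trkk by (simp only: tr_smult mult_c)
   ultimately show False using c0 n by simp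
  qed
  have emin: "EX d. e ** y ** e = d .* e" if y: "y : S" for y
  proof -
   have yc: "y : C" using y S vnsubD by blast
   obtain d where d: "k ** (y ** k) = d .* (k ** k)" using all[OF y] by blast
   have "e ** y ** e = (1 / c\<^sup>2) .* (k ** ((k ** (y ** k)) ** k))"
    unfolding e_def using kc yc by (simp add: mult_smult smult_mult smult_smult mult_assoc power2_eq_square)
   also have "... = (d / c\<^sup>2) .* (k ** ((k ** k) ** k))" unfolding d using kc by (simp add: mult_smult smult_mult smult_smult)
   also have "... = d .* e" unfolding c e_def using kc c0 by (simp add: smult_smult power2_eq_square)
   finally show ?thesis by blast
  qed
  have "p ** e = e" unfolding e_def using pk kc pc by (simp add: mult_smult flip: mult_assoc)
  moreover have "minproj S e" unfolding minproj_def proj_def using ec es ee eS en emin by blast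
  ultimately show False using False by blast
 qed
 have gg: "g ** g = p" using k0 sub_eq_zero[of p "g ** g"] pc gc by (simp add: k_def)
 define h where "h = mid p g"
 have hS: "h : S" unfolding h_def mid_def using gA p by (intro vnsubD[OF S])
 have hc: "h : C" using hS S vnsubD by blast
 have hs: "~*h = h" unfolding h_def mid_def using gc pc gA by (simp add: star_smult star_add)
 have "h ** h = (1/4) .* ((p ++ g) ++ (p ++ g))" unfolding h_def mid_def using gc pc gA gp gg add_comm[OF gc pc(1)] add_comm[of "(1/4) .* g" "(1/4) .* p"]
  by (simp add: distrib_l distrib_r mult_smult smult_mult smult_smult smult_add)
 also have "... = h" unfolding h_def mid_def using gc pc(1) by (intro tau_ext) (simp_all add: alg algebra_simps)
 finally have hh: "h ** h = h" .
 have ph: "p ** h = h" unfolding h_def mid_def using gc pc gA by (simp add: mult_smult distrib_l)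
 have "tr h = of_real t" unfolding h_def mid_def using gc pc gA by (simp add: tr_smult tr_add s_def)
 then show ?thesis using hS hc hs hh ph unfolding proj_def by blast
qed blast

end

section \<open>Ultrapowers\<close>

locale utp = tvna +
 fixes U :: "nat filter"
 assumes U: "nonprincipal_ultrafilter U"
begin

lemma U_bot [simp]: "U ~= bot" using U by (simp add: nonprincipal_ultrafilter_def)

lemma ev_not: "~ eventually Q U ==> eventually (%k. ~ Q k) U"
 using U by (auto simp: nonprincipal_ultrafilter_def)

lemma ev_ge: "eventually (%k. k >= j) U"
proof -
 have "eventually (%k. k >= j) cofinite" by (simp add: cofinite_eq_sequentially eventually_ge_at_top)
 then show ?thesis using U by (auto simp: nonprincipal_ultrafilter_def le_filter_def)
qed

lemma U_seq: "(f \<longlongrightarrow> l) sequentially ==> (f \<longlongrightarrow> l) U"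
 using U by (auto simp: nonprincipal_ultrafilter_def cofinite_eq_sequentially intro: tendsto_mono)

lemma ultralimit:
 fixes f :: "nat => complex" assumes "!!k. cmod (f k) <= K" shows "EX l. (f \<longlongrightarrow> l) U"
proof -
 have "filtermap f U ~= bot" by (simp add: filtermap_bot_iff)
 moreover have "eventually (%x. x : cball 0 K) (filtermap f U)" using assms by (simp add: eventually_filtermap)
 ultimately obtain l where l: "inf (nhds l) (filtermap f U) ~= bot"
  using compact_cball[of "0::complex" K] unfolding compact_filter by blast
 have "(f \<longlongrightarrow> l) U"
 proof (rule topological_tendstoI, rule ccontr)
  fix S assume S: "open S" "l : S" "~ eventually (%x. f x : S) U"
  have "eventually (%x. x ~: S) (filtermap f U)" using ev_not[OF S(3)] by (simp add: eventually_filtermap)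
  moreover have "eventually (%x. x : S) (nhds l)" using S by (simp add: eventually_nhds_in_open)
  ultimately have "eventually (%x. False) (inf (nhds l) (filtermap f U))" unfolding eventually_inf by fastforce
  then show False using l by (simp add: eventually_False)
 qed
 then show ?thesis by blast
qed

text \<open>m k is the largest j <= k such that Q 0, ..., Q j all hold at k. The restriction j <= k
  keeps the candidates finite and is harmless because U is nonprincipal. Where there is no
  candidate, \<open>Max\<close> is arbitrary, but such k are negligible for U.\<close>

lemma diagonal:
 assumes "!!j. eventually (Q j) U"
 shows "EX m::nat => nat. (ALL j. eventually (%k. m k >= j) U) & eventually (%k. ALL i<=m k. Q i k) U"
proof -
 define A where "A k = {j. j <= k & (ALL i<=j. Q i k)}" for k
 define m where "m k = Max (A k)" for k
 have fin: "finite (A k)" for k unfolding A_def by (rule finite_subset[of _ "{..k}"]) auto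
 have ge: "m k >= j & (ALL i<=m k. Q i k)" if "j : A k" for j k
 proof -
  have "m k : A k" unfolding m_def using that fin by (intro Max_in) auto
  moreover have "j <= m k" unfolding m_def using that fin by (intro Max_ge)
  ultimately show ?thesis by (auto simp: A_def)
 qed
 have ev: "eventually (%k. j : A k) U" for j
 proof -
  have "eventually (%k. ALL i:{..j}. Q i k) U" using assms by (subst eventually_ball_finite_distrib) auto
  with ev_ge[of j] show ?thesis by eventually_elim (auto simp: A_def)
 qed
 have "eventually (%k. m k >= j) U" for j using ev[of j] by eventually_elim (use ge in blast)
 moreover have "eventually (%k. ALL i<=m k. Q i k) U" using ev[of 0] by eventually_elim (use ge in blast)
 ultimately show ?thesis by blast
qed

abbreviation "Seq \<equiv> useqs M"
abbreviation "cl \<equiv> ucls U M"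
abbreviation "P \<equiv> ultrapower U M"

lemma seqI: "(!!k. bnd K (x k)) ==> x : Seq"
 unfolding useqs_def using bnd_c bnd_ge0 opnorm_le_iff by blast

lemma seqE: assumes "x : Seq" obtains K where "!!k. bnd K (x k)"
proof -
 obtain K where K: "!!k. x k : C" "!!k. opnorm M (x k) <= K" using assms by (auto simp: useqs_def)
 then have "0 <= K" using opnorm_ge0 order_trans by blast
 then show ?thesis using that K opnorm_le_iff by blast
qed

lemma seq_c [simp]: "x : Seq ==> x k : C" by (simp add: useqs_def)

lemma seq_const [simp]: "x : C ==> (%k. x) : Seq" using ex_bnd[of x] seqI[of _ "%k. x"] by blast

lemma seq_add [simp]: assumes "x : Seq" "y : Seq" shows "(%k. x k ++ y k) : Seq"
 by (rule seqE[OF assms(1)], rule seqE[OF assms(2)], rule seqI, rule bnd_add) auto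

lemma seq_mult [simp]: assumes "x : Seq" "y : Seq" shows "(%k. x k ** y k) : Seq"
 by (rule seqE[OF assms(1)], rule seqE[OF assms(2)], rule seqI, rule bnd_mult) auto

lemma seq_star [simp]: assumes "x : Seq" shows "(%k. ~*x k) : Seq"
 by (rule seqE[OF assms(1)], rule seqI, rule bnd_star) auto

lemma seq_smult' : assumes "x : Seq" "!!k. cmod (c k) <= L" shows "(%k. c k .* x k) : Seq"
proof (rule seqE[OF assms(1)])
 fix K assume K: "!!k. bnd K (x k)"
 have "bnd (L * K) (c k .* x k)" for k
  by (rule bnd_mono[OF bnd_smult[OF K]]) (intro mult_right_mono assms(2) bnd_ge0[OF K])
 then show ?thesis by (rule seqI)
qed

lemma seq_smult [simp]: "x : Seq ==> (%k. c .* x k) : Seq" using seq_smult'[of x "%_. c"] by blast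

lemma seq_sub [simp]: "x : Seq ==> y : Seq ==> (%k. x k -- y k) : Seq" by (simp add: vsub_def)

lemma seq_unit: "(!!k. unit (u k)) ==> u : Seq" by (rule seqI) (rule unit_bnd)

lemma sub_zero [simp]: "x : C ==> x -- \<zero> = x" by (simp add: vsub_def)

lemma cl_eq_iff: assumes x: "x : Seq" and y: "y : Seq"
 shows "cl x = cl y \<longleftrightarrow> ((%k. nn (x k -- y k)) \<longlongrightarrow> 0) U"
proof
 assume "cl x = cl y"
 moreover have "y : cl y" using y by (simp add: ucls_def)
 ultimately have "y : cl x" by simp
 then show "((%k. nn (x k -- y k)) \<longlongrightarrow> 0) U" by (simp add: ucls_def)
next
 assume l: "((%k. nn (x k -- y k)) \<longlongrightarrow> 0) U"
 have tr: "((%k. nn (a k -- c k)) \<longlongrightarrow> 0) U"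
  if "((%k. nn (a k -- b k)) \<longlongrightarrow> 0) U" "((%k. nn (b k -- c k)) \<longlongrightarrow> 0) U" "a : Seq" "b : Seq" "c : Seq" for a b c
 proof (rule Lim_null_comparison)
  show "eventually (%k. norm (nn (a k -- c k)) <= nn (a k -- b k) + nn (b k -- c k)) U"
   using that by (simp add: sub_tri)
  show "((%k. nn (a k -- b k) + nn (b k -- c k)) \<longlongrightarrow> 0) U" using tendsto_add[OF that(1,2)] by simp
 qed
 have l': "((%k. nn (y k -- x k)) \<longlongrightarrow> 0) U" using l x y sub_swap by simp
 show "cl x = cl y" unfolding ucls_def using tr[OF l'] tr[OF l] x y by auto
qed

lemma carrier_P: "X : vcarrier P \<longleftrightarrow> (EX x:Seq. X = cl x)" by (auto simp: ultrapower_def)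

lemma clE: assumes "X : vcarrier P" obtains x where "x : Seq" "X = cl x" using assms carrier_P by blast

lemma cl_c [simp]: "x : Seq ==> cl x : vcarrier P" using carrier_P by blast

text \<open>The operations of the ultrapower are defined through chosen representatives; this allows
  replacing them by any other representative.\<close>

lemma rep: assumes x: "x : Seq" shows "urep (cl x) : Seq" "((%k. nn (x k -- urep (cl x) k)) \<longlongrightarrow> 0) U"
proof -
 have "x : cl x" using x by (simp add: ucls_def)
 then have "urep (cl x) : cl x" unfolding urep_def by (rule someI[of "%z. z : cl x"])
 then show "urep (cl x) : Seq" "((%k. nn (x k -- urep (cl x) k)) \<longlongrightarrow> 0) U" by (auto simp: ucls_def)
qed

lemma cl_add: assumes x: "x : Seq" and y: "y : Seq" shows "cl x ++\<^sub>P cl y = cl (%k. x k ++ y k)"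
proof -
 let ?x = "urep (cl x)" and ?y = "urep (cl y)"
 note r = rep[OF x] rep[OF y]
 have "((%k. nn ((x k ++ y k) -- (?x k ++ ?y k))) \<longlongrightarrow> 0) U"
 proof (rule Lim_null_comparison)
  have "nn ((x k ++ y k) -- (?x k ++ ?y k)) <= nn (x k -- ?x k) + nn (y k -- ?y k)" for k
  proof -
   have "(x k ++ y k) -- (?x k ++ ?y k) = (x k -- ?x k) ++ (y k -- ?y k)"
    using x y r by (intro tau_ext) (simp_all add: alg)
   then show ?thesis using x y r triangle[of "x k -- ?x k" "y k -- ?y k"] by simp
  qed
  then show "eventually (%k. norm (nn ((x k ++ y k) -- (?x k ++ ?y k))) <= nn (x k -- ?x k) + nn (y k -- ?y k)) U"
   using x y r by simp
  show "((%k. nn (x k -- ?x k) + nn (y k -- ?y k)) \<longlongrightarrow> 0) U" using tendsto_add[OF r(2) r(4)] by simp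
 qed
 then have "cl (%k. x k ++ y k) = cl (%k. ?x k ++ ?y k)" using x y r by (subst cl_eq_iff) auto
 then show ?thesis by (simp add: ultrapower_def)
qed

lemma cl_mult: assumes x: "x : Seq" and y: "y : Seq" shows "cl x **\<^sub>P cl y = cl (%k. x k ** y k)"
proof -
 let ?x = "urep (cl x)" and ?y = "urep (cl y)"
 note r = rep[OF x] rep[OF y]
 obtain K where K: "!!k. bnd K (x k)" using seqE[OF x] by blast
 obtain L where L: "!!k. bnd L (?y k)" using seqE[OF r(3)] by blast
 have "((%k. nn ((x k ** y k) -- (?x k ** ?y k))) \<longlongrightarrow> 0) U"
 proof (rule Lim_null_comparison)
  show "eventually (%k. norm (nn ((x k ** y k) -- (?x k ** ?y k))) <= K * nn (y k -- ?y k) + L * nn (x k -- ?x k)) U"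
   using x y r mult_diff_le[OF K L] by simp
  show "((%k. K * nn (y k -- ?y k) + L * nn (x k -- ?x k)) \<longlongrightarrow> 0) U"
   using tendsto_add[OF tendsto_mult_left[OF r(4), of K] tendsto_mult_left[OF r(2), of L]] by simp
 qed
 then have "cl (%k. x k ** y k) = cl (%k. ?x k ** ?y k)" using x y r by (subst cl_eq_iff) auto
 then show ?thesis by (simp add: ultrapower_def)
qed

lemma cl_smult: assumes x: "x : Seq" shows "c .*\<^sub>P cl x = cl (%k. c .* x k)"
proof -
 let ?x = "urep (cl x)"
 note r = rep[OF x]
 have "nn (c .* x k -- c .* ?x k) = cmod c * nn (x k -- ?x k)" for k
  using x r by (subst nn_smult[symmetric]) (simp_all add: vsub_def smult_add smult_smult mult.commute)
 then have "((%k. nn (c .* x k -- c .* ?x k)) \<longlongrightarrow> 0) U" using tendsto_mult_left[OF r(2), of "cmod c"] by simp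
 then have "cl (%k. c .* x k) = cl (%k. c .* ?x k)" using x r by (subst cl_eq_iff) auto
 then show ?thesis by (simp add: ultrapower_def)
qed

lemma cl_star: assumes x: "x : Seq" shows "~*\<^sub>P cl x = cl (%k. ~*x k)"
proof -
 let ?x = "urep (cl x)"
 note r = rep[OF x]
 have "nn (~*x k -- ~*?x k) = nn (x k -- ?x k)" for k using x r by (simp flip: star_sub)
 then have "cl (%k. ~*x k) = cl (%k. ~*?x k)" using x r by (subst cl_eq_iff) auto
 then show ?thesis by (simp add: ultrapower_def)
qed

lemma cl_one: "\<one>\<^sub>P = cl (%k. \<one>)" by (simp add: ultrapower_def)

lemma cl_zero: "\<zero>\<^sub>P = cl (%k. \<zero>)" unfolding vzero_def[of P] cl_one by (subst cl_smult) simp_all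

lemma cl_sub: "[|x : Seq; y : Seq|] ==> cl x --\<^sub>P cl y = cl (%k. x k -- y k)"
 unfolding vsub_def by (simp add: cl_smult cl_add)

lemmas cl_ops = cl_add cl_mult cl_smult cl_star cl_one cl_zero cl_sub

lemma cl_tr: assumes x: "x : Seq" shows "((%k. tr (x k)) \<longlongrightarrow> vtr P (cl x)) U"
proof -
 let ?x = "urep (cl x)"
 note r = rep[OF x]
 obtain K where K: "!!k. bnd K (?x k)" using seqE[OF r(1)] by blast
 have "cmod (tr (?x k)) <= K" for k using tr_le_nn[of "?x k"] bnd_nn[OF K, of k] r by simp
 then obtain l where l: "((%k. tr (?x k)) \<longlongrightarrow> l) U" using ultralimit[of "%k. tr (?x k)" K] by blast
 have "vtr P (cl x) = Lim U (%k. tr (?x k))" by (simp add: ultrapower_def)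
 then have e: "vtr P (cl x) = l" using tendsto_Lim[OF U_bot l] by simp
 have "((%k. tr (x k) - tr (?x k)) \<longlongrightarrow> 0) U"
  by (rule Lim_null_comparison[OF _ r(2)]) (use x r tr_le_nn in \<open>simp flip: tr_sub\<close>)
 from tendsto_add[OF this l] show ?thesis unfolding e by simp
qed

lemma cl_nn: assumes x: "x : Seq" shows "((%k. nn (x k)) \<longlongrightarrow> nrm2 P (cl x)) U"
proof -
 have "((%k. tr (~*x k ** x k)) \<longlongrightarrow> vtr P (~*\<^sub>P cl x **\<^sub>P cl x)) U"
  using cl_tr[of "%k. ~*x k ** x k"] x by (simp add: cl_ops)
 then show ?thesis unfolding nrm2_def by (intro tendsto_real_sqrt tendsto_Re)
qed

lemma nn_cl_le: "[|x : Seq; eventually (%k. nn (x k) <= e) U|] ==> nrm2 P (cl x) <= e"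
 by (rule tendsto_upperbound[OF cl_nn]) auto

lemma nn_cl_less: "[|x : Seq; nrm2 P (cl x) < e|] ==> eventually (%k. nn (x k) < e) U"
 by (rule order_tendstoD(2)[OF cl_nn])

lemma mult_nn_le: assumes "x : Seq" "y : Seq" "!!k. bnd K (x k)"
 shows "nrm2 P (cl x **\<^sub>P cl y) <= K * nrm2 P (cl y)"
proof -
 have "((%k. nn (x k ** y k)) \<longlongrightarrow> nrm2 P (cl x **\<^sub>P cl y)) U"
  using cl_nn[of "%k. x k ** y k"] assms by (simp add: cl_ops)
 moreover have "((%k. K * nn (y k)) \<longlongrightarrow> K * nrm2 P (cl y)) U" by (intro tendsto_mult_left cl_nn assms)
 ultimately show ?thesis using bndD[OF assms(3)] assms(2) by (intro tendsto_le[OF U_bot]) auto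
qed

lemma ex_cl: "(ALL X:vcarrier P. Q X) \<longleftrightarrow> (ALL x:Seq. Q (cl x))" using carrier_P by auto

lemma tr_eqI: assumes "x : Seq" "y : Seq" "!!k. tr (x k) = tr (y k)" shows "vtr P (cl x) = vtr P (cl y)"
 using tendsto_unique[OF U_bot cl_tr[OF assms(1)]] cl_tr[OF assms(2)] assms(3) by simp

lemma talg_P: "talg P"
proof
 show "\<one>\<^sub>P : vcarrier P" by (simp add: cl_one)
 show "vtr P \<one>\<^sub>P = 1" using tendsto_unique[OF U_bot cl_tr[of "%k. \<one>"] tendsto_const] by (simp add: cl_one)
next
 fix x y assume "x : vcarrier P" "y : vcarrier P"
 then obtain a b where "a : Seq" "x = cl a" "b : Seq" "y = cl b" by (metis clE)
 then show "x ++\<^sub>P y : vcarrier P" "x **\<^sub>P y : vcarrier P" "x ++\<^sub>P y = y ++\<^sub>P x"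
  "c .*\<^sub>P (x ++\<^sub>P y) = c .*\<^sub>P x ++\<^sub>P c .*\<^sub>P y"
  "(c .*\<^sub>P x) **\<^sub>P y = c .*\<^sub>P (x **\<^sub>P y)"
  "x **\<^sub>P (c .*\<^sub>P y) = c .*\<^sub>P (x **\<^sub>P y)"
  "~*\<^sub>P(x ++\<^sub>P y) = ~*\<^sub>P x ++\<^sub>P ~*\<^sub>P y"
  "~*\<^sub>P(x **\<^sub>P y) = ~*\<^sub>P y **\<^sub>P ~*\<^sub>P x" for c
  by (simp_all add: cl_ops add_comm smult_add smult_mult mult_smult star_add star_mult)
 from \<open>a : Seq\<close> \<open>x = cl a\<close> \<open>b : Seq\<close> \<open>y = cl b\<close>
 show "vtr P (x **\<^sub>P y) = vtr P (y **\<^sub>P x)" by (auto simp: cl_ops tr_comm intro!: tr_eqI)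
 have "((%k. tr (a k ++ b k)) \<longlongrightarrow> vtr P (cl a) + vtr P (cl b)) U"
  using tendsto_add[OF cl_tr cl_tr, of a b] \<open>a : Seq\<close> \<open>b : Seq\<close> by (simp add: tr_add)
 then show "vtr P (x ++\<^sub>P y) = vtr P x + vtr P y"
  using cl_tr[of "%k. a k ++ b k"] \<open>a : Seq\<close> \<open>x = cl a\<close> \<open>b : Seq\<close> \<open>y = cl b\<close>
  by (simp add: cl_ops tendsto_unique[OF U_bot])
next
 fix x assume "x : vcarrier P"
 then obtain a where a: "a : Seq" "x = cl a" by (metis clE)
 then show "c .*\<^sub>P x : vcarrier P" "~*\<^sub>P x : vcarrier P" "x ++\<^sub>P \<zero>\<^sub>P = x"
  "x ++\<^sub>P (-1) .*\<^sub>P x = \<zero>\<^sub>P" "(c + d) .*\<^sub>P x = c .*\<^sub>P x ++\<^sub>P d .*\<^sub>P x"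
  "c .*\<^sub>P d .*\<^sub>P x = (c * d) .*\<^sub>P x" "1 .*\<^sub>P x = x"
  "\<one>\<^sub>P **\<^sub>P x = x" "x **\<^sub>P \<one>\<^sub>P = x"
  "~*\<^sub>P~*\<^sub>P x = x" "~*\<^sub>P(c .*\<^sub>P x) = cnj c .*\<^sub>P ~*\<^sub>P x" for c d
  by (simp_all add: cl_ops add_neg add_smult smult_smult star_smult)
 show "vtr P (c .*\<^sub>P x) = c * vtr P x" for c
  using tendsto_mult_left[OF cl_tr[OF a(1)], of c] cl_tr[of "%k. c .* a k"] a
  by (simp add: cl_ops tr_smult tendsto_unique[OF U_bot])
 have l: "((%k. of_real ((nn (a k))\<^sup>2)) \<longlongrightarrow> vtr P (~*\<^sub>P x **\<^sub>P x)) U"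
  using cl_tr[of "%k. ~*a k ** a k"] a by (simp add: cl_ops tr_nn)
 from tendsto_unique[OF U_bot tendsto_Im[OF l]] show "Im (vtr P (~*\<^sub>P x **\<^sub>P x)) = 0" by simp
 from tendsto_lowerbound[OF tendsto_Re[OF l]] show "0 <= Re (vtr P (~*\<^sub>P x **\<^sub>P x))" by simp
 show "x = \<zero>\<^sub>P" if "vtr P (~*\<^sub>P x **\<^sub>P x) = 0"
 proof -
  have "nrm2 P (cl a) = 0" using that a by (simp add: nrm2_def)
  then have "((%k. nn (a k -- \<zero>)) \<longlongrightarrow> 0) U" using cl_nn[OF a(1)] a by simp
  then show ?thesis using a by (simp add: cl_zero cl_eq_iff)
 qed
 obtain K where K: "!!k. bnd K (a k)" using seqE[OF a(1)] by blast
 have "ALL y:vcarrier P. nrm2 P (x **\<^sub>P y) <= K * nrm2 P y"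
  unfolding ex_cl a(2) using mult_nn_le[OF a(1) _ K] by blast
 then show "EX K. ALL y:vcarrier P. nrm2 P (x **\<^sub>P y) <= K * nrm2 P y" by blast
next
 fix x y w assume "x : vcarrier P" "y : vcarrier P" "w : vcarrier P"
 then obtain a b c where "a : Seq" "x = cl a" "b : Seq" "y = cl b" "c : Seq" "w = cl c" by (metis clE)
 then show "x ++\<^sub>P y ++\<^sub>P w = x ++\<^sub>P (y ++\<^sub>P w)"
  "x **\<^sub>P y **\<^sub>P w = x **\<^sub>P (y **\<^sub>P w)"
  "x **\<^sub>P (y ++\<^sub>P w) = x **\<^sub>P y ++\<^sub>P x **\<^sub>P w"
  "(x ++\<^sub>P y) **\<^sub>P w = x **\<^sub>P w ++\<^sub>P y **\<^sub>P w"
  by (simp_all add: cl_ops add_assoc mult_assoc distrib_l distrib_r)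
qed

end

sublocale utp \<subseteq> P: talg "ultrapower U M" by (rule talg_P)

context utp
begin

lemma cl_bnd: "(!!k. bnd K (x k)) ==> P.bnd K (cl x)"
proof -
 assume K: "!!k. bnd K (x k)"
 then have x: "x : Seq" by (rule seqI)
 have "ALL y:vcarrier P. nrm2 P (cl x **\<^sub>P y) <= K * nrm2 P y"
  unfolding ex_cl using mult_nn_le[OF x _ K] by blast
 then show ?thesis using x bnd_ge0[OF K] by (simp add: P.bnd_def)
qed

lemma seq_sqr [simp]: "x : Seq ==> (%k. sqr j (x k)) : Seq" by (induction j) auto

lemma cl_sqr: "x : Seq ==> P.sqr j (cl x) = cl (%k. sqr j (x k))"
 by (induction j) (auto simp: cl_ops)

text \<open>The rational function \<open>z (1 + (z* z)\<^sup>N)\<inverse>\<close> truncates any \<open>z\<close> to a contraction, and for large \<open>N\<close>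
  hardly moves a strict contraction.\<close>

lemma contractive_lift:
 assumes x: "x : Seq" and b: "P.bnd r (cl x)" and eta: "\<eta> > 0"
 shows "EX y. (ALL k. bnd r (y k)) & nrm2 P (cl x --\<^sub>P cl y) < \<eta>"
proof (cases "r = 0")
 case True
 have "nrm2 P (cl x) <= 0" using P.bnd_nn[OF b] True by simp
 then show ?thesis using True x eta by (intro exI[of _ "%k. \<zero>"]) (simp add: cl_sub)
next
 case False
 then have r: "r > 0" using P.bnd_ge0[OF b] by simp
 define n where "n = nrm2 P (cl x)"
 have n: "0 <= n" using x by (simp add: n_def)
 \<comment> \<open>Shrinking by \<theta> < 1 makes the class of z a strict contraction, whose high
   powers are small, while \<theta> is so close to 1 that shrinking costs less than \<eta> /
   2.\<close>
 define \<theta> where "\<theta> = 1 - \<eta> / (2 * n + \<eta> + \<eta>)"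
 have th: "0 < \<theta>" "\<theta> < 1" using n eta by (auto simp: \<theta>_def field_simps)
 have thn: "(1 - \<theta>) * n < \<eta> / 2"
 proof -
  have "(1 - \<theta>) * n = \<eta> * (n / (2 * n + \<eta> + \<eta>))" by (simp add: \<theta>_def)
  also have "n / (2 * n + \<eta> + \<eta>) < 1 / 2" using n eta by (simp add: field_simps)
  finally show ?thesis using eta by simp
 qed
 have "(%i. r * (\<theta> * (\<theta>\<^sup>2) ^ i)) \<longlonglongrightarrow> r * (\<theta> * 0)"
  by (intro tendsto_intros LIMSEQ_power_zero) (use th in \<open>simp add: power_less_one_iff abs_square_less_1\<close>)
 then have "eventually (%i. r * (\<theta> * (\<theta>\<^sup>2) ^ i) < \<eta> / 2) sequentially" using eta by (intro order_tendstoD(2)) auto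
 then obtain i where i: "!!i'. i' >= i ==> r * (\<theta> * (\<theta>\<^sup>2) ^ i') < \<eta> / 2" by (auto simp: eventually_sequentially)
 have ii: "i <= 2 ^ Suc i" using less_exp[of "Suc i"] by simp
 define z where "z k = of_real (\<theta> / r) .* x k" for k
 have z: "z : Seq" unfolding z_def using x by simp
 have zc: "z k : C" for k using z by simp
 have Z: "cl z = of_real (\<theta> / r) .*\<^sub>P cl x" using x by (simp add: cl_smult z_def[abs_def])
 have "P.bnd (cmod (of_real (\<theta> / r)) * r) (cl z)" unfolding Z by (rule P.bnd_smult[OF b])
 then have bz: "P.bnd \<theta> (cl z)" unfolding norm_of_real using r th by simp
 \<comment> \<open>c is the power of ~*z ** z in the truncation, written as ~*s ** s so that
   \<open>inverse_one_plus\<close> inverts 1 + c.\<close>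
 define s where "s k = sqr i (~*z k ** z k)" for k
 define c where "c k = sqr (Suc i) (~*z k ** z k)" for k
 have sc: "s k : C" "c k : C" for k using zc by (simp_all add: s_def c_def)
 have c: "c : Seq" unfolding c_def by (rule seq_sqr) (use z in simp)
 have ss: "~*(s k) ** s k = c k" for k unfolding s_def c_def using zc by (simp add: sqr_star star_mult)
 have "EX R. R : C & (\<one> ++ ~*(s k) ** s k) ** R = \<one> & bnd 1 R" for k
  using inverse_one_plus[OF sc(1)[of k]] by (elim exE conjE) (intro exI conjI)
 then obtain R where R: "!!k. R k : C" "!!k. (\<one> ++ c k) ** R k = \<one>" "!!k. bnd 1 (R k)" unfolding ss by metis
 define y' where "y' k = z k ** R k" for k
 have y'c: "y' k : C" for k using zc R by (simp add: y'_def)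
 have y'b: "bnd 1 (y' k)" for k
 proof (rule bndI[OF y'c])
  fix v assume v: "v : C"
  define w where "w = R k ** v"
  have w: "w : C" using R v by (simp add: w_def)
  have "v = (\<one> ++ c k) ** R k ** v" using R v by simp
  also have "... = w ++ c k ** w" unfolding w_def using R(1) v sc by (simp add: distrib_r mult_assoc)
  finally have v': "v = w ++ c k ** w" .
  have q: "Re (tr (~*w ** (c k ** w))) = (nn (s k ** w))\<^sup>2" using quad_sq[OF sc(1) w, of k] by (simp add: ss)
  have cs: "~*(c k) = c k" unfolding c_def using zc by (intro sqr_star) (simp_all add: star_mult)
  have "Re (tr (~*(c k ** w) ** w)) = (nn (s k ** w))\<^sup>2" using q sc w by (simp add: star_mult cs mult_assoc)
  then have "(nn v)\<^sup>2 = (nn w)\<^sup>2 + 2 * (nn (s k ** w))\<^sup>2 + (nn (c k ** w))\<^sup>2"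
   unfolding v' using nn_add_sq[of w "c k ** w"] sc w by simp
  moreover have "(nn (z k ** w))\<^sup>2 <= (nn w)\<^sup>2 + (nn (s k ** w))\<^sup>2"
   using moment_max[OF zc w, of k i] q unfolding c_def by simp
  ultimately have "(nn (z k ** w))\<^sup>2 <= (nn v)\<^sup>2"
   using zero_le_power2[of "nn (s k ** w)"] zero_le_power2[of "nn (c k ** w)"] by linarith
  then have "nn (z k ** w) <= nn v" by (rule power2_le_imp_le) (use v in simp)
  then show "nn (y' k ** v) <= 1 * nn v" unfolding y'_def w_def using zc R(1) v by (simp add: mult_assoc)
 qed simp
 define y where "y k = of_real r .* y' k" for k
 have yb: "bnd r (y k)" for k using bnd_smult[OF y'b, of "of_real r" k] r by (simp add: y_def)
 have y: "y : Seq" by (rule seqI[OF yb])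
 \<comment> \<open>From R = 1 - c ** R and r z = \<theta> x, the difference is (1 - \<theta>) x + r
   (z ** c ** R).\<close>
 have diff: "nn (x k -- y k) <= (1 - \<theta>) * nn (x k) + r * nn (z k ** c k)" for k
 proof -
  have xk: "x k : C" using x by simp
  have "R k = \<one> -- c k ** R k"
  proof (rule tau_ext)
   fix w assume w: "w : C"
   have "tr (w ** ((\<one> ++ c k) ** R k)) = tr (w ** \<one>)" unfolding R(2) ..
   then show "tr (w ** R k) = tr (w ** (\<one> -- c k ** R k))"
    using w R(1) sc by (simp add: alg algebra_simps)
  qed (use R(1) sc in auto)
  then have "y' k = z k ** (\<one> -- c k ** R k)" unfolding y'_def by (rule arg_cong)
  also have "... = z k -- (z k ** c k) ** R k" using zc sc R(1) by (intro tau_ext) (simp_all add: alg)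
  finally have "x k -- y k = of_real (1 - \<theta>) .* x k ++ of_real r .* ((z k ** c k) ** R k)"
   unfolding y_def using xk zc sc R(1) r by (intro tau_ext) (simp_all add: alg z_def algebra_simps)
  then have "nn (x k -- y k) <= (1 - \<theta>) * nn (x k) + r * nn ((z k ** c k) ** R k)"
   using triangle[of "of_real (1 - \<theta>) .* x k" "of_real r .* ((z k ** c k) ** R k)"] xk zc sc R(1) r th
   by (simp only: nn_smult norm_of_real mult_c smult_c) simp
  also have "nn ((z k ** c k) ** R k) <= 1 * nn (z k ** c k)" by (rule bndR[OF R(3)]) (use zc sc in simp)
  finally show ?thesis using r by simp
 qed
 have Cc: "cl c = P.sqr (Suc i) (~*\<^sub>P cl z **\<^sub>P cl z)"
  using z by (simp add: cl_star cl_mult cl_sqr c_def[abs_def] del: P.sqr.simps sqr.simps)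
 have "P.bnd ((\<theta>\<^sup>2) ^ (2 ^ Suc i)) (cl c)" unfolding Cc by (rule P.bnd_sqr[OF P.bnd_star_mult[OF bz]])
 then have "nrm2 P (cl c) <= (\<theta>\<^sup>2) ^ (2 ^ Suc i)" by (rule P.bnd_nn)
 then have "\<theta> * nrm2 P (cl c) <= \<theta> * (\<theta>\<^sup>2) ^ (2 ^ Suc i)" using th by (intro mult_left_mono) auto
 moreover have "nrm2 P (cl z **\<^sub>P cl c) <= \<theta> * nrm2 P (cl c)" by (rule P.bndD[OF bz]) (use c in simp)
 ultimately have zc': "r * nrm2 P (cl z **\<^sub>P cl c) < \<eta> / 2"
  using i[OF ii] r by (smt (verit) mult_left_mono)
 have "((%k. (1 - \<theta>) * nn (x k) + r * nn (z k ** c k)) \<longlongrightarrow> (1 - \<theta>) * n + r * nrm2 P (cl z **\<^sub>P cl c)) U"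
  unfolding n_def using z c x cl_nn[of "%k. z k ** c k"] by (intro tendsto_add tendsto_mult_left cl_nn) (simp_all add: cl_mult)
 moreover have "((%k. nn (x k -- y k)) \<longlongrightarrow> nrm2 P (cl x --\<^sub>P cl y)) U"
  using cl_nn[of "%k. x k -- y k"] x y by (simp add: cl_sub)
 ultimately have "nrm2 P (cl x --\<^sub>P cl y) <= (1 - \<theta>) * n + r * nrm2 P (cl z **\<^sub>P cl c)"
  using diff by (intro tendsto_le[OF U_bot]) auto
 then have "nrm2 P (cl x --\<^sub>P cl y) < \<eta>" using thn zc' by simp
 then show ?thesis using yb by blast
qed

text \<open>Each s n is approximated by a sequence of honest contractions; a subsequence with
  prescribed Cauchy rate is then diagonalised over the coordinates. The contractions bound the
  diagonal sequence.\<close>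

lemma complete_P:
 assumes s: "!!n::nat. P.bnd 1 (s n)"
  and cau: "!!e. e > 0 ==> EX N. ALL m>=N. ALL n>=N. nrm2 P (s m --\<^sub>P s n) < e"
 shows "EX y. P.bnd 1 (cl y) & (ALL k. bnd 1 (y k)) & (%n. nrm2 P (s n --\<^sub>P cl y)) \<longlonglongrightarrow> 0"
proof -
 have sc: "s n : vcarrier P" for n using P.bnd_c[OF s] .
 have "EX y. (ALL k. bnd 1 (y k)) & nrm2 P (s n --\<^sub>P cl y) < 1 / Suc n" for n
 proof -
  obtain x where x: "x : Seq" "s n = cl x" using clE[OF sc] by blast
  show ?thesis using contractive_lift[OF x(1), of 1 "1 / Suc n"] s[of n] x(2) by simp
 qed
 then obtain y where y: "!!n k. bnd 1 (y n k)" "!!n. nrm2 P (s n --\<^sub>P cl (y n)) < 1 / Suc n" by metis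
 have yS: "y n : Seq" for n by (rule seqI[OF y(1)])
 have "EX N. ALL m>=N. ALL n>=N. nrm2 P (cl (y m) --\<^sub>P cl (y n)) < 1 / Suc i" for i
 proof -
  obtain N where N: "!!m n. m >= N ==> n >= N ==> nrm2 P (s m --\<^sub>P s n) < 1 / (3 * Suc i)"
   using cau[of "1 / (3 * Suc i)"] by auto
  show ?thesis
  proof (intro exI[of _ "max N (3 * Suc i)"] allI impI)
   fix m n assume mn: "m >= max N (3 * Suc i)" "n >= max N (3 * Suc i)"
   have "1 / real (Suc m) <= 1 / (3 * Suc i)" "1 / real (Suc n) <= 1 / (3 * Suc i)"
    using mn by (auto intro!: divide_left_mono)
   moreover have "nrm2 P (cl (y m) --\<^sub>P cl (y n)) <= nrm2 P (s m --\<^sub>P cl (y m)) + (nrm2 P (s m --\<^sub>P s n) + nrm2 P (s n --\<^sub>P cl (y n)))"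
    using P.sub_tri[of "cl (y m)" "s m" "cl (y n)"] P.sub_tri[of "s m" "s n" "cl (y n)"] P.sub_swap[of "cl (y m)" "s m"] sc yS by simp
   ultimately have "nrm2 P (cl (y m) --\<^sub>P cl (y n)) < 3 * (1 / (3 * Suc i))"
    using y(2)[of m] y(2)[of n] N[of m n] mn by linarith
   moreover have "3 * (1 / real (3 * Suc i)) = 1 / real (Suc i)" by (simp add: field_simps)
   ultimately show "nrm2 P (cl (y m) --\<^sub>P cl (y n)) < 1 / Suc i" by (simp only:)
  qed
 qed
 then obtain N where N: "!!i m n. m >= N i ==> n >= N i ==> nrm2 P (cl (y m) --\<^sub>P cl (y n)) < 1 / Suc i" by metis
 \<comment> \<open>The maximum makes one index serve all accuracies up to i at once.\<close>
 define NN where "NN i = Max (N ` {..i})" for i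
 have NN: "NN j >= N i" if "i <= j" for i j unfolding NN_def using that by (intro Max_ge) auto
 define w where "w i = y (NN i)" for i
 have wS: "w i : Seq" for i unfolding w_def by (rule yS)
 define Q where "Q j k \<longleftrightarrow> (ALL i:{..j}. nn (w i k -- w j k) < 1 / Suc i)" for j k
 have "eventually (Q j) U" for j unfolding Q_def
 proof (subst eventually_ball_finite_distrib, simp, rule ballI)
  fix i assume i: "i : {..j}"
  have "nrm2 P (cl (w i) --\<^sub>P cl (w j)) < 1 / Suc i" unfolding w_def by (rule N) (use NN i in auto)
  then show "eventually (%k. nn (w i k -- w j k) < 1 / Suc i) U"
   using nn_cl_less[of "%k. w i k -- w j k"] wS by (simp add: cl_sub)
 qed
 from diagonal[of Q, OF this] obtain m where m: "!!j. eventually (%k. m k >= j) U" "eventually (%k. ALL i<=m k. Q i k) U" by blast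
 define v where "v k = w (m k) k" for k
 have vb: "bnd 1 (v k)" for k unfolding v_def w_def by (rule y)
 have vS: "v : Seq" by (rule seqI[OF vb])
 have wv: "nrm2 P (cl (w i) --\<^sub>P cl v) <= 1 / Suc i" for i
  unfolding cl_sub[OF wS vS]
 proof (rule nn_cl_le)
  show "eventually (%k. nn (w i k -- v k) <= 1 / Suc i) U" using m(1)[of i] m(2)
   by eventually_elim (auto simp: Q_def v_def less_imp_le)
 qed (use wS vS in auto)
 have lim: "(%n. nrm2 P (s n --\<^sub>P cl v)) \<longlonglongrightarrow> 0"
 proof (rule LIMSEQ_I)
  fix e :: real assume e: "e > 0"
  obtain i where i: "1 / real (Suc i) < e / 3" using reals_Archimedean[of "e / 3"] e by (auto simp: inverse_eq_divide)
  show "EX no. ALL n>=no. norm (nrm2 P (s n --\<^sub>P cl v) - 0) < e"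
  proof (intro exI[of _ "max i (NN i)"] allI impI)
   fix n assume n: "n >= max i (NN i)"
   have "1 / real (Suc n) <= 1 / real (Suc i)" using n by (auto intro!: divide_left_mono)
   moreover have "nrm2 P (cl (y n) --\<^sub>P cl (w i)) < 1 / Suc i" unfolding w_def by (rule N) (use NN[of i i] n in auto)
   moreover have "nrm2 P (s n --\<^sub>P cl v) <= nrm2 P (s n --\<^sub>P cl (y n)) + (nrm2 P (cl (y n) --\<^sub>P cl (w i)) + nrm2 P (cl (w i) --\<^sub>P cl v))"
    using P.sub_tri[of "s n" "cl (y n)" "cl v"] P.sub_tri[of "cl (y n)" "cl (w i)" "cl v"] sc yS wS vS by simp
   ultimately have "nrm2 P (s n --\<^sub>P cl v) < e" using y(2)[of n] wv[of i] i by linarith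
   then show "norm (nrm2 P (s n --\<^sub>P cl v) - 0) < e" using sc vS by simp
  qed
 qed
 have "P.bnd 1 (cl v)" by (rule cl_bnd[OF vb])
 then show ?thesis using vb lim by (intro exI[of _ v] conjI allI)
qed

lemma tvna_P: "tvna P"
proof
 fix s assume s: "!!n::nat. s n : vcarrier P" "!!n. opnorm P (s n) <= 1"
  and cau: "!!\<epsilon>. 0 < \<epsilon> ==> EX K. ALL m>=K. ALL n>=K. nrm2 P (s m --\<^sub>P s n) < \<epsilon>"
 have "P.bnd 1 (s n)" for n using s P.opnorm_le_iff by simp
 from complete_P[OF this cau] obtain y where y: "P.bnd 1 (cl y)" "(%n. nrm2 P (s n --\<^sub>P cl y)) \<longlonglongrightarrow> 0" by blast
 then show "EX x:vcarrier P. opnorm P x <= 1 & (%n. nrm2 P (s n --\<^sub>P x)) \<longlonglongrightarrow> 0"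
  using P.opnorm_le_iff[OF P.bnd_c[OF y(1)], of 1] P.bnd_c[OF y(1)] by auto
qed

end

sublocale utp \<subseteq> P: tvna "ultrapower U M" by (rule tvna_P)

context utp
begin

lemma cl_unit: assumes "!!k. unit (u k)" shows "P.unit (cl u)"
 using seq_unit[OF assms] unitD[OF assms] by (simp add: P.unit_def cl_ops)

lemma cl_scalar: assumes c: "(c \<longlongrightarrow> l) U" "!!k. cmod (c k) <= L" shows "cl (%k. c k .* \<one>) = l .*\<^sub>P \<one>\<^sub>P"
proof -
 have "nn (c k .* \<one> -- l .* \<one>) = cmod (c k - l)" for k
 proof -
  have "c k .* \<one> -- l .* \<one> = (c k - l) .* \<one>" by (intro tau_ext) (simp_all add: alg algebra_simps)
  then show ?thesis by (simp add: nn_smult)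
 qed
 moreover have "((%k. cmod (c k - l)) \<longlongrightarrow> 0) U" using c(1) by (simp add: LIM_zero tendsto_norm_zero)
 ultimately have "cl (%k. c k .* \<one>) = cl (%k. l .* \<one>)"
  using seq_smult'[of "%k. \<one>" c L] c(2) by (subst cl_eq_iff) auto
 then show ?thesis by (simp add: cl_ops)
qed

text \<open>Dixmier averaging is uniform, so relative commutants that are factors on each coordinate
  stay factors in the ultrapower.\<close>

lemma scalar_if_central:
 assumes S: "!!k. vnsub (S k)" "!!k. tcen (S k)" and z: "z : Seq" "!!k. z k : S k"
  and cen: "!!u. [|!!k. u k : S k; !!k. unit (u k)|] ==> cl u **\<^sub>P cl z = cl z **\<^sub>P cl u"
 shows "EX c. cl z = c .*\<^sub>P \<one>\<^sub>P"
proof -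
 have zc: "z k : C" for k using z by simp
 \<comment> \<open>A factor 2 is given away because the supremum over unitaries need not be
   attained. If z k is already scalar, u = 1 serves.\<close>
 have "EX u. u : S k & unit u & nn (tr (z k) .* \<one> -- z k) <= 2 * nn (u ** z k ** ~*u -- z k)" for k
 proof (rule ccontr)
  let ?n = "nn (tr (z k) .* \<one> -- z k)"
  assume n: "~ (EX u. u : S k & unit u & ?n <= 2 * nn (u ** z k ** ~*u -- z k))"
  have "unit \<one>" by (simp add: unit_def)
  then have "0 < ?n" using n vnsubD(2)[OF S(1)] zc by force
  moreover have "?n <= ?n / 2" by (rule dist_scalar[OF S z(2)]) (use n in \<open>force simp: not_le\<close>)
  ultimately show False by simp
 qed
 then obtain u where u: "!!k. u k : S k" "!!k. unit (u k)"
  "!!k. nn (tr (z k) .* \<one> -- z k) <= 2 * nn (u k ** z k ** ~*(u k) -- z k)" by metis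
 have uS: "u : Seq" by (rule seq_unit[OF u(2)])
 note uu = P.unitD[OF cl_unit[of u, OF u(2)]]
 have "cl u **\<^sub>P cl z **\<^sub>P ~*\<^sub>P cl u = cl z **\<^sub>P (cl u **\<^sub>P ~*\<^sub>P cl u)"
  unfolding cen[OF u(1,2)] using uu(1) z by (simp add: P.mult_assoc)
 then have "cl u **\<^sub>P cl z **\<^sub>P ~*\<^sub>P cl u = cl z" unfolding uu(3) using z by simp
 then have "cl (%k. u k ** z k ** ~*(u k)) = cl z" using z uS by (simp add: cl_star cl_mult)
 then have "((%k. nn (u k ** z k ** ~*(u k) -- z k)) \<longlongrightarrow> 0) U" using uS z by (subst (asm) cl_eq_iff) auto
 from tendsto_mult_left[OF this, of 2] have l: "((%k. 2 * nn (u k ** z k ** ~*(u k) -- z k)) \<longlongrightarrow> 0) U" by simp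
 obtain K where K: "!!k. bnd K (z k)" using seqE[OF z(1)] by blast
 have tb: "cmod (tr (z k)) <= K" for k using tr_le_nn[OF zc, of k] bnd_nn[OF K, of k] by simp
 have sq: "(%k. tr (z k) .* \<one>) : Seq" by (rule seq_smult'[OF seq_const[OF one_c] tb])
 have "((%k. nn (tr (z k) .* \<one> -- z k)) \<longlongrightarrow> 0) U"
  by (rule Lim_null_comparison[OF _ l]) (use u(3) zc in simp)
 then have "cl z = cl (%k. tr (z k) .* \<one>)" using sq z(1) by (subst eq_commute, subst cl_eq_iff) auto
 then show ?thesis using cl_scalar[OF cl_tr[OF z(1)] tb] by auto
qed

lemma tcen_P: assumes "tcen C" shows "P.tcen (vcarrier P)"
 unfolding P.tcen_def
proof (intro ballI impI)
 fix Z assume Z: "Z : vcarrier P" "ALL y:vcarrier P. Z **\<^sub>P y = y **\<^sub>P Z"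
 obtain z where z: "z : Seq" "Z = cl z" using clE[OF Z(1)] by blast
 show "EX c. Z = c .*\<^sub>P \<one>\<^sub>P" unfolding z(2)
  by (rule scalar_if_central[where S = "%_. C"]) (use vnsub_C assms z Z seq_unit in auto)
qed

text \<open>A contractive lift y of V has 2-norm close to 1 in the limit, and
  \<open>near_unit\<close> then moves each coordinate to a unitary at small cost.\<close>

lemma unit_lift:
 assumes f: "tcen C" and V: "P.unit V" and eta: "\<eta> > 0"
 shows "EX u. (ALL k. unit (u k)) & nrm2 P (V --\<^sub>P cl u) < \<eta>"
proof -
 \<comment> \<open>2 \<delta> <= (\<eta> / 2)^2 bounds the distance between u and y by \<eta> / 2,
   and \<delta> <= \<eta> / 4 bounds that between y and V.\<close>
 define \<delta> where "\<delta> = min (1/2) (min (\<eta> / 4) (\<eta>\<^sup>2 / 8))"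
 have d: "\<delta> > 0" "\<delta> <= 1/2" "\<delta> <= \<eta> / 4" "\<delta> <= \<eta>\<^sup>2 / 8" using eta by (auto simp: \<delta>_def)
 have Vc: "V : vcarrier P" using P.unitD[OF V] by simp
 obtain x where x: "x : Seq" "V = cl x" using clE[OF Vc] by blast
 obtain y where y: "!!k. bnd 1 (y k)" "nrm2 P (V --\<^sub>P cl y) < \<delta>"
  using contractive_lift[OF x(1), of 1 \<delta>] P.unit_bnd[OF V] d x(2) by auto
 have yS: "y : Seq" by (rule seqI[OF y(1)])
 have "ALL k. EX u. unit u & (nn (u -- y k))\<^sup>2 <= 1 - (nn (y k))\<^sup>2" using near_unit[OF f y(1)] by blast
 then obtain u where u: "!!k. unit (u k)" "!!k. (nn (u k -- y k))\<^sup>2 <= 1 - (nn (y k))\<^sup>2" by metis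
 have uS: "u : Seq" by (rule seq_unit[OF u(1)])
 have "nrm2 P V = 1" using P.unit_nn(1)[OF V P.one_c] Vc by simp
 then have "1 - \<delta> <= nrm2 P (cl y)" using P.nn_diff[of V "cl y"] Vc yS y(2) by (simp add: abs_le_iff)
 then have "(1 - \<delta>)\<^sup>2 <= (nrm2 P (cl y))\<^sup>2" using d by (intro power_mono) auto
 then have ny: "1 - (nrm2 P (cl y))\<^sup>2 <= 2 * \<delta>" by (simp add: power2_eq_square algebra_simps) (smt (verit) zero_le_square)
 have "((%k. nn (u k -- y k)) \<longlongrightarrow> nrm2 P (cl u --\<^sub>P cl y)) U"
  using cl_nn[of "%k. u k -- y k"] uS yS by (simp add: cl_sub)
 then have "((%k. (nn (u k -- y k))\<^sup>2) \<longlongrightarrow> (nrm2 P (cl u --\<^sub>P cl y))\<^sup>2) U" by (rule tendsto_power)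
 moreover have "((%k. 1 - (nn (y k))\<^sup>2) \<longlongrightarrow> 1 - (nrm2 P (cl y))\<^sup>2) U"
  by (intro tendsto_diff tendsto_const tendsto_power cl_nn yS)
 ultimately have "(nrm2 P (cl u --\<^sub>P cl y))\<^sup>2 <= 1 - (nrm2 P (cl y))\<^sup>2"
  using u(2) by (intro tendsto_le[OF U_bot]) auto
 also have "... <= 2 * (\<eta>\<^sup>2 / 8)" using ny d by linarith
 also have "... = (\<eta> / 2)\<^sup>2" by (simp add: power_divide)
 finally have "nrm2 P (cl u --\<^sub>P cl y) <= \<eta> / 2" by (rule power2_le_imp_le) (use eta in simp)
 then have "nrm2 P (V --\<^sub>P cl u) < \<eta>"
  using P.sub_tri[of V "cl y" "cl u"] P.sub_swap[of "cl y" "cl u"] Vc yS uS y(2) d eta by simp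
 then show ?thesis using u(1) by blast
qed

section \<open>The diagonal embedding, and embeddings in general\<close>

definition dg :: "'a => (nat => 'a) set" where "dg x = cl (%k. x)"

lemma dg_c [simp]: "x : C ==> dg x : vcarrier P" by (simp add: dg_def)

lemma dg_nn: "x : C ==> nrm2 P (dg x) = nn x"
 unfolding dg_def using tendsto_unique[OF U_bot cl_nn[of "%k. x"] tendsto_const] by simp

lemma dg_tr: "x : C ==> vtr P (dg x) = tr x"
 unfolding dg_def using tendsto_unique[OF U_bot cl_tr[of "%k. x"] tendsto_const] by simp

lemma dg_hom: "star_hom M P dg"
 unfolding star_hom_def by (auto simp: dg_def cl_ops)

lemma dg_sub: "[|x : C; y : C|] ==> dg (x -- y) = dg x --\<^sub>P dg y" by (simp add: dg_def cl_ops)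

end

text \<open>Injectivity comes for free: a trace-preserving *-homomorphism is isometric for the
  2-norm.\<close>

lemma embeddingI:
 assumes "talg M" "talg P" and h: "star_hom M P f" and t: "!!x. x : vcarrier M ==> vtr P (f x) = vtr M x"
 shows "embedding M P f"
proof -
 interpret M: talg M by fact
 interpret P: talg P by fact
 note hh = h[unfolded star_hom_def]
 have c: "f x : vcarrier P" if "x : vcarrier M" for x using hh that by blast
 have sub: "f (x --\<^sub>M y) = f x --\<^sub>P f y" if "x : vcarrier M" "y : vcarrier M" for x y
  using hh that by (simp add: vsub_def)
 have nn: "nrm2 P (f x) = nrm2 M x" if "x : vcarrier M" for x
 proof -
  have "f (~*\<^sub>M x **\<^sub>M x) = ~*\<^sub>P f x **\<^sub>P f x" using hh that by simp
  then show ?thesis using t[of "~*\<^sub>M x **\<^sub>M x"] that by (simp add: nrm2_def)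
 qed
 have "inj_on f (vcarrier M)"
 proof (rule inj_onI)
  fix x y assume xy: "x : vcarrier M" "y : vcarrier M" "f x = f y"
  then have "nrm2 M (x --\<^sub>M y) = 0" using nn[of "x --\<^sub>M y"] sub c by simp
  then show "x = y" using xy by (intro M.eq_if_nn) auto
 qed
 then show ?thesis unfolding embedding_def using h t by blast
qed

locale emb = M: talg M + P: talg P for M :: "'a tvna" and P :: "'b tvna" +
 fixes f assumes emb: "embedding M P f"
begin

lemma c [simp]: "x : vcarrier M ==> f x : vcarrier P"
 and one: "f \<one>\<^sub>M = \<one>\<^sub>P"
 and add: "[|x : vcarrier M; y : vcarrier M|] ==> f (x ++\<^sub>M y) = f x ++\<^sub>P f y"
 and mult: "[|x : vcarrier M; y : vcarrier M|] ==> f (x **\<^sub>M y) = f x **\<^sub>P f y"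
 and smult: "x : vcarrier M ==> f (a .*\<^sub>M x) = a .*\<^sub>P f x"
 and star: "x : vcarrier M ==> f (~*\<^sub>M x) = ~*\<^sub>P f x"
 and tr: "x : vcarrier M ==> vtr P (f x) = vtr M x"
 using emb unfolding embedding_def star_hom_def by auto

lemma sub: "[|x : vcarrier M; y : vcarrier M|] ==> f (x --\<^sub>M y) = f x --\<^sub>P f y"
 by (simp add: vsub_def add smult)

lemma nn: "x : vcarrier M ==> nrm2 P (f x) = nrm2 M x"
 unfolding nrm2_def by (simp add: star[symmetric] mult[symmetric] tr)

lemma sqr: "x : vcarrier M ==> f (M.sqr j x) = P.sqr j (f x)"
 by (induction j) (auto simp: mult)

text \<open>Homomorphism and trace preservation keep all moments, and these determine operator
  bounds.\<close>

lemma bnd: assumes "M.bnd K x" shows "P.bnd K (f x)"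
proof (rule P.bnd_if_moments)
 have x: "x : vcarrier M" using assms M.bnd_c by blast
 show "f x : vcarrier P" "0 <= K" using x M.bnd_ge0[OF assms] by auto
 fix j
 have "nrm2 P (P.sqr j (~*\<^sub>P f x **\<^sub>P f x)) = nrm2 M (M.sqr j (~*\<^sub>M x **\<^sub>M x))"
  using x by (simp add: star[symmetric] mult[symmetric] sqr[symmetric] nn)
 also have "... <= (K\<^sup>2) ^ (2 ^ j)" by (rule M.bnd_nn[OF M.bnd_sqr[OF M.bnd_star_mult[OF assms]]])
 finally show "nrm2 P (P.sqr j (~*\<^sub>P f x **\<^sub>P f x)) <= 1 * (K\<^sup>2) ^ (2 ^ j)" by simp
qed

end

sublocale utp \<subseteq> dg: emb M "ultrapower U M" dg
 by unfold_locales (intro embeddingI talg_P talg_axioms dg_hom dg_tr)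

section \<open>Systems of matrix units\<close>

context talg
begin

primrec vsum :: "(nat => 'a) => nat => 'a" where
 "vsum f 0 = \<zero>"
| "vsum f (Suc n) = vsum f n ++ f n"

lemma vsum_c [simp]: "(!!i. i < n ==> f i : C) ==> vsum f n : C" by (induction n) auto

lemma vsum_cong: "(!!i. i < n ==> f i = g i) ==> vsum f n = vsum g n" by (induction n) auto

lemma tr_vsum: "(!!i. i < n ==> f i : C) ==> tr (vsum f n) = (\<Sum>i<n. tr (f i))"
 by (induction n) (auto simp: tr_add)

lemma mult_vsum: "[|x : C; !!i. i < n ==> f i : C|] ==> x ** vsum f n = vsum (%i. x ** f i) n"
 by (induction n) (auto simp: distrib_l)

lemma vsum_mult: "[|x : C; !!i. i < n ==> f i : C|] ==> vsum f n ** x = vsum (%i. f i ** x) n"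
 by (induction n) (auto simp: distrib_r)

lemma star_vsum: "(!!i. i < n ==> f i : C) ==> ~*(vsum f n) = vsum (%i. ~*f i) n"
 by (induction n) (auto simp: star_add)

lemma smult_vsum: "(!!i. i < n ==> f i : C) ==> c .* vsum f n = vsum (%i. c .* f i) n"
 by (induction n) (auto simp: smult_add)

lemma tr_mult_vsum: "[|w : C; !!i. i < n ==> f i : C|] ==> tr (w ** vsum f n) = (\<Sum>i<n. tr (w ** f i))"
 by (simp add: mult_vsum tr_vsum)

lemma vsum_delta: "[|k < n; x : C|] ==> vsum (%i. if i = k then x else \<zero>) n = x"
 by (rule tau_ext) (auto simp: tr_mult_vsum if_distrib cong: if_cong)

lemma vsum_single: assumes k: "k < n" "f k : C" and z: "!!i. [|i < n; i ~= k|] ==> f i = \<zero>" shows "vsum f n = f k"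
proof -
 have "vsum f n = vsum (%i. if i = k then f k else \<zero>) n" by (rule vsum_cong) (simp add: z)
 then show ?thesis using vsum_delta[OF k] by simp
qed

lemma vsum_mem: "[|vnsub S; !!i. i < n ==> f i : S|] ==> vsum f n : S"
 by (induction n) (auto intro: vnsubD)

text \<open>Matrix units of a direct sum of matrix algebras, encoded by one column of each block: r
  i is the representative of the block containing i, v (r i) is a projection, v i is a partial
  isometry starting from it, and the matrix units are v i ** ~*v j with r i = r j. The sum of the v
  i ** ~*v i may be less than 1; \<open>sys\<close> excludes this.\<close>

definition psys :: "nat => (nat => nat) => (nat => 'a) => bool" where
 "psys n r v \<longleftrightarrow> (ALL i<n. v i : C & r i < n & r (r i) = r i) &
  (ALL i<n. ALL j<n. ~*v i ** v j = (if i = j then v (r i) else \<zero>))"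

definition sys :: "nat => (nat => nat) => (nat => 'a) => bool" where
 "sys n r v \<longleftrightarrow> psys n r v & vsum (%i. v i ** ~*v i) n = \<one>"

context
 fixes n r v assumes p: "psys n r v"
begin

lemma psys_c: "i < n ==> v i : C" and psys_r: "i < n ==> r i < n" "i < n ==> r (r i) = r i"
 and psys_m: "i < n ==> ~*v i ** v i = v (r i)" "[|i < n; j < n; i ~= j|] ==> ~*v i ** v j = \<zero>"
 using p unfolding psys_def by auto

lemma psys_rep: assumes i: "i < n" shows "~*v (r i) = v (r i)" "v (r i) ** v (r i) = v (r i)"
proof -
 have e: "~*v i ** v i = v (r i)" by (rule psys_m(1)[OF i])
 show s: "~*v (r i) = v (r i)" unfolding e[symmetric] using psys_c[OF i] by (simp add: star_mult)
 show "v (r i) ** v (r i) = v (r i)" using psys_m(1)[OF psys_r(1)[OF i]] s psys_r(2)[OF i] by simp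
qed

lemma psys_right: assumes i: "i < n" shows "v i ** v (r i) = v i"
proof -
 let ?p = "v (r i)"
 have c: "v i : C" "?p : C" using psys_c psys_r i by auto
 note q = psys_rep[OF i]
 have "~*(v i -- v i ** ?p) ** (v i -- v i ** ?p) = (\<one> -- ?p) ** ((~*v i ** v i) ** (\<one> -- ?p))"
  using c q by (intro tau_ext) (simp_all add: alg)
 also have "(~*v i ** v i) ** (\<one> -- ?p) = \<zero>" unfolding psys_m(1)[OF i] using c q
  by (simp add: vsub_def distrib_l mult_smult add_neg)
 finally have "tr (~*(v i -- v i ** ?p) ** (v i -- v i ** ?p)) = 0" using c by simp
 then have "v i -- v i ** ?p = \<zero>" using c by (intro tr_faithful) auto
 then show ?thesis using c sub_eq_zero[of "v i" "v i ** ?p"] by simp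
qed

lemma psys_left: "i < n ==> v (r i) ** ~*v i = ~*v i"
 using arg_cong[OF psys_right, of i "vstar M"] psys_rep[of i] psys_c[of i] psys_c[of "r i"] psys_r[of i] by (simp add: star_mult)

lemma psys_tr: "i < n ==> tr (v i ** ~*v i) = tr (v (r i))"
 using tr_comm[of "v i" "~*v i"] psys_c psys_m by simp

lemma psys_tr_pos: "i < n ==> tr (v (r i)) = of_real ((nn (v i))\<^sup>2)"
 using tr_nn[of "v i"] psys_c psys_m by simp

end

lemma sysD: "sys n r v ==> psys n r v" "sys n r v ==> vsum (%i. v i ** ~*v i) n = \<one>" by (simp_all add: sys_def)

lemma sys_unitary_aux:
 assumes v: "psys n r v" and v': "psys n r v'"
  and w: "!!i. i < n ==> w (r i) : C" "!!i. i < n ==> w (r i) ** v (r i) = w (r i)"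
  and j: "j < n"
 shows "vsum (%i. v' i ** (w (r i) ** ~*v i)) n ** v j = v' j ** w (r j)"
proof -
 note c = psys_c[OF v] psys_c[OF v']
 have "vsum (%i. v' i ** (w (r i) ** ~*v i)) n ** v j = vsum (%i. v' i ** (w (r i) ** ~*v i) ** v j) n"
  using c w j by (simp add: vsum_mult)
 also have "... = v' j ** (w (r j) ** ~*v j) ** v j"
 proof (rule vsum_single[OF j])
  show "v' j ** (w (r j) ** ~*v j) ** v j : C" using c w j by simp
  fix i assume i: "i < n" "i ~= j"
  have "v' i ** (w (r i) ** ~*v i) ** v j = v' i ** (w (r i) ** (~*v i ** v j))" using c w j i by (simp add: mult_assoc)
  then show "v' i ** (w (r i) ** ~*v i) ** v j = \<zero>" using psys_m(2)[OF v i(1) j i(2)] c w i by simp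
 qed
 also have "... = v' j ** (w (r j) ** (~*v j ** v j))" using c w j by (simp add: mult_assoc)
 finally show ?thesis using psys_m(1)[OF v j] w j by simp
qed

lemma sys_expand: assumes "sys n r v" "x : C" shows "x = vsum (%i. x ** (v i ** ~*v i)) n"
 using mult_vsum[of x n "%i. v i ** ~*v i"] sysD[OF assms(1)] psys_c[OF sysD(1)[OF assms(1)]] assms(2) by simp

end

context tvna
begin

text \<open>For each block, \<open>comparison\<close> gives a partial isometry w from v (r i) to v'
  (r i). The sum of v' i ** w (r i) ** ~*v i is then unitary and carries one system to the
  other.\<close>

theorem sys_unitary:
 assumes f: "tcen C" and v: "sys n r v" and v': "sys n r v'" and t: "!!i. i < n ==> tr (v (r i)) = tr (v' (r i))"
 shows "EX u. unit u & (ALL i<n. ALL j<n. r i = r j --> u ** (v i ** ~*v j) ** ~*u = v' i ** ~*v' j)"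
proof -
 note p = sysD(1)[OF v] and p' = sysD(1)[OF v']
 note c = psys_c[OF p] psys_c[OF p'] psys_r[OF p]
 have "EX w. w : C & ~*w ** w = v (r i) & w ** ~*w = v' (r i) & w ** v (r i) = w & v' (r i) ** w = w" if i: "i < n" for i
 proof -
  have "proj (v (r i))" "proj (v' (r i))" using psys_rep[OF p i] psys_rep[OF p' i] c i by (auto simp: proj_def)
  then show ?thesis using comparison[OF vnsub_C f, of "v (r i)" "v' (r i)"] t[OF i] c i by blast
 qed
 \<comment> \<open>The choice is a function of the value r i, so that the indices of one block share
   the same w.\<close>
 then have "EX w. ALL i<n. w (r i) : C & ~*(w (r i)) ** w (r i) = v (r i) & w (r i) ** ~*(w (r i)) = v' (r i)
   & w (r i) ** v (r i) = w (r i) & v' (r i) ** w (r i) = w (r i)"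
  by (intro exI[of _ "%k. SOME w. w : C & ~*w ** w = v k & w ** ~*w = v' k & w ** v k = w & v' k ** w = w"] allI impI) (rule someI_ex)
 then obtain w where w: "!!i. i < n ==> w (r i) : C" "!!i. i < n ==> ~*(w (r i)) ** w (r i) = v (r i)"
  "!!i. i < n ==> w (r i) ** ~*(w (r i)) = v' (r i)" "!!i. i < n ==> w (r i) ** v (r i) = w (r i)"
  "!!i. i < n ==> v' (r i) ** w (r i) = w (r i)" by blast
 define u where "u = vsum (%i. v' i ** (w (r i) ** ~*v i)) n"
 have uc: "u : C" unfolding u_def using c w by simp
 have us: "~*u = vsum (%i. v i ** (~*(w (r i)) ** ~*v' i)) n"
  unfolding u_def using c w by (subst star_vsum) (auto simp: star_mult mult_assoc intro!: vsum_cong)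
 have uv: "u ** v j = v' j ** w (r j)" if "j < n" for j
  unfolding u_def by (rule sys_unitary_aux[OF p p' w(1) w(4) that])
 have uv': "~*u ** v' j = v j ** ~*(w (r j))" if j: "j < n" for j
  unfolding us
 proof (rule sys_unitary_aux[OF p' p _ _ j])
  fix i assume i: "i < n"
  show "~*(w (r i)) : C" using w i by simp
  show "~*(w (r i)) ** v' (r i) = ~*(w (r i))"
   using arg_cong[OF w(5)[OF i], of "vstar M"] w(1)[OF i] psys_rep[OF p' i] c i by (simp add: star_mult)
 qed
 have 1: "~*u ** u = \<one>"
 proof -
  have "~*u ** u = vsum (%i. ~*u ** u ** (v i ** ~*v i)) n" by (rule sys_expand[OF v]) (use uc in simp)
  also have "... = vsum (%i. v i ** ~*v i) n"
  proof (rule vsum_cong)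
   fix i assume i: "i < n"
   have "~*u ** u ** (v i ** ~*v i) = ~*u ** (u ** v i) ** ~*v i" using uc c i by (simp add: mult_assoc)
   also have "... = (~*u ** v' i) ** w (r i) ** ~*v i" unfolding uv[OF i] using uc c w i by (simp add: mult_assoc)
   also have "... = v i ** (~*(w (r i)) ** w (r i)) ** ~*v i" unfolding uv'[OF i] using uc c w i by (simp add: mult_assoc)
   finally show "~*u ** u ** (v i ** ~*v i) = v i ** ~*v i" unfolding w(2)[OF i] psys_right[OF p i] .
  qed
  finally show ?thesis using sysD[OF v] by simp
 qed
 have 2: "u ** ~*u = \<one>"
 proof -
  have "u ** ~*u = vsum (%i. u ** ~*u ** (v' i ** ~*v' i)) n" by (rule sys_expand[OF v']) (use uc in simp)
  also have "... = vsum (%i. v' i ** ~*v' i) n"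
  proof (rule vsum_cong)
   fix i assume i: "i < n"
   have "u ** ~*u ** (v' i ** ~*v' i) = u ** (~*u ** v' i) ** ~*v' i" using uc c i by (simp add: mult_assoc)
   also have "... = (u ** v i) ** ~*(w (r i)) ** ~*v' i" unfolding uv'[OF i] using uc c w i by (simp add: mult_assoc)
   also have "... = v' i ** (w (r i) ** ~*(w (r i))) ** ~*v' i" unfolding uv[OF i] using uc c w i by (simp add: mult_assoc)
   finally show "u ** ~*u ** (v' i ** ~*v' i) = v' i ** ~*v' i" unfolding w(3)[OF i] psys_right[OF p' i] .
  qed
  finally show ?thesis using sysD[OF v'] by simp
 qed
 have "u ** (v i ** ~*v j) ** ~*u = v' i ** ~*v' j" if ij: "i < n" "j < n" "r i = r j" for i j
 proof -
  have "u ** (v i ** ~*v j) ** ~*u = (u ** v i) ** ~*(u ** v j)" using uc c ij by (simp add: star_mult mult_assoc)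
  also have "... = v' i ** (w (r j) ** ~*(w (r j))) ** ~*v' j"
   unfolding uv[OF ij(1)] uv[OF ij(2)] ij(3) using c w(1)[OF ij(2)] ij(1,2) by (simp add: star_mult mult_assoc)
  finally show ?thesis unfolding w(3)[OF ij(2)] using psys_right[OF p' ij(1)] ij(3) by simp
 qed
 then show ?thesis using uc 1 2 by (auto simp: unit_def)
qed

subsection \<open>Relative commutants of matrix algebras\<close>

definition mgen :: "nat => (nat => 'a) => 'a set" where
 "mgen n v = {v i ** ~*v j | i j. i < n & j < n}"

text \<open>A single block with representative 0: v i plays the role of the matrix unit
  e_i0.\<close>

abbreviation msys where "msys n v \<equiv> sys n (%_. 0) v"

lemma vnsub_mgen: assumes v: "msys n v" shows "vnsub (comm (mgen n v))"
proof (rule vnsub_comm)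
 note c = psys_c[OF sysD(1)[OF v]]
 show "mgen n v \<subseteq> C" using c by (auto simp: mgen_def)
 show "~*y : mgen n v" if "y : mgen n v" for y using that c unfolding mgen_def by (force simp: star_mult)
qed

lemma msys_pos: assumes v: "msys n v" shows "0 < n"
proof (rule ccontr)
 assume "~ 0 < n"
 then have "\<one> = \<zero>" using sysD(2)[OF v] by simp
 then show False using nn_one nn_zero by (metis zero_neq_one)
qed

text \<open>The (i, j) entry of y as an element of the commutant of the matrix units: the sum over k
  of e_ki y e_jk.\<close>

definition mcoef :: "nat => (nat => 'a) => 'a => nat => nat => 'a" where
 "mcoef n v y i j = vsum (%k. v k ** ((~*v i ** (y ** v j)) ** ~*v k)) n"

context
 fixes n v assumes v: "msys n v"
begin

lemmas mc = psys_c[OF sysD(1)[OF v]]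
lemmas mm = psys_m[OF sysD(1)[OF v]]
lemmas mr = psys_right[OF sysD(1)[OF v]] psys_left[OF sysD(1)[OF v]]

text \<open>Viewing the algebra as n x n matrices over the corner of v 0, the sum is the diagonal
  matrix with all entries t. This identifies the corner with the commutant.\<close>

lemma corner_comm:
 assumes t: "t : C" "v 0 ** t = t" "t ** v 0 = t"
 shows "vsum (%k. v k ** (t ** ~*v k)) n : comm (mgen n v)"
  and "!!a. a < n ==> vsum (%k. v k ** (t ** ~*v k)) n ** v a = v a ** t"
  and "!!a. a < n ==> ~*v a ** vsum (%k. v k ** (t ** ~*v k)) n = t ** ~*v a"
proof -
 let ?s = "vsum (%k. v k ** (t ** ~*v k)) n"
 have sc: "?s : C" using mc t by simp
 have R: "?s ** v a = v a ** t" if a: "a < n" for a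
 proof -
  have "?s ** v a = vsum (%k. v k ** (t ** ~*v k) ** v a) n" using mc t a by (simp add: vsum_mult)
  also have "... = v a ** (t ** ~*v a) ** v a"
  proof (rule vsum_single[OF a])
   fix i assume i: "i < n" "i ~= a"
   have "v i ** (t ** ~*v i) ** v a = v i ** (t ** (~*v i ** v a))" using mc t a i by (simp add: mult_assoc)
   then show "v i ** (t ** ~*v i) ** v a = \<zero>" using mm(2)[OF i(1) a i(2)] mc t i by simp
  qed (use mc t a in simp)
  also have "... = v a ** (t ** (~*v a ** v a))" using mc t a by (simp add: mult_assoc)
  finally show ?thesis using mm(1)[OF a] t by simp
 qed
 have L: "~*v b ** ?s = t ** ~*v b" if b: "b < n" for b
 proof -
  have "~*v b ** ?s = vsum (%k. ~*v b ** (v k ** (t ** ~*v k))) n" using mc t b by (simp add: mult_vsum)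
  also have "... = ~*v b ** (v b ** (t ** ~*v b))"
  proof (rule vsum_single[OF b])
   fix i assume i: "i < n" "i ~= b"
   have "~*v b ** (v i ** (t ** ~*v i)) = (~*v b ** v i) ** (t ** ~*v i)" using mc t b i by (simp add: mult_assoc)
   then show "~*v b ** (v i ** (t ** ~*v i)) = \<zero>" using mm(2)[OF b i(1)] mc t i by simp
  qed (use mc t b in simp)
  also have "... = (~*v b ** v b) ** t ** ~*v b" using mc t b by (simp add: mult_assoc)
  finally show ?thesis using mm(1)[OF b] t by simp
 qed
 show "!!a. a < n ==> ?s ** v a = v a ** t" by (rule R)
 show "!!a. a < n ==> ~*v a ** ?s = t ** ~*v a" by (rule L)
 have "?s ** (v a ** ~*v b) = v a ** ~*v b ** ?s" if ab: "a < n" "b < n" for a b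
 proof -
  have "?s ** (v a ** ~*v b) = (?s ** v a) ** ~*v b" using sc mc ab by (simp add: mult_assoc)
  also have "... = v a ** (t ** ~*v b)" unfolding R[OF ab(1)] using t mc ab by (simp add: mult_assoc)
  also have "... = v a ** ~*v b ** ?s" unfolding L[OF ab(2), symmetric] using sc mc ab by (simp add: mult_assoc)
  finally show ?thesis .
 qed
 then show "?s : comm (mgen n v)" using sc by (auto simp: comm_def mgen_def)
qed

lemma corner: assumes y: "y : C" and ij: "i < n" "j < n"
 shows "~*v i ** (y ** v j) : C" "v 0 ** (~*v i ** (y ** v j)) = ~*v i ** (y ** v j)"
  "~*v i ** (y ** v j) ** v 0 = ~*v i ** (y ** v j)"
proof -
 have z: "0 < n" using ij by simp
 show "~*v i ** (y ** v j) : C" using y mc ij by simp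
 have "v 0 ** (~*v i ** (y ** v j)) = (v 0 ** ~*v i) ** (y ** v j)" using y mc ij z by (simp add: mult_assoc)
 then show "v 0 ** (~*v i ** (y ** v j)) = ~*v i ** (y ** v j)" using mr ij by simp
 have "~*v i ** (y ** v j) ** v 0 = ~*v i ** (y ** (v j ** v 0))" using y mc ij z by (simp add: mult_assoc)
 then show "~*v i ** (y ** v j) ** v 0 = ~*v i ** (y ** v j)" using mr ij by simp
qed

lemma mcoef_comm: "[|y : C; i < n; j < n|] ==> mcoef n v y i j : comm (mgen n v)"
 unfolding mcoef_def using corner by (intro corner_comm)

lemma mcoef_v: "[|y : C; i < n; j < n; a < n|] ==> mcoef n v y i j ** v a = v a ** (~*v i ** (y ** v j))"
 unfolding mcoef_def using corner by (intro corner_comm)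

text \<open>The summand for (i, j) equals e_ii y e_jj, and the diagonal units sum to 1 on both
  sides.\<close>

lemma msys_decomp:
 assumes y: "y : C"
 shows "y = vsum (%i. vsum (%j. mcoef n v y i j ** (v i ** ~*v j)) n) n"
proof (rule tau_ext[OF y])
 have sc: "mcoef n v y i j : C" if "i < n" "j < n" for i j using commD(1)[OF mcoef_comm[OF y that]] .
 show "vsum (%i. vsum (%j. mcoef n v y i j ** (v i ** ~*v j)) n) n : C" using sc mc by simp
 have e: "mcoef n v y i j ** (v i ** ~*v j) = v i ** ~*v i ** (y ** (v j ** ~*v j))" if ij: "i < n" "j < n" for i j
 proof -
  have "mcoef n v y i j ** (v i ** ~*v j) = (mcoef n v y i j ** v i) ** ~*v j" using sc mc ij by (simp add: mult_assoc)
  then show ?thesis unfolding mcoef_v[OF y ij ij(1)] using y mc ij by (simp add: mult_assoc)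
 qed
 have one: "vsum (%i. v i ** ~*v i) n = \<one>" by (rule sysD(2)[OF v])
 have "vsum (%i. vsum (%j. mcoef n v y i j ** (v i ** ~*v j)) n) n
   = vsum (%i. vsum (%j. v i ** ~*v i ** (y ** (v j ** ~*v j))) n) n"
  using e by (intro vsum_cong)
 also have "... = vsum (%i. v i ** ~*v i ** (y ** vsum (%j. v j ** ~*v j) n)) n"
  by (rule vsum_cong) (use y mc in \<open>simp add: mult_vsum\<close>)
 also have "... = vsum (%i. v i ** ~*v i ** y) n" unfolding one using y by simp
 also have "... = vsum (%i. v i ** ~*v i) n ** y" using y mc by (simp add: vsum_mult)
 finally show "tr (w ** y) = tr (w ** vsum (%i. vsum (%j. mcoef n v y i j ** (v i ** ~*v j)) n) n)" if "w : C" for w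
  unfolding one using y by simp
qed

text \<open>A central element of the commutant commutes with the entries of any y and, lying in the
  commutant, with the matrix units; by \<open>msys_decomp\<close> it is central in the whole
  algebra.\<close>

lemma tcen_mgen: assumes f: "tcen C" shows "tcen (comm (mgen n v))"
 unfolding tcen_def
proof (intro ballI impI)
 fix z assume z: "z : comm (mgen n v)" "ALL y:comm (mgen n v). z ** y = y ** z"
 have zc: "z : C" using z commD by blast
 have "z ** y = y ** z" if y: "y : C" for y
 proof -
  have sc: "mcoef n v y i j : C" if "i < n" "j < n" for i j using commD(1)[OF mcoef_comm[OF y that]] .
  have e: "z ** (mcoef n v y i j ** (v i ** ~*v j)) = mcoef n v y i j ** (v i ** ~*v j) ** z" if ij: "i < n" "j < n" for i j
  proof -
   have m: "v i ** ~*v j : mgen n v" "v i ** ~*v j : C" using ij mc by (auto simp: mgen_def)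
   have "z ** (mcoef n v y i j ** (v i ** ~*v j)) = (z ** mcoef n v y i j) ** (v i ** ~*v j)" using zc sc ij m(2) by (simp only: mult_assoc)
   also have "... = (mcoef n v y i j ** z) ** (v i ** ~*v j)" using z(2) mcoef_comm[OF y ij] by simp
   also have "... = mcoef n v y i j ** (z ** (v i ** ~*v j))" using zc sc ij m(2) by (simp only: mult_assoc)
   also have "z ** (v i ** ~*v j) = (v i ** ~*v j) ** z" by (rule commD(2)[OF z(1) m(1)])
   finally show ?thesis using zc sc ij m(2) by (simp only: mult_assoc)
  qed
  have "z ** vsum (%i. vsum (%j. mcoef n v y i j ** (v i ** ~*v j)) n) n = vsum (%i. vsum (%j. mcoef n v y i j ** (v i ** ~*v j)) n) n ** z"
   using zc sc mc by (simp add: mult_vsum vsum_mult e cong: vsum_cong)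
  then show ?thesis using msys_decomp[OF y] by simp
 qed
 then show "EX c. z = c .* \<one>" using f zc unfolding tcen_def by blast
qed

text \<open>The commutant is a copy of the corner of v 0, where e becomes e ** v 0; compressing y by
  it passes through the corner, so minimality persists in the whole algebra.\<close>

lemma minproj_mgen:
 assumes e: "minproj (comm (mgen n v)) e" shows "EX e'. minproj C e'"
proof -
 have z: "0 < n" by (rule msys_pos[OF v])
 have pe: "proj e" "e : comm (mgen n v)" "e ~= \<zero>" and m: "!!y. y : comm (mgen n v) ==> EX c. e ** y ** e = c .* e"
  using e by (auto simp: minproj_def)
 note ec = projD[OF pe(1)]
 note q = psys_rep[OF sysD(1)[OF v] z]
 have vc: "v 0 : C" using mc z .
 have ev: "e ** (v a ** ~*v b) = v a ** ~*v b ** e" if "a < n" "b < n" for a b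
  by (rule commD(2)[OF pe(2)]) (use that in \<open>auto simp: mgen_def\<close>)
 have ea: "e ** v a = v a ** (~*v 0 ** e)" if a: "a < n" for a
 proof -
  have va: "v a ** ~*v 0 = v a" using mr(1)[OF a] q by simp
  have "e ** v a = v a ** ~*v 0 ** e" using ev[OF a z] va by simp
  then show ?thesis using mc a vc ec by (simp add: mult_assoc)
 qed
 define e' where "e' = e ** v 0"
 have e'c: "e' : C" using ec vc by (simp add: e'_def)
 have com: "e ** v 0 = v 0 ** e" using ev[OF z z] q by simp
 have s: "~*e' = e'" unfolding e'_def using ec vc q com by (simp add: star_mult)
 have "e' ** e' = e ** (v 0 ** e) ** v 0" unfolding e'_def using ec vc by (simp add: mult_assoc)
 also have "... = (e ** e) ** (v 0 ** v 0)" unfolding com[symmetric] using ec(1) vc by (simp add: mult_assoc)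
 finally have i: "e' ** e' = e'" using ec q by (simp add: e'_def)
 have "e' ~= \<zero>"
 proof
  assume "e' = \<zero>"
  then have z0: "~*v 0 ** e = \<zero>" unfolding e'_def com using q by simp
  have "e ** (v a ** ~*v a) = \<zero>" if a: "a < n" for a
  proof -
   have "e ** (v a ** ~*v a) = (e ** v a) ** ~*v a" using ec mc a by (simp add: mult_assoc)
   then show ?thesis unfolding ea[OF a] z0 using mc a by simp
  qed
  then have "vsum (%i. e ** (v i ** ~*v i)) n = vsum (%i. \<zero>) n" by (intro vsum_cong)
  moreover have "vsum (%i. \<zero>) n = \<zero>" by (rule vsum_single[OF z]) auto
  ultimately have "e = \<zero>" using sys_expand[OF v ec(1)] by simp
  then show False using pe by simp
 qed
 moreover have "EX c. e' ** y ** e' = c .* e'" if y: "y : C" for y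
 proof -
  define t where "t = ~*v 0 ** (y ** v 0)"
  note t = corner[OF y z z, folded t_def]
  define b where "b = vsum (%k. v k ** (t ** ~*v k)) n"
  have b: "b : comm (mgen n v)" "b ** v 0 = v 0 ** t" unfolding b_def using corner_comm[OF t] z by auto
  have bc: "b : C" using b commD by blast
  obtain c where c: "e ** b ** e = c .* e" using m[OF b(1)] by blast
  have tv: "v 0 ** (y ** v 0) = b ** v 0" using b(2) t(2) q unfolding t_def by simp
  have "e' ** y ** e' = e ** (v 0 ** (y ** (e ** v 0)))" unfolding e'_def using ec vc y by (simp add: mult_assoc)
  also have "... = e ** (v 0 ** (y ** v 0)) ** e" unfolding com using ec vc y by (simp add: mult_assoc)
  also have "... = e ** b ** (v 0 ** e)" unfolding tv using ec vc bc by (simp add: mult_assoc)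
  also have "... = (e ** b ** e) ** v 0" unfolding com[symmetric] using ec vc bc by (simp add: mult_assoc)
  also have "... = c .* e'" unfolding c e'_def using ec vc by (simp add: smult_mult)
  finally show ?thesis by blast
 qed
 ultimately show ?thesis using e'c s i by (auto simp: minproj_def proj_def)
qed

end

text \<open>In the absence of minimal projections, projections of trace 1/n are split off one after
  the other from the remaining complement. Their sum has trace 1, so it is 1, and comparison with
  the first of them yields the column of partial isometries.\<close>

theorem ex_msys:
 assumes S: "vnsub S" and tc: "tcen S" and nm: "~ (EX e. minproj S e)" and n: "0 < n"
 shows "EX v. msys n v & (ALL i<n. v i : S)"
proof -
 have "m <= n ==> EX h. (ALL i<m. h i : S & proj (h i) & tr (h i) = of_real (1 / n)) &
   (ALL i<m. ALL j<m. i ~= j --> h i ** h j = \<zero>)" for m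
 proof (induction m)
  case (Suc m)
  then obtain h where h: "!!i. i < m ==> h i : S" "!!i. i < m ==> proj (h i)" "!!i. i < m ==> tr (h i) = of_real (1 / n)"
   "!!i j. [|i < m; j < m; i ~= j|] ==> h i ** h j = \<zero>" by auto
  note hc = projD[OF h(2)]
  define s where "s = vsum h m"
  have sc: "s : C" unfolding s_def using hc by simp
  have sS: "s : S" unfolding s_def by (rule vsum_mem[OF S h(1)])
  have ss: "~*s = s" unfolding s_def using hc by (subst star_vsum) (auto intro!: vsum_cong)
  have sh: "s ** h i = h i" "h i ** s = h i" if i: "i < m" for i
  proof -
   have "s ** h i = vsum (%k. h k ** h i) m" unfolding s_def using hc i by (simp add: vsum_mult)
   also have "... = h i ** h i" by (rule vsum_single[OF i]) (use h(4) hc i in auto)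
   finally show a: "s ** h i = h i" using hc i by simp
   show "h i ** s = h i" using arg_cong[OF a, of "vstar M"] sc ss hc i by (simp add: star_mult)
  qed
  have "s ** s = vsum (%i. s ** h i) m" unfolding s_def[of] using hc sc by (subst (2) s_def[symmetric], simp add: s_def mult_vsum)
  also have "... = s" unfolding s_def[of] using sh by (intro vsum_cong) (simp add: s_def)
  finally have si: "s ** s = s" .
  have ps: "proj s" using sc ss si by (simp add: proj_def)
  have ts: "tr s = of_real (real m / n)" unfolding s_def using hc h(3) by (simp add: tr_vsum)
  define p where "p = \<one> -- s"
  have pp: "proj p" unfolding p_def by (rule proj_compl[OF ps proj_one]) (use sc in simp)
  have pS: "p : S" unfolding p_def using sS by (intro vnsubD[OF S])
  have tp: "tr p = of_real (1 - real m / n)" unfolding p_def using sc ts by (simp add: tr_sub)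
  have mn: "real m < n" using Suc by simp
  obtain k where k: "k : S" "proj k" "p ** k = k" "tr k = of_real (1 / n)"
  proof -
   have "(EX h:S. proj h & p ** h = h & tr h = of_real (1 / n)) | (EX e. minproj S e & p ** e = e)"
   proof (rule projection_of_trace[OF S pp pS])
    \<comment> \<open>The complement has trace (n - m) / n, so the required fraction of it is 1 / (n
      - m).\<close>
    show "complex_of_real (1 / n) = of_real (1 / (real n - m)) * tr p" unfolding tp of_real_mult[symmetric]
     using mn by (intro arg_cong[of _ _ of_real]) (simp add: field_simps)
    show "1 / (real n - m) <= 1" using Suc.prems by (simp add: field_simps)
   qed (use mn in auto)
   then show ?thesis using nm that by blast
  qed
  note kc = projD[OF k(2)]
  have sk: "s ** k = \<zero>"
  proof -
   have "s ** k = s ** (p ** k)" using k by simp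
   also have "... = (s ** p) ** k" using sc kc projD[OF pp] by (simp add: mult_assoc)
   also have "s ** p = \<zero>" unfolding p_def using sc si by (simp add: vsub_def distrib_l mult_smult add_neg)
   finally show ?thesis using kc by simp
  qed
  have hk: "h i ** k = \<zero>" "k ** h i = \<zero>" if i: "i < m" for i
  proof -
   have "h i ** k = (h i ** s) ** k" using sh i by simp
   also have "... = h i ** (s ** k)" using hc i sc kc by (simp add: mult_assoc)
   finally show a: "h i ** k = \<zero>" using sk hc i by simp
   show "k ** h i = \<zero>" using arg_cong[OF a, of "vstar M"] kc hc i by (simp add: star_mult)
  qed
  show ?case
  proof (rule exI[of _ "h(m := k)"], intro conjI allI impI)
   fix i j assume "i < Suc m" "j < Suc m" "i ~= j"
   then show "(h(m := k)) i ** (h(m := k)) j = \<zero>" using h(4) hk by (auto simp: less_Suc_eq)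
  qed (use h k in \<open>auto simp: less_Suc_eq\<close>)
 qed simp
 from this[of n] obtain h where h: "!!i. i < n ==> h i : S" "!!i. i < n ==> proj (h i)" "!!i. i < n ==> tr (h i) = of_real (1 / n)"
  "!!i j. [|i < n; j < n; i ~= j|] ==> h i ** h j = \<zero>" by auto
 note hc = projD[OF h(2)]
 have "EX w. w : S & ~*w ** w = h 0 & w ** ~*w = h i & w ** h 0 = w & h i ** w = w" if i: "i < n" for i
  using comparison[OF S tc h(2)[OF n] h(1)[OF n] h(2)[OF i] h(1)[OF i]] h(3) n i by auto
 then obtain w where w: "!!i. i < n ==> w i : S" "!!i. i < n ==> ~*(w i) ** w i = h 0" "!!i. i < n ==> w i ** ~*(w i) = h i"
  "!!i. i < n ==> h i ** w i = w i" by metis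
 define v where "v i = (if i = 0 then h 0 else w i)" for i
 have vS: "v i : S" if "i < n" for i using that w h by (simp add: v_def)
 have vc: "v i : C" if "i < n" for i using vS[OF that] S vnsubD by blast
 have hv: "h i ** v i = v i" "v i ** ~*v i = h i" "~*v i ** v i = v 0" if i: "i < n" for i
  using w[OF i] hc[OF n] by (auto simp: v_def)
 have o: "~*v i ** v j = \<zero>" if ij: "i < n" "j < n" "i ~= j" for i j
 proof -
  have "~*v i ** v j = ~*(h i ** v i) ** (h j ** v j)" using hv ij by simp
  also have "... = ~*v i ** (h i ** h j) ** v j" using vc hc ij by (simp add: star_mult mult_assoc)
  finally show ?thesis using h(4) ij vc by simp
 qed
 define s where "s = vsum h n"
 have sc: "s : C" unfolding s_def using hc by simp
 have ss: "~*s = s" unfolding s_def using hc by (subst star_vsum) (auto intro!: vsum_cong)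
 have sh: "s ** h i = h i" if i: "i < n" for i
 proof -
  have "s ** h i = vsum (%k. h k ** h i) n" unfolding s_def using hc i by (simp add: vsum_mult)
  also have "... = h i ** h i" by (rule vsum_single[OF i]) (use h(4) hc i in auto)
  finally show ?thesis using hc i by simp
 qed
 have "s ** vsum h n = vsum (%i. s ** h i) n" using hc sc by (simp add: mult_vsum)
 also have "... = vsum h n" using sh by (intro vsum_cong)
 finally have "proj s" using sc ss unfolding s_def[symmetric] by (simp add: proj_def)
 then have "proj (\<one> -- s)" by (rule proj_compl[OF _ proj_one]) (use sc in simp)
 moreover have "tr (\<one> -- s) = 0" unfolding tr_sub[OF one_c sc] unfolding s_def using hc h(3) n by (simp add: tr_vsum)
 ultimately have "\<one> -- s = \<zero>" by (rule proj_zero_if_tr)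
 then have s1: "s = \<one>" using sub_eq_zero[of \<one> s] sc by simp
 have "vsum (%i. v i ** ~*v i) n = s" unfolding s_def using hv by (intro vsum_cong)
 then have "msys n v" using s1 vc hv o n by (auto simp: sys_def psys_def)
 then show ?thesis using vS by blast
qed

end

section \<open>Matrix algebras with a uniform spectral gap\<close>

text \<open>The ping-pong argument behind relative property (T) of \<open>SL\<^sub>2(\<int>) \<ltimes> \<int>\<^sup>2\<close>: a function on
  \<open>(\<int>/n)\<^sup>2\<close> that is almost invariant under a shear and a rotation and that is concentrated near
  the axis \<open>q = 0\<close> is concentrated at the origin.\<close>

lemma L2_triangle: fixes f g :: "'i => real" shows "L2_set f A <= L2_set g A + L2_set (%i. f i - g i) A"
 using L2_set_triangle_ineq[of g "%i. f i - g i" A] by simp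

lemma L2_sq: "(L2_set f A)\<^sup>2 = (\<Sum>i\<in>A. (f i)\<^sup>2)"
 unfolding L2_set_def by (simp add: sum_nonneg)

lemma L2_image: "inj_on g A ==> L2_set (%i. f (g i)) A = L2_set f (g ` A)"
 unfolding L2_set_def by (simp add: sum.reindex)

lemma L2_mono_set: "[|A \<subseteq> B; finite B|] ==> L2_set f A <= L2_set f B"
 unfolding L2_set_def by (intro real_sqrt_le_mono sum_mono2) auto

lemma L2_union: assumes "finite A" "finite B" shows "L2_set f (A \<union> B) <= L2_set f A + L2_set f B"
proof (rule power2_le_imp_le)
 have "(L2_set f (A \<union> B))\<^sup>2 <= (L2_set f A)\<^sup>2 + (L2_set f B)\<^sup>2"
  unfolding L2_sq using assms by (subst sum.union_inter[symmetric]) (auto intro: sum_nonneg)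
 also have "... <= (L2_set f A + L2_set f B)\<^sup>2" by (simp add: power2_sum)
 finally show "(L2_set f (A \<union> B))\<^sup>2 <= (L2_set f A + L2_set f B)\<^sup>2" .
qed simp

lemma ping_pong:
 fixes F :: "int \<times> int => real" and h :: int
 defines "I \<equiv> {-h..h} \<times> {-h..h}"
 assumes h: "0 <= h" and z: "F (0, 0) = 0"
  and a: "L2_set F {x : I. 3 * \<bar>snd x\<bar> > h} <= \<alpha>"
  and s: "L2_set (%x. F (fst x - 2 * snd x, snd x) - F x) I <= \<sigma>"
  and t: "L2_set (%x. F (- snd x, fst x) - F x) I <= \<tau>"
 shows "L2_set F I <= 10 * (\<alpha> + \<sigma> + \<tau>)"
proof -
 \<comment> \<open>V and H are the cones around the two axes. In V0 the shears by 2 q and -2 q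
   remain inside the box, because 3 |q| <= h; the rest of V is covered by the bound
   \<alpha>.\<close>
 define V0 where "V0 = {x : I. snd x ~= 0 & \<bar>fst x\<bar> <= \<bar>snd x\<bar> & 3 * \<bar>snd x\<bar> <= h}"
 define V where "V = {x : I. snd x ~= 0 & \<bar>fst x\<bar> <= \<bar>snd x\<bar>}"
 define H where "H = {x : I. fst x ~= 0 & \<bar>snd x\<bar> <= \<bar>fst x\<bar>}"
 define f where "f x = (fst x - 2 * snd x, snd x)" for x :: "int \<times> int"
 define g where "g x = (fst x + 2 * snd x, snd x)" for x :: "int \<times> int"
 have finI: "finite I" unfolding I_def by simp
 have fin: "finite I" "finite V0" "finite V" "finite H" unfolding V0_def V_def H_def using finI by simp_all
 have pos: "0 <= \<alpha>" "0 <= \<sigma>" "0 <= \<tau>" by (rule order_trans[OF L2_set_nonneg a] order_trans[OF L2_set_nonneg s] order_trans[OF L2_set_nonneg t])+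
 define n0 where "n0 = L2_set F V0"
 have injf: "inj_on f A" and injg: "inj_on g A" for A by (auto simp: inj_on_def f_def g_def)
 have fH: "f ` V0 \<subseteq> H" "g ` V0 \<subseteq> H" unfolding V0_def H_def f_def g_def I_def by auto
 have disj: "f ` V0 \<inter> g ` V0 = {}"
 proof -
  have "f x ~= g y" if "x : V0" "y : V0" for x y
  proof
   assume e: "f x = g y"
   then have 1: "snd x = snd y" "fst x - 2 * snd x = fst y + 2 * snd x" by (auto simp: f_def g_def)
   have 2: "snd x ~= 0" "\<bar>fst x\<bar> <= \<bar>snd x\<bar>" "\<bar>fst y\<bar> <= \<bar>snd y\<bar>" using that by (simp_all add: V0_def)
   show False using 1 2 by linarith
  qed
  then show ?thesis by blast
 qed
 have lf: "n0 - \<sigma> <= L2_set F (f ` V0)"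
 proof -
  have "n0 <= L2_set (%x. F (f x)) V0 + L2_set (%x. F x - F (f x)) V0" unfolding n0_def by (rule L2_triangle)
  also have "L2_set (%x. F x - F (f x)) V0 = L2_set (%x. F (f x) - F x) V0" unfolding L2_set_def by (simp add: power2_commute)
  also have "... <= L2_set (%x. F (f x) - F x) I" by (rule L2_mono_set) (use fin in \<open>auto simp: V0_def\<close>)
  also have "... <= \<sigma>" using s by (simp add: f_def)
  finally show ?thesis by (simp add: L2_image[OF injf])
 qed
 have lg: "n0 - \<sigma> <= L2_set F (g ` V0)"
 proof -
  have fg: "f (g x) = x" for x by (simp add: f_def g_def)
  have "n0 <= L2_set (%x. F (g x)) V0 + L2_set (%x. F x - F (g x)) V0" unfolding n0_def by (rule L2_triangle)
  also have "L2_set (%x. F x - F (g x)) V0 = L2_set (%x. F (f (g x)) - F (g x)) V0" by (simp add: fg)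
  also have "... = L2_set (%x. F (f x) - F x) (g ` V0)" by (rule L2_image[OF injg])
  also have "... <= L2_set (%x. F (f x) - F x) I" by (rule L2_mono_set) (use fin fH in \<open>auto simp: H_def\<close>)
  also have "... <= \<sigma>" using s by (simp add: f_def)
  finally show ?thesis by (simp add: L2_image[OF injg])
 qed
 have lV: "L2_set F V <= n0 + \<alpha>"
 proof -
  have "V = V0 \<union> {x : V. 3 * \<bar>snd x\<bar> > h}" unfolding V_def V0_def by auto
  then have "L2_set F V <= n0 + L2_set F {x : V. 3 * \<bar>snd x\<bar> > h}"
   unfolding n0_def using L2_union[of V0 "{x : V. 3 * \<bar>snd x\<bar> > h}" F] fin by simp
  also have "L2_set F {x : V. 3 * \<bar>snd x\<bar> > h} <= L2_set F {x : I. 3 * \<bar>snd x\<bar> > h}"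
   by (rule L2_mono_set) (use fin in \<open>auto simp: V_def\<close>)
  finally show ?thesis using a by simp
 qed
 have lH: "L2_set F H <= L2_set F V + \<tau>"
 proof -
  let ?j = "%x::int \<times> int. (- snd x, fst x)"
  have "L2_set F H <= L2_set (%x. F (?j x)) H + L2_set (%x. F x - F (?j x)) H" by (rule L2_triangle)
  also have "L2_set (%x. F x - F (?j x)) H = L2_set (%x. F (?j x) - F x) H" unfolding L2_set_def by (simp add: power2_commute)
  also have "... <= L2_set (%x. F (?j x) - F x) I" by (rule L2_mono_set) (use fin in \<open>auto simp: H_def\<close>)
  also have "L2_set (%x. F (?j x)) H = L2_set F (?j ` H)" by (rule L2_image) (auto simp: inj_on_def)
  also have "... <= L2_set F V" by (rule L2_mono_set) (use fin in \<open>auto simp: H_def V_def I_def\<close>)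
  finally show ?thesis using t by simp
 qed
 \<comment> \<open>The two shears send V0 to disjoint parts of H, each carrying nearly the norm n0,
   while the rotation bounds H by V. So sqrt 2 times n0 is at most n0 up to the errors, and 7/5 <
   sqrt 2 leaves a definite margin.\<close>
 have n0: "n0 <= 4 * (\<alpha> + \<sigma> + \<tau>)"
 proof (cases "n0 <= \<sigma>")
  case False
  have nz: "0 <= n0 - \<sigma>" using False by simp
  have "2 * (n0 - \<sigma>)\<^sup>2 <= (L2_set F (f ` V0))\<^sup>2 + (L2_set F (g ` V0))\<^sup>2"
   using power_mono[OF lf nz, of 2] power_mono[OF lg nz, of 2] by linarith
  also have "... = (L2_set F (f ` V0 \<union> g ` V0))\<^sup>2" unfolding L2_sq by (rule sum.union_disjoint[symmetric]) (use fin disj in auto)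
  also have "... <= (L2_set F H)\<^sup>2" by (intro power_mono L2_mono_set) (use fH fin in auto)
  also have "... <= (n0 + \<alpha> + \<tau>)\<^sup>2" using lV lH by (intro power_mono) auto
  finally have "(sqrt 2 * (n0 - \<sigma>))\<^sup>2 <= (n0 + \<alpha> + \<tau>)\<^sup>2" by (simp add: power_mult_distrib)
  then have i: "sqrt 2 * (n0 - \<sigma>) <= n0 + \<alpha> + \<tau>" by (rule power2_le_imp_le) (use False pos in simp)
  have "(7/5)\<^sup>2 <= (sqrt 2)\<^sup>2" by (simp add: power2_eq_square)
  then have "7/5 <= sqrt 2" by (rule power2_le_imp_le) simp
  then have "7/5 * (n0 - \<sigma>) <= sqrt 2 * (n0 - \<sigma>)" using False by (intro mult_right_mono) auto
  then show ?thesis using i pos by simp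
 qed (use pos in simp)
 have "I \<subseteq> insert (0, 0) (V \<union> H)" unfolding V_def H_def I_def by auto
 then have "L2_set F I <= L2_set F ({(0, 0)} \<union> (V \<union> H))" by (intro L2_mono_set) (use fin in auto)
 also have "... <= L2_set F {(0, 0)} + L2_set F (V \<union> H)" by (rule L2_union) (use fin in auto)
 also have "L2_set F {(0, 0)} = 0" using z by (simp add: L2_set_def)
 finally have "L2_set F I <= L2_set F V + L2_set F H" using L2_union[of V H F] fin by simp
 then show ?thesis using lV lH n0 pos by simp
qed

section \<open>Roots of unity, Weyl operators and the Fourier matrix on Z/n\<close>

definition ww :: "nat => int => complex" where "ww n m = cis (2 * pi * of_int m / real n)"

lemma ww_add: "ww n (a + b) = ww n a * ww n b"
 unfolding ww_def by (simp add: cis_mult add_divide_distrib distrib_left)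

lemma ww_zero [simp]: "ww n 0 = 1" by (simp add: ww_def)
lemma ww_norm [simp]: "cmod (ww n a) = 1" by (simp add: ww_def)
lemma ww_cnj: "cnj (ww n a) = ww n (- a)" by (simp add: ww_def cis_cnj)

lemma ww_dvd: assumes "0 < n" "int n dvd a" shows "ww n a = 1"
proof -
 obtain k where "a = int n * k" using assms by auto
 then have "2 * pi * of_int a / real n = 2 * pi * of_int k" using assms by simp
 then show ?thesis unfolding ww_def by (simp only: cis_multiple_2pi[OF Ints_of_int])
qed

lemma ww_cong: assumes "0 < n" "int n dvd a - b" shows "ww n a = ww n b"
 using ww_add[of n "a - b" b] ww_dvd[OF assms] by simp

lemma ww_eq_1: assumes n: "0 < n" and e: "ww n a = 1" shows "int n dvd a"
proof -
 have "exp (\<i> * of_real (2 * pi * of_int a / real n)) = 1" using e unfolding ww_def cis_conv_exp .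
 then obtain k :: int where "2 * pi * of_int a / real n = of_int (2 * k) * pi" unfolding exp_eq_1 by auto
 then have "real_of_int a = real_of_int (int n * k)" using n by (simp add: field_simps)
 then have "a = int n * k" by (simp only: of_int_eq_iff)
 then show ?thesis by simp
qed

text \<open>The box -h..h is a full set of residues modulo n, and multiplication by ww n m shifts
  the summation index by one. So this factor fixes the sum, which must vanish unless the factor is
  1.\<close>

lemma ww_sum:
 assumes n: "int n = 2 * h + 1" "0 <= h"
 shows "(\<Sum>p\<in>{-h..h}. ww n (p * m)) = (if int n dvd m then of_nat n else 0)"
proof (cases "int n dvd m")
 case True
 then have "ww n (p * m) = 1" for p using n by (intro ww_dvd) (linarith, simp)
 moreover have "card {-h..h} = n" using n by simp
 ultimately show ?thesis using True by simp
next
 case False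
 let ?f = "%p. ww n (p * m)"
 let ?S = "\<Sum>p\<in>{-h..h}. ?f p"
 have n0: "0 < n" using n by linarith
 have "ww n m * ?S = (\<Sum>p\<in>{-h..h}. ?f (p + 1))" unfolding sum_distrib_left
  by (rule sum.cong) (auto simp: ww_add[symmetric] algebra_simps)
 also have "... = sum ?f ((%p. p + 1) ` {-h..h})" by (subst sum.reindex) auto
 also have "(%p. p + 1) ` {-h..h} = insert (h + 1) {-h+1..h}" using n(2) by (auto simp: image_iff)
 also have "sum ?f ... = ?f (h + 1) + sum ?f {-h+1..h}" by simp
 also have "?f (h + 1) = ?f (- h)" 
 proof (rule ww_cong[OF n0])
  have "(h + 1) * m - (- h) * m = int n * m" using n by (simp add: algebra_simps)
  then show "int n dvd (h + 1) * m - (- h) * m" by simp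
 qed
 also have "?f (- h) + sum ?f {-h+1..h} = sum ?f (insert (-h) {-h+1..h})" by simp
 also have "insert (-h) {-h+1..h} = {-h..h}" using n(2) by auto
 finally have "(ww n m - 1) * ?S = 0" by (simp add: left_diff_distrib)
 moreover have "ww n m ~= 1" using ww_eq_1[OF n0] False by blast
 ultimately show ?thesis using False by simp
qed

lemma ww_sum_nat:
 assumes n: "int n = 2 * h + 1" "0 <= h"
 shows "(\<Sum>i<n. ww n (int i * m)) = (if int n dvd m then of_nat n else 0)"
proof -
 have n0: "0 < n" using n by linarith
 have "(\<Sum>i<n. ww n (int i * m)) = (\<Sum>p\<in>{-h..h}. ww n (p * m))"
 proof (rule sum.reindex_bij_witness[where i = "%p. nat (p mod int n)" and j = "%i. if int i <= h then int i else int i - int n"])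
  fix p assume p: "p : {-h..h}"
  show "nat (p mod int n) : {..<n}" using n0 by (simp add: nat_less_iff)
  show "(if int (nat (p mod int n)) <= h then int (nat (p mod int n)) else int (nat (p mod int n)) - int n) = p"
  proof (cases "0 <= p")
   case True then show ?thesis using p n by simp
  next
   case False
   then have "p mod int n = p + int n" using p n by (intro mod_pos_pos_trivial[of "p + int n" "int n", simplified]) auto
   then show ?thesis using False p n by simp
  qed
 next
  fix i assume i: "i : {..<n}"
  show "(if int i <= h then int i else int i - int n) : {-h..h}" using i n by auto
  show "nat ((if int i <= h then int i else int i - int n) mod int n) = i"
  proof -
   have "(if int i <= h then int i else int i - int n) mod int n = int (i mod n)" by (simp add: zmod_int)
   then show ?thesis using i by simp
  qed
  show "ww n ((if int i <= h then int i else int i - int n) * m) = ww n (int i * m)"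
   by (rule ww_cong[OF n0]) (simp add: left_diff_distrib)
 qed
 then show ?thesis using ww_sum[OF n] by simp
qed

text \<open>The angle lies between \<pi> / 6 and \<pi> in absolute value, because n = 2 h + 1 <= 12
  |q|. Hence the squared distance 2 - 2 cos \<theta> is at least 2 - sqrt 3, which exceeds
  1/4.\<close>

lemma ww_gap:
 assumes n: "int n = 2 * h + 1" and q: "\<bar>q\<bar> <= h" "3 * \<bar>q\<bar> > h"
 shows "1/2 <= cmod (ww n q - 1)"
proof (rule power2_le_imp_le)
 define \<theta> where "\<theta> = 2 * pi * of_int q / real n"
 have nr: "real n = 2 * of_int h + 1" using arg_cong[OF n, of real_of_int] by simp
 have "0 < n" using n q by linarith
 then have n0: "real n > 0" by simp
 have a: "\<bar>\<theta>\<bar> = 2 * pi * of_int \<bar>q\<bar> / real n" using n0 by (simp add: \<theta>_def abs_mult)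
 have q3: "3 * real_of_int \<bar>q\<bar> >= of_int h + 1" "real_of_int \<bar>q\<bar> <= of_int h" "real_of_int h >= 0" using q by linarith+
 have "\<bar>\<theta>\<bar> <= pi"
 proof -
  have "pi * (2 * real_of_int \<bar>q\<bar>) <= pi * real n" using nr q3 by (intro mult_left_mono) auto
  then show ?thesis unfolding a using n0 by (simp add: divide_le_eq mult_ac)
 qed
 moreover have "pi / 6 <= \<bar>\<theta>\<bar>"
 proof -
  have "pi * real n <= pi * (12 * real_of_int \<bar>q\<bar>)" using nr q3 by (intro mult_left_mono) auto
  then show ?thesis unfolding a using n0 by (simp add: divide_simps mult_ac)
 qed
 ultimately have "cos \<bar>\<theta>\<bar> <= cos (pi / 6)" by (intro cos_monotone_0_pi_le) auto
 then have c: "cos \<theta> <= sqrt 3 / 2" by (simp add: cos_30)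
 have "(sqrt 3)\<^sup>2 <= (7/4)\<^sup>2" by (simp add: power2_eq_square)
 then have s: "sqrt 3 <= 7/4" by (rule power2_le_imp_le) simp
 have "(cmod (ww n q - 1))\<^sup>2 = (cos \<theta> - 1)\<^sup>2 + (sin \<theta>)\<^sup>2" by (simp add: cmod_power2 ww_def \<theta>_def)
 also have "... = 2 - 2 * cos \<theta>" using sin_cos_squared_add[of \<theta>] by (simp add: power2_eq_square algebra_simps)
 finally show "(1/2)\<^sup>2 <= (cmod (ww n q - 1))\<^sup>2" using c s by (simp add: power2_eq_square)
qed simp

text \<open>Entries of a Weyl operator: the diagonal character of frequency p times the cyclic shift
  by q. The box of pairs (p, q) represents (Z/n)^2.\<close>

definition WW :: "nat => int => int => nat => nat => complex" where
 "WW n p q i j = (if int n dvd int i - int j - q then ww n (p * int i) else 0)"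

text \<open>The sum runs over the operators for fixed entries, so this is the completeness relation
  of the Weyl basis. The sum over p forces i = k; the sum over q picks the single shift that links i
  to j.\<close>

lemma WW_orth:
 assumes n: "int n = 2 * h + 1" "0 <= h" and ij: "i < n" "j < n" "k < n" "l < n"
 shows "(\<Sum>x\<in>{-h..h} \<times> {-h..h}. WW n (fst x) (snd x) i j * cnj (WW n (fst x) (snd x) k l))
  = (if i = k & j = l then of_nat n else 0)"
proof -
 have dv: "int n dvd int a - int b \<longleftrightarrow> a = b" if "a < n" "b < n" for a b
  using that by (metis (full_types) dvd_0_right eq_iff_diff_eq_0 mod_eq_dvd_iff mod_less of_nat_eq_iff zmod_int)
 define Q where "Q q \<longleftrightarrow> int n dvd int i - int j - q & int n dvd int k - int l - q" for q
 have "(\<Sum>x\<in>{-h..h} \<times> {-h..h}. WW n (fst x) (snd x) i j * cnj (WW n (fst x) (snd x) k l))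
   = (\<Sum>p\<in>{-h..h}. \<Sum>q\<in>{-h..h}. WW n p q i j * cnj (WW n p q k l))"
  by (simp add: sum.cartesian_product case_prod_beta)
 also have "... = (\<Sum>p\<in>{-h..h}. \<Sum>q\<in>{-h..h}. ww n (p * (int i - int k)) * (if Q q then 1 else 0))"
  by (intro sum.cong refl) (auto simp: WW_def Q_def ww_cnj ww_add[symmetric] algebra_simps)
 also have "... = (\<Sum>p\<in>{-h..h}. ww n (p * (int i - int k))) * (\<Sum>q\<in>{-h..h}. if Q q then 1 else 0)"
  by (simp add: sum_product)
 also have "(\<Sum>p\<in>{-h..h}. ww n (p * (int i - int k))) = (if i = k then of_nat n else 0)"
  using ww_sum[OF n, of "int i - int k"] dv[of i k] ij by simp
 also have "(\<Sum>q\<in>{-h..h}. if Q q then 1 else 0) = (if j = l then 1 else 0 :: complex)" if "i = k"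
 proof (cases "j = l")
  case True
  \<comment> \<open>The representative of i - j in the symmetric interval -h..h.\<close>
  define d where "d = (int i - int j + h) mod int n - h"
  have dd: "int n dvd int i - int j - d"
   unfolding d_def using mod_eq_dvd_iff[of "int i - int j + h" "int n" "(int i - int j + h) mod int n"] by (simp add: algebra_simps)
  have dI: "d : {-h..h}" unfolding d_def using n pos_mod_bound[of "int n" "int i - int j + h"] by simp
  have uq: "q = d" if q: "q : {-h..h}" "int n dvd int i - int j - q" for q
  proof -
   have "int n dvd (int i - int j - d) - (int i - int j - q)" by (rule dvd_diff[OF dd q(2)])
   then have "int n dvd q - d" by simp
   moreover have "\<bar>q - d\<bar> < int n" using q(1) dI n by auto
   ultimately show ?thesis using zdvd_not_zless[of "\<bar>q - d\<bar>" "int n"] by fastforce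
  qed
  have "Q q \<longleftrightarrow> q = d" if "q : {-h..h}" for q
   unfolding Q_def \<open>i = k\<close>[symmetric] True[symmetric] using uq[OF that] dd by blast
  then have "(\<Sum>q\<in>{-h..h}. if Q q then 1 else 0) = (\<Sum>q\<in>{-h..h}. if q = d then 1 else 0 :: complex)"
   by (intro sum.cong refl) simp
  then show ?thesis using dI True by simp
 next
  case False
  have "~ Q q" for q
  proof
   assume "Q q"
   then have "int n dvd (int k - int l - q) - (int i - int j - q)" unfolding Q_def by (elim conjE) (rule dvd_diff)
   moreover have "(int k - int l - q) - (int i - int j - q) = int j - int l" using \<open>i = k\<close> by simp
   ultimately have "int n dvd int j - int l" by (simp only:)
   then show False using dv ij False by simp
  qed
  then show ?thesis using False by simp
 qed
 ultimately show ?thesis by (cases "i = k") auto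
qed

text \<open>The three unitaries act on the Weyl basis by a character, a shear and a rotation.\<close>

definition conjm :: "nat => (nat => nat => complex) => (nat => nat => complex) => nat => nat => complex" where
 "conjm n x W k l = (\<Sum>i<n. \<Sum>j<n. W i j * cnj (x i k) * x j l)"

definition dia :: "(nat => complex) => nat => nat => complex" where "dia d i k = (if i = k then d i else 0)"

lemma conjm_dia: "[|k < n; l < n|] ==> conjm n (dia d) W k l = W k l * cnj (d k) * d l"
proof -
 assume kl: "k < n" "l < n"
 have "conjm n (dia d) W k l = (\<Sum>i<n. \<Sum>j<n. if j = l then (if i = k then W k l * cnj (d k) * d l else 0) else 0)"
  unfolding conjm_def dia_def by (intro sum.cong) auto
 then show ?thesis using kl by simp
qed

text \<open>The clock matrix; \<open>xd\<close> below is the quadratic chirp and \<open>xf\<close>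
  the discrete Fourier matrix.\<close>

definition xu :: "nat => nat => nat => complex" where "xu n = dia (%i. ww n (int i))"
definition xd :: "nat => nat => nat => complex" where "xd n = dia (%i. ww n (int i * int i))"
definition xf :: "nat => nat => nat => complex" where "xf n i k = ww n (int i * int k) / of_real (sqrt n)"

lemma conj_xu: "[|0 < n; k < n; l < n|] ==> conjm n (xu n) (WW n p q) k l = ww n (- q) * WW n p q k l"
proof -
 assume a: "0 < n" "k < n" "l < n"
 have "cnj (ww n (int k)) * ww n (int l) = ww n (- q)" if "int n dvd int k - int l - q"
  unfolding ww_cnj ww_add[symmetric] by (rule ww_cong[OF a(1)]) (use dvd_minus_iff[THEN iffD2, OF that] in \<open>simp add: algebra_simps\<close>)
 then show ?thesis using a unfolding xu_def conjm_dia[OF a(2,3)] by (auto simp: WW_def mult_ac)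
qed

lemma conj_xd: "[|0 < n; k < n; l < n|] ==> conjm n (xd n) (WW n p q) k l = ww n (q * q) * WW n (p - 2 * q) q k l"
proof -
 assume a: "0 < n" "k < n" "l < n"
 have "ww n (p * int k) * (cnj (ww n (int k * int k)) * ww n (int l * int l)) = ww n (q * q) * ww n ((p - 2 * q) * int k)"
  if d: "int n dvd int k - int l - q"
  unfolding ww_cnj ww_add[symmetric]
 proof (rule ww_cong[OF a(1)])
  have "p * int k + (- (int k * int k) + int l * int l) - (q * q + (p - 2 * q) * int k)
   = (int k - int l - q) * (q - int l - int k)" by (simp add: algebra_simps)
  then show "int n dvd p * int k + (- (int k * int k) + int l * int l) - (q * q + (p - 2 * q) * int k)"
   using d by simp
 qed
 then show ?thesis using a unfolding xd_def conjm_dia[OF a(2,3)] by (auto simp: WW_def mult_ac)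
qed

lemma conj_xf:
 assumes n: "int n = 2 * h + 1" "0 <= h" and kl: "k < n" "l < n"
 shows "conjm n (xf n) (WW n p q) k l = ww n (q * p) * WW n (- q) p k l"
proof -
 have n0: "0 < n" using n by linarith
 have sq: "complex_of_real (sqrt n) * complex_of_real (sqrt n) = of_nat n" by (simp flip: of_real_mult)
 have inner: "(\<Sum>j<n. WW n p q i j * cnj (xf n i k) * xf n j l) = ww n (int i * (p - int k + int l)) * ww n (- (q * int l)) / of_nat n"
  if i: "i < n" for i
 proof -
  \<comment> \<open>Row i of a Weyl operator has exactly one nonzero entry, in column i - q modulo
    n.\<close>
  define j0 where "j0 = nat ((int i - q) mod int n)"
  have j0: "j0 < n" "int j0 = (int i - q) mod int n" unfolding j0_def using n0 by (auto simp: nat_less_iff)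
  have dd: "int n dvd int i - int j0 - q" using j0(2) mod_eq_dvd_iff[of "int i - q" "int n" "(int i - q) mod int n"] by (simp add: algebra_simps)
  have un: "j = j0" if "j < n" "int n dvd int i - int j - q" for j
  proof -
   have "int n dvd (int i - int j0 - q) - (int i - int j - q)" by (rule dvd_diff[OF dd that(2)])
   then have "int n dvd int j - int j0" by simp
   moreover have "\<bar>int j - int j0\<bar> < int n" using that(1) j0(1) by auto
   ultimately show ?thesis using zdvd_not_zless[of "\<bar>int j - int j0\<bar>" "int n"] by fastforce
  qed
  have "WW n p q i j = 0" if "j < n" "j ~= j0" for j using un[OF that(1)] that(2) unfolding WW_def by metis
  then have "(\<Sum>j<n. WW n p q i j * cnj (xf n i k) * xf n j l) = (\<Sum>j<n. if j = j0 then WW n p q i j0 * cnj (xf n i k) * xf n j0 l else 0)"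
   by (intro sum.cong refl) simp
  also have "... = ww n (p * int i) * cnj (xf n i k) * xf n j0 l" using j0 dd by (simp add: WW_def)
  also have "... = ww n (p * int i) * ww n (- (int i * int k)) * ww n (int j0 * int l) / of_nat n"
   by (simp add: xf_def ww_cnj sq)
  also have "ww n (int j0 * int l) = ww n ((int i - q) * int l)"
  proof (rule ww_cong[OF n0])
   have "int j0 * int l - (int i - q) * int l = (int i - int j0 - q) * (- int l)" by (simp add: algebra_simps)
   then show "int n dvd int j0 * int l - (int i - q) * int l" using dd by simp
  qed
  also have "ww n (p * int i) * ww n (- (int i * int k)) * ww n ((int i - q) * int l)
   = ww n (int i * (p - int k + int l)) * ww n (- (q * int l))"
   unfolding ww_add[symmetric] by (rule arg_cong[of _ _ "ww n"]) (simp add: algebra_simps)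
  finally show ?thesis .
 qed
 have "conjm n (xf n) (WW n p q) k l = (\<Sum>i<n. ww n (int i * (p - int k + int l))) * ww n (- (q * int l)) / of_nat n"
  unfolding conjm_def by (simp add: inner sum_distrib_right sum_divide_distrib)
 also have "... = (if int n dvd p - int k + int l then ww n (- (q * int l)) else 0)"
  using n0 unfolding ww_sum_nat[OF n] by simp
 also have "... = ww n (q * p) * WW n (- q) p k l"
 proof -
  have e: "int n dvd p - int k + int l \<longleftrightarrow> int n dvd int k - int l - p"
   using dvd_minus_iff[of "int n" "p - int k + int l"] by (simp add: algebra_simps)
  have "ww n (- (q * int l)) = ww n (q * p) * ww n (- q * int k)" if d: "int n dvd p - int k + int l"
   unfolding ww_add[symmetric]
  proof (rule ww_cong[OF n0])
   have "- (q * int l) - (q * p + - q * int k) = (p - int k + int l) * (- q)" by (simp add: algebra_simps)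
   then show "int n dvd - (q * int l) - (q * p + - q * int k)" using d by simp
  qed
  then show ?thesis unfolding WW_def e[symmetric] by simp
 qed
 finally show ?thesis .
qed

definition unim :: "nat => (nat => nat => complex) => bool" where
 "unim n x \<longleftrightarrow> (ALL i<n. ALL j<n. (\<Sum>k<n. x i k * cnj (x j k)) = (if i = j then 1 else 0))"

lemma unim_dia: assumes "!!i. cmod (d i) = 1" shows "unim n (dia d)"
 unfolding unim_def
proof (intro allI impI)
 fix i j assume ij: "i < n" "j < n"
 have "(\<Sum>k<n. dia d i k * cnj (dia d j k)) = (\<Sum>k<n. if k = i then (if i = j then d i * cnj (d i) else 0) else 0)"
  unfolding dia_def by (intro sum.cong) auto
 then show "(\<Sum>k<n. dia d i k * cnj (dia d j k)) = (if i = j then 1 else 0)"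
  using ij assms[of i] assms[of j] by (simp add: complex_norm_square[symmetric])
qed

lemma unim_x: assumes n: "int n = 2 * h + 1" "0 <= h" shows "unim n (xu n)" "unim n (xd n)" "unim n (xf n)"
proof -
 show "unim n (xu n)" "unim n (xd n)" unfolding xu_def xd_def by (rule unim_dia, simp)+
 have n0: "0 < n" using n by linarith
 have dv: "int n dvd int a - int b \<longleftrightarrow> a = b" if "a < n" "b < n" for a b
  using that by (metis (full_types) dvd_0_right eq_iff_diff_eq_0 mod_eq_dvd_iff mod_less of_nat_eq_iff zmod_int)
 have sq: "complex_of_real (sqrt n) * complex_of_real (sqrt n) = of_nat n" by (simp flip: of_real_mult)
 show "unim n (xf n)" unfolding unim_def
 proof (intro allI impI)
  fix i j assume ij: "i < n" "j < n"
  have "(\<Sum>k<n. xf n i k * cnj (xf n j k)) = (\<Sum>k<n. ww n (int k * (int i - int j))) / of_nat n"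
   unfolding sum_divide_distrib by (intro sum.cong refl) (simp add: xf_def ww_cnj sq ww_add[symmetric] algebra_simps)
  then show "(\<Sum>k<n. xf n i k * cnj (xf n j k)) = (if i = j then 1 else 0)"
   unfolding ww_sum_nat[OF n] using dv[OF ij] n0 by simp
 qed
qed

lemma sum_swap4:
 fixes f :: "'a => 'a => 'a => 'a => complex"
 shows "(\<Sum>i\<in>A. \<Sum>j\<in>A. \<Sum>k\<in>A. \<Sum>l\<in>A. f i j k l) = (\<Sum>k\<in>A. \<Sum>l\<in>A. \<Sum>i\<in>A. \<Sum>j\<in>A. f i j k l)"
proof -
 have "(\<Sum>i\<in>A. \<Sum>j\<in>A. \<Sum>k\<in>A. \<Sum>l\<in>A. f i j k l) = (\<Sum>i\<in>A. \<Sum>k\<in>A. \<Sum>j\<in>A. \<Sum>l\<in>A. f i j k l)"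
  by (rule sum.cong[OF refl], rule sum.swap)
 also have "... = (\<Sum>k\<in>A. \<Sum>i\<in>A. \<Sum>j\<in>A. \<Sum>l\<in>A. f i j k l)" by (rule sum.swap)
 also have "... = (\<Sum>k\<in>A. \<Sum>i\<in>A. \<Sum>l\<in>A. \<Sum>j\<in>A. f i j k l)"
  by (rule sum.cong[OF refl], rule sum.cong[OF refl], rule sum.swap)
 also have "... = (\<Sum>k\<in>A. \<Sum>l\<in>A. \<Sum>i\<in>A. \<Sum>j\<in>A. f i j k l)"
  by (rule sum.cong[OF refl], rule sum.swap)
 finally show ?thesis .
qed

section \<open>Scalar matrices and Weyl coefficients over a system of matrix units\<close>

context tvna
begin

context
 fixes n v assumes v: "msys n v"
begin

lemmas vc = psys_c[OF sysD(1)[OF v]]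
lemmas vm = psys_m[OF sysD(1)[OF v]]
lemmas vr = psys_right[OF sysD(1)[OF v]] psys_left[OF sysD(1)[OF v]]

definition mat :: "(nat => nat => complex) => 'a" where
 "mat x = vsum (%i. vsum (%j. x i j .* (v i ** ~*v j)) n) n"

lemma mat_c [simp]: "mat x : C" unfolding mat_def using vc by simp

lemma mat_row: assumes a: "a < n" shows "~*v a ** mat x = vsum (%j. x a j .* ~*v j) n"
proof -
 have "~*v a ** mat x = vsum (%i. vsum (%j. x i j .* (~*v a ** v i ** ~*v j)) n) n"
  unfolding mat_def using vc a by (subst mult_vsum) (auto simp: mult_vsum mult_smult mult_assoc intro!: vsum_cong)
 also have "... = vsum (%j. x a j .* (~*v a ** v a ** ~*v j)) n"
 proof (rule vsum_single[OF a])
  show "vsum (%j. x a j .* (~*v a ** v a ** ~*v j)) n : C" using vc a by simp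
  fix i assume i: "i < n" "i ~= a"
  have "vsum (%j. x i j .* (~*v a ** v i ** ~*v j)) n = vsum (%j. \<zero>) n"
   by (rule vsum_cong) (use vm(2)[OF a i(1)] i vc in simp)
  also have "... = \<zero>" by (rule vsum_single[OF a]) auto
  finally show "vsum (%j. x i j .* (~*v a ** v i ** ~*v j)) n = \<zero>" .
 qed
 also have "... = vsum (%j. x a j .* ~*v j) n" using vm(1)[OF a] vr(2) by (intro vsum_cong) simp
 finally show ?thesis .
qed

lemma mat_col: assumes a: "a < n" shows "~*mat x ** v a = vsum (%j. cnj (x a j) .* v j) n"
proof -
 have "~*mat x ** v a = ~*(~*v a ** mat x)" using vc[OF a] by (simp add: star_mult)
 also have "... = vsum (%j. cnj (x a j) .* v j) n" unfolding mat_row[OF a] using vc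
  by (subst star_vsum) (auto simp: star_smult intro!: vsum_cong)
 finally show ?thesis .
qed

lemma mat_comm: assumes z: "z : comm (mgen n v)" shows "z ** mat x = mat x ** z"
proof -
 have zc: "z : C" using z commD by blast
 have e: "z ** (v i ** ~*v j) = v i ** ~*v j ** z" if "i < n" "j < n" for i j
  by (rule commD(2)[OF z]) (use that in \<open>auto simp: mgen_def\<close>)
 show ?thesis unfolding mat_def using zc vc e
  by (simp add: mult_vsum vsum_mult mult_smult smult_mult cong: vsum_cong)
qed

lemma row_parseval: assumes y: "y : C" shows "(nn y)\<^sup>2 = (\<Sum>i<n. (nn (~*v i ** y))\<^sup>2)"
proof -
 have "tr (~*y ** y) = tr (~*y ** (vsum (%i. v i ** ~*v i) n ** y))" using sysD(2)[OF v] y by simp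
 also have "... = (\<Sum>i<n. tr (~*y ** (v i ** ~*v i ** y)))" using y vc by (simp add: vsum_mult tr_mult_vsum)
 also have "... = (\<Sum>i<n. of_real ((nn (~*v i ** y))\<^sup>2))"
  using y vc by (intro sum.cong refl) (simp add: tr_nn[symmetric] star_mult mult_assoc del: of_real_power)
 finally have "complex_of_real ((nn y)\<^sup>2) = of_real (\<Sum>i<n. (nn (~*v i ** y))\<^sup>2)"
  using tr_nn[OF y] by simp
 then show ?thesis by (simp only: of_real_eq_iff)
qed

lemma entry_parseval: assumes y: "y : C" shows "(nn y)\<^sup>2 = (\<Sum>i<n. \<Sum>j<n. (nn (~*v i ** (y ** v j)))\<^sup>2)"
proof -
 have "(nn (~*v i ** y))\<^sup>2 = (\<Sum>j<n. (nn (~*v i ** (y ** v j)))\<^sup>2)" if i: "i < n" for i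
 proof -
  have "(nn (~*v i ** y))\<^sup>2 = (nn (~*(~*v i ** y)))\<^sup>2" using y vc[OF i] by simp
  also have "... = (\<Sum>j<n. (nn (~*v j ** ~*(~*v i ** y)))\<^sup>2)" by (rule row_parseval) (use y vc[OF i] in simp)
  also have "... = (\<Sum>j<n. (nn (~*v i ** (y ** v j)))\<^sup>2)"
  proof (intro sum.cong refl)
   fix j assume "j : {..<n}"
   then have j: "j < n" by simp
   have "~*v j ** ~*(~*v i ** y) = ~*(~*v i ** (y ** v j))" using y vc i j by (simp add: star_mult mult_assoc)
   then show "(nn (~*v j ** ~*(~*v i ** y)))\<^sup>2 = (nn (~*v i ** (y ** v j)))\<^sup>2" using y vc i j by simp
  qed
  finally show ?thesis .
 qed
 then show ?thesis unfolding row_parseval[OF y] by simp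
qed

text \<open>All entries of mat x ** ~*mat x - 1 vanish, and by \<open>entry_parseval\<close> the
  2-norm is computed from the entries.\<close>

lemma mat_unim: assumes x: "unim n x" shows "mat x ** ~*mat x = \<one>"
proof -
 let ?Z = "mat x ** ~*mat x"
 have e: "~*v i ** (?Z ** v j) = (if i = j then v 0 else \<zero>)" if ij: "i < n" "j < n" for i j
 proof (rule tau_ext)
  have n0: "0 < n" using ij by simp
  fix w assume w: "w : C"
  have "~*v i ** (?Z ** v j) = (~*v i ** mat x) ** (~*mat x ** v j)" using vc ij by (simp add: mult_assoc)
  also have "... = vsum (%k. vsum (%l. (x i k * cnj (x j l)) .* (~*v k ** v l)) n) n"
   unfolding mat_row[OF ij(1)] mat_col[OF ij(2)] using vc
   by (subst vsum_mult) (auto simp: mult_vsum mult_smult smult_mult smult_smult smult_vsum mult.commute intro!: vsum_cong)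
  finally have "tr (w ** (~*v i ** (?Z ** v j))) = (\<Sum>k<n. \<Sum>l<n. x i k * cnj (x j l) * tr (w ** (~*v k ** v l)))"
   using w vc by (simp add: tr_mult_vsum mult_smult tr_smult)
  also have "... = (\<Sum>k<n. \<Sum>l<n. if l = k then x i k * cnj (x j k) * tr (w ** v 0) else 0)"
   by (intro sum.cong refl) (use vm w in auto)
  also have "... = (\<Sum>k<n. x i k * cnj (x j k)) * tr (w ** v 0)" by (simp add: sum_distrib_right)
  also have "... = tr (w ** (if i = j then v 0 else \<zero>))" using x ij w unfolding unim_def by simp
  finally show "tr (w ** (~*v i ** (?Z ** v j))) = tr (w ** (if i = j then v 0 else \<zero>))" .
 qed (use vc ij in auto)
 have "nn (?Z -- \<one>) = 0"
 proof -
  have "~*v i ** ((?Z -- \<one>) ** v j) = \<zero>" if ij: "i < n" "j < n" for i j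
  proof -
   have "~*v i ** ((?Z -- \<one>) ** v j) = ~*v i ** (?Z ** v j) -- ~*v i ** v j"
    using vc ij by (simp add: vsub_def distrib_l distrib_r mult_smult smult_mult)
   also have "~*v i ** v j = (if i = j then v 0 else \<zero>)" using vm ij by auto
   finally show ?thesis unfolding e[OF ij] using vc[of 0] ij by simp
  qed
  then have "(nn (?Z -- \<one>))\<^sup>2 = 0" by (subst entry_parseval) auto
  then show ?thesis by simp
 qed
 then show ?thesis by (intro eq_if_nn) auto
qed

lemma mat_bnd: assumes x: "unim n x" shows "bnd 1 (mat x)"
proof -
 have "bnd 1 (~*mat x)"
 proof (rule bndI)
  fix y assume y: "y : C"
  have "(nn (~*mat x ** y))\<^sup>2 = Re (tr (~*y ** (mat x ** ~*mat x ** y)))" using y by (simp add: nn_sq star_mult mult_assoc)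
  also have "... = (nn y)\<^sup>2" unfolding mat_unim[OF x] using y by (simp add: nn_sq)
  finally show "nn (~*mat x ** y) <= 1 * nn y" using y by simp
 qed auto
 from bnd_star[OF this] show ?thesis by simp
qed

text \<open>For matrices over the corner of v 0 this is the unnormalised partial trace of the
  adjoint of W times y: the coefficient of y along W, with values in the corner.\<close>

definition tt :: "(nat => nat => complex) => 'a => 'a" where
 "tt W y = vsum (%i. vsum (%j. cnj (W i j) .* (~*v i ** (y ** v j))) n) n"

lemma tt_c [simp]: "y : C ==> tt W y : C" unfolding tt_def using vc by simp

lemma tr_tt: "[|w : C; y : C|] ==> tr (w ** tt W y) = (\<Sum>i<n. \<Sum>j<n. cnj (W i j) * tr (w ** (~*v i ** (y ** v j))))"
 unfolding tt_def using vc by (simp add: tr_mult_vsum mult_smult tr_smult)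

lemma tt_sub: "[|y : C; z : C|] ==> tt W (y -- z) = tt W y -- tt W z"
 by (rule tau_ext) (use vc in \<open>simp_all add: tr_tt vsub_def distrib_l distrib_r mult_smult smult_mult tr_add tr_smult
  algebra_simps sum.distrib sum_subtractf\<close>)

lemma tt_scale: assumes "!!i j. [|i < n; j < n|] ==> W' i j = c * W i j" "y : C" shows "tt W' y = cnj c .* tt W y"
 by (rule tau_ext) (use assms in \<open>simp_all add: tr_tt mult_smult tr_smult sum_distrib_left mult.assoc\<close>)

lemma tt_conj: assumes y: "y : C" shows "tt W (mat x ** y ** ~*mat x) = tt (conjm n x W) y"
proof (rule tau_ext)
 fix w assume w: "w : C"
 have e: "tr (w ** (~*v i ** (mat x ** y ** ~*mat x ** v j))) = (\<Sum>k<n. \<Sum>l<n. x i k * cnj (x j l) * tr (w ** (~*v k ** (y ** v l))))"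
  if ij: "i < n" "j < n" for i j
 proof -
  have "~*v i ** (mat x ** y ** ~*mat x ** v j) = (~*v i ** mat x) ** (y ** (~*mat x ** v j))"
   using vc ij y by (simp add: mult_assoc)
  also have "... = vsum (%k. vsum (%l. (x i k * cnj (x j l)) .* (~*v k ** (y ** v l))) n) n"
   unfolding mat_row[OF ij(1)] mat_col[OF ij(2)] using vc y
   by (subst vsum_mult) (auto simp: mult_vsum mult_smult smult_mult smult_smult smult_vsum mult.commute intro!: vsum_cong)
  finally show ?thesis using w vc y by (simp add: tr_mult_vsum mult_smult tr_smult)
 qed
 have "tr (w ** tt W (mat x ** y ** ~*mat x)) =
   (\<Sum>i<n. \<Sum>j<n. \<Sum>k<n. \<Sum>l<n. cnj (W i j) * x i k * cnj (x j l) * tr (w ** (~*v k ** (y ** v l))))"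
  using w y by (simp add: tr_tt e sum_distrib_left mult.assoc)
 also have "... = (\<Sum>k<n. \<Sum>l<n. \<Sum>i<n. \<Sum>j<n. cnj (W i j) * x i k * cnj (x j l) * tr (w ** (~*v k ** (y ** v l))))"
  by (rule sum_swap4)
 also have "... = tr (w ** tt (conjm n x W) y)"
  using w y by (simp add: tr_tt conjm_def sum_distrib_right)
 finally show "tr (w ** tt W (mat x ** y ** ~*mat x)) = tr (w ** tt (conjm n x W) y)" .
qed (use y in auto)

lemma nn_tt: assumes y: "y : C"
 shows "of_real ((nn (tt W y))\<^sup>2) = (\<Sum>k<n. \<Sum>l<n. \<Sum>i<n. \<Sum>j<n. W i j * cnj (W k l) * cnj (tr (~*(~*v k ** (y ** v l)) ** (~*v i ** (y ** v j)))))"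
proof -
 have "of_real ((nn (tt W y))\<^sup>2) = tr (~*(tt W y) ** tt W y)" using y by (simp add: tr_nn del: of_real_power)
 also have "... = (\<Sum>k<n. \<Sum>l<n. cnj (W k l) * cnj (tr (~*(~*v k ** (y ** v l)) ** tt W y)))"
  using y vc by (subst tr_tt) (auto intro!: sum.cong tr_swap simp del: star_mult)
 also have "... = (\<Sum>k<n. \<Sum>l<n. \<Sum>i<n. \<Sum>j<n. W i j * cnj (W k l) * cnj (tr (~*(~*v k ** (y ** v l)) ** (~*v i ** (y ** v j)))))"
  using y vc by (intro sum.cong refl) (subst tr_tt, auto simp: sum_distrib_left mult_ac)
 finally show ?thesis .
qed

context
 fixes h :: int assumes n: "int n = 2 * h + 1" "0 <= h"
begin

text \<open>\<open>WW_orth\<close> collapses the fourfold sum of entries to n times the diagonal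
  terms, which \<open>entry_parseval\<close> adds up.\<close>

lemma tt_parseval: assumes y: "y : C"
 shows "L2_set (%x. nn (tt (WW n (fst x) (snd x)) y)) ({-h..h} \<times> {-h..h}) = sqrt n * nn y"
proof -
 let ?I = "{-h..h} \<times> {-h..h}"
 define G where "G i j k l = cnj (tr (~*(~*v k ** (y ** v l)) ** (~*v i ** (y ** v j))))" for i j k l
 have "complex_of_real (\<Sum>x\<in>?I. (nn (tt (WW n (fst x) (snd x)) y))\<^sup>2)
   = (\<Sum>x\<in>?I. \<Sum>k<n. \<Sum>l<n. \<Sum>i<n. \<Sum>j<n. WW n (fst x) (snd x) i j * cnj (WW n (fst x) (snd x) k l) * G i j k l)"
  unfolding of_real_sum by (simp only: nn_tt[OF y] G_def)
 also have "... = (\<Sum>k<n. \<Sum>l<n. \<Sum>i<n. \<Sum>j<n. \<Sum>x\<in>?I. WW n (fst x) (snd x) i j * cnj (WW n (fst x) (snd x) k l) * G i j k l)"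
  by (subst sum.swap, intro sum.cong refl, subst sum.swap, intro sum.cong refl, subst sum.swap, intro sum.cong refl, rule sum.swap)
 also have "... = (\<Sum>k<n. \<Sum>l<n. \<Sum>i<n. \<Sum>j<n. if j = l then (if i = k then of_nat n * G k l k l else 0) else 0)"
  by (intro sum.cong refl) (simp add: sum_distrib_right[symmetric] WW_orth[OF n])
 also have "... = of_nat n * (\<Sum>k<n. \<Sum>l<n. G k l k l)" by (simp add: sum_distrib_left)
 also have "(\<Sum>k<n. \<Sum>l<n. G k l k l) = (\<Sum>k<n. \<Sum>l<n. of_real ((nn (~*v k ** (y ** v l)))\<^sup>2))"
  unfolding G_def using y vc by (intro sum.cong refl) (subst tr_nn, auto)
 also have "... = of_real ((nn y)\<^sup>2)" unfolding entry_parseval[OF y] by simp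
 finally have "complex_of_real (\<Sum>x\<in>?I. (nn (tt (WW n (fst x) (snd x)) y))\<^sup>2) = of_real (real n * (nn y)\<^sup>2)" by simp
 then have "(\<Sum>x\<in>?I. (nn (tt (WW n (fst x) (snd x)) y))\<^sup>2) = real n * (nn y)\<^sup>2" by (simp only: of_real_eq_iff)
 then show ?thesis unfolding L2_set_def using y by (simp add: real_sqrt_mult)
qed

text \<open>Let F (p, q) be the norm of the Weyl coefficient of y. Conjugation by \<open>xd\<close>
  and \<open>xf\<close> moves the coefficients by the shear and the rotation up to phases;
  conjugation by \<open>xu\<close> multiplies them by a root of unity depending on q, so
  \<open>ww_gap\<close> controls those with large |q|. The hypothesis \<open>y0\<close> clears the
  origin, and Parseval cancels the size n. The constant is 10 from \<open>ping_pong\<close> times 2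
  from \<open>ww_gap\<close>.\<close>

theorem matrix_gap0:
 assumes y: "y : C" and y0: "tt (WW n 0 0) y = \<zero>"
 shows "nn y <= 20 * (nn (mat (xu n) ** y ** ~*mat (xu n) -- y) + nn (mat (xd n) ** y ** ~*mat (xd n) -- y)
  + nn (mat (xf n) ** y ** ~*mat (xf n) -- y))"
proof -
 let ?I = "{-h..h} \<times> {-h..h}"
 have n0: "0 < n" using n by linarith
 define F where "F x = nn (tt (WW n (fst x) (snd x)) y)" for x
 define d where "d X = mat X ** y ** ~*mat X -- y" for X
 have dc: "d X : C" for X using y by (simp add: d_def)
 have key: "L2_set (%x. F (\<sigma> x) - F x) ?I <= sqrt n * nn (d X)"
  if c: "!!p q i j. [|i < n; j < n|] ==> conjm n X (WW n p q) i j = c p q * WW n (fst (\<sigma> (p, q))) (snd (\<sigma> (p, q))) i j"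
   "!!p q. cmod (c p q) = 1" for X c \<sigma>
 proof -
  have p: "\<bar>F (\<sigma> x) - F x\<bar> <= nn (tt (WW n (fst x) (snd x)) (d X))" for x
  proof -
   obtain p q where x: "x = (p, q)" by (cases x)
   have e: "tt (WW n p q) (mat X ** y ** ~*mat X) = cnj (c p q) .* tt (WW n (fst (\<sigma> x)) (snd (\<sigma> x))) y"
    unfolding tt_conj[OF y] x by (rule tt_scale[OF c(1) y])
   have "nn (tt (WW n p q) (mat X ** y ** ~*mat X)) = F (\<sigma> x)" unfolding e using y c(2) by (simp add: nn_smult F_def)
   moreover have "tt (WW n p q) (d X) = tt (WW n p q) (mat X ** y ** ~*mat X) -- tt (WW n p q) y"
    unfolding d_def using y by (intro tt_sub) auto
   ultimately show ?thesis using nn_diff[of "tt (WW n p q) (mat X ** y ** ~*mat X)" "tt (WW n p q) y"] y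
    unfolding F_def x by simp
  qed
  have "L2_set (%x. F (\<sigma> x) - F x) ?I <= L2_set (%x. nn (tt (WW n (fst x) (snd x)) (d X))) ?I"
   unfolding L2_set_def by (intro real_sqrt_le_mono sum_mono) (metis p abs_ge_zero power2_abs power_mono)
  then show ?thesis unfolding tt_parseval[OF dc] .
 qed
 have s: "L2_set (%x. F (fst x - 2 * snd x, snd x) - F x) ?I <= sqrt n * nn (d (xd n))"
  using key[of "xd n" "%p q. ww n (q * q)" "%x. (fst x - 2 * snd x, snd x)"] by (simp add: conj_xd[OF n0])
 have t: "L2_set (%x. F (- snd x, fst x) - F x) ?I <= sqrt n * nn (d (xf n))"
  using key[of "xf n" "%p q. ww n (q * p)" "%x. (- snd x, fst x)"] by (simp add: conj_xf[OF n])
 have a: "L2_set F {x : ?I. 3 * \<bar>snd x\<bar> > h} <= 2 * (sqrt n * nn (d (xu n)))"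
 proof -
  have p: "F x <= 2 * nn (tt (WW n (fst x) (snd x)) (d (xu n)))" if x: "x : {x : ?I. 3 * \<bar>snd x\<bar> > h}" for x
  proof -
   obtain p q where pq: "x = (p, q)" by (cases x)
   let ?t = "tt (WW n p q) y"
   have e: "tt (WW n p q) (mat (xu n) ** y ** ~*mat (xu n)) = cnj (ww n (- q)) .* ?t"
    unfolding tt_conj[OF y] by (rule tt_scale[OF _ y]) (simp add: conj_xu[OF n0])
   have "tt (WW n p q) (d (xu n)) = cnj (ww n (- q)) .* ?t -- ?t"
    unfolding d_def using y e by (subst tt_sub) auto
   also have "... = (ww n q - 1) .* ?t" using y by (intro tau_ext) (simp_all add: alg ww_cnj algebra_simps)
   finally have "nn (tt (WW n p q) (d (xu n))) = cmod (ww n q - 1) * nn ?t" using y by (simp add: nn_smult)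
   moreover have "1/2 * nn ?t <= cmod (ww n q - 1) * nn ?t"
    using x y unfolding pq by (intro mult_right_mono ww_gap[OF n(1)]) auto
   ultimately show ?thesis unfolding pq F_def by simp
  qed
  have "L2_set F {x : ?I. 3 * \<bar>snd x\<bar> > h} <= L2_set (%x. 2 * nn (tt (WW n (fst x) (snd x)) (d (xu n)))) {x : ?I. 3 * \<bar>snd x\<bar> > h}"
   by (rule L2_set_mono) (use p y in \<open>auto simp: F_def\<close>)
  also have "... <= L2_set (%x. 2 * nn (tt (WW n (fst x) (snd x)) (d (xu n)))) ?I" by (rule L2_mono_set) auto
  also have "... = 2 * L2_set (%x. nn (tt (WW n (fst x) (snd x)) (d (xu n)))) ?I" by (rule L2_set_right_distrib[symmetric]) simp
  finally show ?thesis unfolding tt_parseval[OF dc] .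
 qed
 have "L2_set F ?I <= 10 * (2 * (sqrt n * nn (d (xu n))) + sqrt n * nn (d (xd n)) + sqrt n * nn (d (xf n)))"
  by (rule ping_pong[OF n(2) _ a s t]) (simp add: F_def y0)
 moreover have "L2_set F ?I = sqrt n * nn y" unfolding F_def by (rule tt_parseval[OF y])
 ultimately have "sqrt n * nn y <= sqrt n * (20 * nn (d (xu n)) + 10 * nn (d (xd n)) + 10 * nn (d (xf n)))"
  by (simp add: algebra_simps)
 then have "nn y <= 20 * nn (d (xu n)) + 10 * nn (d (xd n)) + 10 * nn (d (xf n))" using n0 by simp
 also have "... <= 20 * (nn (d (xu n)) + nn (d (xd n)) + nn (d (xf n)))" using dc by simp
 finally show ?thesis unfolding d_def .
qed

end

lemma corner_bnd:
 assumes t: "bnd K t" "v 0 ** t = t" "t ** v 0 = t"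
 shows "bnd K (vsum (%k. v k ** (t ** ~*v k)) n)" (is "bnd K ?s")
proof (rule bndI)
 have tc: "t : C" using t bnd_c by blast
 show sc: "?s : C" using vc tc by simp
 show K: "0 <= K" by (rule bnd_ge0[OF t(1)])
 fix y assume y: "y : C"
 have "(nn (?s ** y))\<^sup>2 = (\<Sum>i<n. (nn (~*v i ** (?s ** y)))\<^sup>2)" by (rule row_parseval) (use sc y in simp)
 also have "... <= (\<Sum>i<n. (K * nn (~*v i ** y))\<^sup>2)"
 proof (rule sum_mono)
  fix i assume "i : {..<n}"
  then have i: "i < n" by simp
  have "~*v i ** (?s ** y) = (~*v i ** ?s) ** y" using sc y vc[OF i] by (simp only: mult_assoc star_c)
  also have "... = t ** (~*v i ** y)" unfolding corner_comm(3)[OF v tc t(2,3) i] using tc y vc[OF i] by (simp add: mult_assoc)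
  finally have "nn (~*v i ** (?s ** y)) <= K * nn (~*v i ** y)" using bndD[OF t(1)] y vc[OF i] by simp
  then show "(nn (~*v i ** (?s ** y)))\<^sup>2 <= (K * nn (~*v i ** y))\<^sup>2" using sc y vc[OF i] by (intro power_mono) auto
 qed
 also have "... = (K * nn y)\<^sup>2" unfolding power_mult_distrib row_parseval[OF y] sum_distrib_left ..
 finally show "nn (?s ** y) <= K * nn y" by (rule power2_le_imp_le) (use K y in simp)
qed

end

text \<open>z is the conditional expectation of y onto the commutant: the partial trace of y,
  normalised and amplified. Then y - z has no coefficient at the origin, and conjugation by b i
  fixes z, so the displacements of y - z are those of y.\<close>

theorem matrix_gap:
 assumes v: "msys n v" and n: "int n = 2 * h + 1" "0 <= h"
 shows "EX b. (ALL i<3::nat. bnd 1 (b i) & b i ** ~*b i = \<one> & (ALL z:comm (mgen n v). z ** b i = b i ** z)) &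
  (ALL y K. bnd K y --> (EX z:comm (mgen n v). bnd K z & nn (y -- z) <= 20 * (\<Sum>i<3. nn (b i ** y ** ~*b i -- y))))"
proof -
 define x where "x i = (if i = 0 then xu n else if i = 1 then xd n else xf n)" for i :: nat
 define b where "b i = mat n v (x i)" for i
 have un: "unim n (x i)" for i unfolding x_def using unim_x[OF n] by simp
 have b1: "b i ** ~*b i = \<one>" "bnd 1 (b i)" for i unfolding b_def by (rule mat_unim[OF v un], rule mat_bnd[OF v un])
 have bc: "b i : C" for i using b1 bnd_c by blast
 have com: "z ** b i = b i ** z" if "z : comm (mgen n v)" for z i unfolding b_def by (rule mat_comm[OF v that])
 have n0: "0 < n" using n by linarith
 note vc = psys_c[OF sysD(1)[OF v]]
 note vm = psys_m[OF sysD(1)[OF v]]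
 have "EX z:comm (mgen n v). bnd K z & nn (y -- z) <= 20 * (\<Sum>i<3. nn (b i ** y ** ~*b i -- y))" if y: "bnd K y" for y K
 proof -
  have yc: "y : C" using y bnd_c by blast
  define u where "u = vsum (%j. ~*v j ** (y ** v j)) n"
  have vj: "bnd 1 (v j)" if "j < n" for j
  proof -
   have "proj (v 0)" using psys_rep[OF sysD(1)[OF v] n0] vc[OF n0] by (simp add: proj_def)
   then have p: "bnd 1 (v 0)" by (rule proj_bnd)
   show ?thesis
   proof (rule bndI)
    fix w assume w: "w : C"
    have "(nn (v j ** w))\<^sup>2 = Re (tr (~*w ** (~*v j ** v j ** w)))" using quad_sq[of "v j" w] vc that w by simp
    also have "... = (nn (v 0 ** w))\<^sup>2" unfolding vm(1)[OF that] using proj_nn[OF \<open>proj (v 0)\<close> w] by simp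
    also have "... <= (nn w)\<^sup>2" using bndD[OF p w] vc[OF n0] w by (intro power_mono) auto
    finally have "nn (v j ** w) <= nn w" by (rule power2_le_imp_le) (use w in simp)
    then show "nn (v j ** w) <= 1 * nn w" by simp
   qed (use vc that in auto)
  qed
  have "bnd (real m * K) (vsum (%j. ~*v j ** (y ** v j)) m)" if "m <= n" for m using that
  proof (induction m)
   case (Suc m)
   have "bnd (1 * (K * 1)) (~*v m ** (y ** v m))" using Suc by (intro bnd_mult bnd_star y vj) auto
   from bnd_add[OF Suc(1) this] Suc(2) show ?case by (simp add: algebra_simps)
  qed simp
  then have ub: "bnd (n * K) u" unfolding u_def by simp
  have uc: "u : C" using ub bnd_c by blast
  \<comment> \<open>The amplification has n diagonal entries t, hence partial trace u, the same as
    that of y.\<close>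
  define t where "t = of_real (1 / n) .* u"
  have tc: "t : C" using uc by (simp add: t_def)
  have tb: "bnd K t" using bnd_smult[OF ub, of "of_real (1 / n)"] n0 by (simp add: t_def norm_divide)
  have u0: "v 0 ** u = u" "u ** v 0 = u" unfolding u_def using corner[OF v yc] vc n0 yc
   by (simp_all add: mult_vsum vsum_mult cong: vsum_cong)
  have t0: "v 0 ** t = t" "t ** v 0 = t" unfolding t_def using u0 uc vc[OF n0] by (simp_all add: mult_smult smult_mult)
  define z where "z = vsum (%k. v k ** (t ** ~*v k)) n"
  have zb: "bnd K z" unfolding z_def by (rule corner_bnd[OF v tb t0])
  have zc: "z : C" using zb bnd_c by blast
  have zS: "z : comm (mgen n v)" unfolding z_def by (rule corner_comm[OF v tc t0])
  have tW: "tt n v (WW n 0 0) w = vsum (%j. ~*v j ** (w ** v j)) n" if w: "w : C" for w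
  proof (rule tau_ext)
   fix r assume r: "r : C"
   have dv: "int n dvd int i - int j \<longleftrightarrow> i = j" if "i < n" "j < n" for i j
    using that by (metis (full_types) dvd_0_right eq_iff_diff_eq_0 mod_eq_dvd_iff mod_less of_nat_eq_iff zmod_int)
   have "tr (r ** tt n v (WW n 0 0) w) = (\<Sum>i<n. \<Sum>j<n. if j = i then tr (r ** (~*v i ** (w ** v i))) else 0)"
    unfolding tr_tt[OF v r w] by (intro sum.cong refl) (auto simp: WW_def dv)
   also have "... = tr (r ** vsum (%j. ~*v j ** (w ** v j)) n)" using r w vc by (simp add: tr_mult_vsum)
   finally show "tr (r ** tt n v (WW n 0 0) w) = tr (r ** vsum (%j. ~*v j ** (w ** v j)) n)" .
  qed (use w vc tt_c[OF v] in auto)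
  have "tt n v (WW n 0 0) z = u"
  proof -
   have "~*v j ** (z ** v j) = t" if j: "j < n" for j
   proof -
    have "z ** v j = v j ** t" unfolding z_def by (rule corner_comm(2)[OF v tc t0 j])
    then have "~*v j ** (z ** v j) = (~*v j ** v j) ** t" using vc j tc by (simp add: mult_assoc)
    then show ?thesis using vm(1)[OF j] t0 by simp
   qed
   then have "tt n v (WW n 0 0) z = vsum (%j. t) n" unfolding tW[OF zc] by (intro vsum_cong)
   also have "... = u" using tc uc n0 by (intro tau_ext) (simp_all add: tr_mult_vsum t_def mult_smult tr_smult)
   finally show ?thesis .
  qed
  moreover have "tt n v (WW n 0 0) y = u" unfolding tW[OF yc] u_def ..
  ultimately have y0: "tt n v (WW n 0 0) (y -- z) = \<zero>" using tt_sub[OF v yc zc] uc by simp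
  have inv: "b i ** (y -- z) ** ~*b i -- (y -- z) = b i ** y ** ~*b i -- y" for i
  proof -
   have "b i ** z ** ~*b i = z ** (b i ** ~*b i)" unfolding com[OF zS, symmetric] using zc bc by (simp add: mult_assoc)
   then have e: "b i ** z ** ~*b i = z" using b1 zc by simp
   have "b i ** (y -- z) ** ~*b i = b i ** y ** ~*b i -- b i ** z ** ~*b i"
    using bc yc zc by (simp add: vsub_def distrib_l distrib_r mult_smult smult_mult)
   then show ?thesis unfolding e using bc yc zc by (intro tau_ext) (simp_all add: alg)
  qed
  have "nn (y -- z) <= 20 * (nn (b 0 ** (y -- z) ** ~*b 0 -- (y -- z)) + nn (b 1 ** (y -- z) ** ~*b 1 -- (y -- z)) + nn (b 2 ** (y -- z) ** ~*b 2 -- (y -- z)))"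
   using matrix_gap0[OF v n _ y0] yc zc by (simp add: b_def x_def)
  then have "nn (y -- z) <= 20 * (\<Sum>i<3. nn (b i ** y ** ~*b i -- y))" unfolding inv by (simp add: numeral_3_eq_3 numeral_2_eq_2)
  then show ?thesis using zS zb by blast
 qed
 then show ?thesis using b1 com by (intro exI[of _ b]) blast
qed

end

section \<open>Finite-dimensional subalgebras\<close>

context talg
begin

lemma lincomb_vsum:
 assumes "!!i. i < N ==> g i : C"
 shows "lincomb M (map c [0..<N]) (map g [0..<N]) = vsum (%i. c i .* g i) N"
proof -
 have "a : C ==> foldr (%(c, f) acc. c .* f ++ acc) (zip (map c [0..<N]) (map g [0..<N])) a = vsum (%i. c i .* g i) N ++ a" for a
  using assms
 proof (induction N arbitrary: a)
  case (Suc N)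
  then show ?case by (simp add: add_assoc)
 qed simp
 then show ?thesis using assms by (simp add: lincomb_def)
qed

definition ons :: "nat => (nat => 'a) => bool" where
 "ons N b \<longleftrightarrow> (ALL i<N. b i : C) & (ALL i<N. ALL j<N. tr (~*b i ** b j) = (if i = j then 1 else 0))"

definition pr :: "nat => (nat => 'a) => 'a => 'a" where
 "pr N b x = vsum (%i. tr (~*b i ** x) .* b i) N"

lemma onsD: "[|ons N b; i < N|] ==> b i : C"
 "[|ons N b; i < N; j < N|] ==> tr (~*b i ** b j) = (if i = j then 1 else 0)" by (auto simp: ons_def)

lemma pr_c [simp]: "ons N b ==> pr N b x : C" unfolding pr_def by (auto simp: onsD)

lemma pr_add: "[|ons N b; x : C; y : C|] ==> pr N b (x ++ y) = pr N b x ++ pr N b y"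
 by (rule tau_ext) (simp_all add: pr_def tr_mult_vsum onsD distrib_l tr_add mult_smult tr_smult ring_distribs sum.distrib)

lemma pr_smult: "[|ons N b; x : C|] ==> pr N b (c .* x) = c .* pr N b x"
 by (rule tau_ext) (simp_all add: pr_def tr_mult_vsum onsD mult_smult tr_smult sum_distrib_left mult.assoc)

lemma tr_pr: "[|ons N b; i < N|] ==> tr (~*b i ** pr N b x) = tr (~*b i ** x)"
 unfolding pr_def by (simp add: tr_mult_vsum onsD mult_smult tr_smult if_distrib cong: if_cong)

lemma pr_sq: assumes o: "ons N b" and x: "x : C"
 shows "tr (~*x ** pr N b x) = of_real (\<Sum>i<N. (cmod (tr (~*b i ** x)))\<^sup>2)"
  "(nn (pr N b x))\<^sup>2 = (\<Sum>i<N. (cmod (tr (~*b i ** x)))\<^sup>2)"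
  "(nn (x -- pr N b x))\<^sup>2 = (nn x)\<^sup>2 - (\<Sum>i<N. (cmod (tr (~*b i ** x)))\<^sup>2)"
proof -
 have s: "tr (~*y ** b i) = cnj (tr (~*b i ** y))" if "y : C" "i < N" for y i
  using tr_swap[of y "b i"] that onsD[OF o] by simp
 have f: "tr (~*y ** pr N b x) = (\<Sum>i<N. tr (~*b i ** x) * cnj (tr (~*b i ** y)))" if "y : C" for y
  unfolding pr_def using that onsD(1)[OF o] by (simp add: tr_mult_vsum mult_smult tr_smult s)
 show 1: "tr (~*x ** pr N b x) = of_real (\<Sum>i<N. (cmod (tr (~*b i ** x)))\<^sup>2)"
  unfolding f[OF x] of_real_sum by (intro sum.cong refl) (simp only: complex_norm_square)
 have 2: "tr (~*(pr N b x) ** pr N b x) = of_real (\<Sum>i<N. (cmod (tr (~*b i ** x)))\<^sup>2)"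
  unfolding f[OF pr_c[OF o]] of_real_sum by (intro sum.cong refl) (simp only: complex_norm_square tr_pr[OF o] lessThan_iff)
 show 3: "(nn (pr N b x))\<^sup>2 = (\<Sum>i<N. (cmod (tr (~*b i ** x)))\<^sup>2)" unfolding nn_sq[OF pr_c[OF o]] 2 by simp
 have "tr (~*(pr N b x) ** x) = cnj (tr (~*x ** pr N b x))" using tr_swap[of "pr N b x" x] x o by simp
 then show "(nn (x -- pr N b x))\<^sup>2 = (nn x)\<^sup>2 - (\<Sum>i<N. (cmod (tr (~*b i ** x)))\<^sup>2)"
  using nn_sub_sq[OF x pr_c[OF o], of x] 3 1 by simp
qed

lemma bessel: "[|ons N b; x : C|] ==> (\<Sum>i<N. (cmod (tr (~*b i ** x)))\<^sup>2) <= (nn x)\<^sup>2"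
 using pr_sq(3)[of N b x] zero_le_power2[of "nn (x -- pr N b x)"] by linarith

text \<open>One Gram-Schmidt step inside B. The span of the family is recorded as the set of fixed
  points of \<open>pr\<close>.\<close>

lemma ons_extend:
 assumes o: "ons N b" and bB: "!!i. i < N ==> b i : B" and B: "star_subalg M B" and g: "g : B"
 shows "EX N' b'. ons N' b' & (ALL i<N'. b' i : B) & g = pr N' b' g & (ALL x:B. x = pr N b x --> x = pr N' b' x)"
proof (cases "g = pr N b g")
 case True then show ?thesis using o bB by blast
next
 case False
 have gc: "g : C" using g B by (auto simp: star_subalg_def)
 define g' where "g' = g -- pr N b g"
 have g'c: "g' : C" using gc o by (simp add: g'_def)
 define a where "a = nn g'"
 have a: "a > 0" using False gc o sub_eq_zero[of g "pr N b g"] nn_zero_iff[OF g'c] nn_ge0[OF g'c] unfolding a_def g'_def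
  by (metis less_eq_real_def pr_c)
 define w where "w = of_real (1 / a) .* g'"
 have wc: "w : C" using g'c by (simp add: w_def)
 have "0 .* \<one> : B" using B unfolding star_subalg_def by blast
 then have zB: "\<zero> : B" by (simp only: vzero_def)
 have vB: "vsum (%i. c i .* b i) k : B" if "k <= N" for c k using that
  by (induction k) (use B bB zB in \<open>auto simp: star_subalg_def\<close>)
 have "pr N b g : B" unfolding pr_def by (rule vB) simp
 then have wB: "w : B" unfolding w_def g'_def vsub_def using g B by (auto simp: star_subalg_def)
 have o1: "tr (~*b i ** g') = 0" if "i < N" for i
  unfolding g'_def using onsD(1)[OF o that] gc o tr_pr[OF o that] by (simp add: vsub_def distrib_l mult_smult tr_add tr_smult)
 have o2: "tr (~*b i ** w) = 0" "tr (~*w ** b i) = 0" if "i < N" for i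
 proof -
  show 1: "tr (~*b i ** w) = 0" unfolding w_def using o1[OF that] onsD(1)[OF o that] g'c by (simp add: mult_smult tr_smult)
  show "tr (~*w ** b i) = 0" using tr_swap[OF wc onsD(1)[OF o that]] 1 by simp
 qed
 have ww: "tr (~*w ** w) = 1" unfolding tr_nn[OF wc] unfolding w_def using g'c a by (simp add: nn_smult a_def[symmetric] norm_divide)
 define b' where "b' = b(N := w)"
 have o': "ons (Suc N) b'" unfolding ons_def b'_def using onsD[OF o] o2 ww wc by (auto simp: less_Suc_eq)
 have prS: "pr (Suc N) b' x = pr N b x ++ tr (~*w ** x) .* w" for x
  unfolding pr_def vsum.simps b'_def by (auto intro!: arg_cong2[of _ _ _ _ "vadd M"] vsum_cong)
 have orth: "tr (~*w ** pr N b x) = 0" for x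
  unfolding pr_def using wc onsD(1)[OF o] o2 by (simp add: tr_mult_vsum mult_smult tr_smult)
 have e: "g = pr N b g ++ g'" unfolding g'_def using gc o by (intro tau_ext) (simp_all add: alg)
 have "tr (~*w ** g') = of_real a"
  unfolding w_def using g'c a tr_nn[OF g'c] by (simp add: star_smult smult_mult tr_smult a_def power2_eq_square)
 then have "tr (~*w ** g) = of_real a" using orth wc o g'c by (subst e) (simp add: distrib_l tr_add)
 moreover have "of_real a .* w = g'" unfolding w_def using a g'c by (simp add: smult_smult flip: of_real_mult)
 ultimately have "g = pr (Suc N) b' g" unfolding prS using e by simp
 moreover have "x = pr (Suc N) b' x" if "x : B" "x = pr N b x" for x
 proof -
  have xc: "x : C" using that(1) B by (auto simp: star_subalg_def)
  have "tr (~*w ** x) = 0" using orth[of x] that(2) by simp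
  then show ?thesis unfolding prS using that(2) wc xc by simp
 qed
 moreover have "ALL i<Suc N. b' i : B" using bB wB by (auto simp: b'_def less_Suc_eq)
 ultimately show ?thesis using o' by blast
qed

lemma ex_onb:
 assumes B: "star_subalg M B" and fd: "fin_dim M B"
 shows "EX N b. ons N b & (ALL i<N. b i : B) & (ALL x:B. x = pr N b x)"
proof -
 obtain fs where fs: "set fs \<subseteq> B" "!!x. x : B ==> EX cs. length cs = length fs & x = lincomb M cs fs"
  using fd by (auto simp: fin_dim_def)
 have "set gs \<subseteq> B ==> EX N b. ons N b & (ALL i<N. b i : B) & (ALL g:set gs. g = pr N b g)" for gs
 proof (induction gs)
  case Nil
  have "ons 0 (%_. \<one>)" by (simp add: ons_def)
  then show ?case by (intro exI[of _ 0] exI[of _ "%_. \<one>"]) simp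
 next
  case (Cons g gs)
  then obtain N b where b: "ons N b" "!!i. i < N ==> b i : B" "!!x. x : set gs ==> x = pr N b x" by auto
  obtain N' b' where b': "ons N' b'" "ALL i<N'. b' i : B" "g = pr N' b' g" "ALL x:B. x = pr N b x --> x = pr N' b' x"
   using ons_extend[OF b(1,2) B, of g] Cons(2) by auto
  have "x = pr N' b' x" if "x : set (g # gs)" for x
   using that b'(3,4) b(3)[of x] Cons(2) by auto
  then show ?case using b' by blast
 qed
 from this[OF fs(1)] obtain N b where b: "ons N b" "ALL i<N. b i : B" "!!g. g : set fs ==> g = pr N b g" by blast
 have fc: "g : C" if "g : set fs" for g using that fs B by (auto simp: star_subalg_def)
 have "x = pr N b x" if x: "x : B" for x
 proof -
  obtain cs where cs: "length cs = length fs" "x = lincomb M cs fs" using fs(2)[OF x] by blast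
  have "set gs \<subseteq> set fs ==> lincomb M cs gs : C & lincomb M cs gs = pr N b (lincomb M cs gs)" for cs gs
  proof (induction gs arbitrary: cs)
   case Nil
   have "pr N b \<zero> = \<zero>" using pr_smult[OF b(1) zero_c, of 0] b(1) by simp
   then show ?case by (simp add: lincomb_def)
  next
   case (Cons g gs)
   show ?case
   proof (cases cs)
    case Nil
    have "pr N b \<zero> = \<zero>" using pr_smult[OF b(1) zero_c, of 0] b(1) by simp
    then show ?thesis using Nil by (simp add: lincomb_def)
   next
    case (Cons c cs')
    have e: "lincomb M cs (g # gs) = c .* g ++ lincomb M cs' gs" using Cons by (simp add: lincomb_def)
    have g: "g : C" "g = pr N b g" using Cons.prems fc b(3) by auto
    have l: "lincomb M cs' gs : C" "lincomb M cs' gs = pr N b (lincomb M cs' gs)" using Cons.IH Cons.prems by auto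
    show ?thesis unfolding e using g l pr_add[OF b(1), of "c .* g" "lincomb M cs' gs"] pr_smult[OF b(1), of g c] by simp
   qed
  qed
  then show ?thesis unfolding cs(2) by blast
 qed
 then show ?thesis using b by blast
qed

lemma cv_scal: assumes c: "(c \<longlongrightarrow> l) F" and x: "x : C" shows "cv F (%n. c n .* x) (l .* x)"
proof (rule cvI[where g = "%n. cmod (c n - l) * nn x"])
 have "c n .* x -- l .* x = (c n - l) .* x" for n using x by (intro tau_ext) (simp_all add: alg algebra_simps)
 then show "eventually (%n. nn (c n .* x -- l .* x) <= cmod (c n - l) * nn x) F" using x by (simp add: nn_smult)
 have "((%n. cmod (c n - l)) \<longlongrightarrow> 0) F" using c by (simp add: LIM_zero tendsto_norm_zero)
 then show "((%n. cmod (c n - l) * nn x) \<longlongrightarrow> 0) F" by (rule tendsto_mult_left_zero)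
qed (use x in auto)

lemma cv_vsum: "(!!i. i < N ==> cv F (%n. s n i) (x i)) ==> cv F (%n. vsum (s n) N) (vsum x N)"
 by (induction N) (auto intro: cv_add)

end

section \<open>Expectations, minimal projections and matrix units in finite dimension\<close>

context tvna
begin

context
 fixes B assumes B: "star_subalg M B" and fd: "fin_dim M B"
begin

text \<open>B consists of the fixed points of the orthogonal projection onto it, which is continuous
  for the 2-norm.\<close>

lemma vnsub_findim: "vnsub B"
 unfolding vnsub_def
proof (intro conjI allI impI)
 show "star_subalg M B" by (rule B)
 fix s x K assume a: "(ALL n::nat. s n : B & bnd K (s n)) & cv sequentially s x"
 then have c: "cv sequentially s x" by simp
 note xc = cv_c(2)[OF c]
 obtain N b where b: "ons N b" "ALL i<N. b i : B" "ALL x:B. x = pr N b x" using ex_onb[OF B fd] by blast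
 have "cv sequentially (%n. pr N b (s n)) (pr N b x)"
  unfolding pr_def by (intro cv_vsum cv_scal cv_tr cv_cmult star_c c) (use onsD(1)[OF b(1)] in auto)
 moreover have "(%n. pr N b (s n)) = s"
 proof
  fix n show "pr N b (s n) = s n" using a b(3)[rule_format, of "s n"] by simp
 qed
 ultimately have xe: "pr N b x = x" using cv_unique[OF c, of "pr N b x"] by force
 have "0 .* \<one> : B" using B unfolding star_subalg_def by blast
 then have zB: "\<zero> : B" by (simp only: vzero_def)
 have vB: "vsum (%i. c i .* b i) k : B" if "k <= N" for c k using that
  by (induction k) (use B b(2) zB in \<open>auto simp: star_subalg_def\<close>)
 have "pr N b x : B" unfolding pr_def by (rule vB) simp
 then show "x : B" by (simp only: xe)
qed

text \<open>E is the orthogonal projection onto B for the trace inner product, so it gives nearest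
  points. That E does not increase operator bounds follows from E (x ** y) = E x ** y for y in B,
  together with the contractivity of E for the 2-norm.\<close>

lemma ex_expectation:
 "EX E. (ALL x:C. E x : B) & (ALL x:C. ALL y:B. nn (x -- E x) <= nn (x -- y)) & (ALL K x. bnd K x --> bnd K (E x))"
proof -
 obtain N b where b: "ons N b" "ALL i<N. b i : B" "!!x. x : B ==> x = pr N b x" using ex_onb[OF B fd] by blast
 note S = vnsub_findim
 have Bc: "x : C" if "x : B" for x using that S vnsubD by blast
 define E where "E = pr N b"
 have EB: "E x : B" for x unfolding E_def pr_def using b(2) by (intro vsum_mem[OF S] vnsubD(5)[OF S]) auto
 have Ec: "E x : C" for x using EB Bc by blast
 have Etr: "tr (~*y ** E x) = tr (~*y ** x)" if x: "x : C" and y: "y : B" for x y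
 proof -
  have yc: "y : C" using y Bc by blast
  have bc: "b i : C" if "i < N" for i using onsD(1)[OF b(1) that] .
  have st: "~*y = vsum (%i. cnj (tr (~*b i ** y)) .* ~*b i) N"
   by (subst b(3)[OF y], unfold pr_def, subst star_vsum) (use bc in \<open>auto simp: star_smult intro!: vsum_cong\<close>)
  have ex: "tr (~*y ** w) = (\<Sum>i<N. cnj (tr (~*b i ** y)) * tr (~*b i ** w))" if w: "w : C" for w
   unfolding st using bc w by (simp add: vsum_mult tr_vsum smult_mult tr_smult)
  show ?thesis unfolding ex[OF Ec] ex[OF x] unfolding E_def by (intro sum.cong refl) (use tr_pr[OF b(1)] in simp)
 qed
 have uniq: "z = E x" if "z : B" "x : C" "!!y. y : B ==> tr (~*y ** z) = tr (~*y ** x)" for z x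
 proof -
  have zc: "z : C" using that Bc by blast
  have "z -- E x : B" using that EB by (intro vnsubD[OF S])
  then have "tr (~*(z -- E x) ** (z -- E x)) = 0"
   using that(3)[of "z -- E x"] Etr[OF that(2), of "z -- E x"] zc Ec by (simp add: vsub_def[of M z] distrib_l mult_smult tr_add tr_smult)
  then show ?thesis using zc Ec tr_faithful sub_eq_zero by (meson sub_c)
 qed
 have Emult: "E (x ** y) = E x ** y" if "x : C" "y : B" for x y
 proof (rule uniq[symmetric])
  have yc: "y : C" using that Bc by blast
  show "E x ** y : B" using EB that by (intro vnsubD[OF S])
  show "x ** y : C" using that yc by simp
  fix z assume z: "z : B"
  have zc: "z : C" using z Bc by blast
  have zy: "z ** ~*y : B" using z that by (intro vnsubD[OF S])
  have "tr (~*z ** (w ** y)) = tr (~*(z ** ~*y) ** w)" if "w : C" for w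
   using that zc yc tr_comm[of "~*z ** w" y] by (simp add: star_mult mult_assoc)
  then show "tr (~*z ** (E x ** y)) = tr (~*z ** (x ** y))" using Etr[OF that(1) zy] Ec that by simp
 qed
 have Estar: "E (~*x) = ~*(E x)" if "x : C" for x
 proof (rule uniq[symmetric])
  show "~*(E x) : B" using EB by (intro vnsubD[OF S])
  show "~*x : C" using that by simp
  fix z assume z: "z : B"
  have zc: "z : C" using z Bc by blast
  have zB: "~*z : B" using z by (intro vnsubD[OF S])
  have "tr (~*z ** ~*w) = cnj (tr (~*~*z ** w))" if "w : C" for w
   using that zc tr_star[of "w ** z"] tr_comm[of w z] by (simp add: star_mult)
  then show "tr (~*z ** ~*(E x)) = tr (~*z ** ~*x)" using Etr[OF that zB] Ec that by simp
 qed
 have Enn: "nn (E x) <= nn x" if "x : C" for x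
 proof -
  have "(nn (E x))\<^sup>2 <= (nn x)\<^sup>2" unfolding E_def pr_sq(2)[OF b(1) that] by (rule bessel[OF b(1) that])
  then show ?thesis by (rule power2_le_imp_le) (use that in simp)
 qed
 have near: "nn (x -- E x) <= nn (x -- y)" if x: "x : C" and y: "y : B" for x y
 proof -
  have yc: "y : C" using y Bc by blast
  let ?z = "y -- E x"
  have zB: "?z : B" using y EB by (intro vnsubD[OF S])
  have e: "x -- y = (x -- E x) -- ?z" using x yc Ec by (intro tau_ext) (simp_all add: alg)
  have "tr (~*?z ** (x -- E x)) = 0" using Etr[OF x zB] yc Ec x by (simp add: vsub_def[of M x] distrib_l mult_smult tr_add tr_smult)
  then have "(nn (x -- y))\<^sup>2 = (nn (x -- E x))\<^sup>2 + (nn ?z)\<^sup>2" unfolding e using nn_sub_sq[of "x -- E x" ?z] x yc Ec by simp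
  then have "(nn (x -- E x))\<^sup>2 <= (nn (x -- y))\<^sup>2" by simp
  then show ?thesis by (rule power2_le_imp_le) (use x yc in simp)
 qed
 have Ebnd: "bnd K (E x)" if x: "bnd K x" for K x
 proof (rule bnd_if_moments[OF Ec])
  have xc: "x : C" using x bnd_c by blast
  show K: "0 <= K" by (rule bnd_ge0[OF x])
  have e1: "nn (E w ** y) <= K * nn y" if "bnd K w" "y : B" for w y
  proof -
   have wc: "w : C" and yc: "y : C" using that bnd_c Bc by auto
   have "nn (E w ** y) = nn (E (w ** y))" using Emult[OF wc that(2)] by simp
   also have "... <= nn (w ** y)" by (rule Enn) (use wc yc in simp)
   also have "... <= K * nn y" by (rule bndD[OF that(1) yc])
   finally show ?thesis .
  qed
  \<comment> \<open>Left multiplication by E x is controlled only on B. The moments require no more,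
    since the powers of ?h belong to B.\<close>
  let ?h = "~*(E x) ** E x"
  have hB: "?h : B" using EB by (intro vnsubD[OF S])
  have sB: "sqr j ?h : B" for j by (induction j) (use hB in \<open>auto intro: vnsubD[OF S]\<close>)
  have sj: "ALL y:B. nn (sqr j ?h ** y) <= (K\<^sup>2) ^ (2 ^ j) * nn y" for j
  proof (induction j)
   case 0
   show ?case
   proof
    fix y assume y: "y : B"
    have yc: "y : C" using y Bc by blast
    have ey: "E x ** y : B" using EB y by (intro vnsubD[OF S])
    have "nn (~*(E x) ** (E x ** y)) <= K * nn (E x ** y)"
     using e1[OF bnd_star[OF x] ey] Estar[OF xc] by simp
    also have "... <= K * (K * nn y)" using e1[OF x y] K by (intro mult_left_mono)
    finally show "nn (sqr 0 ?h ** y) <= (K\<^sup>2) ^ (2 ^ 0) * nn y" using Ec yc by (simp add: mult_assoc power2_eq_square)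
   qed
  next
   case (Suc j)
   show ?case
   proof
    fix y assume y: "y : B"
    have yc: "y : C" using y Bc by blast
    have ey: "sqr j ?h ** y : B" using sB y by (intro vnsubD[OF S])
    have "nn (sqr j ?h ** (sqr j ?h ** y)) <= (K\<^sup>2) ^ (2 ^ j) * nn (sqr j ?h ** y)" using Suc ey by blast
    also have "... <= (K\<^sup>2) ^ (2 ^ j) * ((K\<^sup>2) ^ (2 ^ j) * nn y)" using Suc y by (intro mult_left_mono) auto
    finally show "nn (sqr (Suc j) ?h ** y) <= (K\<^sup>2) ^ (2 ^ Suc j) * nn y"
     using Ec yc by (simp add: mult_assoc power_add mult_2)
   qed
  qed
  show "nn (sqr j ?h) <= 1 * (K\<^sup>2) ^ (2 ^ j)" for j using bspec[OF sj vnsubD(2)[OF S], of j] Ec by simp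
 qed
 show ?thesis by (intro exI[of _ E] conjI ballI allI impI EB near Ebnd)
qed

definition ofam :: "nat => (nat => 'a) => bool" where
 "ofam m e \<longleftrightarrow> (ALL i<m. e i : B & proj (e i) & e i ~= \<zero>) & (ALL i<m. ALL j<m. i ~= j --> e i ** e j = \<zero>)"

text \<open>Normalised orthogonal projections form an orthonormal family. Parseval with respect to a
  basis of B of size N, followed by Bessel with respect to the family, gives m <= N.\<close>

lemma ofam_bound: "EX N. ALL m e. ofam m e --> m <= N"
proof -
 obtain N b where b: "ons N b" "ALL i<N. b i : B" "!!x. x : B ==> x = pr N b x" using ex_onb[OF B fd] by blast
 have "m <= N" if e: "ofam m e" for m e
 proof -
  have ep: "e i : B" "proj (e i)" "e i ~= \<zero>" if "i < m" for i using e that by (auto simp: ofam_def)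
  note ec = projD[OF ep(2)]
  have en: "nn (e i) > 0" if "i < m" for i using ep[OF that] ec(1)[OF that] nn_zero_iff nn_ge0 by (metis less_eq_real_def)
  define f where "f i = of_real (1 / nn (e i)) .* e i" for i
  have fc: "f i : C" "f i : B" if "i < m" for i using that ec ep vnsubD(5)[OF vnsub_findim] by (auto simp: f_def)
  have of: "ons m f" unfolding ons_def
  proof (intro conjI allI impI)
   fix i j assume ij: "i < m" "j < m"
   have "tr (~*f i ** f j) = of_real (1 / nn (e i)) * of_real (1 / nn (e j)) * tr (e i ** e j)"
    using ij ec by (simp add: f_def star_smult smult_mult mult_smult smult_smult tr_smult)
   then show "tr (~*f i ** f j) = (if i = j then 1 else 0)"
    using e ij ec proj_tr[OF ep(2)] en[OF ij(1)] by (auto simp: ofam_def power2_eq_square)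
  qed (use fc in auto)
  have "real m = (\<Sum>i<m. (nn (f i))\<^sup>2)" using onsD(2)[OF of] fc by (simp add: nn_sq)
  also have "... = (\<Sum>i<m. \<Sum>k<N. (cmod (tr (~*b k ** f i)))\<^sup>2)"
  proof (intro sum.cong refl)
   fix i assume "i : {..<m}"
   then have f: "f i : C" "f i = pr N b (f i)" using fc b(3) by auto
   then show "(nn (f i))\<^sup>2 = (\<Sum>k<N. (cmod (tr (~*b k ** f i)))\<^sup>2)" using pr_sq(2)[OF b(1) f(1)] by simp
  qed
  also have "... = (\<Sum>k<N. \<Sum>i<m. (cmod (tr (~*f i ** b k)))\<^sup>2)"
  proof (subst sum.swap, intro sum.cong refl)
   fix k i assume "k : {..<N}" "i : {..<m}"
   then have "tr (~*b k ** f i) = cnj (tr (~*f i ** b k))" using onsD(1)[OF b(1)] fc by (intro tr_swap) auto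
   then show "(cmod (tr (~*b k ** f i)))\<^sup>2 = (cmod (tr (~*f i ** b k)))\<^sup>2" by simp
  qed
  also have "... <= (\<Sum>k<N. (nn (b k))\<^sup>2)" by (intro sum_mono bessel[OF of]) (use onsD(1)[OF b(1)] in auto)
  also have "... = real N" using onsD[OF b(1)] by (simp add: nn_sq)
  finally show ?thesis by simp
 qed
 then show ?thesis by blast
qed

text \<open>Take a longest orthogonal family. It sums to 1, since otherwise the complement could be
  added; and each member is minimal, since otherwise it could be split in two.\<close>

lemma ex_minimal_partition:
 "EX m e. ofam m e & vsum e m = \<one> & (ALL i<m. minproj B (e i))"
proof -
 note S = vnsub_findim
 obtain N where N: "!!m e. ofam m e ==> m <= N" using ofam_bound by blast
 have "ofam 0 (%_. \<one>)" by (simp add: ofam_def)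
 then obtain m where m: "EX e. ofam m e" "!!m'. (EX e. ofam m' e) ==> m' <= m"
  using ex_has_greatest_nat[of "%m. EX e. ofam m e" 0 "%m. m" N] N by (metis le_eq_less_or_eq not_less_eq_eq)
 obtain e where e: "ofam m e" using m by blast
 have ep: "e i : B" "proj (e i)" "e i ~= \<zero>" if "i < m" for i using e that by (auto simp: ofam_def)
 have eo: "e i ** e j = \<zero>" if "i < m" "j < m" "i ~= j" for i j using e that by (auto simp: ofam_def)
 note ec = projD[OF ep(2)]
 have "vsum e m = \<one>"
 proof -
  define s where "s = vsum e m"
  have sc: "s : C" unfolding s_def using ec by simp
  have ss: "~*s = s" unfolding s_def using ec by (subst star_vsum) (auto intro!: vsum_cong)
  have sh: "s ** e i = e i" if i: "i < m" for i
  proof -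
   have "s ** e i = vsum (%k. e k ** e i) m" unfolding s_def using ec i by (simp add: vsum_mult)
   also have "... = e i ** e i" by (rule vsum_single[OF i]) (use eo ec i in auto)
   finally show ?thesis using ec i by simp
  qed
  have "s ** vsum e m = vsum (%i. s ** e i) m" using ec sc by (simp add: mult_vsum)
  also have "... = vsum e m" using sh by (intro vsum_cong)
  finally have "proj s" using sc ss unfolding s_def[symmetric] by (simp add: proj_def)
  then have p: "proj (\<one> -- s)" by (rule proj_compl[OF _ proj_one]) (use sc in simp)
  have sB: "\<one> -- s : B" unfolding s_def by (intro vnsubD[OF S] vsum_mem[OF S] ep(1))
  have o1: "(\<one> -- s) ** e i = \<zero>" if "i < m" for i using sc ec(1)[OF that] sh[OF that] by (simp add: vsub_def distrib_r smult_mult add_neg)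
  have o2: "e i ** (\<one> -- s) = \<zero>" if "i < m" for i
   using arg_cong[OF o1[OF that], of "vstar M"] sc ec[OF that] projD[OF p] by (simp add: star_mult)
  have "\<one> -- s = \<zero>"
  proof (rule ccontr)
   assume "\<one> -- s ~= \<zero>"
   then have "ofam (Suc m) (e(m := \<one> -- s))" unfolding ofam_def using ep eo p sB o1 o2 by (auto simp: less_Suc_eq)
   then show False using m(2)[of "Suc m"] by auto
  qed
  then show ?thesis using sub_eq_zero[of \<one> s] sc by (simp add: s_def)
 qed
 moreover have "minproj B (e i)" if i: "i < m" for i
 proof -
  have split: False if h: "h : B" "proj h" "h ~= \<zero>" "h ~= e i" "e i ** h = h" for h
  proof -
   note hc = projD[OF h(2)]
   have he: "h ** e i = h" using arg_cong[OF h(5), of "vstar M"] hc ec[OF i] by (simp add: star_mult)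
   define k where "k = e i -- h"
   have k: "proj k" unfolding k_def by (rule proj_compl[OF h(2) ep(2)[OF i] h(5)])
   note kc = projD[OF k]
   have kB: "k : B" unfolding k_def using ep(1)[OF i] h by (intro vnsubD[OF S])
   have kn: "k ~= \<zero>" using sub_eq_zero[of "e i" h] ec[OF i] hc h(4) by (auto simp: k_def)
   have ek: "e i ** k = k" "k ** e i = k" unfolding k_def using ec[OF i] hc h(5) he
    by (simp_all add: vsub_def distrib_l distrib_r mult_smult smult_mult)
   have hk: "h ** k = \<zero>" "k ** h = \<zero>" unfolding k_def using ec[OF i] hc h(5) he
    by (simp_all add: vsub_def distrib_l distrib_r mult_smult smult_mult add_neg)
   have o: "x ** e j = \<zero> & e j ** x = \<zero>" if x: "x : C" "e i ** x = x" "x ** e i = x" and j: "j < m" "j ~= i" for x j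
   proof
    have "x ** e j = x ** (e i ** e j)" using x ec[OF i] ec[OF j(1)] by (simp flip: mult_assoc)
    then show "x ** e j = \<zero>" using eo[OF i j(1)] j x by simp
    have "e j ** x = (e j ** e i) ** x" using x ec[OF i] ec[OF j(1)] by (simp add: mult_assoc)
    then show "e j ** x = \<zero>" using eo[OF j(1) i] j x by simp
   qed
   note oh = o[OF hc(1) h(5) he] and ok = o[OF kc(1) ek]
   have "ofam (Suc m) (e(i := h, m := k))" unfolding ofam_def
   proof (intro conjI allI impI)
    fix j l assume "j < Suc m" "l < Suc m" "j ~= l"
    then show "(e(i := h, m := k)) j ** (e(i := h, m := k)) l = \<zero>"
     using eo oh ok hk i by (auto simp: less_Suc_eq)
   qed (use ep h k kB kn i in \<open>auto simp: less_Suc_eq\<close>)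
   then show False using m(2)[of "Suc m"] by auto
  qed
  \<comment> \<open>Half the trace of e i. A projection of this trace below e i would split it, so
    \<open>projection_of_trace\<close> yields a minimal projection below e i, which has to be e i
    itself.\<close>
  define t where "t = (nn (e i))\<^sup>2 / 2"
  have en: "nn (e i) > 0" using ep[OF i] ec(1)[OF i] nn_zero_iff nn_ge0 by (metis less_eq_real_def)
  have "(EX h:B. proj h & e i ** h = h & tr h = of_real t) | (EX e'. minproj B e' & e i ** e' = e')"
   by (rule projection_of_trace[OF S ep(2)[OF i] ep(1)[OF i], of t "of_real (1/2)" "1/2"])
    (simp_all add: t_def proj_tr[OF ep(2)[OF i]])
  then show ?thesis
  proof
   assume "EX h:B. proj h & e i ** h = h & tr h = of_real t"
   then obtain h where h: "h : B" "proj h" "e i ** h = h" "tr h = of_real t" by blast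
   have "t > 0" using en by (simp add: t_def)
   then have "h ~= \<zero>" using h(4) by auto
   moreover have "h ~= e i" using h(4) proj_tr[OF ep(2)[OF i]] en by (auto simp: t_def simp flip: of_real_power)
   ultimately show ?thesis using split h by blast
  next
   assume "EX e'. minproj B e' & e i ** e' = e'"
   then obtain e' where e': "minproj B e'" "e i ** e' = e'" by blast
   then have "e' = e i" using split[of e'] by (auto simp: minproj_def)
   then show ?thesis using e' by simp
  qed
 qed
 ultimately show ?thesis using e by blast
qed

end

text \<open>By minimality of f, y = e ** x ** f has ~*y ** y = c f. Rescaling makes y a partial
  isometry, and minimality of e then determines its range projection.\<close>

lemma minproj_iso:
 assumes S: "vnsub S" and e: "minproj S e" and f: "minproj S f" and x: "x : S" "e ** x ** f ~= \<zero>"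
 shows "EX v:S. ~*v ** v = f & v ** ~*v = e"
proof -
 have pe: "proj e" "e : S" "!!y. y : S ==> EX c. e ** y ** e = c .* e"
  and pf: "proj f" "f : S" "!!y. y : S ==> EX c. f ** y ** f = c .* f" using e f by (auto simp: minproj_def)
 note ec = projD[OF pe(1)] and fc = projD[OF pf(1)]
 have xc: "x : C" using x S vnsubD by blast
 define y where "y = e ** x ** f"
 have yS: "y : S" unfolding y_def using x pe pf by (intro vnsubD[OF S])
 have yc: "y : C" using yS S vnsubD by blast
 have yf: "y ** f = y" "e ** y = y" unfolding y_def using ec fc xc by (simp_all add: mult_assoc) (metis ec(1,3) mult_assoc mult_c fc(1) xc)
 have fy: "f ** ~*y = ~*y" using arg_cong[OF yf(1), of "vstar M"] yc fc by (simp add: star_mult)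
 have yy: "~*y ** y : S" using yS by (intro vnsubD[OF S])
 obtain c where c: "f ** (~*y ** y) ** f = c .* f" using pf(3)[OF yy] by blast
 have "f ** (~*y ** y) ** f = (f ** ~*y) ** (y ** f)" using yc fc by (simp add: mult_assoc)
 then have c: "~*y ** y = c .* f" using c yf fy by simp
 have ny: "nn y > 0" using x(2) yc nn_zero_iff nn_ge0 unfolding y_def[symmetric] by (metis less_eq_real_def)
 have tc: "of_real ((nn y)\<^sup>2) = c * of_real ((nn f)\<^sup>2)" using tr_nn[OF yc] c proj_tr[OF pf(1)] fc by (simp add: tr_smult)
 have nf: "nn f > 0" using tc ny fc(1) nn_ge0 by (metis less_eq_real_def mult_zero_right of_real_0 of_real_eq_iff power_zero_numeral zero_less_power less_irrefl)
 define a where "a = nn y / nn f"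
 have a: "a > 0" using ny nf by (simp add: a_def)
 have ca: "c = of_real (a\<^sup>2)" using tc nf by (simp add: a_def power_divide field_simps)
 define v where "v = of_real (1 / a) .* y"
 have vc: "v : C" using yc by (simp add: v_def)
 have vS: "v : S" unfolding v_def by (rule vnsubD(5)[OF S yS])
 have vv: "~*v ** v = f" unfolding v_def using yc c fc ca a
  by (simp add: star_smult smult_mult mult_smult smult_smult power2_eq_square flip: of_real_mult)
 have vf: "v ** f = v" "e ** v = v" unfolding v_def using yf yc fc ec by (simp_all add: smult_mult mult_smult)
 have ve: "~*v ** e = ~*v" using arg_cong[OF vf(2), of "vstar M"] vc ec by (simp add: star_mult)
 have p: "proj (v ** ~*v)" by (rule proj_if_star_mult[OF vc pf(1) vv vf(1)])
 have "v ** ~*v : S" using vS by (intro vnsubD[OF S])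
 then obtain d where d: "e ** (v ** ~*v) ** e = d .* e" using pe(3) by blast
 have "e ** (v ** ~*v) ** e = (e ** v) ** (~*v ** e)" using vc ec by (simp add: mult_assoc)
 then have d: "v ** ~*v = d .* e" using d vf ve by simp
 have "d .* e = (d * d) .* e" using projD(3)[OF p] unfolding d using ec by (simp add: smult_mult mult_smult smult_smult)
 then have "d * tr e = d * d * tr e" using arg_cong[of _ _ tr] ec by (metis tr_smult)
 moreover have "tr (v ** ~*v) = of_real ((nn f)\<^sup>2)" using tr_comm[of v "~*v"] vc vv proj_tr[OF pf(1)] by simp
 then have "d * tr e ~= 0" using d nf ec by (simp add: tr_smult)
 ultimately have "d = 1" by simp
 then have "v ** ~*v = e" using d ec by simp
 then show ?thesis using vS vv by blast
qed

text \<open>Blocks are the equivalence classes of minimal projections of a partition of 1, with the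
  least index as representative. A corner e i ** b ** e j vanishes between inequivalent projections
  by \<open>minproj_iso\<close>, and is a multiple of v i ** ~*v j otherwise.\<close>

theorem findim_sys:
 assumes B: "star_subalg M B" and fd: "fin_dim M B"
 shows "EX m r v. sys m r v & (ALL i<m. v i : B) &
  (ALL b:B. EX cf. b = vsum (%i. vsum (%j. (if r i = r j then cf i j else 0) .* (v i ** ~*v j)) m) m)"
proof -
 note S = vnsub_findim[OF B fd]
 obtain m e where e: "ofam B m e" "vsum e m = \<one>" "!!i. i < m ==> minproj B (e i)"
  using ex_minimal_partition[OF B fd] by blast
 have ep: "e i : B" "proj (e i)" "e i ~= \<zero>" if "i < m" for i using e(1) that by (auto simp: ofam_def[OF B fd])
 have eo: "e i ** e j = \<zero>" if "i < m" "j < m" "i ~= j" for i j using e(1) that by (auto simp: ofam_def[OF B fd])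
 note ec = projD[OF ep(2)]
 define R where "R i j \<longleftrightarrow> (EX v:B. ~*v ** v = e j & v ** ~*v = e i)" for i j
 have Bc: "x : C" if "x : B" for x using that S vnsubD by blast
 have refl: "R i i" if "i < m" for i unfolding R_def using ec[OF that] ep(1)[OF that] by metis
 have sym: "R j i" if "R i j" for i j
  using that unfolding R_def by (metis Bc star_star vnsubD(6)[OF S])
 have trans: "R i k" if ij: "R i j" and jk: "R j k" and m: "i < m" "j < m" "k < m" for i j k
 proof -
  obtain v w where v: "v : B" "~*v ** v = e j" "v ** ~*v = e i" and w: "w : B" "~*w ** w = e k" "w ** ~*w = e j"
   using ij jk unfolding R_def by blast
  have c: "v : C" "w : C" using v w Bc by auto
  have "~*(v ** w) ** (v ** w) = ~*w ** ((~*v ** v) ** w)" using c by (simp add: star_mult mult_assoc)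
  also have "... = (~*w ** w) ** (~*w ** w)" unfolding v(2) w(3)[symmetric] using c by (simp add: mult_assoc)
  also have "... = e k" unfolding w(2) using ec[OF m(3)] by simp
  finally have 1: "~*(v ** w) ** (v ** w) = e k" .
  have "(v ** w) ** ~*(v ** w) = v ** ((w ** ~*w) ** ~*v)" using c by (simp add: star_mult mult_assoc)
  also have "... = (v ** ~*v) ** (v ** ~*v)" unfolding w(3) v(2)[symmetric] using c by (simp add: mult_assoc)
  also have "... = e i" unfolding v(3) using ec[OF m(1)] by simp
  finally show ?thesis unfolding R_def using 1 vnsubD(4)[OF S v(1) w(1)] by blast
 qed
 define r where "r i = (LEAST j. j < m & R i j)" for i
 have r: "r i < m" "R i (r i)" if "i < m" for i
  using LeastI[of "%j. j < m & R i j" i] refl[OF that] that unfolding r_def by auto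
 have req: "r i = r j" if "R i j" "i < m" "j < m" for i j
 proof -
  have "(%k. k < m & R i k) = (%k. k < m & R j k)" using that trans sym by (intro ext) metis
  then show ?thesis unfolding r_def by simp
 qed
 have rr: "r (r i) = r i" if "i < m" for i using req[OF r(2)[OF that] that r(1)[OF that]] by simp
 \<comment> \<open>At a representative, v i is the projection itself, as \<open>psys\<close>
   demands.\<close>
 define v where "v i = (if i = r i then e i else SOME v. v : B & ~*v ** v = e (r i) & v ** ~*v = e i)" for i
 have v: "v i : B" "~*v i ** v i = e (r i)" "v i ** ~*v i = e i" if i: "i < m" for i
 proof -
  have "v i : B & ~*v i ** v i = e (r i) & v i ** ~*v i = e i"
  proof (cases "i = r i")
   case True then show ?thesis using ep(1)[OF i] ec[OF i] by (simp add: v_def)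
  next
   case False
   have "EX v. v : B & ~*v ** v = e (r i) & v ** ~*v = e i" using r(2)[OF i] unfolding R_def by blast
   from someI_ex[OF this] show ?thesis using False by (simp add: v_def)
  qed
  then show "v i : B" "~*v i ** v i = e (r i)" "v i ** ~*v i = e i" by auto
 qed
 have vc: "v i : C" if "i < m" for i using v(1)[OF that] Bc by blast
 have vr: "v (r i) = e (r i)" if "i < m" for i using rr[OF that] by (simp add: v_def)
 have vo: "~*v i ** v j = \<zero>" if ij: "i < m" "j < m" "i ~= j" for i j
 proof -
  have "tr (~*(~*v i ** v j) ** (~*v i ** v j)) = tr (~*v j ** ((v i ** ~*v i) ** v j))" using vc ij by (simp add: star_mult mult_assoc)
  also have "... = tr ((v i ** ~*v i) ** (v j ** ~*v j))" using vc ij tr_comm[of "~*v j" "(v i ** ~*v i) ** v j"] by (simp add: mult_assoc)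
  also have "... = 0" unfolding v(3)[OF ij(1)] v(3)[OF ij(2)] eo[OF ij] by simp
  finally show ?thesis using vc ij by (intro tr_faithful) auto
 qed
 have ps: "psys m r v" unfolding psys_def using vc r rr v vo vr by auto
 have "vsum (%i. v i ** ~*v i) m = \<one>" using e(2) v(3) vsum_cong[of m "%i. v i ** ~*v i" e] by simp
 then have sy: "sys m r v" using ps by (simp add: sys_def)
 have "EX cf. b = vsum (%i. vsum (%j. (if r i = r j then cf i j else 0) .* (v i ** ~*v j)) m) m" if b: "b : B" for b
 proof -
  have bc: "b : C" using b Bc by blast
  have "EX c. e i ** b ** e j = (if r i = r j then c else 0) .* (v i ** ~*v j)" if ij: "i < m" "j < m" for i j
  proof -
   define y where "y = ~*v i ** (b ** v j)"
   have yB: "y : B" unfolding y_def using v(1) ij b by (intro vnsubD[OF S]) auto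
   have yc: "y : C" using yB Bc by blast
   have ebe: "e i ** b ** e j = v i ** (y ** ~*v j)"
    unfolding y_def v(3)[OF ij(1), symmetric] v(3)[OF ij(2), symmetric] using vc ij bc by (simp add: mult_assoc)
   have "e (r i) ** ~*v i = ~*v i" "v j ** e (r j) = v j"
    using psys_left[OF ps ij(1)] psys_right[OF ps ij(2)] vr ij by auto
   moreover have "e (r i) : C" "e (r j) : C" using ec r ij by auto
   moreover from this have "e (r i) ** y ** e (r j) = (e (r i) ** ~*v i) ** (b ** (v j ** e (r j)))"
    unfolding y_def using vc ij bc by (simp add: mult_assoc)
   ultimately have yy: "e (r i) ** y ** e (r j) = y" by (simp add: y_def)
   show ?thesis
   proof (cases "r i = r j")
    case True
    obtain c where "e (r i) ** y ** e (r i) = c .* e (r i)" using e(3)[OF r(1)[OF ij(1)]] yB unfolding minproj_def by blast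
    then have "y = c .* v (r i)" using yy True vr[OF ij(1)] by simp
    then have "e i ** b ** e j = c .* ((v i ** v (r i)) ** ~*v j)" unfolding ebe
     using vc ij r(1)[OF ij(1)] by (simp add: smult_mult mult_smult mult_assoc)
    then show ?thesis using psys_right[OF ps ij(1)] True by auto
   next
    case False
    have "y = \<zero>"
    proof (rule ccontr)
     assume "y ~= \<zero>"
     then have "R (r i) (r j)" unfolding R_def using yy yB
      by (intro minproj_iso[OF S e(3)[OF r(1)[OF ij(1)]] e(3)[OF r(1)[OF ij(2)]], of y]) auto
     then have "r (r i) = r (r j)" using r ij by (intro req) auto
     then show False using rr ij False by simp
    qed
    then show ?thesis unfolding ebe using vc ij False by simp
   qed
  qed
  then obtain cf where cf: "!!i j. i < m ==> j < m ==> e i ** b ** e j = (if r i = r j then cf i j else 0) .* (v i ** ~*v j)"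
   by metis
  have "b = vsum e m ** (b ** vsum e m)" unfolding e(2) using bc by simp
  also have "... = vsum (%i. vsum (%j. e i ** b ** e j) m) m"
   using ec bc by (subst vsum_mult) (auto simp: mult_vsum mult_assoc intro!: vsum_cong)
  also have "... = vsum (%i. vsum (%j. (if r i = r j then cf i j else 0) .* (v i ** ~*v j)) m) m"
   by (intro vsum_cong cf)
  finally show ?thesis by blast
 qed
 then show ?thesis using sy v(1) by blast
qed

lemma sum_pairs: "(\<Sum>i<m. \<Sum>j<m. f i j) = (\<Sum>k<m * m. f (k div m) (k mod m) :: complex)" for m :: nat
proof -
 have "(\<Sum>k\<in>{i * m..<i * m + m}. f (k div m) (k mod m)) = (\<Sum>j<m. f i j)" for i
  using sum.shift_bounds_nat_ivl[of "%k. f (k div m) (k mod m)" 0 "i * m" m]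
  by (simp add: add.commute atLeast0LessThan)
 then show ?thesis using sum.nat_group[of "%k. f (k div m) (k mod m)" m m] by simp
qed

text \<open>Copies of e with orthogonal ranges number at most 1 / tr e. Those of a maximal family
  fill up 1 because a factor is prime, and then the elements x i ** e ** ~*x j span the
  algebra.\<close>

theorem fin_dim_if_minproj:
 assumes f: "tcen C" and e: "minproj C e" shows "fin_dim M C"
proof -
 have pe: "proj e" "e ~= \<zero>" "!!y. y : C ==> EX c. e ** y ** e = c .* e" using e by (auto simp: minproj_def)
 note ec = projD[OF pe(1)]
 have "e ** (e ** y) = e ** y" if "y : C" for y using mult_assoc[of e e y] ec that by simp
 note ec = ec this
 have ne: "nn e > 0" using pe(2) ec(1) nn_zero_iff nn_ge0 by (metis less_eq_real_def)
 \<comment> \<open>The x i ** e are partial isometries starting at e with orthogonal ranges; F m x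
   is the sum of these ranges.\<close>
 define Q where "Q m x \<longleftrightarrow> (ALL i<m. x i : C) & (ALL i<m. ALL j<m. (e ** ~*x i) ** (x j ** e) = (if i = j then e else \<zero>))" for m :: nat and x :: "nat => 'a"
 define F where "F m x = vsum (%i. (x i ** e) ** (e ** ~*x i)) m" for m and x :: "nat => 'a"
 have Fc: "F m x : C" and Fs: "~*F m x = F m x" and Fx: "!!j. j < m ==> F m x ** (x j ** e) = x j ** e" if q: "Q m x" for m :: nat and x :: "nat => 'a"
 proof -
  have xc: "x i : C" if "i < m" for i using q that by (simp add: Q_def)
  show "F m x : C" unfolding F_def using xc ec by simp
  show "~*F m x = F m x" unfolding F_def using xc ec by (subst star_vsum) (auto simp: star_mult mult_assoc intro!: vsum_cong)
  fix j assume j: "j < m"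
  have "F m x ** (x j ** e) = vsum (%i. (x i ** e) ** ((e ** ~*x i) ** (x j ** e))) m"
   unfolding F_def using xc ec j by (subst vsum_mult) (auto simp: mult_assoc intro!: vsum_cong)
  also have "... = (x j ** e) ** ((e ** ~*x j) ** (x j ** e))"
   by (rule vsum_single[OF j]) (use q xc ec j in \<open>auto simp: Q_def\<close>)
  also have "... = (x j ** e) ** e" using q j by (simp add: Q_def)
  also have "... = x j ** e" using xc[OF j] ec(1,3) by (simp add: mult_assoc)
  finally show "F m x ** (x j ** e) = x j ** e" .
 qed
 have Fp: "proj (F m x)" if q: "Q m x" for m x
 proof -
  have xc: "x i : C" if "i < m" for i using q that by (simp add: Q_def)
  have "F m x ** F m x = vsum (%i. (F m x ** (x i ** e)) ** (e ** ~*x i)) m"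
   by (subst (2) F_def, subst mult_vsum) (use Fc[OF q] xc ec in \<open>auto simp: mult_assoc intro!: vsum_cong\<close>)
  also have "... = F m x" unfolding F_def[of m x] using Fx[OF q] by (intro vsum_cong) (simp add: F_def)
  finally show ?thesis using Fc[OF q] Fs[OF q] by (simp add: proj_def)
 qed
 have bound: "m <= nat \<lceil>1 / (nn e)\<^sup>2\<rceil>" if q: "Q m x" for m x
 proof -
  have xc: "x i : C" if "i < m" for i using q that by (simp add: Q_def)
  have "tr (F m x) = (\<Sum>i<m. tr ((x i ** e) ** (e ** ~*x i)))" unfolding F_def using xc ec by (simp add: tr_vsum)
  also have "... = (\<Sum>i<m. tr e)"
  proof (intro sum.cong refl)
   fix i assume "i : {..<m}"
   then have i: "i < m" by simp
   have "tr ((x i ** e) ** (e ** ~*x i)) = tr ((e ** ~*x i) ** (x i ** e))" using xc[OF i] ec by (intro tr_comm) auto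
   then show "tr ((x i ** e) ** (e ** ~*x i)) = tr e" using q i by (simp add: Q_def)
  qed
  finally have "complex_of_real ((nn (F m x))\<^sup>2) = of_real (real m * (nn e)\<^sup>2)"
   unfolding proj_tr[OF Fp[OF q]] proj_tr[OF pe(1)] by simp
  then have "(nn (F m x))\<^sup>2 = real m * (nn e)\<^sup>2" by (simp only: of_real_eq_iff)
  moreover have "nn (F m x) <= 1" using bnd_nn[OF proj_bnd[OF Fp[OF q]]] .
  then have "(nn (F m x))\<^sup>2 <= 1\<^sup>2" using Fc[OF q] by (intro power_mono) auto
  ultimately have "real m <= 1 / (nn e)\<^sup>2" using ne by (simp add: pos_le_divide_eq)
  then have "real m <= real (nat \<lceil>1 / (nn e)\<^sup>2\<rceil>)" by (rule order_trans[OF _ real_nat_ceiling_ge])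
  then show ?thesis by simp
 qed
 have "Q 0 (%_. \<one>)" by (simp add: Q_def)
 then obtain m where m: "EX x. Q m x" "!!m'. (EX x. Q m' x) ==> m' <= m"
  using ex_has_greatest_nat[of "%m. EX x. Q m x" 0 "%m. m" "nat \<lceil>1 / (nn e)\<^sup>2\<rceil>"] bound by (metis le_eq_less_or_eq not_less_eq_eq)
 obtain x where q: "Q m x" using m by blast
 have xc: "x i : C" if "i < m" for i using q that by (simp add: Q_def)
 define a where "a = \<one> -- F m x"
 note Fp' = projD[OF Fp[OF q]]
 have pa: "proj a" unfolding a_def by (rule proj_compl[OF Fp[OF q] proj_one]) (use Fp' in simp)
 note ac = projD[OF pa]
 have ax: "a ** (x j ** e) = \<zero>" if "j < m" for j unfolding a_def
  using Fp' xc[OF that] ec Fx[OF q that] by (simp add: vsub_def distrib_r smult_mult add_neg)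
 have z: "a ** (s ** e) = \<zero>" if s: "s : C" for s
 proof (rule ccontr)
  \<comment> \<open>Rescaled, this element starts at e and its range avoids all previous ones, so it
    would extend the maximal family.\<close>
  assume nz: "a ** (s ** e) ~= \<zero>"
  let ?y = "a ** (s ** e)"
  have yc: "?y : C" using ac s ec by simp
  have "~*s ** (a ** s) : C" using s ac by simp
  then obtain c where c: "e ** (~*s ** (a ** s)) ** e = c .* e" using pe(3) by blast
  have yy: "~*?y ** ?y = e ** (~*s ** ((a ** a) ** s)) ** e" using ac(1,2) s ec(1,2) by (simp add: star_mult mult_assoc)
  then have cc: "~*?y ** ?y = c .* e" using c ac(3) by simp
  have ny: "nn ?y > 0" using nz yc nn_zero_iff nn_ge0 by (metis less_eq_real_def)
  have tc: "of_real ((nn ?y)\<^sup>2) = c * of_real ((nn e)\<^sup>2)" using tr_nn[OF yc] cc proj_tr[OF pe(1)] ec by (simp add: tr_smult)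
  define t where "t = nn ?y / nn e"
  have t: "t > 0" using ny ne by (simp add: t_def)
  have ct: "c = of_real (t\<^sup>2)" using tc ne by (simp add: t_def power_divide field_simps)
  define w where "w = of_real (1 / t) .* ?y"
  have wc: "w : C" using yc by (simp add: w_def)
  have we: "w ** e = w" "a ** w = w" unfolding w_def using ac s ec by (simp_all add: smult_mult mult_smult mult_assoc) (metis ac(1,3) mult_assoc mult_c ec(1) s)
  have ew: "e ** ~*w = ~*w" using arg_cong[OF we(1), of "vstar M"] wc ec by (simp add: star_mult)
  have ww: "~*w ** w = e" unfolding w_def using yc cc ec ct t
   by (simp add: star_smult smult_mult mult_smult smult_smult power2_eq_square flip: of_real_mult)
  have xw: "(e ** ~*x i) ** w = \<zero>" if i: "i < m" for i
  proof -
   have "(e ** ~*x i) ** a = \<zero>" using arg_cong[OF ax[OF i], of "vstar M"] ac xc[OF i] ec by (simp add: star_mult)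
   then have "(e ** ~*x i) ** a ** w = \<zero>" using wc by simp
   then show ?thesis using we(2) wc ac(1) xc[OF i] ec(1) by (simp add: mult_assoc)
  qed
  have wx: "~*w ** (x i ** e) = \<zero>" if i: "i < m" for i
   using arg_cong[OF xw[OF i], of "vstar M"] wc xc[OF i] ec by (simp add: star_mult)
  have "Q (Suc m) (x(m := w))" unfolding Q_def
   using q xc wc we(1) ew ww xw wx by (auto simp: Q_def less_Suc_eq)
  then show False using m(2)[of "Suc m"] by auto
 qed
 have "a = \<zero> | e = \<zero>" by (rule prime_subfactor[OF vnsub_C f ac(1) ec(1) z])
 then have F1: "F m x = \<one>" using pe(2) sub_eq_zero[of \<one> "F m x"] Fp' by (auto simp: a_def)
 define g where "g k = x (k div m) ** e ** ~*x (k mod m)" for k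
 have kk: "k div m < m" "k mod m < m" if "k < m * m" for k
 proof -
  have "m > 0" using that by (cases m) auto
  then show "k div m < m" "k mod m < m" using that by (auto simp: less_mult_imp_div_less)
 qed
 have gc: "g k : C" if "k < m * m" for k unfolding g_def using kk[OF that] xc ec by simp
 have "EX cs. length cs = length (map g [0..<m * m]) & s = lincomb M cs (map g [0..<m * m])" if s: "s : C" for s
 proof -
  have "EX c. e ** (~*x i ** (s ** x j)) ** e = c .* e" if "i < m" "j < m" for i j using pe(3) xc s that by simp
  then obtain cf where cf: "!!i j. i < m ==> j < m ==> e ** (~*x i ** (s ** x j)) ** e = cf i j .* e" by metis
  have "s = vsum (%k. cf (k div m) (k mod m) .* g k) (m * m)"
  proof (rule tau_ext[OF s])
   fix w assume w: "w : C"
   have e2: "tr (w ** ((x i ** e) ** (e ** ~*x i) ** (s ** ((x j ** e) ** (e ** ~*x j))))) = tr (w ** (cf i j .* (x i ** e ** ~*x j)))"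
    if ij: "i < m" "j < m" for i j
   proof -
    have "(x i ** e) ** (e ** ~*x i) ** (s ** ((x j ** e) ** (e ** ~*x j)))
     = (x i ** e) ** ((e ** (~*x i ** (s ** x j)) ** e) ** (e ** ~*x j))" using xc ij s ec(1) by (simp add: mult_assoc)
    also have "... = cf i j .* (x i ** ((e ** e) ** (e ** ~*x j)))" unfolding cf[OF ij] using xc ij ec(1) by (simp add: mult_assoc mult_smult smult_mult)
    also have "... = cf i j .* (x i ** ((e ** e) ** ~*x j))" unfolding ec(3) using xc ij ec(1) by (subst mult_assoc[symmetric]) (auto simp: ec(3))
    finally show ?thesis unfolding ec(3) using xc ij ec(1) by (simp add: mult_assoc)
   qed
   have "s = F m x ** (s ** F m x)" unfolding F1 using s by simp
   then have "tr (w ** s) = tr (w ** (F m x ** (s ** F m x)))" by simp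
   also have "F m x ** (s ** F m x) = vsum (%i. vsum (%j. (x i ** e) ** (e ** ~*x i) ** (s ** ((x j ** e) ** (e ** ~*x j)))) m) m"
    unfolding F_def using xc ec s by (subst vsum_mult) (auto simp: mult_vsum intro!: vsum_cong)
   also have "tr (w ** ...) = (\<Sum>i<m. \<Sum>j<m. tr (w ** ((x i ** e) ** (e ** ~*x i) ** (s ** ((x j ** e) ** (e ** ~*x j))))))"
    using xc ec s w by (simp add: tr_mult_vsum)
   also have "... = (\<Sum>i<m. \<Sum>j<m. tr (w ** (cf i j .* (x i ** e ** ~*x j))))" using e2 by simp
   also have "... = (\<Sum>k<m*m. tr (w ** (cf (k div m) (k mod m) .* g k)))"
    unfolding g_def by (rule sum_pairs)
   also have "... = tr (w ** vsum (%k. cf (k div m) (k mod m) .* g k) (m * m))" using gc w by (simp add: tr_mult_vsum)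
   finally show "tr (w ** s) = tr (w ** vsum (%k. cf (k div m) (k mod m) .* g k) (m * m))" .
  qed (use gc in simp)
  then have "s = lincomb M (map (%k. cf (k div m) (k mod m)) [0..<m * m]) (map g [0..<m * m])"
   using lincomb_vsum[of "m * m" g "%k. cf (k div m) (k mod m)"] gc by simp
  then show ?thesis by (intro exI[of _ "map (%k. cf (k div m) (k mod m)) [0..<m * m]"]) simp
 qed
 moreover have "set (map g [0..<m * m]) \<subseteq> C" using gc by auto
 ultimately show ?thesis unfolding fin_dim_def by blast
qed

end

section \<open>Approximate homomorphisms\<close>

text \<open>Preserving these quantities forces \<open>f\<close> to be an embedding: linearity comes for free, because the inner
  products \<open>\<tau>(x* y)\<close> are preserved.\<close>

definition tst :: "'a tvna => 'a => 'a => 'a => real \<times> real \<times> real \<times> complex" where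
 "tst M a b d = (nrm2 M (a --\<^sub>M d), nrm2 M (a **\<^sub>M b --\<^sub>M d), nrm2 M (~*\<^sub>M a --\<^sub>M d), vtr M a)"

text \<open>Operator bounds are preserved exactly and for all r, while everything else is only
  approximate: images of a bounded sequence then remain bounded, so they define an element of the
  ultrapower.\<close>

definition ahom :: "'a tvna => 'b tvna => 'a set => real => ('a => 'b) => bool" where
 "ahom M P F \<epsilon> \<phi> \<longleftrightarrow> (ALL a:F. \<phi> a : vcarrier P & (ALL r. talg.bnd M r a --> talg.bnd P r (\<phi> a))) &
  (ALL a:F. ALL b:F. ALL d:F. dist (tst P (\<phi> a) (\<phi> b) (\<phi> d)) (tst M a b d) < \<epsilon>)"

lemma ahomD: assumes "ahom M P F \<epsilon> \<phi>" "a : F"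
 shows "\<phi> a : vcarrier P" "talg.bnd M r a ==> talg.bnd P r (\<phi> a)"
  "[|b : F; d : F|] ==> dist (tst P (\<phi> a) (\<phi> b) (\<phi> d)) (tst M a b d) < \<epsilon>"
 using assms by (auto simp: ahom_def)

lemma ahom_mono: "[|ahom M P F \<epsilon> \<phi>; F' \<subseteq> F; \<epsilon> <= \<epsilon>'|] ==> ahom M P F' \<epsilon>' \<phi>"
 unfolding ahom_def by (blast intro: less_le_trans)

lemma ahom_comp:
 assumes f: "ahom M P F \<epsilon> \<phi>" and g: "ahom P Q (\<phi> ` F) \<epsilon>' \<psi>" shows "ahom M Q F (\<epsilon> + \<epsilon>') (%x. \<psi> (\<phi> x))"
 unfolding ahom_def
proof (intro conjI ballI allI impI)
 fix a assume a: "a : F"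
 show "\<psi> (\<phi> a) : vcarrier Q" using ahomD(1)[OF g] a by simp
 show "talg.bnd Q r (\<psi> (\<phi> a))" if "talg.bnd M r a" for r using ahomD(2)[OF g] ahomD(2)[OF f a that] a by simp
 fix b d assume bd: "b : F" "d : F"
 have "dist (tst Q (\<psi> (\<phi> a)) (\<psi> (\<phi> b)) (\<psi> (\<phi> d))) (tst M a b d)
  <= dist (tst Q (\<psi> (\<phi> a)) (\<psi> (\<phi> b)) (\<psi> (\<phi> d))) (tst P (\<phi> a) (\<phi> b) (\<phi> d)) + dist (tst P (\<phi> a) (\<phi> b) (\<phi> d)) (tst M a b d)"
  by (rule dist_triangle)
 then show "dist (tst Q (\<psi> (\<phi> a)) (\<psi> (\<phi> b)) (\<psi> (\<phi> d))) (tst M a b d) < \<epsilon> + \<epsilon>'"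
  using ahomD(3)[OF f a bd] ahomD(3)[OF g, of "\<phi> a" "\<phi> b" "\<phi> d"] a bd by simp
qed

lemma ahom_nn: assumes "ahom M P F \<epsilon> \<phi>" "a : F" "d : F"
 shows "\<bar>nrm2 P (\<phi> a --\<^sub>P \<phi> d) - nrm2 M (a --\<^sub>M d)\<bar> < \<epsilon>"
 using dist_fst_le[of "tst P (\<phi> a) (\<phi> a) (\<phi> d)" "tst M a a d"] ahomD(3)[OF assms(1,2,2,3)]
 by (simp add: tst_def dist_real_def)

context talg
begin

lemma tst_conj: assumes u: "unit u" and c: "a : C" "b : C" "d : C"
 shows "tst M (u ** a ** ~*u) (u ** b ** ~*u) (u ** d ** ~*u) = tst M a b d"
proof -
 have uc: "u : C" "~*u ** u = \<one>" using unitD[OF u] by auto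
 have uu: "~*u ** (u ** y) = y" if "y : C" for y using mult_assoc[of "~*u" u y] uc that by simp
 have n: "nn (u ** y ** ~*u) = nn y" if "y : C" for y using unit_nn[OF u] unit_nn[OF unit_star[OF u]] uc that by simp
 have s: "u ** x ** ~*u -- u ** y ** ~*u = u ** (x -- y) ** ~*u" if "x : C" "y : C" for x y
  using that uc(1) by (simp add: vsub_def distrib_l distrib_r smult_mult mult_smult)
 have m: "(u ** a ** ~*u) ** (u ** b ** ~*u) = u ** (a ** b) ** ~*u" using c uc(1) uu by (simp add: mult_assoc)
 have t: "~*(u ** a ** ~*u) = u ** ~*a ** ~*u" using c uc(1) by (simp add: star_mult mult_assoc)
 have "tr (u ** a ** ~*u) = tr a" using c uc tr_comm[of "u ** a" "~*u"] uu by simp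
 then show ?thesis unfolding tst_def m t using s n c by simp
qed

lemma cv_tst: assumes "!!n. bnd K (s n)" "cv F s x" "cv F t y" "cv F w z"
 shows "((%n. tst M (s n) (t n) (w n)) \<longlongrightarrow> tst M x y z) F"
 unfolding tst_def by (intro tendsto_Pair cv_nn cv_tr cv_sub cv_star cv_mult[OF assms(1)] assms)

text \<open>Every x is approximated by members of D with a common operator bound. The entry D 0 = 0
  ensures that a candidate within any such bound is always present.\<close>

definition bdense :: "(nat => 'a) => bool" where
 "bdense D \<longleftrightarrow> (ALL n. D n : C) & D 0 = \<zero> & (ALL x:C. EX r. ALL \<epsilon>>0. EX n. bnd r (D n) & nn (D n -- x) < \<epsilon>)"

text \<open>A set dense for the 2-norm gives no control of operator norms. For each of its points d
  and each n and r, an element of bound r within 1 / (n + 1) of d is selected if one exists.\<close>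

lemma ex_bdense: assumes "separable M" shows "EX D. bdense D"
proof -
 obtain D where D: "countable D" "D \<subseteq> C" "!!x \<epsilon>. [|x : C; \<epsilon> > 0|] ==> EX d:D. nn (x -- d) < \<epsilon>"
  using assms unfolding separable_def by meson
 define Q where "Q d n r y \<longleftrightarrow> bnd (real r) y & nn (y -- d) < 1 / real (Suc n)" for d y and n r :: nat
 define p where "p = (%(d, n, r). if EX y. Q d n r y then SOME y. Q d n r y else \<zero>)"
 have pQ: "Q d n r (p (d, n, r))" if "Q d n r y" for d n r y
  using that someI[of "Q d n r" y] by (auto simp: p_def)
 have pc: "p t : C" for t
 proof (cases t)
  case (fields d n r)
  show ?thesis
  proof (cases "EX y. Q d n r y")
   case True
   then have "Q d n r (p (d, n, r))" using pQ by blast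
   then show ?thesis unfolding fields Q_def using bnd_c by blast
  qed (auto simp: p_def fields)
 qed
 define Y where "Y = p ` (D \<times> UNIV \<times> UNIV)"
 have "D ~= {}" using D(3)[OF one_c, of 1] by auto
 then have Y: "range (from_nat_into Y) = Y" using D(1) by (intro range_from_nat_into) (auto simp: Y_def)
 define E where "E = case_nat \<zero> (from_nat_into Y)"
 have Yc: "from_nat_into Y n : C" for n
 proof -
  have "from_nat_into Y n : Y" using Y by blast
  then show ?thesis unfolding Y_def by (elim imageE) (simp only: pc)
 qed
 have "EX r. ALL \<epsilon>>0. EX n. bnd r (E n) & nn (E n -- x) < \<epsilon>" if x: "x : C" for x
 proof -
  obtain K where K: "bnd K x" using ex_bnd[OF x] by blast
  have bx: "bnd (real (nat \<lceil>K\<rceil>)) x" by (rule bnd_mono[OF K]) (rule real_nat_ceiling_ge)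
  show ?thesis
  proof (intro exI[of _ "real (nat \<lceil>K\<rceil>)"] allI impI)
   fix \<epsilon> :: real assume "\<epsilon> > 0"
   then obtain n where n: "1 / real (Suc n) < \<epsilon> / 2" using nat_approx_posE[of "\<epsilon> / 2"] by auto
   obtain d where d: "d : D" "nn (x -- d) < 1 / real (Suc n)" using D(3)[OF x, of "1 / real (Suc n)"] by auto
   have q: "Q d n (nat \<lceil>K\<rceil>) (p (d, n, nat \<lceil>K\<rceil>))" using bx d by (intro pQ[of _ _ _ x]) (simp add: Q_def)
   have dc: "d : C" using d D by auto
   have "nn (p (d, n, nat \<lceil>K\<rceil>) -- x) < \<epsilon>"
    using sub_tri[OF pc dc x, of "(d, n, nat \<lceil>K\<rceil>)"] q d(2) n sub_swap[OF x dc] unfolding Q_def by linarith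
   moreover have "p (d, n, nat \<lceil>K\<rceil>) : Y" using d by (auto simp: Y_def)
   then obtain i where "p (d, n, nat \<lceil>K\<rceil>) = from_nat_into Y i" using Y by (metis imageE)
   ultimately show "EX n. bnd (real (nat \<lceil>K\<rceil>)) (E n) & nn (E n -- x) < \<epsilon>"
    using q by (intro exI[of _ "Suc i"]) (simp add: E_def Q_def)
  qed
 qed
 then have "bdense E" using Yc by (simp add: bdense_def E_def split: nat.split)
 then show ?thesis by blast
qed

lemma approximants: assumes D: "bdense D"
 shows "EX e. ALL x:C. (EX r. ALL k. bnd r (e k x)) & cv sequentially (%k. e k x) x & (ALL k. e k x : D ` {..k::nat})"
proof -
 have Dc: "D n : C" "D 0 = \<zero>" for n using D by (auto simp: bdense_def)
 have "EX f. (EX r. ALL k. bnd r (f k)) & cv sequentially f x & (ALL k. f k : D ` {..k::nat})" if x: "x : C" for x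
 proof -
  obtain r where r: "!!\<epsilon>. \<epsilon> > 0 ==> EX n. bnd r (D n) & nn (D n -- x) < \<epsilon>" using D x unfolding bdense_def by meson
  then obtain n1 where "bnd r (D n1)" using zero_less_one by blast
  then have r0: "bnd r \<zero>" using bnd_ge0 by (intro bndI) auto
  define T where "T k = {y : D ` {..k}. bnd r y}" for k :: nat
  define f where "f k = arg_min_on (%y. nn (y -- x)) (T k)" for k
  have fin: "finite (T k)" "T k ~= {}" for k using r0 Dc(2) by (force simp: T_def)+
  have fT: "f k : T k" for k unfolding f_def using arg_min_if_finite(1)[OF fin] .
  have le: "nn (f k -- x) <= nn (y -- x)" if "y : T k" for k y unfolding f_def by (rule arg_min_least[OF fin that])
  have "cv sequentially f x"
   unfolding cv_def
  proof (intro conjI allI x)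
   show fc: "f k : C" for k using fT[of k] Dc by (auto simp: T_def)
   show "(%k. nn (f k -- x)) \<longlonglongrightarrow> 0"
   proof (rule LIMSEQ_I)
    fix \<epsilon> :: real assume "\<epsilon> > 0"
    then obtain n where n: "bnd r (D n)" "nn (D n -- x) < \<epsilon>" using r by blast
    have "norm (nn (f k -- x) - 0) < \<epsilon>" if "k >= n" for k
     using le[of "D n" k] n that fc x by (auto simp: T_def)
    then show "EX no. ALL n>=no. norm (nn (f n -- x) - 0) < \<epsilon>" by blast
   qed
  qed
  then show ?thesis using fT by (intro exI[of _ f]) (auto simp: T_def)
 qed
 then obtain g where g: "ALL x:C. (EX r. ALL k. bnd r (g x k)) & cv sequentially (g x) x & (ALL k. g x k : D ` {..k::nat})" by metis
 then show ?thesis by (intro exI[of _ "%k x. g x k"]) simp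
qed

end

text \<open>Inner products are preserved, so f (x + a y) and f x + a f y have equal norms and the
  same inner products with every value of f; their difference has norm 0.\<close>

lemma embedding_if_mult_star_tr:
 assumes "talg M" "talg P" and c: "!!x. x : vcarrier M ==> f x : vcarrier P"
  and mult: "!!x y. [|x : vcarrier M; y : vcarrier M|] ==> f (x **\<^sub>M y) = f x **\<^sub>P f y"
  and star: "!!x. x : vcarrier M ==> f (~*\<^sub>M x) = ~*\<^sub>P f x"
  and tr: "!!x. x : vcarrier M ==> vtr P (f x) = vtr M x"
 shows "embedding M P f"
proof (rule embeddingI[OF assms(1,2)])
 interpret M: talg M by fact
 interpret P: talg P by fact
 have ip: "vtr P (~*\<^sub>P f x **\<^sub>P f y) = vtr M (~*\<^sub>M x **\<^sub>M y)" if "x : vcarrier M" "y : vcarrier M" for x y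
  using that tr[of "~*\<^sub>M x **\<^sub>M y"] by (simp add: mult star)
 have lin: "f (x ++\<^sub>M a .*\<^sub>M y) = f x ++\<^sub>P a .*\<^sub>P f y" if x: "x : vcarrier M" and y: "y : vcarrier M" for x y a
 proof -
  let ?s = "x ++\<^sub>M a .*\<^sub>M y" and ?t = "f x ++\<^sub>P a .*\<^sub>P f y"
  have sc: "?s : vcarrier M" and tc: "?t : vcarrier P" using x y c by auto
  have eq: "vtr P (~*\<^sub>P f w **\<^sub>P f ?s) = vtr P (~*\<^sub>P f w **\<^sub>P ?t)" if w: "w : vcarrier M" for w
   using x y w c ip[OF w sc] ip[OF w x] ip[OF w y]
   by (simp add: P.distrib_l M.distrib_l P.tr_add M.tr_add P.mult_smult M.mult_smult P.tr_smult M.tr_smult)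
  have eq': "vtr P (~*\<^sub>P f ?s **\<^sub>P f w) = vtr P (~*\<^sub>P?t **\<^sub>P f w)" if w: "w : vcarrier M" for w
   using eq[OF w] P.tr_swap[OF c[OF sc] c[OF w]] P.tr_swap[OF tc c[OF w]] by simp
  have "vtr P (~*\<^sub>P?t **\<^sub>P f ?s) = vtr P (~*\<^sub>P?t **\<^sub>P ?t)"
   using x y c eq[OF x] eq[OF y] tc c[OF sc]
   by (simp add: P.star_add P.star_smult P.distrib_r P.smult_mult P.tr_add P.tr_smult)
  then have t: "vtr P (~*\<^sub>P?t **\<^sub>P f ?s) = of_real ((nrm2 P ?t)\<^sup>2)" unfolding P.tr_nn[OF tc] .
  then have "of_real ((nrm2 P (f ?s))\<^sup>2) = complex_of_real ((nrm2 P ?t)\<^sup>2)" using eq'[OF sc] P.tr_nn[OF c[OF sc]] by simp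
  then have "(nrm2 P (f ?s))\<^sup>2 = (nrm2 P ?t)\<^sup>2" by (simp only: of_real_eq_iff)
  then have "(nrm2 P (f ?s --\<^sub>P ?t))\<^sup>2 = 0" unfolding P.nn_sub_sq[OF c[OF sc] tc] t by simp
  then show ?thesis using P.eq_if_nn[OF c[OF sc] tc] by simp
 qed
 have z: "f \<zero>\<^sub>M = \<zero>\<^sub>P"
  using ip[of "\<zero>\<^sub>M" "\<zero>\<^sub>M"] P.tr_faithful[of "f \<zero>\<^sub>M"] c by simp
 have add: "f (x ++\<^sub>M y) = f x ++\<^sub>P f y" if "x : vcarrier M" "y : vcarrier M" for x y
  using lin[OF that, of 1] that c by simp
 have smult: "f (a .*\<^sub>M y) = a .*\<^sub>P f y" if "y : vcarrier M" for y a
  using lin[of "\<zero>\<^sub>M" y a] that c z by (simp add: M.add_comm[of "\<zero>\<^sub>M"] P.add_comm[of "\<zero>\<^sub>P"])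
 have "(nrm2 P (f \<one>\<^sub>M --\<^sub>P \<one>\<^sub>P))\<^sup>2 = 0"
  using P.nn_sub_sq[of "f \<one>\<^sub>M" "\<one>\<^sub>P"] c[of "\<one>\<^sub>M"] ip[of "\<one>\<^sub>M" "\<one>\<^sub>M"] tr[of "\<one>\<^sub>M"] P.nn_sq[of "f \<one>\<^sub>M"] by simp
 then have one: "f \<one>\<^sub>M = \<one>\<^sub>P" using P.eq_if_nn[of "f \<one>\<^sub>M" "\<one>\<^sub>P"] c by simp
 show "star_hom M P f" unfolding star_hom_def using c one add mult smult star by auto
 show "!!x. x : vcarrier M ==> vtr P (f x) = vtr M x" by (rule tr)
qed

text \<open>Testing with d = a ** b or d = ~*a makes a distance 0 on the side of M, so it is 0 on
  the side of P as well.\<close>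

lemma embedding_if_tst:
 assumes "talg M" "talg P" and c: "!!x. x : vcarrier M ==> f x : vcarrier P"
  and t: "!!a b d. [|a : vcarrier M; b : vcarrier M; d : vcarrier M|] ==> tst P (f a) (f b) (f d) = tst M a b d"
 shows "embedding M P f"
proof (rule embedding_if_mult_star_tr[OF assms(1,2) c])
 interpret M: talg M by fact
 interpret P: talg P by fact
 have s0: "x --\<^sub>M x = \<zero>\<^sub>M" if "x : vcarrier M" for x using that by (intro M.tau_ext) (simp_all add: M.alg)
 show "vtr P (f x) = vtr M x" if "x : vcarrier M" for x using t[of x x x] that by (simp add: tst_def)
 show "f (x **\<^sub>M y) = f x **\<^sub>P f y" if "x : vcarrier M" "y : vcarrier M" for x y
  using t[of x y "x **\<^sub>M y"] that s0[of "x **\<^sub>M y"] c by (intro P.eq_if_nn[symmetric]) (simp_all add: tst_def)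
 show "f (~*\<^sub>M x) = ~*\<^sub>P f x" if "x : vcarrier M" for x
  using t[of x x "~*\<^sub>M x"] that s0[of "~*\<^sub>M x"] c by (intro P.eq_if_nn[symmetric]) (simp_all add: tst_def)
qed

lemma (in emb) tst: "[|a : vcarrier M; b : vcarrier M; d : vcarrier M|] ==> tst P (f a) (f b) (f d) = tst M a b d"
 using emb by (simp add: tst_def nn flip: sub mult star) (simp add: embedding_def)

section \<open>Exact lifts, and approximate homomorphisms against embeddings into the
  ultrapower\<close>

context utp
begin

lemma cl_tst: "[|x : Seq; y : Seq; z : Seq|] ==> ((%k. tst M (x k) (y k) (z k)) \<longlongrightarrow> tst P (cl x) (cl y) (cl z)) U"
 unfolding tst_def by (intro tendsto_Pair) (simp_all add: cl_ops cl_nn cl_tr)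

text \<open>Lifts with a coordinatewise property at all accuracies are diagonalised to an exact
  lift; Q is tested at each coordinate separately, so it passes to the diagonal.\<close>

lemma seq_lift: assumes X: "X : vcarrier P" and b: "!!y. Q y ==> bnd r y"
  and l: "!!\<eta>. \<eta> > 0 ==> EX y. (ALL k. Q (y k)) & nrm2 P (X --\<^sub>P cl y) < \<eta>"
 shows "EX y. y : Seq & X = cl y & (ALL k. Q (y k))"
proof -
 obtain x where x: "x : Seq" "X = cl x" using clE[OF X] .
 have "ALL j::nat. EX y. (ALL k. Q (y k)) & nrm2 P (cl x --\<^sub>P cl y) < 1 / real (Suc j)" using l x(2) by simp
 then obtain y where y: "!!j k. Q (y j k)" "!!j. nrm2 P (cl x --\<^sub>P cl (y j)) < 1 / real (Suc j)" by metis
 have ys: "y j : Seq" for j by (rule seqI[OF b[OF y(1)]])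
 have "eventually (%k. nn (x k -- y j k) < 1 / real (Suc j)) U" for j
  using y(2)[of j] x ys by (intro nn_cl_less) (simp_all add: cl_sub)
 from diagonal[of "%j k. nn (x k -- y j k) < 1 / real (Suc j)", OF this] obtain m where m: "!!j. eventually (%k. m k >= j) U"
  "eventually (%k. ALL i<=m k. nn (x k -- y i k) < 1 / real (Suc i)) U" by blast
 define w where "w k = y (m k) k" for k
 have w: "w : Seq" unfolding w_def by (rule seqI[OF b[OF y(1)]])
 have "((%k. nn (x k -- w k)) \<longlongrightarrow> 0) U"
 proof (rule tendstoI)
  fix \<epsilon> :: real assume "\<epsilon> > 0"
  then obtain j where j: "1 / real (Suc j) < \<epsilon>" using nat_approx_posE by blast
  show "eventually (%k. dist (nn (x k -- w k)) 0 < \<epsilon>) U"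
   using m(1)[of j] m(2)
  proof eventually_elim
   case (elim k)
   have "nn (x k -- w k) < 1 / real (Suc (m k))" using elim by (auto simp: w_def)
   also have "... <= 1 / real (Suc j)" using elim by (simp add: frac_le)
   finally show ?case using j x w by simp
  qed
 qed
 then have "X = cl w" unfolding x(2) using cl_eq_iff[OF x(1) w] by simp
 then show ?thesis using w y(1) unfolding w_def by blast
qed

lemma exact_lift: assumes X: "X : vcarrier P" "P.bnd r X"
 shows "EX y. y : Seq & X = cl y & (ALL k. bnd r (y k))"
proof (rule seq_lift[OF X(1)])
 obtain x where x: "x : Seq" "X = cl x" using clE[OF X(1)] .
 show "EX y. (ALL k. bnd r (y k)) & nrm2 P (X --\<^sub>P cl y) < \<eta>" if "\<eta> > 0" for \<eta>
  using contractive_lift[OF x(1) _ that] X(2) x(2) by simp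
qed

lemma exact_unit_lift: assumes f: "tcen C" and V: "P.unit V"
 shows "EX u. u : Seq & V = cl u & (ALL k. unit (u k))"
 by (rule seq_lift[OF P.unitD(1)[OF V] unit_bnd unit_lift[OF f V]])

end

locale utq = utp M U + N: talg N for M :: "'a tvna" and U and N :: "'b tvna"
begin

text \<open>Lift each value of \<pi> with the least bound, \<open>opnorm N a\<close>; a suitable
  coordinate then passes the finitely many approximate tests, and the operator bounds hold at every
  coordinate.\<close>

lemma ex_ahom_if_embedding:
 assumes \<pi>: "embedding N P \<pi>" and F: "finite F" "F \<subseteq> vcarrier N" and e: "\<epsilon> > 0"
 shows "EX \<phi>. ahom N M F \<epsilon> \<phi>"
proof -
 interpret e: emb N P \<pi> by unfold_locales (rule \<pi>)
 have "ALL a:vcarrier N. EX y. y : Seq & \<pi> a = cl y & (ALL k. bnd (opnorm N a) (y k))"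
  using exact_lift[OF e.c e.bnd[OF N.bnd_opnorm]] by blast
 then obtain y where y: "!!a. a : vcarrier N ==> y a : Seq & \<pi> a = cl (y a) & (ALL k. bnd (opnorm N a) (y a k))" by metis
 have "eventually (%k. ALL a:F. ALL b:F. ALL d:F. dist (tst M (y a k) (y b k) (y d k)) (tst N a b d) < \<epsilon>) U"
 proof (intro eventually_ball_finite ballI F(1))
  fix a b d assume "a : F" "b : F" "d : F"
  then have c: "a : vcarrier N" "b : vcarrier N" "d : vcarrier N" using F by auto
  have "((%k. tst M (y a k) (y b k) (y d k)) \<longlongrightarrow> tst P (\<pi> a) (\<pi> b) (\<pi> d)) U" using cl_tst y c by simp
  then show "eventually (%k. dist (tst M (y a k) (y b k) (y d k)) (tst N a b d) < \<epsilon>) U"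
   unfolding e.tst[OF c] using e by (rule tendstoD)
 qed
 then obtain k where k: "ALL a:F. ALL b:F. ALL d:F. dist (tst M (y a k) (y b k) (y d k)) (tst N a b d) < \<epsilon>"
  using eventually_happens'[OF U_bot] by blast
 have "bnd r (y a k)" if "a : F" "N.bnd r a" for a r
 proof -
  have a: "a : vcarrier N" using that F by auto
  have "opnorm N a <= r" using N.opnorm_le_iff[OF a] that N.bnd_ge0 by blast
  then show ?thesis using y[OF a] bnd_mono by blast
 qed
 then have "ahom N M F \<epsilon> (%a. y a k)" unfolding ahom_def using k y F by auto
 then show ?thesis by blast
qed

text \<open>The maps \<phi> k need only be given on finite sets exhausting D: x is sent to the class
  of \<phi> k (e k x), and the tests become exact in the limit.\<close>

lemma limit_embedding:
 assumes D: "N.bdense D" and H: "!!k. D ` {..k} \<subseteq> H k" and \<phi>: "!!k. ahom N M (H k) (\<delta> k) (\<phi> k)" and d: "\<delta> \<longlonglongrightarrow> 0"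
 shows "EX \<rho> e. embedding N P \<rho> & (ALL x:vcarrier N. \<rho> x = cl (%k. \<phi> k (e k x)) & (%k. \<phi> k (e k x)) : Seq &
  N.cv sequentially (%k. e k x) x & (ALL k. e k x : H k & e k x : vcarrier N))"
proof -
 obtain e where e: "!!x. x : vcarrier N ==> (EX r. ALL k. N.bnd r (e k x)) & N.cv sequentially (%k. e k x) x & (ALL k. e k x : D ` {..k})"
  using N.approximants[OF D] by blast
 have eH: "e k x : H k" if "x : vcarrier N" for k x using e[OF that] H by blast
 define s where "s x k = \<phi> k (e k x)" for x k
 have s: "s x : Seq" if x: "x : vcarrier N" for x
 proof -
  obtain r where "!!k. N.bnd r (e k x)" using e[OF x] by blast
  then have "bnd r (s x k)" for k unfolding s_def using ahomD(2)[OF \<phi> eH[OF x]] by blast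
  then show ?thesis by (rule seqI)
 qed
 have t: "tst P (cl (s a)) (cl (s b)) (cl (s d)) = tst N a b d" if c: "a : vcarrier N" "b : vcarrier N" "d : vcarrier N" for a b d
 proof -
  obtain r where r: "!!k. N.bnd r (e k a)" using e[OF c(1)] by blast
  have 1: "((%k. tst N (e k a) (e k b) (e k d)) \<longlongrightarrow> tst N a b d) U"
   using N.cv_tst[of r "%k. e k a" sequentially a "%k. e k b" b "%k. e k d" d] e c r by (intro U_seq) simp
  have 2: "((%k. tst M (s a k) (s b k) (s d k)) \<longlongrightarrow> tst P (cl (s a)) (cl (s b)) (cl (s d))) U" using cl_tst s c by simp
  have "((%k. dist (tst M (s a k) (s b k) (s d k)) (tst N (e k a) (e k b) (e k d))) \<longlongrightarrow> 0) U"
  proof (rule tendsto_sandwich[OF _ _ tendsto_const U_seq[OF d]])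
   show "eventually (%k. dist (tst M (s a k) (s b k) (s d k)) (tst N (e k a) (e k b) (e k d)) <= \<delta> k) U"
    using ahomD(3)[OF \<phi> eH[OF c(1)] eH[OF c(2)] eH[OF c(3)]] unfolding s_def by (intro always_eventually allI less_imp_le)
  qed simp
  from tendsto_unique[OF U_bot tendsto_dist[OF 2 1] this] show ?thesis by simp
 qed
 have "embedding N P (%x. cl (s x))" by (rule embedding_if_tst[OF N.talg_axioms talg_P]) (use s t in auto)
 moreover have ec: "e k x : vcarrier N" if "x : vcarrier N" for k x
 proof -
  have "N.cv sequentially (%k. e k x) x" using e[OF that] by (elim conjE)
  then show ?thesis by (rule N.cv_c(1))
 qed
 moreover have "N.cv sequentially (%k. e k x) x" if "x : vcarrier N" for x using e[OF that] by (elim conjE)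
 ultimately show ?thesis using eH s unfolding s_def
  by (intro exI[of _ "%x. cl (%k. \<phi> k (e k x))"] exI[of _ e] conjI ballI allI) simp_all
qed

end

text \<open>A sequence of counterexamples on an exhausting sequence of finite sets would converge to an embedding that violates
  the hypothesis on embeddings.\<close>

lemma (in utp) near_identity:
 assumes f: "tcen C" and D: "bdense D"
  and J: "!!\<rho> F \<epsilon>. [|embedding M P \<rho>; !!x. x : C ==> EX z. z : Seq & (ALL k. z k : S) & \<rho> x = cl z; finite F; F \<subseteq> C; \<epsilon> > 0|]
   ==> EX V. P.unit V & (ALL x:F. nrm2 P (V **\<^sub>P \<rho> x **\<^sub>P ~*\<^sub>P V --\<^sub>P dg x) < \<epsilon>)"
  and F: "finite F" "F \<subseteq> C" and e: "\<epsilon> > 0"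
 shows "EX F' \<delta>. finite F' & F \<subseteq> F' & F' \<subseteq> C & \<delta> > 0 & (ALL \<phi>. ahom M M F' \<delta> \<phi> & \<phi> ` F' \<subseteq> S -->
  (EX u. unit u & (ALL x:F. nn (u ** \<phi> x ** ~*u -- x) < \<epsilon>)))"
proof (rule ccontr)
 interpret utq M U M by unfold_locales
 assume n: "~ ?thesis"
 define H where "H k = F \<union> D ` {..k}" for k :: nat
 have Hc: "finite (H k)" "F \<subseteq> H k" "H k \<subseteq> C" for k using F D by (auto simp: H_def bdense_def)
 have "ALL k. EX \<phi>. ahom M M (H k) (1 / real (Suc k)) \<phi> & \<phi> ` H k \<subseteq> S & ~ (EX u. unit u & (ALL x:F. nn (u ** \<phi> x ** ~*u -- x) < \<epsilon>))"
 proof (rule allI, rule ccontr)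
  fix k
  assume "~ (EX \<phi>. ahom M M (H k) (1 / real (Suc k)) \<phi> & \<phi> ` H k \<subseteq> S & ~ (EX u. unit u & (ALL x:F. nn (u ** \<phi> x ** ~*u -- x) < \<epsilon>)))"
  then have q: "ALL \<phi>. ahom M M (H k) (1 / real (Suc k)) \<phi> & \<phi> ` H k \<subseteq> S --> (EX u. unit u & (ALL x:F. nn (u ** \<phi> x ** ~*u -- x) < \<epsilon>))" by blast
  show False by (rule notE[OF n], intro exI[of _ "H k"] exI[of _ "1 / real (Suc k)"] conjI Hc q) simp
 qed
 from choice[OF this] obtain \<phi> where "ALL k. ahom M M (H k) (1 / real (Suc k)) (\<phi> k) & \<phi> k ` H k \<subseteq> S &
  ~ (EX u. unit u & (ALL x:F. nn (u ** \<phi> k x ** ~*u -- x) < \<epsilon>))" by (elim exE) (rule that)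
 then have \<phi>: "!!k. ahom M M (H k) (1 / real (Suc k)) (\<phi> k)" "!!k. \<phi> k ` H k \<subseteq> S"
  "!!k u. unit u ==> EX x:F. \<epsilon> <= nn (u ** \<phi> k x ** ~*u -- x)" by (blast, blast, fastforce simp: not_less)
 have HD: "D ` {..k} \<subseteq> H k" for k by (simp add: H_def)
 obtain \<rho> e where \<rho>: "embedding M P \<rho>" and
  er: "!!x. x : C ==> \<rho> x = cl (%k. \<phi> k (e k x)) & (%k. \<phi> k (e k x)) : Seq &
   cv sequentially (%k. e k x) x & (ALL k. e k x : H k & e k x : C)"
  using limit_embedding[OF D HD \<phi>(1) LIMSEQ_Suc[OF lim_1_over_n]] by (elim exE conjE) (rule that, assumption, rule bspec)
 have "EX V. P.unit V & (ALL x:F. nrm2 P (V **\<^sub>P \<rho> x **\<^sub>P ~*\<^sub>P V --\<^sub>P dg x) < \<epsilon> / 2)"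
 proof (rule J[OF \<rho> _ F])
  show "EX z. z : Seq & (ALL k. z k : S) & \<rho> x = cl z" if "x : C" for x
   using er[OF that] \<phi>(2) by (intro exI[of _ "%k. \<phi> k (e k x)"]) blast
 qed (use e in simp)
 then obtain V where V: "P.unit V" "!!x. x : F ==> nrm2 P (V **\<^sub>P \<rho> x **\<^sub>P ~*\<^sub>P V --\<^sub>P dg x) < \<epsilon> / 2" by blast
 obtain v where v: "v : Seq" "V = cl v" "!!k. unit (v k)" using exact_unit_lift[OF f V(1)] by blast
 have "eventually (%k. ALL x:F. nn (v k ** \<phi> k x ** ~*v k -- x) < \<epsilon>) U"
 proof (intro eventually_ball_finite ballI F(1))
  fix x assume x: "x : F"
  then have xc: "x : C" using F by auto
  let ?s = "%k. \<phi> k (e k x)"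
  have s: "?s : Seq" using er[OF xc] by simp
  have "nrm2 P (cl (%k. v k ** ?s k ** ~*v k -- x)) < \<epsilon> / 2"
   using V(2)[OF x] er[OF xc] v xc s by (simp add: cl_ops dg_def)
  then have 1: "eventually (%k. nn (v k ** ?s k ** ~*v k -- x) < \<epsilon> / 2) U"
   using v s xc by (intro nn_cl_less) simp_all
  have "(%k. nn (e k x -- x) + 1 / real (Suc k)) \<longlonglongrightarrow> 0 + 0"
   using er[OF xc] by (intro tendsto_add LIMSEQ_Suc[OF lim_1_over_n] cvD) simp
  then have 2: "eventually (%k. nn (e k x -- x) + 1 / real (Suc k) < \<epsilon> / 2) U"
   using e by (intro order_tendstoD(2)[OF U_seq]) auto
  show "eventually (%k. nn (v k ** \<phi> k x ** ~*v k -- x) < \<epsilon>) U"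
   using 1 2
  proof eventually_elim
   case (elim k)
   have xH: "x : H k" "e k x : H k" using x er[OF xc] Hc by auto
   have c: "\<phi> k x : C" "?s k : C" "v k : C" using ahomD(1)[OF \<phi>(1)] xH v by auto
   \<comment> \<open>The limit embedding controls \<phi> k at the approximant of x; passing to x
     itself costs their distance plus the error of \<phi> k. This is why F is part of every H
     k.\<close>
   have "nn (v k ** \<phi> k x ** ~*v k -- v k ** ?s k ** ~*v k) = nn (\<phi> k x -- ?s k)"
    using tst_conj[OF v(3)[of k] c(1,1,2)] by (simp add: tst_def)
   moreover have "nn (\<phi> k x -- ?s k) < nn (e k x -- x) + 1 / real (Suc k)"
    using ahom_nn[OF \<phi>(1) xH] sub_swap[OF xc, of "e k x"] er[OF xc] by auto
   ultimately show ?case using elim xc c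
     sub_tri[of "v k ** \<phi> k x ** ~*v k" "v k ** ?s k ** ~*v k" x] by auto
  qed
 qed
 then obtain k where "ALL x:F. nn (v k ** \<phi> k x ** ~*v k -- x) < \<epsilon>" using eventually_happens'[OF U_bot] by blast
 moreover have "EX x:F. \<epsilon> <= nn (v k ** \<phi> k x ** ~*v k -- x)" by (rule \<phi>(3)) (rule v(3))
 ultimately show False by force
qed

section \<open>Matrix coefficients\<close>

definition cmul :: "nat => (nat => nat) => (nat => nat => complex) => (nat => nat => complex) => nat => nat => complex" where
 "cmul m r c d i k = (\<Sum>j<m. if r i = r j then c i j * d j k else 0)"

definition cadj :: "(nat => nat => complex) => nat => nat => complex" where
 "cadj c i j = cnj (c j i)"

primrec csqr :: "nat => (nat => nat) => nat => (nat => nat => complex) => nat => nat => complex" where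
 "csqr m r 0 c = c"
| "csqr m r (Suc j) c = cmul m r (csqr m r j c) (csqr m r j c)"

definition mxn :: "nat => (nat => nat) => (nat => real) => (nat => nat => complex) => real" where
 "mxn m r t c = sqrt (\<Sum>i<m. \<Sum>j<m. if r i = r j then (cmod (c j i))\<^sup>2 * t i else 0)"

text \<open>The value of \<open>tst\<close> on elements with fixed coefficient matrices depends on
  the system only through the weights t. Being continuous in t, it allows a change to nearby
  rational weights.\<close>

definition tstw :: "nat => (nat => nat) => (nat => real) => (nat => nat => complex) => (nat => nat => complex) => (nat => nat => complex) => real \<times> real \<times> real \<times> complex" where
 "tstw m r t a b d = (mxn m r t (%i j. a i j - d i j), mxn m r t (%i j. cmul m r a b i j - d i j),
  mxn m r t (%i j. cadj a i j - d i j), \<Sum>i<m. a i i * of_real (t i))"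

lemma tendsto_mxn: "(!!i. i < m ==> ((%n. t n i) \<longlongrightarrow> \<tau> i) F) ==> ((%n. mxn m r (t n) c) \<longlongrightarrow> mxn m r \<tau> c) F"
 unfolding mxn_def by (intro tendsto_real_sqrt tendsto_sum) (auto intro!: tendsto_mult_left)

lemma tendsto_tstw: "(!!i. i < m ==> ((%n. t n i) \<longlongrightarrow> \<tau> i) F) ==> ((%n. tstw m r (t n) a b d) \<longlongrightarrow> tstw m r \<tau> a b d) F"
 unfolding tstw_def by (intro tendsto_Pair tendsto_mxn tendsto_sum tendsto_mult_left tendsto_of_real) auto

lemma mxn_mono: "(!!i. i < m ==> t i <= s i) ==> mxn m r t c <= mxn m r s c"
 unfolding mxn_def by (intro real_sqrt_le_mono sum_mono) (auto intro!: mult_left_mono)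

context talg
begin

definition mx :: "nat => (nat => nat) => (nat => 'a) => (nat => nat => complex) => 'a" where
 "mx m r v c = vsum (%i. vsum (%j. (if r i = r j then c i j else 0) .* (v i ** ~*v j)) m) m"

lemma mx_conj:
 assumes u: "u : C" and v: "!!i. i < m ==> v i : C" and v': "!!i. i < m ==> v' i : C"
  and e: "!!i j. [|i < m; j < m; r i = r j|] ==> u ** (v i ** ~*v j) ** ~*u = v' i ** ~*v' j"
 shows "u ** mx m r v c ** ~*u = mx m r v' c"
proof -
 have "u ** mx m r v c ** ~*u = vsum (%i. vsum (%j. (if r i = r j then c i j else 0) .* (u ** (v i ** ~*v j) ** ~*u)) m) m"
  unfolding mx_def using u v by (simp add: mult_vsum vsum_mult mult_smult smult_mult cong: vsum_cong)
 also have "... = mx m r v' c" unfolding mx_def using u v v' e by (intro vsum_cong) (auto simp: smult_zero_left)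
 finally show ?thesis .
qed

lemma mx_mem: "[|vnsub S; !!i j. [|i < m; j < m|] ==> v i ** ~*v j : S|] ==> mx m r v c : S"
 unfolding mx_def by (intro vsum_mem vnsubD(5)) auto

context
 fixes m r v assumes p: "psys m r v"
begin

lemma mx_c [simp]: "mx m r v c : C" unfolding mx_def using psys_c[OF p] by simp

lemma tr_mult_mx: assumes w: "w : C"
 shows "tr (w ** mx m r v c) = (\<Sum>i<m. \<Sum>j<m. if r i = r j then c i j * tr (w ** (v i ** ~*v j)) else 0)"
proof -
 have "tr (w ** mx m r v c) = (\<Sum>i<m. \<Sum>j<m. (if r i = r j then c i j else 0) * tr (w ** (v i ** ~*v j)))"
  unfolding mx_def using w psys_c[OF p] by (simp add: tr_mult_vsum mult_smult tr_smult)
 also have "... = (\<Sum>i<m. \<Sum>j<m. if r i = r j then c i j * tr (w ** (v i ** ~*v j)) else 0)" by (intro sum.cong refl) simp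
 finally show ?thesis .
qed

lemma mx_v: assumes k: "k < m" shows "mx m r v c ** v k = vsum (%i. (if r i = r k then c i k else 0) .* v i) m"
proof -
 note vc = psys_c[OF p]
 have "mx m r v c ** v k = vsum (%i. vsum (%j. (if r i = r j then c i j else 0) .* (v i ** (~*v j ** v k))) m) m"
  unfolding mx_def using vc k by (simp add: vsum_mult smult_mult mult_assoc cong: vsum_cong)
 also have "... = vsum (%i. (if r i = r k then c i k else 0) .* v i) m"
 proof (rule vsum_cong)
  fix i assume i: "i < m"
  have "vsum (%j. (if r i = r j then c i j else 0) .* (v i ** (~*v j ** v k))) m
   = (if r i = r k then c i k else 0) .* (v i ** (~*v k ** v k))"
   by (rule vsum_single[OF k]) (use psys_m[OF p] psys_r[OF p] vc i k in \<open>auto simp: mult_zero\<close>)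
  also have "... = (if r i = r k then c i k else 0) .* v i"
  proof (cases "r i = r k")
   case True
   have "v i ** (~*v k ** v k) = v i" using psys_m(1)[OF p k] psys_right[OF p i] True by simp
   then show ?thesis by simp
  next
   case False
   then show ?thesis using vc i k smult_zero_left by simp
  qed
  finally show "vsum (%j. (if r i = r j then c i j else 0) .* (v i ** (~*v j ** v k))) m = (if r i = r k then c i k else 0) .* v i" .
 qed
 finally show ?thesis .
qed

lemma mx_mult: "mx m r v c ** mx m r v d = mx m r v (cmul m r c d)"
proof (rule tau_ext)
 note vc = psys_c[OF p]
 fix w assume w: "w : C"
 let ?t = "%i l. tr (w ** (v i ** ~*v l))"
 have a: "tr ((w ** mx m r v c) ** (v k ** ~*v l)) = (\<Sum>i<m. if r i = r k then c i k * ?t i l else 0)" if "k < m" "l < m" for k l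
 proof -
  have "tr ((w ** mx m r v c) ** (v k ** ~*v l)) = tr (w ** ((mx m r v c ** v k) ** ~*v l))"
   using that vc w by (simp add: mult_assoc)
  also have "... = (\<Sum>i<m. (if r i = r k then c i k else 0) * ?t i l)"
   unfolding mx_v[OF that(1)] using that vc w by (simp add: vsum_mult tr_mult_vsum smult_mult mult_smult tr_smult)
  also have "... = (\<Sum>i<m. if r i = r k then c i k * ?t i l else 0)" by (intro sum.cong refl) simp
  finally show ?thesis .
 qed
 let ?g = "%i l k. if r i = r k & r i = r l then c i k * d k l * ?t i l else 0"
 have "tr (w ** (mx m r v c ** mx m r v d)) = tr ((w ** mx m r v c) ** mx m r v d)" using w by (simp add: mult_assoc)
 also have "... = (\<Sum>k<m. \<Sum>l<m. \<Sum>i<m. ?g i l k)"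
  using w by (subst tr_mult_mx) (auto simp: a sum_distrib_left intro!: sum.cong sum.neutral)
 also have "... = (\<Sum>k<m. \<Sum>i<m. \<Sum>l<m. ?g i l k)" by (intro sum.cong refl sum.swap)
 also have "... = (\<Sum>i<m. \<Sum>k<m. \<Sum>l<m. ?g i l k)" by (rule sum.swap)
 also have "... = (\<Sum>i<m. \<Sum>l<m. \<Sum>k<m. ?g i l k)" by (intro sum.cong refl sum.swap)
 also have "... = tr (w ** mx m r v (cmul m r c d))"
  unfolding tr_mult_mx[OF w] cmul_def by (intro sum.cong refl) (auto simp: sum_distrib_right intro!: sum.cong)
 finally show "tr (w ** (mx m r v c ** mx m r v d)) = tr (w ** mx m r v (cmul m r c d))" .
qed simp_all

lemma mx_star: "~*mx m r v c = mx m r v (cadj c)"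
proof (rule tau_ext)
 note vc = psys_c[OF p]
 fix w assume w: "w : C"
 let ?c = "%i j. cnj (if r i = r j then c i j else 0)"
 have "~*mx m r v c = vsum (%i. vsum (%j. ?c i j .* (v j ** ~*v i)) m) m"
  unfolding mx_def using vc by (simp add: star_vsum star_smult star_mult cong: vsum_cong)
 then have "tr (w ** ~*mx m r v c) = (\<Sum>i<m. \<Sum>j<m. ?c i j * tr (w ** (v j ** ~*v i)))"
  using vc w by (simp add: tr_mult_vsum mult_smult tr_smult)
 also have "... = (\<Sum>j<m. \<Sum>i<m. ?c i j * tr (w ** (v j ** ~*v i)))" by (rule sum.swap)
 also have "... = tr (w ** mx m r v (cadj c))"
  unfolding tr_mult_mx[OF w] cadj_def by (intro sum.cong refl) auto
 finally show "tr (w ** ~*mx m r v c) = tr (w ** mx m r v (cadj c))" .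
qed simp_all

lemma mx_sub: "mx m r v c -- mx m r v d = mx m r v (%i j. c i j - d i j)"
proof (rule tau_ext)
 fix w assume w: "w : C"
 have "tr (w ** (mx m r v c -- mx m r v d)) = tr (w ** mx m r v c) - tr (w ** mx m r v d)"
  using w by (simp add: vsub_def distrib_l mult_smult tr_add tr_smult)
 also have "... = tr (w ** mx m r v (%i j. c i j - d i j))"
  unfolding tr_mult_mx[OF w] sum_subtractf[symmetric] by (intro sum.cong refl) (auto simp: left_diff_distrib)
 finally show "tr (w ** (mx m r v c -- mx m r v d)) = tr (w ** mx m r v (%i j. c i j - d i j))" .
qed simp_all

context
 fixes t assumes t: "!!i. i < m ==> (nn (v i))\<^sup>2 = t i"
begin

lemma tr_mx: "tr (mx m r v c) = (\<Sum>i<m. c i i * of_real (t i))"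
proof -
 note vc = psys_c[OF p]
 have e: "tr (v i ** ~*v j) = (if i = j then of_real (t i) else 0)" if "i < m" "j < m" for i j
  using tr_comm[of "v i" "~*v j"] vc psys_m[OF p] psys_tr_pos[OF p, of i] t[of i] that by auto
 have "tr (mx m r v c) = (\<Sum>i<m. \<Sum>j<m. if r i = r j then c i j * tr (\<one> ** (v i ** ~*v j)) else 0)"
  using tr_mult_mx[of \<one> c] by simp
 also have "... = (\<Sum>i<m. \<Sum>j<m. if i = j then c i i * of_real (t i) else 0)" by (intro sum.cong refl) (use vc in \<open>auto simp: e\<close>)
 finally show ?thesis by simp
qed

lemma nn_mx: "nn (mx m r v c) = mxn m r t c"
proof -
 have "of_real ((nn (mx m r v c))\<^sup>2) = tr (mx m r v (cmul m r (cadj c) c))"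
  unfolding tr_nn[OF mx_c, symmetric] mx_star mx_mult ..
 also have "... = (\<Sum>i<m. \<Sum>j<m. of_real (if r i = r j then (cmod (c j i))\<^sup>2 * t i else 0))"
  unfolding tr_mx cmul_def cadj_def sum_distrib_right
  by (intro sum.cong refl) (simp only: of_real_mult complex_norm_square mult.commute if_distrib of_real_0 mult_zero_left cong: if_cong; simp)
 finally have "(nn (mx m r v c))\<^sup>2 = (\<Sum>i<m. \<Sum>j<m. if r i = r j then (cmod (c j i))\<^sup>2 * t i else 0)"
  by (simp only: of_real_sum[symmetric] of_real_eq_iff)
 then show ?thesis unfolding mxn_def using real_sqrt_unique[of "nn (mx m r v c)"] by simp
qed

lemma tst_mx: "tst M (mx m r v a) (mx m r v b) (mx m r v d) = tstw m r t a b d"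
 unfolding tst_def tstw_def mx_mult mx_star mx_sub nn_mx tr_mx ..

end

lemma sqr_mx: "sqr j (mx m r v c) = mx m r v (csqr m r j c)"
 by (induction j) (simp_all add: mx_mult)

end

end

text \<open>All moments are increasing functions of the weights, so lowering the weights preserves
  the operator bound exactly.\<close>

lemma mx_bnd:
 assumes M: "tvna M" and P: "talg P" and v: "talg.psys M m r v" and f: "talg.psys P m r f"
  and le: "!!i. i < m ==> nrm2 P (f i) <= nrm2 M (v i)" and b: "talg.bnd M K (talg.mx M m r v c)"
 shows "talg.bnd P K (talg.mx P m r f c)"
proof -
 interpret M: tvna M by fact
 interpret P: talg P by fact
 have n: "nrm2 P (P.mx m r f a) <= nrm2 M (M.mx m r v a)" for a
  unfolding M.nn_mx[OF v refl] P.nn_mx[OF f refl] using le P.psys_c[OF f] by (intro mxn_mono power_mono) auto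
 show ?thesis
 proof (rule P.bnd_if_moments[OF P.mx_c[OF f] M.bnd_ge0[OF b]])
  fix j
  have "nrm2 P (P.sqr j (~*\<^sub>P P.mx m r f c **\<^sub>P P.mx m r f c)) <= nrm2 M (M.sqr j (~*\<^sub>M M.mx m r v c **\<^sub>M M.mx m r v c))"
   unfolding M.mx_star[OF v] P.mx_star[OF f] M.mx_mult[OF v] P.mx_mult[OF f] M.sqr_mx[OF v] P.sqr_mx[OF f] by (rule n)
  also have "... <= 1 * (K\<^sup>2) ^ (2 ^ j)" using M.bnd_nn[OF M.bnd_sqr[OF M.bnd_star_mult[OF b], of j]] by simp
  finally show "nrm2 P (P.sqr j (~*\<^sub>P P.mx m r f c **\<^sub>P P.mx m r f c)) <= 1 * (K\<^sup>2) ^ (2 ^ j)" .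
 qed
qed

lemma (in emb) mx: "(!!i. i < m ==> v i : vcarrier M) ==> f (M.mx m r v c) = P.mx m r (%i. f (v i)) c"
proof -
 assume v: "!!i. i < m ==> v i : vcarrier M"
 have z: "f \<zero>\<^sub>M = \<zero>\<^sub>P" using smult[of "\<one>\<^sub>M" 0] one by (simp add: M.smult_zero_left P.smult_zero_left)
 have s: "f (M.vsum g n) = P.vsum (%i. f (g i)) n" if "!!i. i < n ==> g i : vcarrier M" for g n
  using that by (induction n) (auto simp: z add)
 show ?thesis unfolding M.mx_def P.mx_def using v by (simp add: s smult mult star cong: P.vsum_cong)
qed

lemma sys_hom: assumes "talg M" "talg P" and h: "star_hom M P f" and v: "talg.sys M m r v"
 shows "talg.sys P m r (%i. f (v i))"
proof -
 interpret M: talg M by fact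
 interpret P: talg P by fact
 have c: "f x : vcarrier P" if "x : vcarrier M" for x using h that by (auto simp: star_hom_def)
 have h: "f \<one>\<^sub>M = \<one>\<^sub>P" "!!x y. [|x : vcarrier M; y : vcarrier M|] ==> f (x ++\<^sub>M y) = f x ++\<^sub>P f y"
  "!!x y. [|x : vcarrier M; y : vcarrier M|] ==> f (x **\<^sub>M y) = f x **\<^sub>P f y"
  "!!x. x : vcarrier M ==> f (~*\<^sub>M x) = ~*\<^sub>P f x" "!!x a. x : vcarrier M ==> f (a .*\<^sub>M x) = a .*\<^sub>P f x"
  using h by (auto simp: star_hom_def)
 note p = M.sysD(1)[OF v]
 note vc = M.psys_c[OF p]
 have z: "f \<zero>\<^sub>M = \<zero>\<^sub>P" using h(5)[of "\<one>\<^sub>M" 0] h(1) by (simp add: M.smult_zero_left P.smult_zero_left)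
 have m: "~*\<^sub>P f (v i) **\<^sub>P f (v j) = (if i = j then f (v (r i)) else \<zero>\<^sub>P)" if "i < m" "j < m" for i j
 proof -
  have "~*\<^sub>P f (v i) **\<^sub>P f (v j) = f (~*\<^sub>M v i **\<^sub>M v j)" using vc that by (simp add: h)
  then show ?thesis using M.psys_m[OF p] that z by (cases "i = j") auto
 qed
 have "P.psys m r (%i. f (v i))" unfolding P.psys_def using m vc c M.psys_r[OF p] by simp
 moreover have "P.vsum (%i. f (v i) **\<^sub>P ~*\<^sub>P f (v i)) n = f (M.vsum (%i. v i **\<^sub>M ~*\<^sub>M v i) n)" if "n <= m" for n
  using that vc by (induction n) (auto simp: z h)
 then have "P.vsum (%i. f (v i) **\<^sub>P ~*\<^sub>P f (v i)) m = \<one>\<^sub>P" using M.sysD(2)[OF v] h(1) by simp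
 ultimately show ?thesis by (simp add: P.sys_def)
qed

lemma (in emb) sys: "M.sys m r v ==> P.sys m r (%i. f (v i))"
 by (rule sys_hom[OF M.talg_axioms P.talg_axioms emb[unfolded embedding_def, THEN conjunct1]])

text \<open>Index i receives a block of s i consecutive indices starting at x i, and f i adds up the
  matrix units from the block of r i to the block of i. Indices beyond the last block are left over,
  so the result need not sum to 1.\<close>

lemma (in tvna) psys_of_weights:
 assumes e: "msys n e" and r: "!!i. i < m ==> r i < m" "!!i. i < m ==> r (r i) = r i" "!!i. i < m ==> s (r i) = (s i :: nat)"
  and s: "(\<Sum>i<m. s i) <= n"
 shows "EX f. psys m r f & (ALL i<m. (nn (f i))\<^sup>2 = real (s i) / real n) &
  (ALL T. vnsub T & (ALL i<n. ALL j<n. e i ** ~*e j : T) --> (ALL i<m. f i : T))"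
proof -
 note p = sysD(1)[OF e]
 note ec = psys_c[OF p]
 have n0: "0 < n" by (rule msys_pos[OF e])
 define x where "x i = (\<Sum>k<i. s k)" for i
 have xm: "x i + s i <= x j" if "i < j" for i j
 proof -
  have "x i + s i = x (Suc i)" by (simp add: x_def)
  also have "... <= x j" unfolding x_def using that by (intro sum_mono2) auto
  finally show ?thesis .
 qed
 have xn: "x i + l < n" if "i < m" "l < s i" for i l using xm[OF that(1)] s that(2) unfolding x_def[of m] by linarith
 have xi: "i = j & l = l'" if "x i + l = x j + l'" "l < s i" "l' < s j" for i j l l'
  using that xm[of i j] xm[of j i] by (cases i j rule: linorder_cases) auto
 define f where "f i = vsum (%l. e (x i + l) ** ~*e (x (r i) + l)) (s i)" for i
 have rn: "x (r i) + l < n" if "i < m" "l < s i" for i l using xn[OF r(1)[OF that(1)]] r(3)[OF that(1)] that by simp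
 have fc: "f i : C" if "i < m" for i unfolding f_def using ec xn[OF that] rn[OF that] by simp
 have em: "~*e a ** e b = (if a = b then e 0 else \<zero>)" if "a < n" "b < n" for a b using psys_m[OF p] that by auto
 have e0: "e 0 : C" using ec n0 by simp
 have er: "e a ** e 0 = e a" "e 0 ** ~*e a = ~*e a" if "a < n" for a using psys_right[OF p that] psys_left[OF p that] by auto
 have four: "(e a ** ~*e b) ** (e c ** ~*e d) = (if b = c then e a ** ~*e d else \<zero>)"
  if "a < n" "b < n" "c < n" "d < n" for a b c d
 proof -
  have "(e a ** ~*e b) ** (e c ** ~*e d) = e a ** ((~*e b ** e c) ** ~*e d)" using that ec by (simp add: mult_assoc)
  then show ?thesis unfolding em[OF that(2,3)] using that ec er e0 by auto
 qed
 have ff: "~*f i ** f j = (if i = j then f (r i) else \<zero>)" if i: "i < m" and j: "j < m" for i j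
 proof -
  have st: "~*f i = vsum (%l. e (x (r i) + l) ** ~*e (x i + l)) (s i)"
   unfolding f_def using ec xn[OF i] rn[OF i] by (subst star_vsum) (auto simp: star_mult intro!: vsum_cong)
  have "~*f i ** f j = vsum (%l. vsum (%l'. (e (x (r i) + l) ** ~*e (x i + l)) ** (e (x j + l') ** ~*e (x (r j) + l'))) (s j)) (s i)"
   unfolding st using fc[OF j] ec xn[OF i] rn[OF i] xn[OF j] rn[OF j]
   by (subst vsum_mult) (auto simp: f_def mult_vsum intro!: vsum_cong)
  also have "... = vsum (%l. if i = j then e (x (r i) + l) ** ~*e (x (r i) + l) else \<zero>) (s i)"
  proof (rule vsum_cong)
   fix l assume l: "l < s i"
   let ?g = "%l'. (e (x (r i) + l) ** ~*e (x i + l)) ** (e (x j + l') ** ~*e (x (r j) + l'))"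
   have g: "?g l' = (if x i + l = x j + l' then e (x (r i) + l) ** ~*e (x (r j) + l') else \<zero>)" if "l' < s j" for l'
    by (rule four[OF rn[OF i l] xn[OF i l] xn[OF j that] rn[OF j that]])
   show "vsum ?g (s j) = (if i = j then e (x (r i) + l) ** ~*e (x (r i) + l) else \<zero>)"
   proof (cases "i = j")
    case True
    have "vsum ?g (s j) = ?g l"
    proof (rule vsum_single)
     show "l < s j" using l True by simp
     then show "?g l : C" using ec rn[OF i l] xn[OF i l] xn[OF j] rn[OF j] by simp
     show "?g l' = \<zero>" if "l' < s j" "l' ~= l" for l' using g[OF that(1)] that True by simp
    qed
    then show ?thesis using g[of l] l True by simp
   next
    case False
    have "?g l' = \<zero>" if "l' < s j" for l' using g[OF that] xi[OF _ l that] False by auto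
    then have "vsum ?g (s j) = vsum (%_. \<zero>) (s j)" by (rule vsum_cong)
    moreover have "vsum (%_. \<zero>) k = \<zero>" for k by (induction k) auto
    ultimately show ?thesis using False by simp
   qed
  qed
  also have "... = (if i = j then f (r i) else \<zero>)"
  proof (cases "i = j")
   case True then show ?thesis using r i by (simp add: f_def)
  next
   case False
   have "vsum (%_. \<zero>) k = \<zero>" for k by (induction k) auto
   then show ?thesis using False by simp
  qed
  finally show ?thesis .
 qed
 have ps: "psys m r f" unfolding psys_def using fc ff r by simp
 have te: "tr (e a ** ~*e a) = 1 / of_nat n" if "a < n" for a
 proof -
  have t: "tr (e b ** ~*e b) = tr (e 0)" if "b < n" for b using psys_tr[OF p that] .
  have "1 = tr (vsum (%i. e i ** ~*e i) n)" unfolding sysD(2)[OF e] by simp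
  also have "... = of_nat n * tr (e 0)" using ec t by (simp add: tr_vsum)
  finally show ?thesis using t[OF that] n0 by (simp add: field_simps)
 qed
 have "(nn (f i))\<^sup>2 = real (s i) / real n" if i: "i < m" for i
 proof -
  have "complex_of_real ((nn (f i))\<^sup>2) = tr (f (r i))" using psys_tr_pos[OF ps i] by simp
  also have "... = (\<Sum>l<s i. tr (e (x (r i) + l) ** ~*e (x (r i) + l)))"
   unfolding f_def r(2)[OF i] r(3)[OF i] using ec rn[OF i] by (simp add: tr_vsum)
  also have "... = of_real (real (s i) / real n)" using te rn[OF i] by simp
  finally show ?thesis by (simp only: of_real_eq_iff)
 qed
 moreover have "f i : T" if "vnsub T" "!!i j. i < n ==> j < n ==> e i ** ~*e j : T" "i < m" for T i
  unfolding f_def using that xn rn by (intro vsum_mem) auto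
 ultimately show ?thesis using ps by blast
qed

text \<open>Project onto a finite-dimensional subalgebra, read off coefficient matrices, and realise
  them over a system built from n x n matrix units whose weights approximate the original ones. All
  values lie in any von Neumann subalgebra containing these units.\<close>

lemma ex_ahom_AFD:
 assumes R: "tvna R" "AFD R" and N: "tvna N" and F: "finite F" "F \<subseteq> vcarrier R" and \<epsilon>: "\<epsilon> > 0"
 shows "EX n0. ALL n>=n0. ALL e. talg.sys N n (%_. 0) e --> (EX \<psi>. ahom R N F \<epsilon> \<psi> &
  (ALL T. talg.vnsub N T & (ALL i<n. ALL j<n. e i **\<^sub>N ~*\<^sub>N e j : T) --> \<psi> ` F \<subseteq> T))"
proof -
 interpret R: tvna R by fact
 interpret N: tvna N by fact
 have "ALL j. EX B. star_subalg R B & fin_dim R B & (ALL x:F. EX b:B. nrm2 R (x --\<^sub>R b) < 1 / real (Suc j))"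
  using R(2) F unfolding AFD_def by simp
 then obtain B where B: "!!j. star_subalg R (B j)" "!!j. fin_dim R (B j)"
  "!!j x. x : F ==> EX b:B j. nrm2 R (x --\<^sub>R b) < 1 / real (Suc j)" by metis
 have "ALL j. EX E. (ALL x:R.C. E x : B j) & (ALL x:R.C. ALL y:B j. nrm2 R (x --\<^sub>R E x) <= nrm2 R (x --\<^sub>R y)) & (ALL K x. R.bnd K x --> R.bnd K (E x))"
  using R.ex_expectation[OF B(1,2)] by blast
 then obtain E where E: "!!j x. x : R.C ==> E j x : B j"
  "!!j x y. [|x : R.C; y : B j|] ==> nrm2 R (x --\<^sub>R E j x) <= nrm2 R (x --\<^sub>R y)"
  "!!j K x. R.bnd K x ==> R.bnd K (E j x)" by metis
 have Ec: "E j x : R.C" if "x : R.C" for j x using E(1)[OF that] B(1)[of j] by (auto simp: star_subalg_def)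
 have cvE: "R.cv sequentially (%j. E j x) x" if x: "x : F" for x
 proof (rule R.cvI[where g = "%j. 1 / real (Suc j)"])
  have xc: "x : R.C" using x F by auto
  then show "x : R.C" "E j x : R.C" for j using Ec by auto
  have "nrm2 R (E j x --\<^sub>R x) <= 1 / real (Suc j)" for j
  proof -
   obtain b where "b : B j" "nrm2 R (x --\<^sub>R b) < 1 / real (Suc j)" using B(3)[OF x] by blast
   then show ?thesis using E(2)[OF xc, of b j] R.sub_swap[OF Ec[OF xc] xc, of j] by linarith
  qed
  then show "eventually (%j. nrm2 R (E j x --\<^sub>R x) <= 1 / real (Suc j)) sequentially" by simp
  show "(%j. 1 / real (Suc j)) \<longlonglongrightarrow> 0" by (rule LIMSEQ_Suc[OF lim_1_over_n])
 qed
 have "eventually (%j. ALL a:F. ALL b:F. ALL d:F. dist (tst R (E j a) (E j b) (E j d)) (tst R a b d) < \<epsilon> / 2) sequentially"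
 proof (intro eventually_ball_finite ballI F(1))
  fix a b d assume abd: "a : F" "b : F" "d : F"
  have ac: "a : R.C" using abd F by auto
  have bb: "R.bnd (opnorm R a) (E j a)" for j by (rule E(3)[OF R.bnd_opnorm[OF ac]])
  show "eventually (%j. dist (tst R (E j a) (E j b) (E j d)) (tst R a b d) < \<epsilon> / 2) sequentially"
   using \<epsilon> by (intro tendstoD[OF R.cv_tst[OF bb cvE[OF abd(1)] cvE[OF abd(2)] cvE[OF abd(3)]]]) simp
 qed
 then obtain j where j: "!!a b d. [|a : F; b : F; d : F|] ==> dist (tst R (E j a) (E j b) (E j d)) (tst R a b d) < \<epsilon> / 2"
  using eventually_happens'[OF sequentially_bot] by blast
 obtain m r v where v: "R.sys m r v" and cf: "ALL b:B j. EX cf. b = R.mx m r v cf"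
  using R.findim_sys[OF B(1,2), of j] unfolding R.mx_def by blast
 note p = R.sysD(1)[OF v]
 have "ALL x:R.C. EX c. E j x = R.mx m r v c" using cf E(1) by blast
 then obtain c where c: "!!x. x : R.C ==> E j x = R.mx m r v (c x)" by metis
 define \<tau> where "\<tau> i = (nrm2 R (v i))\<^sup>2" for i
 have \<tau>r: "\<tau> (r i) = \<tau> i" if "i < m" for i
 proof -
  have "complex_of_real (\<tau> (r i)) = of_real (\<tau> i)"
   using R.psys_tr_pos[OF p that] R.psys_tr_pos[OF p R.psys_r(1)[OF p that]] R.psys_r(2)[OF p that] by (simp add: \<tau>_def)
  then show ?thesis by (simp only: of_real_eq_iff)
 qed
 have \<tau>0: "0 <= \<tau> i" for i by (simp add: \<tau>_def)
 have "complex_of_real (\<Sum>i<m. \<tau> i) = vtr R (R.vsum (%i. v i **\<^sub>R ~*\<^sub>R v i) m)"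
  using R.psys_c[OF p] R.psys_tr[OF p] R.psys_tr_pos[OF p] by (simp add: R.tr_vsum \<tau>_def)
 then have "complex_of_real (\<Sum>i<m. \<tau> i) = of_real 1" unfolding R.sysD(2)[OF v] by simp
 then have \<tau>1: "(\<Sum>i<m. \<tau> i) = 1" by (simp only: of_real_eq_iff)
 \<comment> \<open>Rounding down lets the blocks fit into n and keeps the weights below the original
   ones, as \<open>mx_bnd\<close> demands.\<close>
 define t where "t n i = real (nat \<lfloor>real n * \<tau> i\<rfloor>) / real n" for n i
 have fl: "real (nat \<lfloor>real n * \<tau> i\<rfloor>) <= real n * \<tau> i" "real n * \<tau> i - 1 <= real (nat \<lfloor>real n * \<tau> i\<rfloor>)" for n i
  using \<tau>0[of i] by (auto simp: of_nat_floor)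
 have "(%n. t n i) \<longlonglongrightarrow> \<tau> i" for i
 proof (rule tendsto_sandwich)
  have "(%n. \<tau> i - 1 / real n) \<longlonglongrightarrow> \<tau> i - 0" by (intro tendsto_diff tendsto_const lim_1_over_n)
  then show "(%n. \<tau> i - 1 / real n) \<longlonglongrightarrow> \<tau> i" by simp
  show "eventually (%n. \<tau> i - 1 / real n <= t n i) sequentially"
   using eventually_gt_at_top[of 0]
  proof eventually_elim
   case (elim n)
   have "\<tau> i - 1 / real n = (real n * \<tau> i - 1) / real n" using elim by (simp add: field_simps)
   also have "... <= t n i" unfolding t_def by (intro divide_right_mono fl(2)) simp
   finally show ?case .
  qed
  show "eventually (%n. t n i <= \<tau> i) sequentially"
   using eventually_gt_at_top[of 0] by eventually_elim (use fl(1) in \<open>simp add: t_def field_simps\<close>)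
 qed simp
 then have tw: "(%n. tstw m r (t n) a b d) \<longlonglongrightarrow> tstw m r \<tau> a b d" for a b d by (rule tendsto_tstw)
 have "eventually (%n. ALL a:F. ALL b:F. ALL d:F. dist (tstw m r (t n) (c a) (c b) (c d)) (tstw m r \<tau> (c a) (c b) (c d)) < \<epsilon> / 2) sequentially"
  using \<epsilon> by (intro eventually_ball_finite ballI F(1) tendstoD[OF tw]) simp
 then obtain n0 where n0: "!!n a b d. [|n >= n0; a : F; b : F; d : F|] ==>
  dist (tstw m r (t n) (c a) (c b) (c d)) (tstw m r \<tau> (c a) (c b) (c d)) < \<epsilon> / 2"
  unfolding eventually_sequentially by blast
 show ?thesis
 proof (intro exI[of _ n0] allI impI)
  fix n e assume n: "n0 <= n" and e: "N.sys n (%_. 0) e"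
  have np: "0 < n" by (rule N.msys_pos[OF e])
  have "real (\<Sum>i<m. nat \<lfloor>real n * \<tau> i\<rfloor>) <= (\<Sum>i<m. real n * \<tau> i)" unfolding of_nat_sum by (intro sum_mono fl(1))
  also have "... = real n" unfolding sum_distrib_left[symmetric] \<tau>1 by simp
  finally have sn: "(\<Sum>i<m. nat \<lfloor>real n * \<tau> i\<rfloor>) <= n" by (simp only: of_nat_le_iff)
  obtain f where f: "N.psys m r f" "!!i. i < m ==> (nrm2 N (f i))\<^sup>2 = t n i"
   "!!T i. [|N.vnsub T; ALL i<n. ALL j<n. e i **\<^sub>N ~*\<^sub>N e j : T; i < m|] ==> f i : T"
   using N.psys_of_weights[OF e R.psys_r(1)[OF p] R.psys_r(2)[OF p] _ sn] \<tau>r unfolding t_def by auto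
  define \<psi> where "\<psi> x = N.mx m r f (c x)" for x
  have le: "nrm2 N (f i) <= nrm2 R (v i)" if "i < m" for i
  proof -
   have "(nrm2 N (f i))\<^sup>2 <= (nrm2 R (v i))\<^sup>2"
    unfolding f(2)[OF that] using fl(1)[of n i] np by (simp add: t_def \<tau>_def field_simps)
   then show ?thesis by (rule power2_le_imp_le) (use R.psys_c[OF p that] in simp)
  qed
  have "ahom R N F \<epsilon> \<psi>"
   unfolding ahom_def
  proof (intro conjI ballI allI impI)
   fix a assume a: "a : F"
   have ac: "a : R.C" using a F by auto
   show "\<psi> a : vcarrier N" unfolding \<psi>_def using N.mx_c[OF f(1)] .
   show "N.bnd s (\<psi> a)" if "R.bnd s a" for s
    unfolding \<psi>_def using mx_bnd[OF R(1) N.talg_axioms p f(1) le, of s "c a"] E(3)[OF that, of j] c[OF ac] by simp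
   fix b d assume bd: "b : F" "d : F"
   have bdc: "b : R.C" "d : R.C" using bd F by auto
   have 1: "tst N (\<psi> a) (\<psi> b) (\<psi> d) = tstw m r (t n) (c a) (c b) (c d)"
    unfolding \<psi>_def by (rule N.tst_mx[OF f(1,2)])
   have 2: "tst R (E j a) (E j b) (E j d) = tstw m r \<tau> (c a) (c b) (c d)"
    unfolding c[OF ac] c[OF bdc(1)] c[OF bdc(2)] by (rule R.tst_mx[OF p]) (simp add: \<tau>_def)
   show "dist (tst N (\<psi> a) (\<psi> b) (\<psi> d)) (tst R a b d) < \<epsilon>"
    using dist_triangle[of "tst N (\<psi> a) (\<psi> b) (\<psi> d)" "tst R a b d" "tst R (E j a) (E j b) (E j d)"]
     j[OF a bd] n0[OF n a bd] unfolding 1 2 by linarith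
  qed
  moreover have "\<psi> ` F \<subseteq> T" if "N.vnsub T" "ALL i<n. ALL j<n. e i **\<^sub>N ~*\<^sub>N e j : T" for T
  proof -
   have "\<psi> x : T" for x unfolding \<psi>_def
    using f(3)[OF that] by (intro N.mx_mem[OF that(1)] N.vnsubD(4,6)[OF that(1)]) auto
   then show ?thesis by blast
  qed
  ultimately show "EX \<psi>. ahom R N F \<epsilon> \<psi> & (ALL T. N.vnsub T & (ALL i<n. ALL j<n. e i **\<^sub>N ~*\<^sub>N e j : T) --> \<psi> ` F \<subseteq> T)" by blast
 qed
qed

text \<open>On a finite-dimensional subalgebra the unitary of \<open>sys_unitary\<close> conjugates
  \<rho> to dg exactly, both being trace-preserving. The distance to the subalgebra is paid twice,
  hence the halves of \<epsilon>.\<close>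

lemma (in utp) near_conj_AFD:
 assumes f: "tcen C" and A: "AFD M" and \<rho>: "embedding M P \<rho>" and F: "finite F" "F \<subseteq> C" and e: "\<epsilon> > 0"
 shows "EX V. P.unit V & (ALL x:F. nrm2 P (V **\<^sub>P \<rho> x **\<^sub>P ~*\<^sub>P V --\<^sub>P dg x) < \<epsilon>)"
proof -
 interpret \<rho>: emb M P \<rho> by unfold_locales (rule \<rho>)
 obtain B where B: "star_subalg M B" "fin_dim M B" "!!x. x : F ==> EX b:B. nn (x -- b) < \<epsilon> / 2"
  using A F e unfolding AFD_def by (meson half_gt_zero)
 obtain m r v where v: "sys m r v" and cf: "ALL b:B. EX cf. b = mx m r v cf"
  using findim_sys[OF B(1,2)] unfolding mx_def by blast
 note p = sysD(1)[OF v]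
 have vc: "v i : C" if "i < m" for i using psys_c[OF p that] .
 have "vtr P (\<rho> (v (r i))) = vtr P (dg (v (r i)))" if "i < m" for i
  using vc psys_r(1)[OF p that] dg_tr \<rho>.emb by (simp add: embedding_def)
 from P.sys_unitary[OF tcen_P[OF f] \<rho>.sys[OF v] dg.sys[OF v] this] obtain V where V: "P.unit V"
  "!!i j. [|i < m; j < m; r i = r j|] ==> V **\<^sub>P (\<rho> (v i) **\<^sub>P ~*\<^sub>P \<rho> (v j)) **\<^sub>P ~*\<^sub>P V = dg (v i) **\<^sub>P ~*\<^sub>P dg (v j)" by blast
 have Vc: "V : vcarrier P" using P.unitD[OF V(1)] by simp
 have Vb: "V **\<^sub>P \<rho> b **\<^sub>P ~*\<^sub>P V = dg b" if "b : B" for b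
 proof -
  obtain c where c: "b = mx m r v c" using cf \<open>b : B\<close> by blast
  have m: "\<rho> b = P.mx m r (%i. \<rho> (v i)) c" "dg b = P.mx m r (%i. dg (v i)) c"
   unfolding c by (rule \<rho>.mx, rule vc, assumption, rule dg.mx, rule vc, assumption)
  show ?thesis unfolding m by (rule P.mx_conj[OF Vc]) (use vc V(2) in auto)
 qed
 have "nrm2 P (V **\<^sub>P \<rho> x **\<^sub>P ~*\<^sub>P V --\<^sub>P dg x) < \<epsilon>" if x: "x : F" for x
 proof -
  have xc: "x : C" using x F by auto
  obtain b where b: "b : B" "nn (x -- b) < \<epsilon> / 2" using B(3)[OF x] by blast
  have bc: "b : C" using b B(1) by (auto simp: star_subalg_def)
  have 1: "nrm2 P (V **\<^sub>P \<rho> x **\<^sub>P ~*\<^sub>P V --\<^sub>P V **\<^sub>P \<rho> b **\<^sub>P ~*\<^sub>P V) = nn (x -- b)"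
   using P.tst_conj[OF V(1) \<rho>.c[OF xc] \<rho>.c[OF xc] \<rho>.c[OF bc]] \<rho>.nn[of "x -- b"] \<rho>.sub[OF xc bc] xc bc by (simp add: tst_def)
  have 2: "nrm2 P (dg b --\<^sub>P dg x) = nn (x -- b)" using dg_nn[of "b -- x"] dg_sub[OF bc xc] sub_swap[OF xc bc] xc bc by simp
  show ?thesis using P.sub_tri[of "V **\<^sub>P \<rho> x **\<^sub>P ~*\<^sub>P V" "dg b" "dg x"] 1 2 b Vb[OF b(1)] Vc \<rho>.c[OF xc] xc bc by simp
 qed
 then show ?thesis using V(1) by blast
qed

section \<open>Central sequences\<close>

context talg
begin

context
 fixes \<alpha> assumes \<alpha>: "automorphism M \<alpha>"
begin

lemma aut: "x : C ==> \<alpha> x : C" "\<alpha> \<one> = \<one>" "[|x : C; y : C|] ==> \<alpha> (x ** y) = \<alpha> x ** \<alpha> y"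
 "x : C ==> \<alpha> (c .* x) = c .* \<alpha> x" "x : C ==> \<alpha> (~*x) = ~*\<alpha> x"
 using \<alpha> unfolding automorphism_def star_hom_def by blast+

lemma aut_inj: "[|\<alpha> x = \<alpha> y; x : C; y : C|] ==> x = y"
 using \<alpha> unfolding automorphism_def bij_betw_def inj_on_def by blast

lemma aut_surj: "y : C ==> EX x:C. y = \<alpha> x"
 using \<alpha> unfolding automorphism_def bij_betw_def by blast

lemma aut_comm: assumes X: "X \<subseteq> C" shows "comm (\<alpha> ` X) = \<alpha> ` comm X"
proof
 show "comm (\<alpha> ` X) \<subseteq> \<alpha> ` comm X"
 proof
  fix z assume z: "z : comm (\<alpha> ` X)"
  obtain y where y: "y : C" "z = \<alpha> y" using aut_surj commD(1)[OF z] by blast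
  have "y ** x = x ** y" if x: "x : X" for x
  proof (rule aut_inj)
   have xc: "x : C" using x X by blast
   have "\<alpha> y ** \<alpha> x = \<alpha> x ** \<alpha> y" using commD(2)[OF z, of "\<alpha> x"] x y by simp
   then show "\<alpha> (y ** x) = \<alpha> (x ** y)" "y ** x : C" "x ** y : C" using xc y aut(3) by simp_all
  qed
  then have "y : comm X" using y by (simp add: comm_def)
  then show "z : \<alpha> ` comm X" using y by blast
 qed
 show "\<alpha> ` comm X \<subseteq> comm (\<alpha> ` X)"
 proof (clarify)
  fix y assume y: "y : comm X"
  note yc = commD(1)[OF y]
  have "\<alpha> y ** \<alpha> x = \<alpha> x ** \<alpha> y" if "x : X" for x
  proof -
   have xc: "x : C" using that X by blast
   show ?thesis using aut(3)[OF yc xc] aut(3)[OF xc yc] commD(2)[OF y that] by simp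
  qed
  then show "\<alpha> y : comm (\<alpha> ` X)" using aut(1)[OF yc] by (simp add: comm_def)
 qed
qed

lemma aut_tcen: assumes S: "S \<subseteq> C" "tcen S" shows "tcen (\<alpha> ` S)"
 unfolding tcen_def
proof (clarify)
 fix x assume x: "x : S" and c: "ALL y:\<alpha> ` S. \<alpha> x ** y = y ** \<alpha> x"
 have xc: "x : C" using x S by blast
 have "x ** y = y ** x" if y: "y : S" for y
 proof (rule aut_inj)
  have yc: "y : C" using y S by blast
  have "\<alpha> x ** \<alpha> y = \<alpha> y ** \<alpha> x" using c y by blast
  then show "\<alpha> (x ** y) = \<alpha> (y ** x)" "x ** y : C" "y ** x : C" using xc yc aut(3) by simp_all
 qed
 then obtain a where "x = a .* \<one>" using S(2) x unfolding tcen_def by blast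
 then show "EX a. \<alpha> x = a .* \<one>" using aut(2,4) one_c by (intro exI[of _ a]) simp
qed

end

lemma unit_one: "unit \<one>" by (simp add: unit_def)

end

context utp
begin

text \<open>\<open>Y\<close> consists of limits of the unitaries from \<open>matrix_gap\<close>, and \<open>\<pi>\<close> is a limit of maps into the corresponding matrix
  algebras.\<close>

lemma ex_determined_commutant:
 assumes f: "tcen C" and nm: "~ (EX e. minproj C e)" and D: "bdense D" and R: "tvna R" "AFD R"
  and AH: "!!F \<epsilon>. [|finite F; F \<subseteq> C; \<epsilon> > 0|] ==> EX \<phi>. ahom M R F \<epsilon> \<phi>"
 shows "EX \<pi> Y. embedding M P \<pi> & finite Y & Y \<subseteq> vcarrier P & (ALL y:Y. ~*\<^sub>P y : Y) &
  P.tcen (P.comm Y) & P.comm Y \<subseteq> P.comm (\<pi> ` C)"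
proof -
 interpret utq M U M by unfold_locales
 have Dc: "D ` {..k} \<subseteq> C" for k using D by (auto simp: bdense_def)
 define Q where "Q k n e b \<sigma> \<longleftrightarrow> msys n e & ahom M M (D ` {..k}) (1 / real (Suc k)) \<sigma> & \<sigma> ` D ` {..k} \<subseteq> comm (comm (mgen n e)) &
  (ALL i<3::nat. bnd 1 (b i) & b i ** ~*b i = \<one> & (ALL z:comm (mgen n e). z ** b i = b i ** z)) &
  (ALL y K. bnd K y --> (EX z:comm (mgen n e). bnd K z & nn (y -- z) <= 20 * (\<Sum>i<3. nn (b i ** y ** ~*b i -- y))))" for k n e b \<sigma>
 have "EX n e b \<sigma>. Q k n e b \<sigma>" for k
 proof -
  let ?\<epsilon> = "1 / (2 * real (Suc k))"
  obtain \<phi> where \<phi>: "ahom M R (D ` {..k}) ?\<epsilon> \<phi>" using AH[OF _ Dc, of k ?\<epsilon>] by auto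
  have "finite (\<phi> ` D ` {..k})" "\<phi> ` D ` {..k} \<subseteq> vcarrier R" "?\<epsilon> > 0" using ahomD(1)[OF \<phi>] by auto
  from ex_ahom_AFD[OF R tvna_axioms this] obtain n0 where n0: "ALL n>=n0. ALL e. msys n e -->
   (EX \<psi>. ahom R M (\<phi> ` D ` {..k}) ?\<epsilon> \<psi> & (ALL T. vnsub T & (ALL i<n. ALL j<n. e i ** ~*e j : T) --> \<psi> ` \<phi> ` D ` {..k} \<subseteq> T))"
   by (elim exE) (rule that)
  \<comment> \<open>Odd for \<open>matrix_gap\<close>, and at least n0 for
    \<open>ex_ahom_AFD\<close>.\<close>
  define n where "n = 2 * n0 + 1"
  have n: "n0 <= n" "0 < n" by (simp_all add: n_def)
  obtain e where e: "msys n e" using ex_msys[OF vnsub_C f nm n(2)] by (elim exE conjE) (rule that)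
  obtain \<psi> where \<psi>: "ahom R M (\<phi> ` D ` {..k}) ?\<epsilon> \<psi>"
   "ALL T. vnsub T & (ALL i<n. ALL j<n. e i ** ~*e j : T) --> \<psi> ` \<phi> ` D ` {..k} \<subseteq> T"
   using n0[rule_format, OF n(1) e] by (elim exE conjE) (rule that)
  have vA: "vnsub (comm (mgen n e))" by (rule vnsub_mgen[OF e])
  have vB: "vnsub (comm (comm (mgen n e)))" by (rule vnsub_comm) (use vnsubD[OF vA] in auto)
  have eB: "e i ** ~*e j : comm (comm (mgen n e))" if "i < n" "j < n" for i j
  proof -
   have m: "e i ** ~*e j : mgen n e" using that by (auto simp: mgen_def)
   have "e i : C" "e j : C" using psys_c[OF sysD(1)[OF e]] that by auto
   then show ?thesis unfolding comm_def[of "comm _"] using commD(2)[OF _ m] by auto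
  qed
  have 1: "(%x. \<psi> (\<phi> x)) ` D ` {..k} \<subseteq> comm (comm (mgen n e))"
   using \<psi>(2)[rule_format, of "comm (comm (mgen n e))"] vB eB by (simp add: image_image)
  have 2: "ahom M M (D ` {..k}) (1 / real (Suc k)) (%x. \<psi> (\<phi> x))"
   by (rule ahom_mono[OF ahom_comp[OF \<phi> \<psi>(1)]]) (simp_all add: field_simps)
  have "int n = 2 * int n0 + 1" "0 <= int n0" by (simp_all add: n_def)
  from matrix_gap[OF e this] obtain b where "(ALL i<3::nat. bnd 1 (b i) & b i ** ~*b i = \<one> & (ALL z:comm (mgen n e). z ** b i = b i ** z)) &
   (ALL y K. bnd K y --> (EX z:comm (mgen n e). bnd K z & nn (y -- z) <= 20 * (\<Sum>i<3. nn (b i ** y ** ~*b i -- y))))"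
   by (elim exE) (rule that)
  then have "Q k n e b (%x. \<psi> (\<phi> x))" unfolding Q_def using e 1 2 by (intro conjI) (elim conjE; assumption)+
  then show ?thesis by blast
 qed
 then obtain n e b \<sigma> where Q: "!!k. Q k (n k) (e k) (b k) (\<sigma> k)" by metis
 have k: "!!k. msys (n k) (e k)" "!!k. ahom M M (D ` {..k}) (1 / real (Suc k)) (\<sigma> k)"
  "!!k. \<sigma> k ` D ` {..k} \<subseteq> comm (comm (mgen (n k) (e k)))" using Q unfolding Q_def by blast+
 have b: "(ALL i<3::nat. bnd 1 (b k i) & b k i ** ~*b k i = \<one> & (ALL z:comm (mgen (n k) (e k)). z ** b k i = b k i ** z)) &
  (ALL y K. bnd K y --> (EX z:comm (mgen (n k) (e k)). bnd K z & nn (y -- z) <= 20 * (\<Sum>i<3. nn (b k i ** y ** ~*b k i -- y))))" for k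
  using Q[of k] unfolding Q_def by (elim conjE) (intro conjI)
 define A where "A k = comm (mgen (n k) (e k))" for k
 have A: "vnsub (A k)" "tcen (A k)" for k unfolding A_def using vnsub_mgen[OF k(1)] tcen_mgen[OF k(1) f] by auto
 have b': "bnd 1 (b k i)" "b k i ** ~*b k i = \<one>" "!!z. z : A k ==> z ** b k i = b k i ** z" if "i < 3" for k i
  using b[of k] that unfolding A_def by auto
 have gap: "EX z:A k. bnd K z & nn (y -- z) <= 20 * (\<Sum>i<3. nn (b k i ** y ** ~*b k i -- y))" if "bnd K y" for k K y
  using b[of k] that unfolding A_def by blast
 obtain \<pi> d where \<pi>: "embedding M P \<pi>" and d: "ALL x:C. \<pi> x = cl (%k. \<sigma> k (d k x)) & (%k. \<sigma> k (d k x)) : Seq &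
  cv sequentially (%k. d k x) x & (ALL k. d k x : D ` {..k} & d k x : C)"
  using limit_embedding[OF D subset_refl k(2) LIMSEQ_Suc[OF lim_1_over_n]] by (elim exE conjE) (rule that)
 define B where "B i = cl (%k. b k i)" for i
 have bs: "(%k. b k i) : Seq" if "i < 3" for i by (rule seqI[OF b'(1)[OF that]])
 have Bc: "B i : vcarrier P" if "i < 3" for i unfolding B_def using bs[OF that] by simp
 have BB: "B i **\<^sub>P ~*\<^sub>P B i = \<one>\<^sub>P" if "i < 3" for i
  unfolding B_def using bs[OF that] b'(2)[OF that] by (simp add: cl_ops)
 define Y where "Y = B ` {..<3} \<union> (%i. ~*\<^sub>P B i) ` {..<3}"
 have Y: "finite Y" "Y \<subseteq> vcarrier P" "ALL y:Y. ~*\<^sub>P y : Y" unfolding Y_def using Bc by auto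
 \<comment> \<open>Commuting with Y makes the displacements by b k i tend to 0. As the constant 20
   is the same for all k, the coordinates can be replaced by elements of the commutants A k.\<close>
 have rep: "EX z. z : Seq & X = cl z & (ALL k. z k : A k)" if X: "X : P.comm Y" for X
 proof -
  have Xc: "X : vcarrier P" using P.commD(1)[OF X] .
  obtain K where K: "P.bnd K X" using P.ex_bnd[OF Xc] by blast
  obtain y where y: "y : Seq" "X = cl y" "!!k. bnd K (y k)" using exact_lift[OF Xc K] by blast
  have "ALL k. EX z. z : A k & bnd K z & nn (y k -- z) <= 20 * (\<Sum>i<3. nn (b k i ** y k ** ~*b k i -- y k))"
   using gap[OF y(3)] by blast
  from choice[OF this] obtain z where "ALL k. z k : A k & bnd K (z k) &
   nn (y k -- z k) <= 20 * (\<Sum>i<3. nn (b k i ** y k ** ~*b k i -- y k))" by (elim exE) (rule that)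
  then have z: "!!k. z k : A k" "!!k. bnd K (z k)"
   "!!k. nn (y k -- z k) <= 20 * (\<Sum>i<3. nn (b k i ** y k ** ~*b k i -- y k))" by simp_all
  have zs: "z : Seq" by (rule seqI[OF z(2)])
  have "((%k. nn (b k i ** y k ** ~*b k i -- y k)) \<longlongrightarrow> 0) U" if i: "i < 3" for i
  proof -
   have "B i **\<^sub>P X = X **\<^sub>P B i" using P.commD(2)[OF X, of "B i"] i by (simp add: Y_def)
   then have "B i **\<^sub>P X **\<^sub>P ~*\<^sub>P B i = X" using Bc[OF i] Xc BB[OF i] by (simp add: P.mult_assoc)
   then have "cl (%k. b k i ** y k ** ~*b k i) = cl y" unfolding B_def y(2) using bs[OF i] y(1) by (simp add: cl_ops)
   then show ?thesis using cl_eq_iff[of "%k. b k i ** y k ** ~*b k i" y] bs[OF i] y(1) by simp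
  qed
  then have "((%k. 20 * (\<Sum>i<3. nn (b k i ** y k ** ~*b k i -- y k))) \<longlongrightarrow> 20 * (\<Sum>i<3::nat. 0)) U"
   by (intro tendsto_mult_left tendsto_sum) simp
  then have lim: "((%k. 20 * (\<Sum>i<3. nn (b k i ** y k ** ~*b k i -- y k))) \<longlongrightarrow> 0) U" by simp
  have "((%k. nn (y k -- z k)) \<longlongrightarrow> 0) U"
   by (rule tendsto_sandwich[OF _ _ tendsto_const lim]) (use z(3) y(1) zs in simp_all)
  then have "X = cl z" unfolding y(2) using cl_eq_iff[OF y(1) zs] by simp
  then show ?thesis using zs z(1) by blast
 qed
 have mem: "cl u : P.comm Y" if u: "u : Seq" "!!k. u k : A k" for u
 proof -
  have 1: "cl u **\<^sub>P B i = B i **\<^sub>P cl u" if "i < 3" for i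
   unfolding B_def using u(1) bs[OF that] b'(3)[OF that u(2)] by (simp add: cl_ops)
  have 2: "cl u **\<^sub>P ~*\<^sub>P B i = ~*\<^sub>P B i **\<^sub>P cl u" if i: "i < 3" for i
  proof -
   have "u k ** ~*b k i = ~*b k i ** u k" for k
   proof -
    have "~*u k ** b k i = b k i ** ~*u k" using b'(3)[OF i] vnsubD(6)[OF A(1) u(2)] by blast
    from arg_cong[OF this, of "vstar M"] show ?thesis using u(1) bs[OF i] seq_c[OF bs[OF i], of k] by (simp add: star_mult)
   qed
   then show ?thesis unfolding B_def using u(1) bs[OF i] by (simp add: cl_ops)
  qed
  show ?thesis unfolding P.comm_def Y_def using u(1) 1 2 by auto
 qed
 have "P.tcen (P.comm Y)"
  unfolding P.tcen_def
 proof (intro ballI impI)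
  fix Z assume Z: "Z : P.comm Y" "ALL y:P.comm Y. Z **\<^sub>P y = y **\<^sub>P Z"
  obtain z where z: "z : Seq" "Z = cl z" "!!k. z k : A k" using rep[OF Z(1)] by blast
  show "EX c. Z = c .*\<^sub>P \<one>\<^sub>P" unfolding z(2)
  proof (rule scalar_if_central[OF A z(1,3)])
   fix u assume "!!k. u k : A k" "!!k. unit (u k)"
   then have "cl u : P.comm Y" by (intro mem seq_unit)
   then show "cl u **\<^sub>P cl z = cl z **\<^sub>P cl u" using Z(2) z(2) by simp
  qed
 qed
 moreover have "P.comm Y \<subseteq> P.comm (\<pi> ` C)"
 proof
  fix X assume X: "X : P.comm Y"
  obtain z where z: "z : Seq" "X = cl z" "!!k. z k : A k" using rep[OF X] by blast
  have "X **\<^sub>P \<pi> x = \<pi> x **\<^sub>P X" if x: "x : C" for x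
  proof -
   have s: "(%k. \<sigma> k (d k x)) : Seq" "\<pi> x = cl (%k. \<sigma> k (d k x))" using d x by auto
   \<comment> \<open>\<sigma> k takes its values in the bicommutant of the matrix units, and z k
     lies in their commutant.\<close>
   have "z k ** \<sigma> k (d k x) = \<sigma> k (d k x) ** z k" for k
   proof -
    have "\<sigma> k (d k x) : comm (A k)" using d x k(3)[of k] unfolding A_def by blast
    from commD(2)[OF this z(3)] show ?thesis by simp
   qed
   then show ?thesis unfolding s(2) z(2) using s(1) z(1) by (simp add: cl_ops)
  qed
  then show "X : P.comm (\<pi> ` C)" using P.commD(1)[OF X] by (auto simp: P.comm_def)
 qed
 ultimately show ?thesis using \<pi> Y by blast
qed

text \<open>Elements nearly commuting with finitely many elements of C, if they violated the claim,
  would in the limit give an element of the commutant of Y. That commutant is a factor, so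
  \<open>dist_scalar\<close> supplies a unitary W in it, which commutes with dg C; its coordinates
  contradict the violation.\<close>

lemma commutator_local:
 assumes f: "tcen C" and Y: "finite Y" "Y \<subseteq> vcarrier P" "ALL y:Y. ~*\<^sub>P y : Y" "P.tcen (P.comm Y)" "P.comm Y \<subseteq> P.comm (dg ` C)"
  and F: "finite F" "F \<subseteq> C" and d: "\<delta> > 0"
 shows "EX G \<gamma>. finite G & G \<subseteq> C & \<gamma> > 0 & (ALL z. bnd K z & (ALL g:G. nn (z ** g -- g ** z) < \<gamma>) -->
  (EX w. unit w & (ALL x:F. nn (w ** x -- x ** w) < \<delta>) & nn (tr z .* \<one> -- z) <= 2 * nn (w ** z -- z ** w) + \<delta>))"
proof (rule ccontr)
 assume n: "~ ?thesis"
 have "ALL y:Y. EX l. l : Seq & y = cl l" using Y(2) carrier_P by blast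
 from bchoice[OF this] obtain l where "ALL y:Y. l y : Seq & y = cl (l y)" by (elim exE) (rule that)
 then have l: "l y : Seq & y = cl (l y)" if "y : Y" for y using that by (rule bspec)
 define bad where "bad z \<longleftrightarrow> bnd K z & ~ (EX w. unit w & (ALL x:F. nn (w ** x -- x ** w) < \<delta>) &
  nn (tr z .* \<one> -- z) <= 2 * nn (w ** z -- z ** w) + \<delta>)" for z
 have "ALL k. EX z. bad z & (ALL y:Y. nn (z ** l y k -- l y k ** z) < 1 / real (Suc k))"
 proof (rule allI, rule ccontr)
  fix k assume a: "~ (EX z. bad z & (ALL y:Y. nn (z ** l y k -- l y k ** z) < 1 / real (Suc k)))"
  \<comment> \<open>The candidate for G consists of the k-th coordinates of lifts of Y.\<close>
  have 1: "finite ((%y. l y k) ` Y)" "(%y. l y k) ` Y \<subseteq> C" using Y l by auto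
  have 2: "ALL z. bnd K z & (ALL g:(%y. l y k) ` Y. nn (z ** g -- g ** z) < 1 / real (Suc k)) -->
  (EX w. unit w & (ALL x:F. nn (w ** x -- x ** w) < \<delta>) & nn (tr z .* \<one> -- z) <= 2 * nn (w ** z -- z ** w) + \<delta>)"
   using a unfolding bad_def by blast
  show False by (rule notE[OF n], intro exI[of _ "(%y. l y k) ` Y"] exI[of _ "1 / real (Suc k)"] conjI 1 2) simp
 qed
 from choice[OF this] obtain z where "ALL k. bad (z k) & (ALL y:Y. nn (z k ** l y k -- l y k ** z k) < 1 / real (Suc k))"
  by (elim exE) (rule that)
 then have z: "!!k. bad (z k)" "!!k y. y : Y ==> nn (z k ** l y k -- l y k ** z k) < 1 / real (Suc k)" by simp_all
 have zb: "bnd K (z k)" for k using z(1)[of k] unfolding bad_def by blast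
 have zs: "z : Seq" by (rule seqI[OF zb])
 let ?Z = "cl z"
 have "?Z **\<^sub>P y = y **\<^sub>P ?Z" if y: "y : Y" for y
 proof -
  have ly: "l y : Seq" "y = cl (l y)" using l[OF y] by auto
  have "((%k. nn (z k ** l y k -- l y k ** z k)) \<longlongrightarrow> 0) U"
   by (rule tendsto_sandwich[OF _ _ tendsto_const U_seq[OF LIMSEQ_Suc[OF lim_1_over_n]]])
    (use zs ly z(2)[OF y] in \<open>auto intro!: always_eventually less_imp_le\<close>)
  then have "cl (%k. z k ** l y k) = cl (%k. l y k ** z k)" using zs ly(1) by (subst cl_eq_iff) simp_all
  then have "?Z **\<^sub>P cl (l y) = cl (l y) **\<^sub>P ?Z" using zs ly(1) by (simp add: cl_ops)
  then show ?thesis using ly(2) by simp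
 qed
 then have ZY: "?Z : P.comm Y" using zs by (simp add: P.comm_def)
 have vY: "P.vnsub (P.comm Y)" by (rule P.vnsub_comm) (use Y in auto)
 let ?c = "nrm2 P (vtr P ?Z .*\<^sub>P \<one>\<^sub>P --\<^sub>P ?Z)"
 have Zc: "?Z : vcarrier P" using zs by simp
 have c0: "0 <= ?c" using Zc by simp
 have conj: "nrm2 P (W **\<^sub>P ?Z **\<^sub>P ~*\<^sub>P W --\<^sub>P ?Z) = nrm2 P (W **\<^sub>P ?Z --\<^sub>P ?Z **\<^sub>P W)" if W: "P.unit W" for W
 proof -
  note w = P.unitD[OF W]
  have "(W **\<^sub>P ?Z **\<^sub>P ~*\<^sub>P W --\<^sub>P ?Z) **\<^sub>P W = W **\<^sub>P ?Z **\<^sub>P (~*\<^sub>P W **\<^sub>P W) --\<^sub>P ?Z **\<^sub>P W"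
   using w(1) Zc by (simp add: vsub_def P.distrib_r P.smult_mult P.mult_assoc)
  then show ?thesis using P.unit_nn(2)[OF W, of "W **\<^sub>P ?Z **\<^sub>P ~*\<^sub>P W --\<^sub>P ?Z"] w Zc by simp
 qed
 have "EX W:P.comm Y. P.unit W & ?c <= 2 * nrm2 P (W **\<^sub>P ?Z --\<^sub>P ?Z **\<^sub>P W)"
 proof (rule ccontr)
  assume a: "~ ?thesis"
  have "nrm2 P (u **\<^sub>P ?Z **\<^sub>P ~*\<^sub>P u --\<^sub>P ?Z) <= ?c / 2" if "u : P.comm Y" "P.unit u" for u
   unfolding conj[OF that(2)] using a that by fastforce
  from P.dist_scalar[OF vY Y(4) ZY this] have "?c = 0" using c0 by simp
  moreover have "0 <= nrm2 P (\<one>\<^sub>P **\<^sub>P ?Z --\<^sub>P ?Z **\<^sub>P \<one>\<^sub>P)" using Zc by simp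
  ultimately show False using a P.unit_one P.vnsubD(2)[OF vY] by fastforce
 qed
 then obtain W where W: "W : P.comm Y" "P.unit W" "?c <= 2 * nrm2 P (W **\<^sub>P ?Z --\<^sub>P ?Z **\<^sub>P W)" by blast
 obtain w where w: "w : Seq" "W = cl w" "!!k. unit (w k)" using exact_unit_lift[OF f W(2)] by blast
 have ev1: "eventually (%k. ALL x:F. nn (w k ** x -- x ** w k) < \<delta>) U"
 proof (intro eventually_ball_finite ballI F(1))
  fix x assume "x : F"
  then have xc: "x : C" using F by blast
  have "W **\<^sub>P dg x = dg x **\<^sub>P W" using P.commD(2)[of W "dg ` C" "dg x"] W(1) Y(5) xc by blast
  then have "cl (%k. w k ** x) = cl (%k. x ** w k)" using w(1) xc unfolding w(2) dg_def by (simp add: cl_ops)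
  then have "((%k. nn (w k ** x -- x ** w k)) \<longlongrightarrow> 0) U" using cl_eq_iff[of "%k. w k ** x" "%k. x ** w k"] w(1) xc by simp
  from order_tendstoD(2)[OF this d] show "eventually (%k. nn (w k ** x -- x ** w k) < \<delta>) U" .
 qed
 have tb: "cmod (tr (z k)) <= K" for k using tr_le_nn[of "z k"] bnd_nn[OF zb, of k] zs by simp
 have ts: "(%k. tr (z k) .* \<one>) : Seq" using seq_smult'[OF seq_const[OF one_c] tb] .
 have "cl (%k. tr (z k) .* \<one>) = vtr P ?Z .*\<^sub>P \<one>\<^sub>P" by (rule cl_scalar[OF cl_tr[OF zs] tb])
 then have "((%k. nn (tr (z k) .* \<one> -- z k)) \<longlongrightarrow> ?c) U" using cl_nn[of "%k. tr (z k) .* \<one> -- z k"] ts zs by (simp flip: cl_sub)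
 moreover have "((%k. nn (w k ** z k -- z k ** w k)) \<longlongrightarrow> nrm2 P (W **\<^sub>P ?Z --\<^sub>P ?Z **\<^sub>P W)) U"
  using cl_nn[of "%k. w k ** z k -- z k ** w k"] w(1) zs unfolding w(2) by (simp add: cl_ops)
 ultimately have "((%k. nn (tr (z k) .* \<one> -- z k) - 2 * nn (w k ** z k -- z k ** w k)) \<longlongrightarrow>
  ?c - 2 * nrm2 P (W **\<^sub>P ?Z --\<^sub>P ?Z **\<^sub>P W)) U" by (intro tendsto_diff tendsto_mult_left)
 from order_tendstoD(2)[OF this, of \<delta>]
 have "eventually (%k. nn (tr (z k) .* \<one> -- z k) - 2 * nn (w k ** z k -- z k ** w k) < \<delta>) U" using W(3) d by simp
 from eventually_happens'[OF U_bot eventually_conj[OF ev1 this]] obtain k where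
  "ALL x:F. nn (w k ** x -- x ** w k) < \<delta>" "nn (tr (z k) .* \<one> -- z k) <= 2 * nn (w k ** z k -- z k ** w k) + \<delta>" by force
 then show False using z(1)[of k] w(3)[of k] unfolding bad_def by blast
qed

lemma comm_dg_dense: assumes D: "bdense D" and W: "W : vcarrier P" "!!n. W **\<^sub>P dg (D n) = dg (D n) **\<^sub>P W"
 shows "W : P.comm (dg ` C)"
proof -
 obtain e where e: "ALL x:C. (EX r. ALL k. bnd r (e k x)) & cv sequentially (%k. e k x) x & (ALL k. e k x : D ` {..k::nat})"
  using approximants[OF D] by blast
 have "W **\<^sub>P dg x = dg x **\<^sub>P W" if x: "x : C" for x
 proof -
  have c: "cv sequentially (%k. e k x) x" and ed: "!!k. e k x : D ` {..k}" using e x by auto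
  note ec = cv_c(1)[OF c]
  have n: "nrm2 P (dg (e k x) --\<^sub>P dg x) = nn (e k x -- x)" for k
   using dg_sub[OF ec x] dg_nn[of "e k x -- x"] ec x by simp
  have c': "P.cv sequentially (%k. dg (e k x)) (dg x)" unfolding P.cv_def n using cvD[OF c] ec x by simp
  have "(%k. W **\<^sub>P dg (e k x)) = (%k. dg (e k x) **\<^sub>P W)"
  proof
   fix k obtain n where "e k x = D n" using ed[of k] by blast
   then show "W **\<^sub>P dg (e k x) = dg (e k x) **\<^sub>P W" using W(2) by simp
  qed
  then show ?thesis using P.cv_unique[OF P.cv_cmult[OF W(1) c'] _ sequentially_bot, of "dg x **\<^sub>P W"] P.cv_multc[OF W(1) c'] by simp
 qed
 then show ?thesis using W(1) by (auto simp: P.comm_def)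
qed

text \<open>Z commutes with dg C but perhaps not with Y, so factoriality of the commutant of Y does
  not apply to Z itself. Coordinatewise it does, through \<open>commutator_local\<close>: the
  coordinates of Z almost commute with any finite subset of C. The unitaries obtained, at accuracies
  growing with k, form an element W of the commutant of dg C, hence [W, Z] = 0, and Z has distance 0
  from the scalars.\<close>

lemma tcen_comm_dg:
 assumes f: "tcen C" and D: "bdense D" and Y: "finite Y" "Y \<subseteq> vcarrier P" "ALL y:Y. ~*\<^sub>P y : Y" "P.tcen (P.comm Y)" "P.comm Y \<subseteq> P.comm (dg ` C)"
 shows "P.tcen (P.comm (dg ` C))"
 unfolding P.tcen_def
proof (intro ballI impI)
 fix Z assume Z: "Z : P.comm (dg ` C)" "ALL y:P.comm (dg ` C). Z **\<^sub>P y = y **\<^sub>P Z"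
 have Zc: "Z : vcarrier P" by (rule P.commD(1)[OF Z(1)])
 obtain z where z: "z : Seq" "Z = cl z" using clE[OF Zc] .
 obtain K where K: "!!k. bnd K (z k)" using seqE[OF z(1)] by blast
 define Q where "Q j k w \<longleftrightarrow> unit w & (ALL x:D ` {..j}. nn (w ** x -- x ** w) < 1 / real (Suc j)) &
  nn (tr (z k) .* \<one> -- z k) <= 2 * nn (w ** z k -- z k ** w) + 1 / real (Suc j)" for j k w
 have ev: "eventually (%k. EX w. Q j k w) U" for j
 proof -
  have Dj: "finite (D ` {..j})" "D ` {..j} \<subseteq> C" "1 / real (Suc j) > 0" using D by (auto simp: bdense_def)
  obtain G \<gamma> where G: "finite G" "G \<subseteq> C" "\<gamma> > 0" "!!y. [|bnd K y; ALL g:G. nn (y ** g -- g ** y) < \<gamma>|] ==>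
   EX w. unit w & (ALL x:D ` {..j}. nn (w ** x -- x ** w) < 1 / real (Suc j)) & nn (tr y .* \<one> -- y) <= 2 * nn (w ** y -- y ** w) + 1 / real (Suc j)"
   using commutator_local[OF f Y Dj, of K] by blast
  have "eventually (%k. ALL g:G. nn (z k ** g -- g ** z k) < \<gamma>) U"
  proof (intro eventually_ball_finite ballI G(1))
   fix g assume "g : G"
   then have gc: "g : C" using G by blast
   have "Z **\<^sub>P dg g = dg g **\<^sub>P Z" using P.commD(2)[OF Z(1)] gc by blast
   then have "cl (%k. z k ** g) = cl (%k. g ** z k)" using z(1) gc unfolding z(2) dg_def by (simp add: cl_ops)
   then have "((%k. nn (z k ** g -- g ** z k)) \<longlongrightarrow> 0) U" using cl_eq_iff[of "%k. z k ** g" "%k. g ** z k"] z(1) gc by simp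
   from order_tendstoD(2)[OF this G(3)] show "eventually (%k. nn (z k ** g -- g ** z k) < \<gamma>) U" .
  qed
  then show ?thesis by eventually_elim (use G(4)[OF K] in \<open>auto simp: Q_def\<close>)
 qed
 from diagonal[of "%j k. EX w. Q j k w", OF ev] obtain m where m: "!!j. eventually (%k. m k >= j) U"
  "eventually (%k. ALL i<=m k. EX w. Q i k w) U" by blast
 \<comment> \<open>The default 1 makes every coordinate unitary, so that w is a bounded sequence
   also where no suitable unitary exists.\<close>
 define w where "w k = (if EX w. Q (m k) k w then SOME w. Q (m k) k w else \<one>)" for k
 have wQ: "Q (m k) k (w k)" if "EX w. Q (m k) k w" for k using someI_ex[OF that] that by (simp add: w_def)
 have wu: "unit (w k)" for k
  using wQ[of k] unit_one by (cases "EX w. Q (m k) k w") (auto simp: Q_def w_def[of k])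
 have ws: "w : Seq" by (rule seq_unit[OF wu])
 have mQ: "eventually (%k. Q (m k) k (w k)) U" using m(2) by eventually_elim (blast intro: wQ)
 have m0: "((%k. 1 / real (Suc (m k))) \<longlongrightarrow> 0) U"
 proof (rule tendstoI)
  fix \<epsilon> :: real assume "\<epsilon> > 0"
  then obtain j where j: "1 / real (Suc j) < \<epsilon>" using nat_approx_posE by blast
  show "eventually (%k. dist (1 / real (Suc (m k))) 0 < \<epsilon>) U"
   using m(1)[of j]
  proof eventually_elim
   case (elim k)
   have "1 / real (Suc (m k)) <= 1 / real (Suc j)" using elim by (simp add: frac_le)
   then show ?case using j by simp
  qed
 qed
 let ?W = "cl w"
 have "?W : P.comm (dg ` C)"
 proof (rule comm_dg_dense[OF D])
  show "?W : vcarrier P" using ws by simp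
  fix n
  have Dn: "D n : C" using D by (simp add: bdense_def)
  have "((%k. nn (w k ** D n -- D n ** w k)) \<longlongrightarrow> 0) U"
  proof (rule tendsto_sandwich[OF _ _ tendsto_const m0])
   show "eventually (%k. nn (w k ** D n -- D n ** w k) <= 1 / real (Suc (m k))) U"
    using m(1)[of n] mQ by eventually_elim (auto simp: Q_def intro: less_imp_le)
  qed (use ws Dn in simp)
  then have "cl (%k. w k ** D n) = cl (%k. D n ** w k)" using ws Dn by (subst cl_eq_iff) simp_all
  then show "?W **\<^sub>P dg (D n) = dg (D n) **\<^sub>P ?W" unfolding dg_def using ws Dn by (simp add: cl_ops)
 qed
 then have "Z **\<^sub>P ?W = ?W **\<^sub>P Z" using Z(2) by blast
 then have "cl (%k. w k ** z k) = cl (%k. z k ** w k)" unfolding z(2) using ws z(1) by (simp add: cl_ops)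
 then have "((%k. nn (w k ** z k -- z k ** w k)) \<longlongrightarrow> 0) U" using cl_eq_iff[of "%k. w k ** z k" "%k. z k ** w k"] ws z(1) by simp
 from tendsto_add[OF tendsto_mult_left[OF this, of 2] m0]
 have lim: "((%k. 2 * nn (w k ** z k -- z k ** w k) + 1 / real (Suc (m k))) \<longlongrightarrow> 0) U" by simp
 have tb: "cmod (tr (z k)) <= K" for k using tr_le_nn[of "z k"] bnd_nn[OF K, of k] z(1) by simp
 have ts: "(%k. tr (z k) .* \<one>) : Seq" using seq_smult'[OF seq_const[OF one_c] tb] .
 have "((%k. nn (tr (z k) .* \<one> -- z k)) \<longlongrightarrow> 0) U"
 proof (rule tendsto_sandwich[OF _ _ tendsto_const lim])
  show "eventually (%k. nn (tr (z k) .* \<one> -- z k) <= 2 * nn (w k ** z k -- z k ** w k) + 1 / real (Suc (m k))) U"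
   using mQ by eventually_elim (simp add: Q_def)
 qed (use z(1) in simp)
 then have "cl (%k. tr (z k) .* \<one>) = Z" unfolding z(2) using ts z(1) by (subst cl_eq_iff) simp_all
 moreover have "cl (%k. tr (z k) .* \<one>) = vtr P Z .*\<^sub>P \<one>\<^sub>P" unfolding z(2) by (rule cl_scalar[OF cl_tr[OF z(1)] tb])
 ultimately show "EX c. Z = c .*\<^sub>P \<one>\<^sub>P" by metis
qed

lemma gen_JungD:
 assumes J: "gen_Jung U M" and e: "embedding M P \<rho>" "embedding M P \<sigma>"
 shows "EX \<alpha>. automorphism P \<alpha> & (ALL x:C. \<rho> x = \<alpha> (\<sigma> x))"
 using J[unfolded gen_Jung_def, rule_format, OF conjI[OF e]] unfolding aut_equiv_def .

lemma tcen_comm_embedding: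
 assumes f: "tcen C" and nm: "~ (EX e. minproj C e)" and D: "bdense D" and R: "tvna R" "AFD R"
  and AH: "!!F \<epsilon>. [|finite F; F \<subseteq> C; \<epsilon> > 0|] ==> EX \<phi>. ahom M R F \<epsilon> \<phi>" and J: "gen_Jung U M" and \<rho>: "embedding M P \<rho>"
 shows "P.tcen (P.comm (\<rho> ` C))"
proof -
 obtain \<pi> Y where \<pi>: "embedding M P \<pi>" and Y: "finite Y" "Y \<subseteq> vcarrier P" "ALL y:Y. ~*\<^sub>P y : Y"
  "P.tcen (P.comm Y)" "P.comm Y \<subseteq> P.comm (\<pi> ` C)" using ex_determined_commutant[OF f nm D R AH] by blast
 obtain \<alpha> where \<alpha>: "automorphism P \<alpha>" "!!x. x : C ==> dg x = \<alpha> (\<pi> x)" 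
  using gen_JungD[OF J dg.emb \<pi>] by (elim exE conjE) (rule that, assumption, rule bspec)
 have \<pi>C: "\<pi> ` C \<subseteq> vcarrier P" using \<pi> by (auto simp: embedding_def star_hom_def)
 have e: "dg ` C = \<alpha> ` \<pi> ` C" using \<alpha>(2) by (simp add: image_image)
 have "P.tcen (P.comm (dg ` C))"
 proof (rule tcen_comm_dg[OF f D])
  show "finite (\<alpha> ` Y)" "\<alpha> ` Y \<subseteq> vcarrier P" using Y P.aut(1)[OF \<alpha>(1)] by auto
  show "ALL y:\<alpha> ` Y. ~*\<^sub>P y : \<alpha> ` Y"
  proof clarify
   fix y assume y: "y : Y"
   then have "\<alpha> (~*\<^sub>P y) = ~*\<^sub>P \<alpha> y" using P.aut(5)[OF \<alpha>(1)] Y(2) by blast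
   then show "~*\<^sub>P \<alpha> y : \<alpha> ` Y" using Y(3) y by (metis imageI)
  qed
  show "P.tcen (P.comm (\<alpha> ` Y))" unfolding P.aut_comm[OF \<alpha>(1) Y(2)]
   by (rule P.aut_tcen[OF \<alpha>(1) _ Y(4)]) (auto dest: P.commD(1))
  show "P.comm (\<alpha> ` Y) \<subseteq> P.comm (dg ` C)" unfolding e P.aut_comm[OF \<alpha>(1) Y(2)] P.aut_comm[OF \<alpha>(1) \<pi>C] using Y(5) by blast
 qed
 then have tc: "P.tcen (P.comm (dg ` C))" .
 obtain \<beta> where \<beta>: "automorphism P \<beta>" "!!x. x : C ==> \<rho> x = \<beta> (dg x)" 
  using gen_JungD[OF J \<rho> dg.emb] by (elim exE conjE) (rule that, assumption, rule bspec)
 have e: "\<rho> ` C = \<beta> ` dg ` C" using \<beta>(2) by (simp add: image_image)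
 have dC: "dg ` C \<subseteq> vcarrier P" by auto
 show ?thesis unfolding e P.aut_comm[OF \<beta>(1) dC] by (rule P.aut_tcen[OF \<beta>(1) _ tc]) (auto dest: P.commD(1))
qed

end

text \<open>Both \<open>v\<^sub>0 v\<^sub>0*\<close> and \<open>v\<^sub>1 v\<^sub>1*\<close> commute with the embedding \<open>\<rho> = \<rho>1 v\<^sub>0 v\<^sub>0* + \<rho>2 v\<^sub>1 v\<^sub>1*\<close>; a partial isometry between them
  in the commutant of \<open>\<rho>\<close> intertwines \<open>\<rho>1\<close> and \<open>\<rho>2\<close>.\<close>

lemma (in tvna) conj_of_commuting:
 assumes N: "talg N" and r1: "embedding N M \<rho>1" and r2: "embedding N M \<rho>2" and v: "sys 2 (%_. 0) v"
  and c1: "!!x i j. [|x : vcarrier N; i < 2; j < 2|] ==> \<rho>1 x ** (v i ** ~*v j) = (v i ** ~*v j) ** \<rho>1 x"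
  and c2: "!!x i j. [|x : vcarrier N; i < 2; j < 2|] ==> \<rho>2 x ** (v i ** ~*v j) = (v i ** ~*v j) ** \<rho>2 x"
  and tc: "!!\<rho>. embedding N M \<rho> ==> tcen (comm (\<rho> ` vcarrier N))"
 shows "EX u. unit u & (ALL x:vcarrier N. u ** \<rho>1 x ** ~*u = \<rho>2 x)"
proof -
 interpret N: talg N by fact
 interpret r1: emb N M \<rho>1 by unfold_locales (rule r1)
 interpret r2: emb N M \<rho>2 by unfold_locales (rule r2)
 note p = sysD(1)[OF v]
 have vc: "v 0 : C" "v 1 : C" using psys_c[OF p] by auto
 define a where "a = v 0 ** ~*v 0"
 define b where "b = v 1 ** ~*v 1"
 define g where "g = v 0 ** ~*v 1"
 have c: "a : C" "b : C" "g : C" using vc by (auto simp: a_def b_def g_def)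
 have four: "(v i ** ~*v j) ** (v k ** ~*v l) = (if j = k then v i ** ~*v l else \<zero>)" if "i < 2" "j < 2" "k < 2" "l < 2" for i j k l
 proof -
  have q: "v i : C" "v j : C" "v k : C" "v l : C" "v 0 : C" using psys_c[OF p] that by auto
  have "(v i ** ~*v j) ** (v k ** ~*v l) = v i ** ((~*v j ** v k) ** ~*v l)" using q by (simp add: mult_assoc)
  then show ?thesis using psys_m[OF p] psys_left[OF p] that q by (cases "j = k") auto
 qed
 have gs: "~*g = v 1 ** ~*v 0" using vc by (simp add: g_def star_mult)
 have as: "~*a = a" "~*b = b" using vc by (simp_all add: a_def b_def star_mult)
 have m: "a ** a = a" "b ** b = b" "a ** b = \<zero>" "b ** a = \<zero>" "g ** ~*g = a" "~*g ** g = b"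
  "a ** g = g" "g ** b = g" "g ** a = \<zero>" "b ** ~*g = ~*g" "~*g ** a = ~*g"
  unfolding gs unfolding a_def b_def g_def by (simp_all add: four)
 have ab: "a ++ b = \<one>"
  using sysD(2)[OF v] c add_comm[of \<zero> a] unfolding a_def[symmetric] b_def[symmetric] by (simp add: numeral_2_eq_2 a_def b_def)
 have k1: "\<rho>1 x ** a = a ** \<rho>1 x" "\<rho>1 x ** b = b ** \<rho>1 x" "\<rho>1 x ** g = g ** \<rho>1 x" if "x : vcarrier N" for x
  using c1[OF that] unfolding a_def b_def g_def by auto
 have k2: "\<rho>2 x ** a = a ** \<rho>2 x" "\<rho>2 x ** b = b ** \<rho>2 x" "\<rho>2 x ** g = g ** \<rho>2 x" "\<rho>2 x ** ~*g = ~*g ** \<rho>2 x" if "x : vcarrier N" for x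
  using c2[OF that] unfolding gs unfolding a_def b_def g_def by auto
 \<comment> \<open>The direct sum of \<rho>1 and \<rho>2 along 1 = a + b, formed inside the same
   algebra.\<close>
 define \<rho> where "\<rho> x = \<rho>1 x ** a ++ \<rho>2 x ** b" for x
 have \<rho>c: "\<rho> x : C" if "x : vcarrier N" for x using that c by (simp add: \<rho>_def)
 have \<rho>a: "\<rho> x ** a = \<rho>1 x ** a" "\<rho> x ** b = \<rho>2 x ** b" "a ** \<rho> x = \<rho>1 x ** a" "b ** \<rho> x = \<rho>2 x ** b" if x: "x : vcarrier N" for x
 proof -
  note xc = r1.c[OF x] r2.c[OF x]
  show "\<rho> x ** a = \<rho>1 x ** a" "\<rho> x ** b = \<rho>2 x ** b"
   unfolding \<rho>_def using xc c m add_comm[of \<zero> "\<rho>2 x ** b"] by (simp_all add: distrib_r mult_assoc)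
  have h: "s ** (y ** t) = y ** (s ** t)" if "y ** s = s ** y" "y : C" "s : C" "t : C" for y s t
   using mult_assoc[of s y t] mult_assoc[of y s t] that by simp
  have "a ** (\<rho>1 x ** a) = \<rho>1 x ** a" "a ** (\<rho>2 x ** b) = \<zero>" "b ** (\<rho>1 x ** a) = \<zero>" "b ** (\<rho>2 x ** b) = \<rho>2 x ** b"
   using h[OF k1(1)[OF x]] h[OF k1(2)[OF x]] h[OF k2(1)[OF x]] h[OF k2(2)[OF x]] xc c m by simp_all
  then show "a ** \<rho> x = \<rho>1 x ** a" "b ** \<rho> x = \<rho>2 x ** b"
   unfolding \<rho>_def using xc c add_comm[of \<zero> "\<rho>2 x ** b"] by (simp_all add: distrib_l)
 qed
 have \<rho>: "embedding N M \<rho>"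
 proof (rule embedding_if_mult_star_tr[OF N talg_axioms \<rho>c])
  fix x assume x: "x : vcarrier N"
  note xc = r1.c[OF x] r2.c[OF x]
  show "\<rho> (~*\<^sub>N x) = ~*\<rho> x" unfolding \<rho>_def using x xc c as k1(1,2)[of "~*\<^sub>N x"] k2(1,2)[of "~*\<^sub>N x"]
   by (simp add: star_add star_mult r1.star r2.star)
  \<comment> \<open>y commutes with the partial isometry g between b and a, so its trace is shared
    equally by the two projections; this makes \<rho> trace-preserving.\<close>
  have half: "2 * tr (y ** a) = tr y" "2 * tr (y ** b) = tr y" if y: "y : C" "y ** g = g ** y" for y
  proof -
   have "tr (y ** a) = tr ((y ** g) ** ~*g)" using y(1) c m(5) by (simp add: mult_assoc)
   also have "... = tr (~*g ** (g ** y))" unfolding y(2) using y c by (intro tr_comm) auto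
   also have "... = tr (b ** y)" using y(1) c m(6) by (simp flip: mult_assoc)
   also have "... = tr (y ** b)" using y c by (intro tr_comm) auto
   finally have e: "tr (y ** a) = tr (y ** b)" .
   moreover have "tr (y ** a) + tr (y ** b) = tr y"
    using y c ab by (simp flip: tr_add distrib_l)
   ultimately show "2 * tr (y ** a) = tr y" "2 * tr (y ** b) = tr y" by simp_all
  qed
  have "2 * tr (\<rho> x) = 2 * vtr N x"
   using half(1)[OF xc(1) k1(3)[OF x]] half(2)[OF xc(2) k2(3)[OF x]] r1 r2 x xc c
   by (simp add: \<rho>_def tr_add embedding_def)
  then show "tr (\<rho> x) = vtr N x" by simp
 next
  fix x y assume x: "x : vcarrier N" and y: "y : vcarrier N"
  note xc = r1.c[OF x] r2.c[OF x] and yc = r1.c[OF y] r2.c[OF y]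
  have "\<rho> x ** \<rho> y = \<rho> x ** (a ** \<rho>1 y) ++ \<rho> x ** (b ** \<rho>2 y)"
   unfolding \<rho>_def[of y] k1(1)[OF y] k2(2)[OF y] using \<rho>c[OF x] yc c by (simp add: distrib_l)
  also have "... = (\<rho> x ** a) ** \<rho>1 y ++ (\<rho> x ** b) ** \<rho>2 y" using \<rho>c[OF x] yc c by (simp add: mult_assoc)
  also have "... = \<rho>1 x ** (\<rho>1 y ** a) ++ \<rho>2 x ** (\<rho>2 y ** b)"
   unfolding \<rho>a(1,2)[OF x] k1(1)[OF y] k2(2)[OF y] using xc yc c by (simp add: mult_assoc)
  finally show "\<rho> (x **\<^sub>N y) = \<rho> x ** \<rho> y"
   unfolding \<rho>_def[of "x **\<^sub>N y"] using x y xc yc c by (simp add: r1.mult r2.mult mult_assoc)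
 qed
 let ?S = "comm (\<rho> ` vcarrier N)"
 interpret \<rho>: emb N M \<rho> by unfold_locales (rule \<rho>)
 have S: "vnsub ?S"
 proof (rule vnsub_comm)
  show "~*y : \<rho> ` vcarrier N" if y: "y : \<rho> ` vcarrier N" for y
  proof -
   obtain x where x: "x : vcarrier N" "y = \<rho> x" using y by blast
   show ?thesis unfolding x(2) \<rho>.star[OF x(1), symmetric] using x(1) by simp
  qed
 qed (use \<rho>c in auto)
 have "a : ?S" "b : ?S" using c \<rho>a by (auto simp: comm_def)
 moreover have "proj a" "proj b" using c as m by (simp_all add: proj_def)
 moreover have "tr a = tr b" using tr_comm[of g "~*g"] c m by simp
 ultimately obtain w where w: "w : ?S" "~*w ** w = a" "w ** ~*w = b" "w ** a = w" "b ** w = w"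
  using comparison[OF S tc[OF \<rho>], of a b] by blast
 have wc: "w : C" using commD(1)[OF w(1)] .
 have int: "w ** \<rho>1 x = \<rho>2 x ** w" if x: "x : vcarrier N" for x
 proof -
  note xc = r1.c[OF x] r2.c[OF x]
  have "w ** \<rho>1 x = (w ** a) ** \<rho>1 x" using w(4) by simp
  also have "... = w ** (\<rho> x ** a)" unfolding \<rho>a(1)[OF x] k1(1)[OF x] using wc c xc by (simp add: mult_assoc)
  also have "... = (w ** \<rho> x) ** a" using wc c \<rho>c[OF x] by (simp add: mult_assoc)
  also have "... = (\<rho> x ** w) ** a" using commD(2)[OF w(1)] x by simp
  also have "... = \<rho> x ** (b ** w)" using wc c \<rho>c[OF x] w(4,5) by (simp add: mult_assoc)
  also have "... = (\<rho> x ** b) ** w" using wc c \<rho>c[OF x] by (simp add: mult_assoc)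
  also have "... = \<rho>2 x ** (b ** w)" unfolding \<rho>a(2)[OF x] using wc c xc by (simp add: mult_assoc)
  finally show ?thesis unfolding w(5) .
 qed
 \<comment> \<open>w leads from a to b and intertwines \<rho>1 with \<rho>2, and g leads from b to a
   and commutes with both. So g ** w and w ** g are unitaries of the corners of a and b, each
   intertwining the two maps.\<close>
 define u where "u = g ** w ++ w ** g"
 have uc: "u : C" using wc c by (simp add: u_def)
 have ws: "~*w ** b = ~*w" "a ** ~*w = ~*w"
  using arg_cong[OF w(5), of "vstar M"] arg_cong[OF w(4), of "vstar M"] wc c as by (simp_all add: star_mult)
 have us: "~*u = ~*w ** ~*g ++ ~*g ** ~*w" unfolding u_def using wc c by (simp add: star_add star_mult)
 have z1: "~*g ** w = \<zero>"
 proof -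
  have "~*g ** w = (~*g ** a) ** (b ** w)" using m(11) w(5) by simp
  also have "... = ~*g ** ((a ** b) ** w)" using wc c by (simp add: mult_assoc)
  finally show ?thesis unfolding m(3) using wc c by simp
 qed
 have z2: "w ** ~*g = \<zero>"
 proof -
  have "w ** ~*g = (w ** a) ** (b ** ~*g)" using m(10) w(4) by simp
  also have "... = w ** ((a ** b) ** ~*g)" using wc c by (simp add: mult_assoc)
  finally show ?thesis unfolding m(3) using wc c by simp
 qed
 have z1': "~*w ** g = \<zero>" and z2': "g ** ~*w = \<zero>"
  using arg_cong[OF z1, of "vstar M"] arg_cong[OF z2, of "vstar M"] wc c by (simp_all add: star_mult)
 have "~*u ** u = \<one>"
 proof -
  have "~*u ** u = (~*w ** ((~*g ** g) ** w) ++ ~*g ** ((~*w ** g) ** w)) ++ (~*w ** ((~*g ** w) ** g) ++ ~*g ** ((~*w ** w) ** g))"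
   unfolding us unfolding u_def using wc c by (simp add: distrib_l distrib_r mult_assoc add_assoc)
  also have "... = a ++ b" unfolding m(6) z1 z1' w(2) using wc c w(2,5) m(6,7) add_comm[of \<zero> b] by simp
  finally show ?thesis unfolding ab .
 qed
 moreover have "u ** ~*u = \<one>"
 proof -
  have "u ** ~*u = (g ** ((w ** ~*w) ** ~*g) ++ w ** ((g ** ~*w) ** ~*g)) ++ (g ** ((w ** ~*g) ** ~*w) ++ w ** ((g ** ~*g) ** ~*w))"
   unfolding us unfolding u_def using wc c by (simp add: distrib_l distrib_r mult_assoc add_assoc)
  also have "... = a ++ b" unfolding m(5) z2 z2' w(3) using wc c w(3) ws m(5,10) add_comm[of \<zero> b] by simp
  finally show ?thesis unfolding ab .
 qed
 ultimately have u: "unit u" using uc by (simp add: unit_def)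
 have "u ** \<rho>1 x ** ~*u = \<rho>2 x" if x: "x : vcarrier N" for x
 proof -
  note xc = r1.c[OF x] r2.c[OF x]
  have "u ** \<rho>1 x = g ** (w ** \<rho>1 x) ++ w ** (g ** \<rho>1 x)" unfolding u_def using wc c xc by (simp add: distrib_r mult_assoc)
  also have "... = (g ** \<rho>2 x) ** w ++ (w ** \<rho>1 x) ** g" unfolding int[OF x] k1(3)[OF x, symmetric] using wc c xc int[OF x] by (simp add: mult_assoc[symmetric])
  also have "... = \<rho>2 x ** u" unfolding int[OF x] k2(3)[OF x, symmetric] u_def using wc c xc by (simp add: distrib_l mult_assoc)
  finally show ?thesis using uc xc unitD(3)[OF u] by (simp add: mult_assoc)
 qed
 then show ?thesis using u by blast
qed

text \<open>\<rho> commutes with the units dg (v i), so dg = \<alpha> \<circ> \<rho> commutes with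
  their images under \<alpha>. A unitary V brings these images back to the original units, and
  \<rho> and the conjugate \<sigma> of dg by V then commute with the same matrix units.\<close>

lemma (in utp) conj_diagonal:
 assumes f: "tcen C" and J: "gen_Jung U M" and v: "msys 2 v" and \<rho>: "embedding M P \<rho>"
  and tc: "!!\<rho>. embedding M P \<rho> ==> P.tcen (P.comm (\<rho> ` C))"
  and S: "!!x. x : C ==> EX z. z : Seq & (ALL k. z k : comm (mgen 2 v)) & \<rho> x = cl z"
 shows "EX V. P.unit V & (ALL x:C. V **\<^sub>P \<rho> x **\<^sub>P ~*\<^sub>P V = dg x)"
proof -
 interpret \<rho>: emb M P \<rho> by unfold_locales (rule \<rho>)
 have vc: "v i : C" if "i < 2" for i using psys_c[OF sysD(1)[OF v]] that .
 obtain \<alpha> where \<alpha>: "automorphism P \<alpha>" "!!x. x : C ==> dg x = \<alpha> (\<rho> x)" 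
  using gen_JungD[OF J dg.emb \<rho>] by (elim exE conjE) (rule that, assumption, rule bspec)
 note au = P.aut[OF \<alpha>(1)]
 let ?v = "%i. dg (v i)" and ?w = "%i. \<alpha> (dg (v i))"
 have sv: "P.sys 2 (%_. 0) ?v" by (rule dg.sys[OF v])
 have sw: "P.sys 2 (%_. 0) ?w"
  by (rule sys_hom[OF talg_P talg_P _ sv]) (use \<alpha>(1) in \<open>simp add: automorphism_def\<close>)
 have half: "vtr P (x 0) = 1 / 2" if x: "P.sys 2 (%_. 0) x" for x
 proof -
  note p = P.sysD(1)[OF x]
  have "1 = vtr P (P.vsum (%i. x i **\<^sub>P ~*\<^sub>P x i) 2)" unfolding P.sysD(2)[OF x] by simp
  also have "... = (\<Sum>i<2. vtr P (x i **\<^sub>P ~*\<^sub>P x i))" using P.psys_c[OF p] by (intro P.tr_vsum) simp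
  also have "... = (\<Sum>i<2::nat. vtr P (x 0))" using P.psys_tr[OF p] by (intro sum.cong refl) simp
  finally have "2 * vtr P (x 0) = 1" by simp
  moreover have "vtr P (x 0) = (2 * vtr P (x 0)) / 2" by simp
  ultimately show ?thesis by (simp only:)
 qed
 obtain V where V: "P.unit V" "!!i j. [|i < 2; j < 2|] ==> V **\<^sub>P (?w i **\<^sub>P ~*\<^sub>P?w j) **\<^sub>P ~*\<^sub>P V = ?v i **\<^sub>P ~*\<^sub>P?v j"
  using P.sys_unitary[OF tcen_P[OF f] sw sv] half[OF sv] half[OF sw] by auto
 note Vu = P.unitD[OF V(1)]
 have VV: "~*\<^sub>P V **\<^sub>P (V **\<^sub>P y) = y" if "y : vcarrier P" for y
  using P.mult_assoc[of "~*\<^sub>P V" V y] Vu that by simp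
 have wc: "?w i : vcarrier P" if "i < 2" for i using au(1) vc[OF that] by simp
 define \<sigma> where "\<sigma> x = V **\<^sub>P dg x **\<^sub>P ~*\<^sub>P V" for x
 have vm: "v i ** ~*v j : mgen 2 v" if "i < 2" "j < 2" for i j using that by (auto simp: mgen_def)
 have \<rho>v: "\<rho> x **\<^sub>P (?v i **\<^sub>P ~*\<^sub>P?v j) = (?v i **\<^sub>P ~*\<^sub>P?v j) **\<^sub>P \<rho> x" if x: "x : C" and ij: "i < 2" "j < 2" for x i j
 proof -
  obtain z where z: "z : Seq" "!!k. z k : comm (mgen 2 v)" "\<rho> x = cl z" using S[OF x] by blast
  have "z k ** (v i ** ~*v j) = (v i ** ~*v j) ** z k" for k by (rule commD(2)[OF z(2) vm[OF ij]])
  then show ?thesis unfolding z(3) dg_def using z(1) vc ij by (simp add: cl_ops)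
 qed
 have dw: "dg x **\<^sub>P (?w i **\<^sub>P ~*\<^sub>P?w j) = (?w i **\<^sub>P ~*\<^sub>P?w j) **\<^sub>P dg x" if x: "x : C" and ij: "i < 2" "j < 2" for x i j
 proof -
  have e: "?w i **\<^sub>P ~*\<^sub>P?w j = \<alpha> (?v i **\<^sub>P ~*\<^sub>P?v j)" using vc ij by (simp add: au)
  show ?thesis unfolding e \<alpha>(2)[OF x] using \<rho>v[OF that] vc ij \<rho>.c[OF x] au(3)[of "\<rho> x" "?v i **\<^sub>P ~*\<^sub>P?v j"]
    au(3)[of "?v i **\<^sub>P ~*\<^sub>P?v j" "\<rho> x"] by simp
 qed
 have \<sigma>: "embedding M P \<sigma>"
 proof (rule embedding_if_tst[OF talg_axioms talg_P])
  show "\<sigma> x : vcarrier P" if "x : C" for x using that Vu by (simp add: \<sigma>_def)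
  show "tst P (\<sigma> a) (\<sigma> b) (\<sigma> d) = tst M a b d" if "a : C" "b : C" "d : C" for a b d
   unfolding \<sigma>_def using P.tst_conj[OF V(1)] dg.tst that by simp
 qed
 have \<sigma>v: "\<sigma> x **\<^sub>P (?v i **\<^sub>P ~*\<^sub>P?v j) = (?v i **\<^sub>P ~*\<^sub>P?v j) **\<^sub>P \<sigma> x" if x: "x : C" and ij: "i < 2" "j < 2" for x i j
 proof -
  let ?E = "?w i **\<^sub>P ~*\<^sub>P?w j"
  have Ec: "?E : vcarrier P" using wc ij by simp
  have cm: "(V **\<^sub>P s **\<^sub>P ~*\<^sub>P V) **\<^sub>P (V **\<^sub>P t **\<^sub>P ~*\<^sub>P V) = V **\<^sub>P (s **\<^sub>P t) **\<^sub>P ~*\<^sub>P V"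
   if "s : vcarrier P" "t : vcarrier P" for s t using that Vu(1) VV by (simp add: P.mult_assoc)
  have "\<sigma> x **\<^sub>P (V **\<^sub>P ?E **\<^sub>P ~*\<^sub>P V) = V **\<^sub>P (dg x **\<^sub>P ?E) **\<^sub>P ~*\<^sub>P V"
   unfolding \<sigma>_def by (rule cm[OF dg_c[OF x] Ec])
  moreover have "(V **\<^sub>P ?E **\<^sub>P ~*\<^sub>P V) **\<^sub>P \<sigma> x = V **\<^sub>P (?E **\<^sub>P dg x) **\<^sub>P ~*\<^sub>P V"
   unfolding \<sigma>_def by (rule cm[OF Ec dg_c[OF x]])
  ultimately show ?thesis unfolding V(2)[OF ij] dw[OF x ij] by simp
 qed
 obtain W where W: "P.unit W" "!!x. x : C ==> W **\<^sub>P \<rho> x **\<^sub>P ~*\<^sub>P W = \<sigma> x"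
  using P.conj_of_commuting[OF talg_axioms \<rho> \<sigma> sv \<rho>v \<sigma>v tc] by blast
 have "(~*\<^sub>P V **\<^sub>P W) **\<^sub>P \<rho> x **\<^sub>P ~*\<^sub>P(~*\<^sub>P V **\<^sub>P W) = dg x" if x: "x : C" for x
 proof -
  note Wc = P.unitD(1)[OF W(1)]
  have "(~*\<^sub>P V **\<^sub>P W) **\<^sub>P \<rho> x **\<^sub>P ~*\<^sub>P(~*\<^sub>P V **\<^sub>P W) = ~*\<^sub>P V **\<^sub>P (W **\<^sub>P \<rho> x **\<^sub>P ~*\<^sub>P W) **\<^sub>P V"
   using Wc Vu(1) \<rho>.c[OF x] by (simp add: P.star_mult P.mult_assoc)
  also have "... = dg x" unfolding W(2)[OF x] \<sigma>_def using Vu x VV by (simp add: P.mult_assoc)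
  finally show ?thesis .
 qed
 moreover have "P.unit (~*\<^sub>P V **\<^sub>P W)" by (rule P.unit_mult[OF P.unit_star[OF V(1)] W(1)])
 ultimately show ?thesis by blast
qed

section \<open>Two-sided approximate intertwining\<close>

text \<open>The order of the quantifiers matters: F' and \<delta> are fixed before \<theta>, but G
  and \<delta>' come after it, so that \<psi> can be made accurate enough for the inversion that
  follows.\<close>

definition good :: "'a tvna => 'b tvna => 'a set => real => 'a set => real => bool" where
 "good M Q F \<epsilon> F' \<delta> \<longleftrightarrow> finite F' & F \<subseteq> F' & F' \<subseteq> vcarrier M & \<delta> > 0 &
  (ALL \<theta> G \<delta>'. ahom M Q F' \<delta> \<theta> & finite G & G \<subseteq> vcarrier Q & \<delta>' > 0 -->
   (EX \<psi>. ahom Q M G \<delta>' \<psi> & (ALL x:F. nrm2 M (\<psi> (\<theta> x) --\<^sub>M x) < \<epsilon>)))"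

definition approx_invertible :: "'a tvna => 'b tvna => bool" where
 "approx_invertible M Q \<longleftrightarrow> (ALL F \<epsilon>. finite F & F \<subseteq> vcarrier M & \<epsilon> > 0 --> (EX F' \<delta>. good M Q F \<epsilon> F' \<delta>))"

lemma goodD: assumes "good M Q F \<epsilon> F' \<delta>"
 shows "finite F'" "F \<subseteq> F'" "F' \<subseteq> vcarrier M" "\<delta> > 0"
  "[|ahom M Q F' \<delta> \<theta>; finite G; G \<subseteq> vcarrier Q; \<delta>' > 0|] ==>
   EX \<psi>. ahom Q M G \<delta>' \<psi> & (ALL x:F. nrm2 M (\<psi> (\<theta> x) --\<^sub>M x) < \<epsilon>)"
 using assms unfolding good_def by simp_all

lemma (in talg) ahom_conj: assumes u: "unit u" and \<psi>: "ahom Q M G \<delta> \<psi>" shows "ahom Q M G \<delta> (%x. u ** \<psi> x ** ~*u)"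
 unfolding ahom_def
proof (intro conjI ballI allI impI)
 fix a assume a: "a : G"
 note c = ahomD(1)[OF \<psi>]
 show "u ** \<psi> a ** ~*u : C" using c[OF a] unitD[OF u] by simp
 show "bnd r (u ** \<psi> a ** ~*u)" if "talg.bnd Q r a" for r by (rule bnd_conj[OF u ahomD(2)[OF \<psi> a that]])
 fix b d assume "b : G" "d : G"
 then show "dist (tst M (u ** \<psi> a ** ~*u) (u ** \<psi> b ** ~*u) (u ** \<psi> d ** ~*u)) (tst Q a b d) < \<delta>"
  using tst_conj[OF u c c c] ahomD(3)[OF \<psi> a] a by simp
qed

text \<open>Any sufficiently accurate \<psi> from Q into S works after correction by a unitary: the
  composite with \<theta> maps into S, and H says that such a composite is nearly a
  conjugation.\<close>

lemma (in talg) approx_invertibleI: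
 assumes H: "!!F \<epsilon>. [|finite F; F \<subseteq> C; \<epsilon> > 0|] ==> EX F' \<delta>. finite F' & F \<subseteq> F' & F' \<subseteq> C & \<delta> > 0 &
   (ALL \<phi>. ahom M M F' \<delta> \<phi> & \<phi> ` F' \<subseteq> S --> (EX u. unit u & (ALL x:F. nn (u ** \<phi> x ** ~*u -- x) < \<epsilon>)))"
  and E: "!!G \<epsilon>. [|finite G; G \<subseteq> vcarrier Q; \<epsilon> > 0|] ==> EX \<psi>. ahom Q M G \<epsilon> \<psi> & \<psi> ` G \<subseteq> S"
 shows "approx_invertible M Q"
 unfolding approx_invertible_def
proof (intro allI impI, elim conjE)
 fix F \<epsilon> assume F: "finite F" "F \<subseteq> C" "\<epsilon> > (0::real)"
 obtain F' \<delta> where F': "finite F'" "F \<subseteq> F'" "F' \<subseteq> C" "\<delta> > 0"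
  and h: "ALL \<phi>. ahom M M F' \<delta> \<phi> & \<phi> ` F' \<subseteq> S --> (EX u. unit u & (ALL x:F. nn (u ** \<phi> x ** ~*u -- x) < \<epsilon>))"
  using H[OF F] by (elim exE conjE) (rule that)
 have "good M Q F \<epsilon> F' (\<delta> / 2)"
  unfolding good_def
 proof (intro conjI F' allI impI, goal_cases)
  case 1 then show ?case using F'(4) by simp
 next
  case (2 \<theta> G \<delta>')
  then have \<theta>: "ahom M Q F' (\<delta> / 2) \<theta>" and G: "finite G" "G \<subseteq> vcarrier Q" "\<delta>' > 0" by auto
  have "finite (G \<union> \<theta> ` F')" "G \<union> \<theta> ` F' \<subseteq> vcarrier Q" "min \<delta>' (\<delta> / 2) > 0" using G F' ahomD(1)[OF \<theta>] by auto
  from E[OF this] obtain \<psi> where \<psi>: "ahom Q M (G \<union> \<theta> ` F') (min \<delta>' (\<delta> / 2)) \<psi>" "\<psi> ` (G \<union> \<theta> ` F') \<subseteq> S"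
   by (elim exE conjE) (rule that)
  have \<psi>1: "ahom Q M (\<theta> ` F') (\<delta> / 2) \<psi>" and \<psi>2: "ahom Q M G \<delta>' \<psi>" by (rule ahom_mono[OF \<psi>(1)]; simp)+
  have "ahom M M F' \<delta> (%x. \<psi> (\<theta> x)) & (%x. \<psi> (\<theta> x)) ` F' \<subseteq> S" using ahom_comp[OF \<theta> \<psi>1] \<psi>(2) by auto
  from h[rule_format, OF this] obtain u where u: "unit u" "ALL x:F. nn (u ** \<psi> (\<theta> x) ** ~*u -- x) < \<epsilon>" by blast
  show ?case using ahom_conj[OF u(1) \<psi>2] u(2) by (intro exI[of _ "%x. u ** \<psi> x ** ~*u"] conjI)
 qed
 then show "EX F' \<delta>. good M Q F \<epsilon> F' \<delta>" by blast
qed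

lemma (in talg) geom_tail:
 assumes s: "!!k. s k : C" and d: "!!k. k >= m ==> nn (s (Suc k) -- s k) <= 3 * (1/2) ^ k" and k: "m <= k" "k <= l"
 shows "nn (s l -- s k) <= 6 * (1/2) ^ k"
proof -
 have "nn (s l -- s k) <= 6 * (1/2) ^ k - 6 * (1/2) ^ l" using k(2)
 proof (induction l rule: dec_induct)
  case base
  have "s k -- s k = \<zero>" using s by (intro tau_ext) (simp_all add: alg)
  then show ?case by simp
 next
  case (step l)
  then show ?case using sub_tri[of "s (Suc l)" "s l" "s k"] s d[of l] k(1) by auto
 qed
 then show ?thesis using zero_le_power[of "1/2::real" l] by linarith
qed

lemma (in emb) bnd_reflect: assumes "P.bnd K (f x)" "x : vcarrier M" shows "M.bnd K x"
proof (rule M.bndI[OF assms(2) P.bnd_ge0[OF assms(1)]])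
 fix y assume y: "y : vcarrier M"
 show "nrm2 M (x **\<^sub>M y) <= K * nrm2 M y"
  using P.bndD[OF assms(1) c[OF y]] nn[of "x **\<^sub>M y"] nn[OF y] mult[OF assms(2) y] y assms(2) by simp
qed

locale intertwining = N: tvna N + R: tvna R for N :: "'a tvna" and R :: "'b tvna" +
 fixes D E assumes D: "N.bdense D" and E: "R.bdense E"
  and N_inv: "approx_invertible N R" and R_inv: "approx_invertible R N"
  and ex_hom: "!!F \<epsilon>. [|finite F; F \<subseteq> vcarrier N; \<epsilon> > 0|] ==> EX \<theta>. ahom N R F \<epsilon> \<theta>"
begin

abbreviation "\<epsilon> n \<equiv> (1/2::real) ^ n"

text \<open>The last conjunct records that \<psi> is already accurate enough to be inverted on G at
  the next stage.\<close>

definition stage :: "nat => 'a set => ('a => 'b) => 'b set => ('b => 'a) => bool" where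
 "stage n F \<theta> G \<psi> \<longleftrightarrow> finite F & F \<subseteq> vcarrier N & D ` {..n} \<subseteq> F & ahom N R F (\<epsilon> n) \<theta> &
  finite G & G \<subseteq> vcarrier R & \<theta> ` F \<subseteq> G & E ` {..n} \<subseteq> G & ahom R N G (\<epsilon> n) \<psi> &
  (ALL x:F. nrm2 N (\<psi> (\<theta> x) --\<^sub>N x) < \<epsilon> n) & (EX G' \<delta>. good R N G (\<epsilon> n) G' \<delta> & ahom R N G' \<delta> \<psi>)"

text \<open>T collects what \<theta> must satisfy in addition: nothing at stage 0, and later that it
  nearly inverts the previous \<psi>.\<close>

lemma ex_stage:
 assumes F: "finite F" "F \<subseteq> vcarrier N" "D ` {..n} \<subseteq> F"
  and T: "!!F' \<delta>. [|finite F'; F' \<subseteq> vcarrier N; \<delta> > 0|] ==> EX \<theta>. ahom N R F' \<delta> \<theta> & T \<theta>"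
 shows "EX \<theta> G \<psi>. stage n F \<theta> G \<psi> & T \<theta>"
proof -
 have e: "\<epsilon> n > 0" by simp
 obtain F' \<delta> where g: "good N R F (\<epsilon> n) F' \<delta>" using N_inv F e unfolding approx_invertible_def by blast
 note gd = goodD[OF g]
 obtain \<theta> where \<theta>: "ahom N R F' (min \<delta> (\<epsilon> n)) \<theta>" "T \<theta>" using T[of F' "min \<delta> (\<epsilon> n)"] gd e by auto
 have \<theta>1: "ahom N R F (\<epsilon> n) \<theta>" "ahom N R F' \<delta> \<theta>" by (rule ahom_mono[OF \<theta>(1)]; use gd in simp)+
 define G where "G = \<theta> ` F \<union> E ` {..n}"
 have G: "finite G" "G \<subseteq> vcarrier R" using F ahomD(1)[OF \<theta>1(1)] E by (auto simp: G_def R.bdense_def)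
 obtain G' \<delta>' where h: "good R N G (\<epsilon> n) G' \<delta>'" using R_inv G e unfolding approx_invertible_def by blast
 note hd = goodD[OF h]
 obtain \<psi> where \<psi>: "ahom R N G' (min \<delta>' (\<epsilon> n)) \<psi>" "ALL x:F. nrm2 N (\<psi> (\<theta> x) --\<^sub>N x) < \<epsilon> n"
  using gd(5)[OF \<theta>1(2) hd(1,3), of "min \<delta>' (\<epsilon> n)"] hd(4) e by auto
 have \<psi>1: "ahom R N G (\<epsilon> n) \<psi>" "ahom R N G' \<delta>' \<psi>" by (rule ahom_mono[OF \<psi>(1)]; use hd in simp)+
 have "stage n F \<theta> G \<psi>" unfolding stage_def
  using F \<theta>1(1) G \<psi>(2) \<psi>1(1) h \<psi>1(2) by (auto simp: G_def)
 then show ?thesis using \<theta>(2) by blast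
qed

lemma ex_tower: "EX F \<theta> G \<psi>. ALL n. stage n (F n) (\<theta> n) (G n) (\<psi> n) & \<psi> n ` G n \<subseteq> F (Suc n) & F n \<subseteq> F (Suc n) &
 (ALL y:G n. nrm2 R (\<theta> (Suc n) (\<psi> n y) --\<^sub>R y) < \<epsilon> n)"
proof -
 have Dc: "D ` {..n} \<subseteq> vcarrier N" for n using D by (auto simp: N.bdense_def)
 define S where "S n s \<longleftrightarrow> stage n (fst s) (fst (snd s)) (fst (snd (snd s))) (snd (snd (snd s)))" for n s
 define Q where "Q n s s' \<longleftrightarrow> snd (snd (snd s)) ` fst (snd (snd s)) \<subseteq> fst s' & fst s \<subseteq> fst s' &
  (ALL y:fst (snd (snd s)). nrm2 R (fst (snd s') (snd (snd (snd s)) y) --\<^sub>R y) < \<epsilon> n)"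
  for n and s s' :: "'a set \<times> ('a => 'b) \<times> 'b set \<times> ('b => 'a)"
 have "EX f. ALL n. S n (f n) & Q n (f n) (f (Suc n))"
 proof (rule dependent_nat_choice)
  have "EX \<theta> G \<psi>. stage 0 (D ` {..0}) \<theta> G \<psi> & True"
  proof (rule ex_stage[OF _ Dc subset_refl])
   show "EX \<theta>. ahom N R F' \<delta> \<theta> & True" if "finite F'" "F' \<subseteq> vcarrier N" "\<delta> > 0" for F' \<delta> using ex_hom[OF that] by simp
  qed simp
  then obtain \<theta> G \<psi> where "stage 0 (D ` {..0}) \<theta> G \<psi>" by (elim exE conjE) (rule that)
  then show "EX s. S 0 s" by (intro exI[of _ "(D ` {..0}, \<theta>, G, \<psi>)"]) (simp add: S_def)
 next
  fix s n assume s: "S n s"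
  obtain F \<theta> G \<psi> where e: "s = (F, \<theta>, G, \<psi>)" by (cases s) auto
  have st: "stage n F \<theta> G \<psi>" using s by (simp add: S_def e)
  then obtain G' \<delta> where g: "good R N G (\<epsilon> n) G' \<delta>" "ahom R N G' \<delta> \<psi>" unfolding stage_def by blast
  have F: "finite F" "F \<subseteq> vcarrier N" and G: "finite G" "G \<subseteq> vcarrier R" and \<psi>: "ahom R N G (\<epsilon> n) \<psi>"
   using st by (simp_all add: stage_def)
  let ?F = "F \<union> \<psi> ` G \<union> D ` {..Suc n}"
  have F': "finite ?F" "?F \<subseteq> vcarrier N" "D ` {..Suc n} \<subseteq> ?F" using F G Dc[of "Suc n"] ahomD(1)[OF \<psi>] by auto
  have "EX \<theta>' H \<psi>'. stage (Suc n) ?F \<theta>' H \<psi>' & (ALL y:G. nrm2 R (\<theta>' (\<psi> y) --\<^sub>R y) < \<epsilon> n)"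
   by (rule ex_stage[OF F']) (rule goodD(5)[OF g])
  then obtain \<theta>' H \<psi>' where
   "stage (Suc n) ?F \<theta>' H \<psi>'" "ALL y:G. nrm2 R (\<theta>' (\<psi> y) --\<^sub>R y) < \<epsilon> n" by (elim exE conjE) (rule that)
  then show "EX s'. S (Suc n) s' & Q n s s'"
   by (intro exI[of _ "(?F, \<theta>', H, \<psi>')"]) (simp add: S_def Q_def e, blast)
 qed
 then obtain f where f: "ALL n. S n (f n) & Q n (f n) (f (Suc n))" by (elim exE) (rule that)
 show ?thesis
  by (intro exI[of _ "%n. fst (f n)"] exI[of _ "%n. fst (snd (f n))"] exI[of _ "%n. fst (snd (snd (f n)))"]
    exI[of _ "%n. snd (snd (snd (f n)))"]) (use f in \<open>simp add: S_def Q_def\<close>)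
qed

theorem iso: "tvna_iso N R"
proof -
 obtain F \<theta> G \<psi> where "ALL n. stage n (F n) (\<theta> n) (G n) (\<psi> n) & \<psi> n ` G n \<subseteq> F (Suc n) & F n \<subseteq> F (Suc n) &
  (ALL y:G n. nrm2 R (\<theta> (Suc n) (\<psi> n y) --\<^sub>R y) < \<epsilon> n)" using ex_tower by (elim exE) (rule that)
 then have st: "stage n (F n) (\<theta> n) (G n) (\<psi> n)" and GF': "\<psi> n ` G n \<subseteq> F (Suc n)"
  and F1: "F n \<subseteq> F (Suc n)" and \<theta>\<psi>': "ALL y:G n. nrm2 R (\<theta> (Suc n) (\<psi> n y) --\<^sub>R y) < \<epsilon> n" for n
  by simp_all
 note st' = st[unfolded stage_def]
 have GF: "\<psi> n y : F (Suc n)" if "y : G n" for n y using GF'[of n] that by blast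
 have \<theta>\<psi>: "nrm2 R (\<theta> (Suc n) (\<psi> n y) --\<^sub>R y) < \<epsilon> n" if "y : G n" for n y by (rule bspec[OF \<theta>\<psi>' that])
 have Fc: "x : vcarrier N" if "x : F n" for n x using st'[of n] that by (elim conjE) (rule subsetD)
 have Gc: "y : vcarrier R" if "y : G n" for n y using st'[of n] that by (elim conjE) (rule subsetD)
 have FG: "\<theta> n x : G n" if "x : F n" for n x using st'[of n] that by (elim conjE) blast
 have DF: "D ` {..n} \<subseteq> F n" and EG: "E ` {..n} \<subseteq> G n" and \<theta>: "ahom N R (F n) (\<epsilon> n) (\<theta> n)" and \<psi>: "ahom R N (G n) (\<epsilon> n) (\<psi> n)" for n
  using st'[of n] by simp_all
 have \<psi>\<theta>: "nrm2 N (\<psi> n (\<theta> n x) --\<^sub>N x) < \<epsilon> n" if "x : F n" for n x using st'[of n] that by simp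
 have \<theta>c: "\<theta> n x : vcarrier R" if "x : F n" for n x by (rule ahomD(1)[OF \<theta> that])
 have \<psi>c: "\<psi> n y : vcarrier N" if "y : G n" for n y by (rule ahomD(1)[OF \<psi> that])
 have Fm: "x : F k" if "x : F m" "m <= k" for x m k using lift_Suc_mono_le[of F, OF F1 that(2)] that(1) by blast
 have \<theta>n: "nrm2 R (\<theta> n a --\<^sub>R \<theta> n b) <= nrm2 N (a --\<^sub>N b) + \<epsilon> n" if "a : F n" "b : F n" for n a b
  using ahom_nn[OF \<theta> that] by linarith
 have \<psi>n: "nrm2 N (\<psi> n a --\<^sub>N \<psi> n b) <= nrm2 R (a --\<^sub>R b) + \<epsilon> n" if "a : G n" "b : G n" for n a b
  using ahom_nn[OF \<psi> that] by linarith
 have half: "\<epsilon> (Suc n) <= \<epsilon> n" "0 < \<epsilon> n" for n by simp_all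
 \<comment> \<open>Compare both sides with the value of \<theta> (Suc k) at \<psi> k (\<theta> k a):
   the round trips in N and R cost \<epsilon> k each, the near isometry of \<theta> (Suc k) costs
   \<epsilon> (Suc k).\<close>
 have \<theta>s: "nrm2 R (\<theta> (Suc k) a --\<^sub>R \<theta> k a) <= 3 * \<epsilon> k" if a: "a : F k" for k a
 proof -
  let ?y = "\<theta> k a"
  have y: "?y : G k" by (rule FG[OF a])
  have p: "\<psi> k ?y : F (Suc k)" and a': "a : F (Suc k)" using GF[OF y] F1 a by auto
  show ?thesis
   using R.sub_tri[OF \<theta>c[OF a'] \<theta>c[OF p] \<theta>c[OF a]] \<theta>n[OF a' p] \<theta>\<psi>[OF y] \<psi>\<theta>[OF a] N.sub_swap[OF Fc[OF a] Fc[OF p]] half[of k]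
   by linarith
 qed
 have \<psi>s: "nrm2 N (\<psi> (Suc k) y --\<^sub>N \<psi> k y) <= 3 * \<epsilon> k" if y: "y : G k" "y : G (Suc k)" for k y
 proof -
  have x: "\<psi> k y : F (Suc k)" by (rule GF[OF y(1)])
  have p: "\<theta> (Suc k) (\<psi> k y) : G (Suc k)" by (rule FG[OF x])
  show ?thesis
   using N.sub_tri[OF \<psi>c[OF y(2)] \<psi>c[OF p] \<psi>c[OF y(1)]] \<psi>n[OF y(2) p] \<psi>\<theta>[OF x] \<theta>\<psi>[OF y(1)] R.sub_swap[OF Gc[OF y(1)] Gc[OF p]] half[of k]
   by linarith
 qed
 obtain e where e: "ALL x:vcarrier N. (EX r. ALL k. N.bnd r (e k x)) & N.cv sequentially (%k. e k x) x & (ALL k. e k x : D ` {..k::nat})"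
  using N.approximants[OF D] by blast
 have eF: "e k x : F k" if "x : vcarrier N" for k x using e that DF by blast
 have ecv: "N.cv sequentially (%k. e k x) x" if "x : vcarrier N" for x using bspec[OF e that] by (elim conjE)
 have "EX r y. (ALL k. R.bnd r (\<theta> k (e k x))) & R.cv sequentially (%k. \<theta> k (e k x)) y" if x: "x : vcarrier N" for x
 proof -
  let ?s = "%k. \<theta> k (e k x)"
  obtain r where r: "!!k. N.bnd r (e k x)" using e x by blast
  have sb: "R.bnd r (?s k)" for k by (rule ahomD(2)[OF \<theta> eF[OF x] r])
  have sc: "?s k : vcarrier R" for k by (rule \<theta>c[OF eF[OF x]])
  have xc: "e k x : vcarrier N" for k by (rule Fc[OF eF[OF x]])
  have "EX y. R.bnd r y & R.cv sequentially ?s y"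
  proof (rule R.complete[OF sb])
   fix \<eta> :: real assume "\<eta> > 0"
   \<comment> \<open>Each of two terms is compared with the K-th one at a cost of 3 + 6 units, and
     18 < 24.\<close>
   then have \<eta>: "\<eta> / 24 > 0" by simp
   obtain m where m: "!!k. k >= m ==> nrm2 N (e k x --\<^sub>N x) < \<eta> / 24"
    using order_tendstoD(2)[OF N.cvD[OF ecv[OF x]] \<eta>] unfolding eventually_sequentially by blast
   obtain j where j: "\<epsilon> j < \<eta> / 24" using real_arch_pow_inv[of "\<eta> / 24" "1/2"] \<eta> by auto
   define K where "K = max m j"
   have K: "\<epsilon> k < \<eta> / 24" if "k >= K" for k
   proof -
    have "\<epsilon> k <= \<epsilon> j" by (rule power_decreasing) (use that in \<open>auto simp: K_def\<close>)
    then show ?thesis using j by linarith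
   qed
   have xK: "nrm2 R (?s k --\<^sub>R \<theta> k (e K x)) <= 3 * (\<eta> / 24)" if k: "k >= K" for k
    using \<theta>n[OF eF[OF x] Fm[OF eF[OF x] k]] N.sub_tri[OF xc x xc, of k K] N.sub_swap[OF x xc, of K] m[of k] m[of K] K[OF k] k
    unfolding K_def by auto
   have tail: "nrm2 R (\<theta> k (e K x) --\<^sub>R \<theta> K (e K x)) <= 6 * (\<eta> / 24)" if k: "k >= K" for k
   proof -
    define t where "t k = (if k >= K then \<theta> k (e K x) else \<zero>\<^sub>R)" for k
    have "nrm2 R (t k --\<^sub>R t K) <= 6 * \<epsilon> K"
    proof (rule R.geom_tail[of t K])
     show "t i : vcarrier R" for i using \<theta>c[OF Fm[OF eF[OF x]]] by (simp add: t_def)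
     show "nrm2 R (t (Suc i) --\<^sub>R t i) <= 3 * \<epsilon> i" if "K <= i" for i
      using \<theta>s[OF Fm[OF eF[OF x] that]] that by (simp add: t_def)
    qed (use k in simp_all)
    then show ?thesis using K[of K] k by (simp add: t_def)
   qed
   have near: "nrm2 R (?s k --\<^sub>R ?s K) <= 9 * (\<eta> / 24)" if k: "k >= K" for k
    using R.sub_tri[OF sc \<theta>c[OF Fm[OF eF[OF x] k]] sc, of k K] xK[OF k] tail[OF k] by linarith
   have "nrm2 R (?s a --\<^sub>R ?s b) < \<eta>" if ab: "a >= K" "b >= K" for a b
    using R.sub_tri[OF sc sc sc, of a b K] near[OF ab(1)] near[OF ab(2)] R.sub_swap[OF sc sc, of K b] \<eta> by linarith
   then show "EX K. ALL m>=K. ALL n>=K. nrm2 R (?s m --\<^sub>R ?s n) < \<eta>" by blast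
  qed
  then show ?thesis using sb by blast
 qed
 then have "ALL x:vcarrier N. EX y. (EX r. ALL k. R.bnd r (\<theta> k (e k x))) & R.cv sequentially (%k. \<theta> k (e k x)) y" by blast
 from bchoice[OF this] obtain f where f0: "ALL x:vcarrier N. (EX r. ALL k. R.bnd r (\<theta> k (e k x))) & R.cv sequentially (%k. \<theta> k (e k x)) (f x)"
  by (elim exE) (rule that)
 have fcv: "R.cv sequentially (%k. \<theta> k (e k x)) (f x)" if "x : vcarrier N" for x using bspec[OF f0 that] by (elim conjE)
 have fc: "f x : vcarrier R" if "x : vcarrier N" for x by (rule R.cv_c(2)[OF fcv[OF that]])
 have e0: "(%k. \<epsilon> k) \<longlonglongrightarrow> 0" by (intro LIMSEQ_realpow_zero) auto
 have femb: "embedding N R f"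
 proof (rule embedding_if_tst[OF N.talg_axioms R.talg_axioms fc])
  fix a b d assume c: "a : vcarrier N" "b : vcarrier N" "d : vcarrier N"
  obtain r where r: "!!k. N.bnd r (e k a)" using e c(1) by blast
  obtain r' where r': "!!k. R.bnd r' (\<theta> k (e k a))" using f0 c(1) by blast
  have 1: "(%k. tst N (e k a) (e k b) (e k d)) \<longlonglongrightarrow> tst N a b d" by (rule N.cv_tst[OF r ecv ecv ecv]) (rule c)+
  have 2: "(%k. tst R (\<theta> k (e k a)) (\<theta> k (e k b)) (\<theta> k (e k d))) \<longlonglongrightarrow> tst R (f a) (f b) (f d)"
   by (rule R.cv_tst[OF r' fcv fcv fcv]) (rule c)+
  have "(%k. dist (tst R (\<theta> k (e k a)) (\<theta> k (e k b)) (\<theta> k (e k d))) (tst N (e k a) (e k b) (e k d))) \<longlonglongrightarrow> 0"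
   by (rule tendsto_sandwich[OF _ _ tendsto_const e0])
    (use ahomD(3)[OF \<theta> eF[OF c(1)] eF[OF c(2)] eF[OF c(3)]] in \<open>auto intro!: always_eventually less_imp_le\<close>)
  from LIMSEQ_unique[OF tendsto_dist[OF 2 1] this] show "tst R (f a) (f b) (f d) = tst N a b d" by simp
 qed
 interpret f: emb N R f by unfold_locales (rule femb)
 \<comment> \<open>The preimage of E i is the limit of its images under \<psi> k; that the limit is
   mapped back to E i is checked with the second round trip.\<close>
 have surjE: "EX x:vcarrier N. f x = E i" for i
 proof -
  let ?y = "E i"
  have yG: "?y : G k" if "k >= i" for k using EG[of k] that by auto
  note yc = Gc[OF yG[OF order_refl]]
  define s where "s k = \<psi> (k + i) ?y" for k
  obtain r where r: "R.bnd r ?y" using R.ex_bnd[OF yc] by blast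
  have sb: "N.bnd r (s k)" for k unfolding s_def by (rule ahomD(2)[OF \<psi> yG r]) simp
  have "nrm2 N (s (Suc k) --\<^sub>N s k) <= 3 * (1/2) ^ k" for k
  proof -
   have "nrm2 N (s (Suc k) --\<^sub>N s k) <= 3 * \<epsilon> (k + i)" using \<psi>s[of ?y "k + i"] yG by (simp add: s_def)
   also have "... <= 3 * (1/2) ^ k" using power_decreasing[of k "k + i" "1/2::real"] by simp
   finally show ?thesis .
  qed
  from N.complete_geom[OF sb this] obtain x where x: "N.bnd r x" "N.cv sequentially s x" by auto
  note xc = N.bnd_c[OF x(1)]
  note sc = N.cv_c(1)[OF x(2)]
  have ec: "e k x : vcarrier N" for k by (rule Fc[OF eF[OF xc]])
  \<comment> \<open>The value of \<psi> (k + i) lies in the set of the next stage, whence the shift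
    by one.\<close>
  let ?k = "%k. Suc (k + i)"
  have est: "nrm2 R (\<theta> (?k k) (e (?k k) x) --\<^sub>R ?y) <= (nrm2 N (e (?k k) x --\<^sub>N x) + nrm2 N (s k --\<^sub>N x)) + 2 * \<epsilon> k" for k
  proof -
   have y: "?y : G (k + i)" using yG by simp
   have p: "s k : F (?k k)" unfolding s_def by (rule GF[OF y])
   have h: "\<epsilon> (k + i) <= \<epsilon> k" using power_decreasing[of k "k + i" "1/2::real"] by simp
   have "nrm2 R (\<theta> (?k k) (s k) --\<^sub>R ?y) < \<epsilon> (k + i)" unfolding s_def by (rule \<theta>\<psi>[OF y])
   then show ?thesis
    using R.sub_tri[OF \<theta>c[OF eF[OF xc]] \<theta>c[OF p] yc, of "?k k"] \<theta>n[OF eF[OF xc] p] N.sub_tri[OF ec xc sc, of "?k k" k] N.sub_swap[OF xc sc, of k] half(1)[of "k + i"] h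
    by linarith
  qed
  have sh: "(%k. g (?k k)) \<longlonglongrightarrow> l" if "g \<longlonglongrightarrow> l" for g and l :: real
   using LIMSEQ_ignore_initial_segment[OF that, of "Suc i"] by simp
  have l: "(%k. (nrm2 N (e (?k k) x --\<^sub>N x) + nrm2 N (s k --\<^sub>N x)) + 2 * \<epsilon> k) \<longlonglongrightarrow> (0 + 0) + 2 * 0"
   by (intro tendsto_add tendsto_mult_left e0 sh[OF N.cvD[OF ecv[OF xc]]] N.cvD[OF x(2)])
  have "R.cv sequentially (%k. \<theta> (?k k) (e (?k k) x)) ?y"
   by (rule R.cvI[OF \<theta>c[OF eF[OF xc]] yc always_eventually[OF allI[OF est]]]) (use l in simp)
  moreover have "R.cv sequentially (%k. \<theta> (?k k) (e (?k k) x)) (f x)"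
   unfolding R.cv_def using \<theta>c[OF eF[OF xc]] fc[OF xc] sh[OF R.cvD[OF fcv[OF xc]]] by blast
  ultimately have "f x = ?y" using R.cv_unique[OF _ _ sequentially_bot] by blast
  then show ?thesis using xc by blast
 qed
 \<comment> \<open>The range is closed under bounded 2-norm limits: f is isometric and reflects
   operator bounds, so preimages form a bounded Cauchy sequence.\<close>
 have "EX x:vcarrier N. f x = y" if y: "y : vcarrier R" for y
 proof -
  obtain g where g: "ALL x:vcarrier R. (EX r. ALL k. R.bnd r (g k x)) & R.cv sequentially (%k. g k x) x & (ALL k. g k x : E ` {..k::nat})"
   using R.approximants[OF E] by blast
  obtain r where r: "!!k. R.bnd r (g k y)" using g y by blast
  have cv: "R.cv sequentially (%k. g k y) y" using bspec[OF g y] by (elim conjE)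
  have "ALL k. EX x. x : vcarrier N & f x = g k y"
  proof
   fix k
   have "g k y : E ` {..k}" using bspec[OF g y] by simp
   then obtain i where "g k y = E i" by blast
   then show "EX x. x : vcarrier N & f x = g k y" using surjE[of i] by auto
  qed
  from choice[OF this] obtain s where s: "ALL k. s k : vcarrier N & f (s k) = g k y" by (elim exE) (rule that)
  then have sc: "s k : vcarrier N" and fs: "f (s k) = g k y" for k by simp_all
  have sb: "N.bnd r (s k)" for k using f.bnd_reflect[OF _ sc] r fs by simp
  have gc: "g k y : vcarrier R" for k by (rule R.cv_c(1)[OF cv])
  have sn: "nrm2 N (s k --\<^sub>N s l) = nrm2 R (g k y --\<^sub>R g l y)" for k l
   using f.nn[of "s k --\<^sub>N s l"] f.sub[OF sc sc, of k l] sc fs by simp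
  have "EX x. N.bnd r x & N.cv sequentially s x"
  proof (rule N.complete[OF sb])
   fix \<eta> :: real assume "\<eta> > 0"
   then obtain m where m: "!!k. k >= m ==> nrm2 R (g k y --\<^sub>R y) < \<eta> / 2"
    using order_tendstoD(2)[OF R.cvD[OF cv], of "\<eta> / 2"] unfolding eventually_sequentially by auto
   have "nrm2 N (s k --\<^sub>N s l) < \<eta>" if "k >= m" "l >= m" for k l
    unfolding sn using R.sub_tri[OF gc y gc, of k l] R.sub_swap[OF y gc, of l] m[OF that(1)] m[OF that(2)] by linarith
   then show "EX K. ALL m>=K. ALL n>=K. nrm2 N (s m --\<^sub>N s n) < \<eta>" by blast
  qed
  then obtain x where x: "N.bnd r x" "N.cv sequentially s x" by blast
  note xc = N.bnd_c[OF x(1)]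
  have "nrm2 R (g k y --\<^sub>R f x) = nrm2 N (s k --\<^sub>N x)" for k
   using f.nn[of "s k --\<^sub>N x"] f.sub[OF sc xc, of k] sc xc fs by simp
  then have "R.cv sequentially (%k. g k y) (f x)" unfolding R.cv_def using gc fc[OF xc] N.cvD[OF x(2)] by simp
  from R.cv_unique[OF this cv sequentially_bot] show ?thesis using xc by blast
 qed
 then have "f ` vcarrier N = vcarrier R" using fc by blast
 then show ?thesis using femb unfolding tvna_iso_def by blast
qed

end

theorem mainTheorem1:
  fixes U :: "nat filter" and N :: "'a tvna" and R :: "'b tvna"
  assumes "CH"
    and "nonprincipal_ultrafilter U"
    and "hyperfinite_II1 R"
    and "II1_factor N" and "separable N"
    and "\<exists>\<pi>. embedding N (ultrapower U R) \<pi>"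
    and "gen_Jung U N"
  shows "tvna_iso N R"
proof -
 have tN: "tvna N" and tR: "tvna R" using assms(3,4) tvna_if_tracial_vna by (auto simp: hyperfinite_II1_def II1_factor_def)
 interpret N: utp N U by (intro utp.intro utp_axioms.intro tN assms(2))
 interpret R: utp R U by (intro utp.intro utp_axioms.intro tR assms(2))
 interpret NR: utq R U N by unfold_locales
 have fN: "N.tcen (vcarrier N)" and fR: "R.tcen (vcarrier R)"
  using assms(3,4) by (simp_all add: N.tcen_C_iff R.tcen_C_iff hyperfinite_II1_def II1_factor_def)
 have AFD: "AFD R" and sR: "separable R" using assms(3) by (simp_all add: hyperfinite_II1_def)
 obtain D where D: "N.bdense D" using N.ex_bdense[OF assms(5)] by blast
 obtain E where E: "R.bdense E" using R.ex_bdense[OF sR] by blast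
 obtain \<pi> where \<pi>: "embedding N (ultrapower U R) \<pi>" using assms(6) by blast
 have AH: "EX \<phi>. ahom N R F \<epsilon> \<phi>" if "finite F" "F \<subseteq> vcarrier N" "\<epsilon> > 0" for F \<epsilon>
  by (rule NR.ex_ahom_if_embedding[OF \<pi> that])
 have nm: "~ (EX e. N.minproj (vcarrier N) e)"
  using N.fin_dim_if_minproj[OF fN] assms(4) by (auto simp: II1_factor_def)
 obtain v where v: "N.sys 2 (%_. 0) v" using N.ex_msys[OF N.vnsub_C fN nm, of 2] by auto
 let ?S = "N.comm (N.mgen 2 v)"
 \<comment> \<open>The commutant inherits factoriality and the absence of minimal projections, so it
   contains matrix units of every size; maps from R into it are built on these.\<close>
 have S: "N.vnsub ?S" "N.tcen ?S" "~ (EX e. N.minproj ?S e)"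
  using N.vnsub_mgen[OF v] N.tcen_mgen[OF v fN] N.minproj_mgen[OF v] nm by auto
 have tc: "N.P.tcen (N.P.comm (\<rho> ` vcarrier N))" if "embedding N (ultrapower U N) \<rho>" for \<rho>
  by (rule N.tcen_comm_embedding[OF fN nm D tR AFD _ assms(7) that]) (rule AH)
 have N_inv: "approx_invertible N R"
 proof (rule N.approx_invertibleI[where S = ?S])
  fix F and \<epsilon> :: real assume F: "finite F" "F \<subseteq> vcarrier N" "\<epsilon> > 0"
  show "EX F' \<delta>. finite F' & F \<subseteq> F' & F' \<subseteq> vcarrier N & \<delta> > 0 & (ALL \<phi>. ahom N N F' \<delta> \<phi> & \<phi> ` F' \<subseteq> ?S -->
   (EX u. N.unit u & (ALL x:F. nrm2 N (u **\<^sub>N \<phi> x **\<^sub>N ~*\<^sub>N u --\<^sub>N x) < \<epsilon>)))"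
  proof (rule N.near_identity[OF fN D _ F])
   fix \<rho> H and \<eta> :: real
   assume \<rho>: "embedding N (ultrapower U N) \<rho>" and z: "!!x. x : vcarrier N ==> EX z. z : useqs N & (ALL k. z k : ?S) & \<rho> x = ucls U N z"
    and H: "finite H" "H \<subseteq> vcarrier N" "\<eta> > 0"
   have "EX V. N.P.unit V & (ALL x:vcarrier N. V **\<^bsub>ultrapower U N\<^esub> \<rho> x **\<^bsub>ultrapower U N\<^esub> ~*\<^bsub>ultrapower U N\<^esub>V = N.dg x)"
    by (rule N.conj_diagonal[OF fN assms(7) v \<rho>]) (erule tc, erule z)
   then obtain V where V: "N.P.unit V" "ALL x:vcarrier N. V **\<^bsub>ultrapower U N\<^esub> \<rho> x **\<^bsub>ultrapower U N\<^esub> ~*\<^bsub>ultrapower U N\<^esub>V = N.dg x" by (elim exE conjE) (rule that)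
   have "nrm2 (ultrapower U N) (V **\<^bsub>ultrapower U N\<^esub> \<rho> x **\<^bsub>ultrapower U N\<^esub> ~*\<^bsub>ultrapower U N\<^esub>V --\<^bsub>ultrapower U N\<^esub> N.dg x) < \<eta>" if x: "x : H" for x
   proof -
    have xc: "x : vcarrier N" using x H by blast
    have "x --\<^sub>N x = \<zero>\<^sub>N" using xc by (intro N.tau_ext) (simp_all add: N.alg)
    then have "nrm2 (ultrapower U N) (N.dg x --\<^bsub>ultrapower U N\<^esub> N.dg x) = 0"
     using N.dg_sub[OF xc xc] N.dg_nn[of "x --\<^sub>N x"] xc by simp
    then show ?thesis using bspec[OF V(2) xc] H(3) by simp
   qed
   then show "EX V. N.P.unit V & (ALL x:H. nrm2 (ultrapower U N) (V **\<^bsub>ultrapower U N\<^esub> \<rho> x **\<^bsub>ultrapower U N\<^esub> ~*\<^bsub>ultrapower U N\<^esub>V --\<^bsub>ultrapower U N\<^esub> N.dg x) < \<eta>)"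
    using V(1) by blast
  qed
 next
  fix G and \<epsilon> :: real assume G: "finite G" "G \<subseteq> vcarrier R" "\<epsilon> > 0"
  obtain n0 where n0: "ALL n>=n0. ALL e. N.sys n (%_. 0) e --> (EX \<psi>. ahom R N G \<epsilon> \<psi> &
   (ALL T. N.vnsub T & (ALL i<n. ALL j<n. e i **\<^sub>N ~*\<^sub>N e j : T) --> \<psi> ` G \<subseteq> T))"
   using ex_ahom_AFD[OF tR AFD tN G] by (elim exE) (rule that)
  have n: "n0 <= Suc n0" "0 < Suc n0" by simp_all
  obtain e where e: "N.sys (Suc n0) (%_. 0) e" "ALL i<Suc n0. e i : ?S" using N.ex_msys[OF S n(2)] by (elim exE conjE) (rule that)
  obtain \<psi> where \<psi>: "ahom R N G \<epsilon> \<psi>" "ALL T. N.vnsub T & (ALL i<Suc n0. ALL j<Suc n0. e i **\<^sub>N ~*\<^sub>N e j : T) --> \<psi> ` G \<subseteq> T"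
   using n0[rule_format, OF n(1) e(1)] by (elim exE conjE) (rule that)
  have "ALL i<Suc n0. ALL j<Suc n0. e i **\<^sub>N ~*\<^sub>N e j : ?S" using e(2) by (intro allI impI N.vnsubD(4,6)[OF S(1)]) auto
  then show "EX \<psi>. ahom R N G \<epsilon> \<psi> & \<psi> ` G \<subseteq> ?S" using \<psi>(1) \<psi>(2)[rule_format, of ?S] S(1) by blast
 qed
 \<comment> \<open>On this side approximate finite dimensionality gives the conjugation for every
   embedding, so the target need not be restricted.\<close>
 have R_inv: "approx_invertible R N"
 proof (rule R.approx_invertibleI[where S = "vcarrier R"])
  fix F and \<epsilon> :: real assume F: "finite F" "F \<subseteq> vcarrier R" "\<epsilon> > 0"
  show "EX F' \<delta>. finite F' & F \<subseteq> F' & F' \<subseteq> vcarrier R & \<delta> > 0 & (ALL \<phi>. ahom R R F' \<delta> \<phi> & \<phi> ` F' \<subseteq> vcarrier R -->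
   (EX u. R.unit u & (ALL x:F. nrm2 R (u **\<^sub>R \<phi> x **\<^sub>R ~*\<^sub>R u --\<^sub>R x) < \<epsilon>)))"
   by (rule R.near_identity[OF fR E _ F]) (rule R.near_conj_AFD[OF fR AFD])
 next
  fix G and \<epsilon> :: real assume G: "finite G" "G \<subseteq> vcarrier N" "\<epsilon> > 0"
  obtain \<phi> where \<phi>: "ahom N R G \<epsilon> \<phi>" using AH[OF G] by blast
  have "\<phi> ` G \<subseteq> vcarrier R" by (intro image_subsetI ahomD(1)[OF \<phi>])
  then show "EX \<psi>. ahom N R G \<epsilon> \<psi> & \<psi> ` G \<subseteq> vcarrier R" using \<phi> by blast
 qed
 interpret intertwining N R D E by (unfold_locales; fact D E N_inv R_inv AH)
 show ?thesis by (rule iso)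
qed

end
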